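(* The model-checking problem for $\mathrm{RAL}^{\#}$ (given a resource-bounded concurrent game structure with diminishing resource $M$, a state $s$ of $M$, an endowment $\eta$, and an $\mathrm{RAL}^{\#}$ formula $\phi$ over the agents, resource types and propositions of $M$, decide whether $M,s,\eta\models\phi$) is decidable in PSPACE, provided resource bounds (the endowments, both the input endowment $\eta$ and those occurring in $\phi$) are written in unary.
   Context: **Models.** A resource-bounded concurrent game structure with diminishing resource (RB-CGS$^\#$) is a tuple $M=(Agt,Res,S,\Pi,\pi,Act,d,c,\delta)$ where: $Agt=\{a_1,\dots,a_n\}$ is a non-empty finite set of agents; $Res$ is a non-empty finite set of $r$ resource types, the first of which is the distinguished diminishing resource; $S$ is a non-empty finite set of states; $\Pi$ is a finite set of propositions and $\pi:\Pi\to\wp(S)$; $Act$ is a non-empty finite set of actions; $d:S\times Agt\to\wp(Act)\setminus\{\emptyset\}$ gives the actions available to each agent at each state, and $D(s)=d(s,a_1)\times\cdots\times d(s,a_n)$; $c:S\times Act\to\mathbb{Z}^r$ is a partial function (defined for available actions) whose components give the consumption (negative) or production (positive) of each resource, and the first component of $c(s,\sigma)$ is always at most $-1$; $\delta:S\times Act^{|Agt|}\to S$ is a partial function giving a successor state for every $s$ and $\sigma\in D(s)$. Models are given as explicit finite inputs. For a resource $\rho\in Res$, $\mathsf{prod}_\rho(s,\sigma)=\max(0,c_\rho(s,\sigma))$ and $\mathsf{cons}_\rho(s,\sigma)=|\min(0,c_\rho(s,\sigma))|$. For $A\subseteq Agt$, $D_A(s)$ is the set of tuples $(\sigma_a)_{a\in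 A}$ with $\sigma_a\in d(s,a)$, and $\sigma_A$ denotes the restriction of $\sigma\in D(s)$ to $A$. **Syntax.** An endowment is a function $\eta:Agt\times Res\to\mathbb{N}$, written $\eta_a(\rho)=\eta(a,\rho)$; $\mathsf{En}$ is the set of all endowments. Formulas of $\mathrm{RAL}^\#$: $\phi,\psi::=p\mid\neg\phi\mid\phi\wedge\psi\mid\langle\!\langle A\rangle\!\rangle_B^{\downarrow}\bigcirc\phi\mid\langle\!\langle A\rangle\!\rangle_B^{\zeta}\bigcirc\phi\mid\langle\!\langle A\rangle\!\rangle_B^{\downarrow}\phi\,\mathcal{U}\,\psi\mid\langle\!\langle A\rangle\!\rangle_B^{\zeta}\phi\,\mathcal{U}\,\psi\mid\langle\!\langle A\rangle\!\rangle_B^{\downarrow}\phi\,\mathcal{R}\,\psi\mid\langle\!\langle A\rangle\!\rangle_B^{\zeta}\phi\,\mathcal{R}\,\psi$, where $p\in\Pi$, $A,B\subseteq Agt$ ($A$ the proponents, $B$ the resource-bounded opponents) and $\zeta\in\mathsf{En}$. **Strategies and computations.** A strategy for $A$ is a map $F_A:S^+\to Act^{|A|}$ with $F_A(\lambda)\in D_A(s)$, where $s$ is the last state of $\lambda\in S^+$. A resource-extended computation is a finite non-empty sequence $\lambda\in(S\times\mathsf{En})^+$ whose projection to states, $\lambda|_S$, is a path of $M$; $\lambda|_{\mathsf{En}}$ is its projection to endowments; $\lambda[i]=(s_i,\eta^i)$ is its $i$-th element ($i\ge1$), $\lambda|_S[1,i]=s_1\cdots s_i$, and $|\lambda|$ is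 its length. $\lambda$ is an $(\eta,F_A,B)$-computation if $\eta^1=\eta$ and for every $1\le i<|\lambda|$ there is $\sigma\in D(s_i)$ such that: (i) $F_A(\lambda|_S[1,i])=\sigma_A$; (ii) $s_{i+1}=\delta(s_i,\sigma)$; (iii) for all $a\in A\cup B$ and $\rho\in Res$, $\eta^i_a(\rho)\ge\mathsf{cons}_\rho(s_i,\sigma_a)$; (iv) for all $a\in A\cup B$ and $\rho\in Res$, $\eta^{i+1}_a(\rho)=\eta^i_a(\rho)+\mathsf{prod}_\rho(s_i,\sigma_a)-\mathsf{cons}_\rho(s_i,\sigma_a)$; (v) for all $a\in Agt\setminus(A\cup B)$ and $\rho\in Res$, $\eta^{i+1}_a(\rho)=\eta^i_a(\rho)$. $out(s,\eta,F_A,B)$ is the set of all maximal $(\eta,F_A,B)$-computations starting in $s$, i.e. those that are not a proper prefix of another $(\eta,F_A,B)$-computation. **Semantics.** Truth $M,s,\eta\models\phi$ is defined for a state $s$ and an endowment $\eta$; propositions ($s\in\pi(p)$), $\neg$, $\wedge$ are standard. For the modalities, let $\theta=\eta$ for $\langle\!\langle A\rangle\!\rangle_B^{\downarrow}$ (the current endowment) and $\theta=\zeta$ for $\langle\!\langle A\rangle\!\rangle_B^{\zeta}$; write $*$ for $\downarrow$ or $\zeta$, and write $\lambda,i\models\phi$ for $M,\lambda|_S[i],\lambda|_{\mathsf{En}}[i]\models\phi$. - $M,s,\eta\models\langle\!\langle A\rangle\!\rangle_B^{*}\bigcirc\phi$ iff there is a strategy $F_A$ such that for all $\lambda\in out(s,\theta,F_A,B)$: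 $|\lambda|>1$ and $\lambda,2\models\phi$. - $M,s,\eta\models\langle\!\langle A\rangle\!\rangle_B^{*}\phi\,\mathcal{U}\,\psi$ iff there is $F_A$ such that for all $\lambda\in out(s,\theta,F_A,B)$ there is $1\le i\le|\lambda|$ with $\lambda,i\models\psi$ and $\lambda,j\models\phi$ for all $1\le j<i$. - $M,s,\eta\models\langle\!\langle A\rangle\!\rangle_B^{*}\phi\,\mathcal{R}\,\psi$ iff there is $F_A$ such that for all $\lambda\in out(s,\theta,F_A,B)$, either there is $1\le i\le|\lambda|$ with $\lambda,i\models\psi\wedge\phi$ and $\lambda,j\models\psi$ for all $1\le j<i$, or $\lambda,j\models\psi$ for all $1\le j\le|\lambda|$. *)

theory Defs
  imports Main "HOL-Library.FuncSet" "HOL-Library.Sublist" "HOL-Computational_Algebra.Polynomial"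
begin

section \<open>Turing machines and PSPACE\<close>

text \<open>
  Deterministic multi-tape Turing machines. Tapes are infinite in both directions; of each tape only
  the cells visited so far (and the cells holding the input) are represented, as the reversed list
  of cells to the left of the head, the scanned cell, and the list of cells to the right of the head.
\<close>

datatype 'a cell = Blank | Inp 'a | Aux nat

datatype move = MLeft | MStay | MRight

type_synonym 'a tape = "'a cell list \<times> 'a cell \<times> 'a cell list"

type_synonym 'a config = "nat \<times> 'a tape list"

record 'a tm =
  tm_tapes :: nat
  tm_states :: "nat set"
  tm_alphabet :: "'a cell set"
  tm_start :: nat
  tm_accept :: nat
  tm_reject :: nat
  tm_delta :: "nat \<Rightarrow> 'a cell list \<Rightarrow> nat \<times> ('a cell \<times> move) list"

definition turing_machine :: "'a tm \<Rightarrow> bool" where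
  "turing_machine T \<longleftrightarrow>
     tm_tapes T \<ge> 1 \<and> finite (tm_states T) \<and> finite (tm_alphabet T) \<and>
     Blank \<in> tm_alphabet T \<and> range Inp \<subseteq> tm_alphabet T \<and>
     {tm_start T, tm_accept T, tm_reject T} \<subseteq> tm_states T \<and> tm_accept T \<noteq> tm_reject T \<and>
     (\<forall>q \<in> tm_states T - {tm_accept T, tm_reject T}.
        \<forall>xs \<in> lists (tm_alphabet T). length xs = tm_tapes T \<longrightarrow>
          fst (tm_delta T q xs) \<in> tm_states T \<and>
          length (snd (tm_delta T q xs)) = tm_tapes T \<and>
          fst ` set (snd (tm_delta T q xs)) \<subseteq> tm_alphabet T)"

fun scanned :: "'a tape \<Rightarrow> 'a cell" where
  "scanned (l, x, r) = x"

fun write_move :: "'a cell \<times> move \<Rightarrow> 'a tape \<Rightarrow> 'a tape" where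
  "write_move (y, MStay) (l, x, r) = (l, y, r)"
| "write_move (y, MLeft) ([], x, r) = ([], Blank, y # r)"
| "write_move (y, MLeft) (z # l, x, r) = (l, z, y # r)"
| "write_move (y, MRight) (l, x, []) = (y # l, Blank, [])"
| "write_move (y, MRight) (l, x, z # r) = (y # l, z, r)"

fun tm_step :: "'a tm \<Rightarrow> 'a config \<Rightarrow> 'a config" where
  "tm_step T (q, ts) =
     (if q = tm_accept T \<or> q = tm_reject T then (q, ts)
      else let (q', acts) = tm_delta T q (map scanned ts) in (q', map2 write_move acts ts))"

fun input_tape :: "'a list \<Rightarrow> 'a tape" where
  "input_tape [] = ([], Blank, [])"
| "input_tape (x # xs) = ([], Inp x, map Inp xs)"

definition tm_run :: "'a tm \<Rightarrow> 'a list \<Rightarrow> nat \<Rightarrow> 'a config" where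
  "tm_run T w t =
     (tm_step T ^^ t) (tm_start T, input_tape w # replicate (tm_tapes T - 1) ([], Blank, []))"

fun tape_cells :: "'a tape \<Rightarrow> nat" where
  "tape_cells (l, x, r) = length l + 1 + length r"

definition config_space :: "'a config \<Rightarrow> nat" where
  "config_space C = sum_list (map tape_cells (snd C))"

definition decides :: "'a tm \<Rightarrow> 'a list set \<Rightarrow> bool" where
  "decides T L \<longleftrightarrow>
     (\<forall>w. \<exists>t. fst (tm_run T w t) = (if w \<in> L then tm_accept T else tm_reject T))"

definition PSPACE :: "'a::finite list set set" where
  "PSPACE = {L. \<exists>(T :: 'a tm) (p :: nat poly). turing_machine T \<and> decides T L \<and>
                  (\<forall>w t. config_space (tm_run T w t) \<le> poly p (length w))}"


section \<open>Models\<close>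

text \<open>
  Models are explicit finite inputs: agents, resource types, states, propositions and actions are
  numbered from 0, and the record stores how many there are of each. Resource type 0 is the
  diminishing one. A joint action is the list of the actions of the agents 0, 1, ..., in this order.
  The partial functions of a model are total functions here; their values outside the
  intended domains are never used, neither by the semantics nor by the encoding.
\<close>

record rbcgs =
  nAgt :: nat
  nRes :: nat
  nSt :: nat
  nProp :: nat
  nAct :: nat
  val :: "nat \<Rightarrow> nat set"
  avail :: "nat \<Rightarrow> nat \<Rightarrow> nat set"
  cost :: "nat \<Rightarrow> nat \<Rightarrow> nat \<Rightarrow> int"
  succ :: "nat \<Rightarrow> nat list \<Rightarrow> nat"

definition Agt :: "rbcgs \<Rightarrow> nat set" where "Agt M = {..<nAgt M}"
definition Res :: "rbcgs \<Rightarrow> nat set" where "Res M = {..<nRes M}"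
definition St :: "rbcgs \<Rightarrow> nat set" where "St M = {..<nSt M}"
definition Props :: "rbcgs \<Rightarrow> nat set" where "Props M = {..<nProp M}"
definition Act :: "rbcgs \<Rightarrow> nat set" where "Act M = {..<nAct M}"

definition joint :: "rbcgs \<Rightarrow> nat \<Rightarrow> nat list set" where
  "joint M s = {\<sigma>. length \<sigma> = nAgt M \<and> (\<forall>a \<in> Agt M. \<sigma> ! a \<in> avail M s a)}"

definition is_rbcgs :: "rbcgs \<Rightarrow> bool" where
  "is_rbcgs M \<longleftrightarrow>
     Agt M \<noteq> {} \<and> Res M \<noteq> {} \<and> St M \<noteq> {} \<and> Act M \<noteq> {} \<and>
     (\<forall>p \<in> Props M. val M p \<subseteq> St M) \<and>
     (\<forall>s \<in> St M. \<forall>a \<in> Agt M. avail M s a \<noteq> {} \<and> avail M s a \<subseteq> Act M) \<and>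
     (\<forall>s \<in> St M. \<forall>a \<in> Agt M. \<forall>\<alpha> \<in> avail M s a. cost M s \<alpha> 0 \<le> -1) \<and>
     (\<forall>s \<in> St M. \<forall>\<sigma> \<in> joint M s. succ M s \<sigma> \<in> St M)"

definition produced :: "rbcgs \<Rightarrow> nat \<Rightarrow> nat \<Rightarrow> nat \<Rightarrow> nat" where
  "produced M \<rho> s \<alpha> = nat (max 0 (cost M s \<alpha> \<rho>))"

definition consumed :: "rbcgs \<Rightarrow> nat \<Rightarrow> nat \<Rightarrow> nat \<Rightarrow> nat" where
  "consumed M \<rho> s \<alpha> = nat \<bar>min 0 (cost M s \<alpha> \<rho>)\<bar>"


section \<open>Syntax\<close>

type_synonym endowment = "nat \<times> nat \<Rightarrow> nat"

definition En :: "rbcgs \<Rightarrow> endowment set" where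
  "En M = (Agt M \<times> Res M) \<rightarrow>\<^sub>E UNIV"

datatype bound = Current | Fixed endowment

text \<open>
  In the modalities the first set is the coalition of proponents and the second one the set of
  resource-bounded opponents; \<open>Current\<close> is the down-arrow superscript.
\<close>

datatype fm =
    Prop nat
  | Neg fm
  | Conj fm fm
  | Next "nat set" "nat set" bound fm
  | Until "nat set" "nat set" bound fm fm
  | Release "nat set" "nat set" bound fm fm

fun bound_over :: "rbcgs \<Rightarrow> bound \<Rightarrow> bool" where
  "bound_over M Current \<longleftrightarrow> True"
| "bound_over M (Fixed \<zeta>) \<longleftrightarrow> \<zeta> \<in> En M"

primrec formula_over :: "rbcgs \<Rightarrow> fm \<Rightarrow> bool" where
  "formula_over M (Prop p) \<longleftrightarrow> p \<in> Props M"
| "formula_over M (Neg \<phi>) \<longleftrightarrow> formula_over M \<phi>"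
| "formula_over M (Conj \<phi> \<psi>) \<longleftrightarrow> formula_over M \<phi> \<and> formula_over M \<psi>"
| "formula_over M (Next A B b \<phi>) \<longleftrightarrow>
     A \<subseteq> Agt M \<and> B \<subseteq> Agt M \<and> bound_over M b \<and> formula_over M \<phi>"
| "formula_over M (Until A B b \<phi> \<psi>) \<longleftrightarrow>
     A \<subseteq> Agt M \<and> B \<subseteq> Agt M \<and> bound_over M b \<and> formula_over M \<phi> \<and> formula_over M \<psi>"
| "formula_over M (Release A B b \<phi> \<psi>) \<longleftrightarrow>
     A \<subseteq> Agt M \<and> B \<subseteq> Agt M \<and> bound_over M b \<and> formula_over M \<phi> \<and> formula_over M \<psi>"


section \<open>Strategies, computations and semantics\<close>

definition strategy :: "rbcgs \<Rightarrow> nat set \<Rightarrow> (nat list \<Rightarrow> nat \<Rightarrow> nat) \<Rightarrow> bool" where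
  "strategy M A F \<longleftrightarrow>
     (\<forall>ss \<in> lists (St M). ss \<noteq> [] \<longrightarrow> F ss \<in> (\<Pi>\<^sub>E a\<in>A. avail M (last ss) a))"

definition is_path :: "rbcgs \<Rightarrow> nat list \<Rightarrow> bool" where
  "is_path M ss \<longleftrightarrow>
     ss \<noteq> [] \<and> set ss \<subseteq> St M \<and>
     (\<forall>i. Suc i < length ss \<longrightarrow> (\<exists>\<sigma> \<in> joint M (ss ! i). ss ! Suc i = succ M (ss ! i) \<sigma>))"

definition ext_computation :: "rbcgs \<Rightarrow> (nat \<times> endowment) list \<Rightarrow> bool" where
  "ext_computation M \<pi> \<longleftrightarrow> \<pi> \<noteq> [] \<and> set \<pi> \<subseteq> St M \<times> En M \<and> is_path M (map fst \<pi>)"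

text \<open>Lists are indexed from 0, so position i here is position i + 1 of the mathematical sequence.\<close>

definition computation ::
  "rbcgs \<Rightarrow> endowment \<Rightarrow> nat set \<Rightarrow> (nat list \<Rightarrow> nat \<Rightarrow> nat) \<Rightarrow> nat set
    \<Rightarrow> (nat \<times> endowment) list \<Rightarrow> bool" where
  "computation M \<eta> A F B \<pi> \<longleftrightarrow>
     ext_computation M \<pi> \<and> snd (\<pi> ! 0) = \<eta> \<and>
     (\<forall>i. Suc i < length \<pi> \<longrightarrow>
       (let s = fst (\<pi> ! i); e = snd (\<pi> ! i); s' = fst (\<pi> ! Suc i); e' = snd (\<pi> ! Suc i) in
        \<exists>\<sigma> \<in> joint M s.
          F (map fst (take (Suc i) \<pi>)) = restrict ((!) \<sigma>) A \<and>
          s' = succ M s \<sigma> \<and>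
          (\<forall>a \<in> A \<union> B. \<forall>\<rho> \<in> Res M. e (a, \<rho>) \<ge> consumed M \<rho> s (\<sigma> ! a)) \<and>
          (\<forall>a \<in> A \<union> B. \<forall>\<rho> \<in> Res M.
             e' (a, \<rho>) = e (a, \<rho>) + produced M \<rho> s (\<sigma> ! a) - consumed M \<rho> s (\<sigma> ! a)) \<and>
          (\<forall>a \<in> Agt M - (A \<union> B). \<forall>\<rho> \<in> Res M. e' (a, \<rho>) = e (a, \<rho>))))"

definition out ::
  "rbcgs \<Rightarrow> nat \<Rightarrow> endowment \<Rightarrow> nat set \<Rightarrow> (nat list \<Rightarrow> nat \<Rightarrow> nat) \<Rightarrow> nat set
    \<Rightarrow> (nat \<times> endowment) list set" where
  "out M s \<eta> A F B =
     {\<pi>. computation M \<eta> A F B \<pi> \<and> fst (\<pi> ! 0) = s \<and>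
         \<not> (\<exists>\<pi>'. computation M \<eta> A F B \<pi>' \<and> strict_prefix \<pi> \<pi>')}"

fun start_endowment :: "bound \<Rightarrow> endowment \<Rightarrow> endowment" where
  "start_endowment Current \<eta> = \<eta>"
| "start_endowment (Fixed \<zeta>) \<eta> = \<zeta>"

primrec sat :: "rbcgs \<Rightarrow> nat \<Rightarrow> endowment \<Rightarrow> fm \<Rightarrow> bool" where
  "sat M s \<eta> (Prop p) \<longleftrightarrow> s \<in> val M p"
| "sat M s \<eta> (Neg \<phi>) \<longleftrightarrow> \<not> sat M s \<eta> \<phi>"
| "sat M s \<eta> (Conj \<phi> \<psi>) \<longleftrightarrow> sat M s \<eta> \<phi> \<and> sat M s \<eta> \<psi>"
| "sat M s \<eta> (Next A B b \<phi>) \<longleftrightarrow>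
     (\<exists>F. strategy M A F \<and>
       (\<forall>\<pi> \<in> out M s (start_endowment b \<eta>) A F B.
          length \<pi> > 1 \<and> sat M (fst (\<pi> ! 1)) (snd (\<pi> ! 1)) \<phi>))"
| "sat M s \<eta> (Until A B b \<phi> \<psi>) \<longleftrightarrow>
     (\<exists>F. strategy M A F \<and>
       (\<forall>\<pi> \<in> out M s (start_endowment b \<eta>) A F B.
          \<exists>i < length \<pi>. sat M (fst (\<pi> ! i)) (snd (\<pi> ! i)) \<psi> \<and>
            (\<forall>j < i. sat M (fst (\<pi> ! j)) (snd (\<pi> ! j)) \<phi>)))"
| "sat M s \<eta> (Release A B b \<phi> \<psi>) \<longleftrightarrow>
     (\<exists>F. strategy M A F \<and>
       (\<forall>\<pi> \<in> out M s (start_endowment b \<eta>) A F B.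
          (\<exists>i < length \<pi>.
             sat M (fst (\<pi> ! i)) (snd (\<pi> ! i)) \<psi> \<and> sat M (fst (\<pi> ! i)) (snd (\<pi> ! i)) \<phi> \<and>
             (\<forall>j < i. sat M (fst (\<pi> ! j)) (snd (\<pi> ! j)) \<psi>)) \<or>
          (\<forall>j < length \<pi>. sat M (fst (\<pi> ! j)) (snd (\<pi> ! j)) \<psi>)))"


section \<open>The model-checking problem as a language\<close>

datatype sym = Zero | One | Minus | Comma | Open | Close

instance sym :: finite
proof
  have "(UNIV :: sym set) = {Zero, One, Minus, Comma, Open, Close}"
    using sym.exhaust by auto
  then show "finite (UNIV :: sym set)"
    by (metis finite.emptyI finite.insertI)
qed

text \<open>
  Inputs are written as nested lists of numbers. All numbers (including the
  costs of actions) are in binary, except for the entries of endowments, which are in unary.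
\<close>

datatype input = Bin int | Unary nat | Lst "input list"

text \<open>Least significant bit first, without trailing zeros; the number 0 is the empty word.\<close>

fun bits :: "nat \<Rightarrow> sym list" where
  "bits n = (if n = 0 then [] else (if odd n then One else Zero) # bits (n div 2))"

declare bits.simps [simp del]

primrec serialize :: "input \<Rightarrow> sym list" where
  "serialize (Bin z) = (if z < 0 then [Minus] else []) @ bits (nat \<bar>z\<bar>) @ [Comma]"
| "serialize (Unary n) = replicate n One @ [Comma]"
| "serialize (Lst xs) = Open # concat (map serialize xs) @ [Close]"

definition bin :: "nat \<Rightarrow> input" where
  "bin n = Bin (int n)"

definition table :: "nat \<Rightarrow> (nat \<Rightarrow> input) \<Rightarrow> input" where
  "table n f = Lst (map f [0..<n])"

definition input_set :: "nat set \<Rightarrow> input" where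
  "input_set A = Lst (map bin (sorted_list_of_set A))"

definition input_endowment :: "rbcgs \<Rightarrow> endowment \<Rightarrow> input" where
  "input_endowment M \<eta> = table (nAgt M) (\<lambda>a. table (nRes M) (\<lambda>\<rho>. Unary (\<eta> (a, \<rho>))))"

text \<open>
  In the cost table, actions that no agent can perform in the given state get an empty entry. The
  entry of a state in the transition table lists the successors for its joint
  actions in lexicographic order.
\<close>

definition input_model :: "rbcgs \<Rightarrow> input" where
  "input_model M = Lst
     [bin (nAgt M), bin (nRes M), bin (nSt M), bin (nProp M), bin (nAct M),
      table (nProp M) (\<lambda>p. input_set (val M p)),
      table (nSt M) (\<lambda>s. table (nAgt M) (\<lambda>a. input_set (avail M s a))),
      table (nSt M) (\<lambda>s. table (nAct M) (\<lambda>\<alpha>.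
        if \<exists>a \<in> Agt M. \<alpha> \<in> avail M s a then table (nRes M) (\<lambda>\<rho>. Bin (cost M s \<alpha> \<rho>)) else Lst [])),
      table (nSt M) (\<lambda>s. Lst (map (\<lambda>\<sigma>. bin (succ M s \<sigma>))
        (product_lists (map (\<lambda>a. sorted_list_of_set (avail M s a)) [0..<nAgt M]))))]"

fun input_bound :: "rbcgs \<Rightarrow> bound \<Rightarrow> input" where
  "input_bound M Current = Lst []"
| "input_bound M (Fixed \<zeta>) = input_endowment M \<zeta>"

primrec input_formula :: "rbcgs \<Rightarrow> fm \<Rightarrow> input" where
  "input_formula M (Prop p) = Lst [bin 0, bin p]"
| "input_formula M (Neg \<phi>) = Lst [bin 1, input_formula M \<phi>]"
| "input_formula M (Conj \<phi> \<psi>) = Lst [bin 2, input_formula M \<phi>, input_formula M \<psi>]"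
| "input_formula M (Next A B b \<phi>) =
     Lst [bin 3, input_set A, input_set B, input_bound M b, input_formula M \<phi>]"
| "input_formula M (Until A B b \<phi> \<psi>) =
     Lst [bin 4, input_set A, input_set B, input_bound M b, input_formula M \<phi>, input_formula M \<psi>]"
| "input_formula M (Release A B b \<phi> \<psi>) =
     Lst [bin 5, input_set A, input_set B, input_bound M b, input_formula M \<phi>, input_formula M \<psi>]"

definition encode :: "rbcgs \<Rightarrow> nat \<Rightarrow> endowment \<Rightarrow> fm \<Rightarrow> sym list" where
  "encode M s \<eta> \<phi> =
     serialize (Lst [input_model M, bin s, input_endowment M \<eta>, input_formula M \<phi>])"

definition RAL_model_checking :: "sym list set" where
  "RAL_model_checking =
     {encode M s \<eta> \<phi> | M s \<eta> \<phi>.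
        is_rbcgs M \<and> s \<in> St M \<and> \<eta> \<in> En M \<and> formula_over M \<phi> \<and> sat M s \<eta> \<phi>}"

end

theory Submission imports Defs begin

text \<open>Polynomial space is reached through alternation: a two-player game with plays of
  polynomial length is evaluated depth first. An actual Turing machine is demanded, so the model
  checker is written in a logic with bounded quantifiers over trees and fuelled jumps, which is
  compiled to alternating stack programs. The plays are short because of the diminishing resource:
  every step costs each bounded agent at least one unit of it, and with endowments in unary a
  computation has fewer steps than the input has symbols. Two obstacles shape the rest. A strategy
  sees states but not endowments, so one choice has to suit all computations with the same states;
  the positions of the strategy game are therefore histories of states and actions, and computations
  are quantified only when a choice is tested. The other resources can grow exponentially, as
  production is given in binary; endowments are therefore kept in binary, where a step adds at most
  one bit, although they are read in unary. Joint actions may be listed outright, since the explicit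
  transition table has an entry for each of them.\<close>

notation iff (infixr "<->" 25)

section \<open>Deterministic stack machines\<close>

datatype ('r, 'y, 'q) sop = SHalt bool | SPush 'r 'y 'q | SPop 'r "'y option => 'q"

fun sstep :: "('q => ('r, 'y, 'q) sop) => 'q \<times> ('r => 'y list) => 'q \<times> ('r => 'y list)" where
  "sstep I (q, st) =
     (case I q of
        SHalt b => (q, st)
      | SPush r y q' => (q', st(r := y # st r))
      | SPop r f => (case st r of [] => (f None, st) | y # ys => (f (Some y), st(r := ys))))"

text \<open>
  Every stack is kept on a tape of its own, with the head on the top symbol and a blank at the
  bottom. A pop is a single step of the Turing machine; a push takes two, since a step writes before
  it moves. The states \<open>T0\<close>, \<open>T1\<close>, \<open>T2\<close> put a blank under the input and walk to its end.
\<close>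

datatype ('r, 'y, 'q) tstate = T0 | T1 | T2 | TMain 'q | TPush 'r 'y 'q | TAcc | TRej

locale stack_machine =
  fixes r0 :: 'r and rs :: "'r list" and Q :: "'q set" and Y :: "'y set"
    and I :: "'q => ('r, 'y, 'q) sop" and q0 :: 'q
    and emb :: "'y => 'a::finite cell" and inp :: "'a => 'y"
  assumes dist: "distinct (r0 # rs)"
    and finQ: "finite Q" and finY: "finite Y" and q0: "q0 \<in> Q"
    and inj: "inj_on emb Y" and nonblank: "Blank \<notin> emb ` Y"
    and emb_inp: "emb (inp a) = Inp a" and inp: "inp a \<in> Y"
    and push: "q \<in> Q ==> I q = SPush r y q' ==> r \<in> set (r0 # rs) \<and> y \<in> Y \<and> q' \<in> Q"
    and pop: "q \<in> Q ==> I q = SPop r f ==>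
                r \<in> set (r0 # rs) \<and> f None \<in> Q \<and> (\<forall>y \<in> Y. f (Some y) \<in> Q)"
begin

abbreviation "R \<equiv> r0 # rs"

definition TQ :: "('r, 'y, 'q) tstate set" where
  "TQ = {T0, T1, T2, TAcc, TRej} \<union> TMain ` Q \<union> (\<lambda>(r, y, q). TPush r y q) ` (set R \<times> Y \<times> Q)"

text \<open>The states of a \<open>tm\<close> are natural numbers; since \<open>TQ\<close> is
  finite, any injection will do as a numbering.\<close>

definition num_of :: "('r, 'y, 'q) tstate => nat" where
  "num_of = (SOME f. inj_on f TQ)"

definition of_num :: "nat => ('r, 'y, 'q) tstate" where
  "of_num = inv_into TQ num_of"

fun sdelta :: "('r, 'y, 'q) tstate => ('r => 'a cell) =>
    ('r, 'y, 'q) tstate \<times> ('r => 'a cell \<times> move)" where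
  "sdelta T0 x = (T1, (\<lambda>r. (x r, MStay))(r0 := (x r0, MLeft)))"
| "sdelta T1 x = (T2, (\<lambda>r. (x r, MStay))(r0 := (x r0, MRight)))"
| "sdelta T2 x =
     (if x r0 = Blank then (TMain q0, (\<lambda>r. (x r, MStay))(r0 := (x r0, MLeft)))
      else (T2, (\<lambda>r. (x r, MStay))(r0 := (x r0, MRight))))"
| "sdelta (TMain q) x =
     (case I q of
        SHalt b => (if b then TAcc else TRej, \<lambda>r. (x r, MStay))
      | SPush r y q' => (TPush r y q', (\<lambda>r. (x r, MStay))(r := (x r, MRight)))
      | SPop r f =>
          if x r = Blank then (TMain (f None), \<lambda>r. (x r, MStay))
          else (TMain (f (Some (inv_into Y emb (x r)))), (\<lambda>r. (x r, MStay))(r := (x r, MLeft))))"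
| "sdelta (TPush r y q) x = (TMain q, (\<lambda>r. (x r, MStay))(r := (emb y, MStay)))"
| "sdelta TAcc x = (TAcc, \<lambda>r. (x r, MStay))"
| "sdelta TRej x = (TRej, \<lambda>r. (x r, MStay))"

definition T :: "'a tm" where
  "T = \<lparr> tm_tapes = length R, tm_states = num_of ` TQ, tm_alphabet = insert Blank (emb ` Y),
         tm_start = num_of T0, tm_accept = num_of TAcc, tm_reject = num_of TRej,
         tm_delta = (\<lambda>n xs. let (q, act) = sdelta (of_num n) (\<lambda>r. the (map_of (zip R xs) r))
                            in (num_of q, map act R)) \<rparr>"

section \<open>Well-formedness of the Turing machine of a stack machine\<close>

lemma finite_TQ: "finite TQ"
  unfolding TQ_def using finQ finY by auto

lemma inj_num: "inj_on num_of TQ"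
  unfolding num_of_def using finite_imp_inj_to_nat_seg[OF finite_TQ] by (metis someI_ex)

lemma of_num: "q \<in> TQ ==> of_num (num_of q) = q"
  unfolding of_num_def using inj_num by simp

lemma num_eq: "q \<in> TQ ==> q' \<in> TQ ==> num_of q = num_of q' <-> q = q'"
  using inj_num by (meson inj_onD)

lemma special_TQ: "T0 \<in> TQ" "T1 \<in> TQ" "T2 \<in> TQ" "TAcc \<in> TQ" "TRej \<in> TQ" "q \<in> Q ==> TMain q \<in> TQ"
  "r \<in> set R ==> y \<in> Y ==> q \<in> Q ==> TPush r y q \<in> TQ"
  by (force simp: TQ_def)+

definition step :: "('r, 'y, 'q) tstate \<times> ('r => 'a tape) => ('r, 'y, 'q) tstate \<times> ('r => 'a tape)" where
  "step C = (case C of (q, tp) =>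
     if q = TAcc \<or> q = TRej then (q, tp)
     else let (q', act) = sdelta q (\<lambda>r. scanned (tp r)) in (q', \<lambda>r. write_move (act r) (tp r)))"

definition conf :: "('r, 'y, 'q) tstate \<times> ('r => 'a tape) => 'a config" where
  "conf C = (num_of (fst C), map (snd C) R)"

text \<open>The Turing machine knows the scanned symbols only for registers in \<open>R\<close>;
  elsewhere the lookup by \<open>map_of\<close> yields an arbitrary value, which must not influence
  the transition.\<close>

lemma sdelta_cong:
  assumes "q \<in> TQ" and "\<And>r. r \<in> set R ==> x r = x' r"
  shows "fst (sdelta q x) = fst (sdelta q x')" and "r \<in> set R ==> snd (sdelta q x) r = snd (sdelta q x') r"
proof -
  have x0: "x r0 = x' r0" using assms(2) by simp
  have "fst (sdelta q x) = fst (sdelta q x') \<and> (\<forall>r \<in> set R. snd (sdelta q x) r = snd (sdelta q x') r)"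
  proof (cases q)
    case (TMain p)
    then have p: "p \<in> Q" using assms(1) by (auto simp: TQ_def)
    show ?thesis
    proof (cases "I p")
      case (SPop r f)
      then have "x r = x' r" using pop[OF p SPop] assms(2) by blast
      then show ?thesis using SPop TMain assms(2) by auto
    qed (use TMain assms(2) in auto)
  qed (use assms(2) x0 in auto)
  then show "fst (sdelta q x) = fst (sdelta q x')"
    and "r \<in> set R ==> snd (sdelta q x) r = snd (sdelta q x') r" by blast+
qed

text \<open>Allows the simulation to be argued with named states and tapes indexed by registers;
  \<open>conf\<close> flattens both only at the end.\<close>

lemma tm_step_conf:
  assumes "fst C \<in> TQ"
  shows "tm_step T (conf C) = conf (step C)"
proof -
  obtain q tp where C: "C = (q, tp)" by (cases C)
  have q: "q \<in> TQ" using assms C by simp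
  show ?thesis
  proof (cases "q = TAcc \<or> q = TRej")
    case True
    then show ?thesis by (auto simp: C conf_def step_def T_def)
  next
    case False
    let ?x = "\<lambda>r. scanned (tp r)"
    let ?x' = "\<lambda>r. the (map_of (zip R (map (scanned \<circ> tp) R)) r)"
    have eq: "r \<in> set R ==> ?x' r = ?x r" for r
      by (subst map_of_zip_map) simp
    obtain q' act where d: "sdelta q ?x = (q', act)" by fastforce
    obtain q'' act' where d': "sdelta q ?x' = (q'', act')" by fastforce
    have "q'' = q'" and act: "\<And>r. r \<in> set R ==> act' r = act r"
      using sdelta_cong[OF q, of ?x' ?x] eq d d' by fastforce+
    have "map2 write_move (map act' R) (map tp R) = map (\<lambda>r. write_move (act r) (tp r)) R"
      using act by (auto simp: zip_map_map map_zip_map2 zip_same_conv_map)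
    moreover have "num_of q \<noteq> num_of TAcc" "num_of q \<noteq> num_of TRej"
      using False num_eq[OF q] special_TQ by auto
    ultimately show ?thesis
      using False d d' \<open>q'' = q'\<close>
      by (simp add: C conf_def step_def T_def of_num[OF q] comp_def)
  qed
qed

lemma sdelta_closed:
  assumes "q \<in> TQ" "q \<noteq> TAcc" "q \<noteq> TRej" and x: "\<And>r. r \<in> set R ==> x r \<in> insert Blank (emb ` Y)"
  shows "fst (sdelta q x) \<in> TQ" and "r \<in> set R ==> fst (snd (sdelta q x) r) \<in> insert Blank (emb ` Y)"
proof -
  have x0: "x r0 \<in> insert Blank (emb ` Y)" using x by simp
  have "fst (sdelta q x) \<in> TQ \<and> (\<forall>r \<in> set R. fst (snd (sdelta q x) r) \<in> insert Blank (emb ` Y))"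
  proof (cases q)
    case (TMain p)
    then have p: "p \<in> Q" using assms(1) by (auto simp: TQ_def)
    show ?thesis
    proof (cases "I p")
      case (SHalt b)
      then show ?thesis using TMain x by (auto simp: TQ_def)
    next
      case (SPush r y q')
      then show ?thesis using TMain x push[OF p SPush] special_TQ(7) by auto
    next
      case (SPop r f)
      note f = pop[OF p SPop]
      have xr: "x r \<in> insert Blank (emb ` Y)" using x f by blast
      then have "x r \<noteq> Blank ==> inv_into Y emb (x r) \<in> Y" by (simp add: inv_into_into)
      then show ?thesis using TMain SPop x f xr by (auto simp: TQ_def)
    qed
  next
    case (TPush r y p)
    then show ?thesis using assms(1) x by (auto simp: TQ_def)
  qed (use assms x0 q0 in \<open>auto simp: TQ_def\<close>)
  then show "fst (sdelta q x) \<in> TQ"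
    and "r \<in> set R ==> fst (snd (sdelta q x) r) \<in> insert Blank (emb ` Y)" by blast+
qed

lemma turing_machine_T: "turing_machine T"
proof -
  have "fst (tm_delta T n xs) \<in> tm_states T \<and> length (snd (tm_delta T n xs)) = tm_tapes T \<and>
        fst ` set (snd (tm_delta T n xs)) \<subseteq> tm_alphabet T"
    if n: "n \<in> tm_states T - {tm_accept T, tm_reject T}" and xs: "xs \<in> lists (tm_alphabet T)"
      and len: "length xs = tm_tapes T" for n xs
  proof -
    obtain q where q: "q \<in> TQ" "n = num_of q" "q \<noteq> TAcc" "q \<noteq> TRej"
      using n by (auto simp: T_def)
    let ?x = "\<lambda>r. the (map_of (zip R xs) r)"
    have x: "?x r \<in> insert Blank (emb ` Y)" if r: "r \<in> set R" for r
    proof -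
      have "length R = length xs" using len by (simp add: T_def)
      then obtain y where y: "map_of (zip R xs) r = Some y"
        using r map_of_zip_is_Some[of R xs r] by blast
      then have "y \<in> set xs" by (meson in_set_zipE map_of_SomeD)
      moreover have "set xs \<subseteq> insert Blank (emb ` Y)" using xs by (auto simp: T_def)
      ultimately show ?thesis using y by auto
    qed
    obtain q' act where d: "sdelta q ?x = (q', act)" by fastforce
    have delta: "tm_delta T n xs = (num_of q', map act R)"
      using d by (simp add: T_def q(2) of_num[OF q(1)])
    have q': "q' \<in> TQ" using sdelta_closed(1)[OF q(1,3,4), of ?x] x d by simp
    have "fst (act r) \<in> tm_alphabet T" if "r \<in> set R" for r
      using sdelta_closed(2)[OF q(1,3,4), of ?x r] x d that by (simp add: T_def)
    then have "fst ` set (map act R) \<subseteq> tm_alphabet T" unfolding set_map by blast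
    then show ?thesis unfolding delta fst_conv snd_conv using q' by (simp add: T_def)
  qed
  then have d: "\<forall>q \<in> tm_states T - {tm_accept T, tm_reject T}.
        \<forall>xs \<in> lists (tm_alphabet T). length xs = tm_tapes T -->
          fst (tm_delta T q xs) \<in> tm_states T \<and>
          length (snd (tm_delta T q xs)) = tm_tapes T \<and>
          fst ` set (snd (tm_delta T q xs)) \<subseteq> tm_alphabet T"
    by (intro ballI impI)
  have "range Inp \<subseteq> emb ` Y"
    using emb_inp inp by (metis image_subset_iff rangeE rev_image_eqI subsetI)
  then have r: "range Inp \<subseteq> tm_alphabet T" by (auto simp: T_def)
  have a: "tm_accept T \<noteq> tm_reject T" using num_eq special_TQ by (simp add: T_def)
  have "tm_tapes T \<ge> 1" "finite (tm_states T)" "finite (tm_alphabet T)" "Blank \<in> tm_alphabet T"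
    "{tm_start T, tm_accept T, tm_reject T} \<subseteq> tm_states T"
    using finite_TQ finY special_TQ by (simp_all add: T_def)
  then show ?thesis
    unfolding turing_machine_def using d r a by (intro conjI)
qed

text \<open>\<open>rep\<close>: the tape holds the stack; \<open>hrep\<close>: the head is one cell above the top.\<close>

definition rep :: "nat => 'a tape => 'y list => bool" where
  "rep H tp s <-> (case tp of (l, x, r) =>
     x # l = map emb s @ [Blank] \<and> set s \<subseteq> Y \<and> length s \<le> H \<and> tape_cells tp \<le> H + 3)"

definition hrep :: "nat => 'a tape => 'y list => bool" where
  "hrep H tp s <-> (case tp of (l, x, r) =>
     l = map emb s @ [Blank] \<and> set s \<subseteq> Y \<and> length s \<le> H \<and> tape_cells tp \<le> H + 3)"

text \<open>A cell is created only if nothing lies to the right of the head. The tape then consists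
  of the stack, the blank under it and the new cell, at most \<open>H + 2\<close> cells. This keeps
  the bound although a pop never gives cells back.\<close>

lemma rep_push:
  assumes "rep H tp s"
  shows "hrep H (write_move (scanned tp, MRight) tp) s"
proof -
  obtain l x r where tp: "tp = (l, x, r)" by (cases tp)
  have e: "x # l = map emb s @ [Blank]" using assms by (auto simp: tp rep_def)
  have "length (x # l) = length (map emb s @ [Blank])" by (simp only: e)
  then have "length l = length s" by simp
  then show ?thesis using assms by (cases r) (auto simp: tp rep_def hrep_def)
qed

lemma hrep_write:
  assumes "hrep H tp s" "y \<in> Y" "length s < H"
  shows "rep H (write_move (emb y, MStay) tp) (y # s)"
  using assms by (cases tp) (auto simp: rep_def hrep_def)

lemma rep_pop:
  assumes "rep H tp (y # s)"
  shows "rep H (write_move (scanned tp, MLeft) tp) s" and "scanned tp = emb y" and "y \<in> Y"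
proof -
  obtain l x r where tp: "tp = (l, x, r)" by (cases tp)
  have l: "l = map emb s @ [Blank]" using assms by (auto simp: tp rep_def)
  then have "l \<noteq> []" by simp
  then obtain z l' where l': "l = z # l'" by (meson neq_Nil_conv)
  have zl: "z # l' = map emb s @ [Blank]" using l l' by simp
  have "length (z # l') = length (map emb s @ [Blank])" by (simp only: zl)
  then have "length l' = length s" by simp
  moreover have "write_move (scanned tp, MLeft) tp = (l', z, x # r)" by (simp add: tp l')
  ultimately show "rep H (write_move (scanned tp, MLeft) tp) s"
    using assms zl by (simp add: tp rep_def l')
  show "scanned tp = emb y" "y \<in> Y" using assms by (auto simp: tp rep_def)
qed

lemma rep_empty: "rep H tp [] ==> scanned tp = Blank"
  by (cases tp) (auto simp: rep_def)

lemma write_same: "write_move (scanned tp, MStay) tp = tp"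
  by (cases tp) auto

text \<open>A halted stack machine stays in its \<open>SHalt\<close> state, whereas the Turing
  machine moves on to \<open>TAcc\<close> or \<open>TRej\<close>; the last alternative keeps the
  relation alive there.\<close>

definition simul :: "nat => 'q \<times> ('r => 'y list) => ('r, 'y, 'q) tstate \<times> ('r => 'a tape) => bool" where
  "simul H c C <-> fst c \<in> Q \<and> (\<forall>r \<in> set R. rep H (snd C r) (snd c r)) \<and>
     (fst C = TMain (fst c) \<or> (\<exists>b. I (fst c) = SHalt b \<and> fst C = (if b then TAcc else TRej)))"

text \<open>The moment between the two steps of a push: the head of stack \<open>r\<close> has moved
  up, the symbol is not yet written, and \<open>c\<close> is still the configuration before the
  push.\<close>

definition hsimul :: "nat => 'q \<times> ('r => 'y list) => ('r, 'y, 'q) tstate \<times> ('r => 'a tape) => bool" where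
  "hsimul H c C <-> fst c \<in> Q \<and>
     (\<exists>r y q. I (fst c) = SPush r y q \<and> fst C = TPush r y q \<and> hrep H (snd C r) (snd c r) \<and>
        (\<forall>r' \<in> set R - {r}. rep H (snd C r') (snd c r')))"

lemma simul_step:
  assumes sim: "simul H c C" and H: "\<And>r. length (snd (sstep I c) r) \<le> H"
  shows "simul H (sstep I c) (step C) \<or> hsimul H c (step C) "
proof -
  obtain q st where c: "c = (q, st)" by (cases c)
  obtain t tp where C: "C = (t, tp)" by (cases C)
  have q: "q \<in> Q" using sim by (simp add: simul_def c)
  have rp: "rep H (tp r) (st r)" if "r \<in> set R" for r using that sim by (auto simp: simul_def c C)
  consider (main) "t = TMain q" | (halt) b where "I q = SHalt b" "t = (if b then TAcc else TRej)"
    using sim by (auto simp: simul_def c C)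
  then show ?thesis
  proof cases
    case halt
    then show ?thesis using sim by (auto simp: simul_def c C step_def)
  next
    case main
    show ?thesis
    proof (cases "I q")
      case (SHalt b)
      then show ?thesis
        using main sim by (auto simp: simul_def c C step_def write_same)
    next
      case (SPush r y q')
      then have "hsimul H c (step C)"
        using main q rp push[OF q SPush]
        by (auto simp: hsimul_def c C step_def write_same intro!: rep_push)
      then show ?thesis by blast
    next
      case (SPop r f)
      note f = pop[OF q SPop]
      show ?thesis
      proof (cases "st r")
        case Nil
        then have "scanned (tp r) = Blank" using rp[of r] f rep_empty by metis
        then show ?thesis
          using main rp f by (auto simp: simul_def c C step_def SPop Nil write_same)
      next
        case (Cons y ys)
        note p = rep_pop[of H "tp r" y ys]
        have rr: "rep H (tp r) (y # ys)" using rp[of r] f Cons by simp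
        have "scanned (tp r) \<noteq> Blank" using p(2,3)[OF rr] nonblank by (metis imageI)
        moreover have "inv_into Y emb (scanned (tp r)) = y" using p(2,3)[OF rr] inj by simp
        ultimately show ?thesis
          using main rp f p[OF rr] by (auto simp: simul_def c C step_def SPop Cons write_same)
      qed
    qed
  qed
qed

lemma hsimul_step:
  assumes sim: "hsimul H c C" and H: "\<And>r. length (snd (sstep I c) r) \<le> H"
  shows "simul H (sstep I c) (step C)"
proof -
  obtain q st where c: "c = (q, st)" by (cases c)
  obtain t tp where C: "C = (t, tp)" by (cases C)
  obtain r y q' where I: "I q = SPush r y q'" and t: "t = TPush r y q'" and q: "q \<in> Q"
    and h: "hrep H (tp r) (st r)" and o: "\<forall>r' \<in> set R - {r}. rep H (tp r') (st r')"
    using sim by (auto simp: hsimul_def c C)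
  have "length (st r) < H" using H[of r] by (simp add: c I)
  then have "rep H (write_move (emb y, MStay) (tp r)) (y # st r)"
    using hrep_write h push[OF q I] by blast
  then show ?thesis
    using o push[OF q I] by (auto simp: simul_def c C I t step_def write_same)
qed

text \<open>The walk ends on the last symbol of the input, which thereby becomes the top of the
  initial stack.\<close>

definition sinit :: "'a list => 'r => 'y list" where
  "sinit w = (\<lambda>r. if r = r0 then rev (map inp w) else [])"

definition tinit :: "'a list => 'r => 'a tape" where
  "tinit w = (\<lambda>r. if r = r0 then input_tape w else ([], Blank, []))"

text \<open>The configurations of the walk to the end of the input.\<close>

definition walk :: "'a list => ('r, 'y, 'q) tstate \<times> ('r => 'a tape) => bool" where
  "walk w C <-> C = (T0, tinit w) \<or>
     (\<exists>r. fst C = T1 \<and> snd C = (tinit w)(r0 := ([], Blank, r)) \<and> (r = map Inp w \<or> w = [] \<and> r = [Blank])) \<or>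
     (\<exists>u v x r. fst C = T2 \<and> w = u @ v \<and> snd C = (tinit w)(r0 := (map Inp (rev u) @ [Blank], x, r)) \<and>
        (if v = [] then x = Blank \<and> r = [] else x # r = map Inp v))"

lemma walk_step:
  assumes "walk w C" and H: "length w \<le> H"
  shows "walk w (step C) \<or> simul H (q0, sinit w) (step C)"
proof -
  obtain t tp where C: "C = (t, tp)" by (cases C)
  consider (0) "C = (T0, tinit w)"
    | (1) r where "t = T1" "tp = (tinit w)(r0 := ([], Blank, r))" "r = map Inp w \<or> w = [] \<and> r = [Blank]"
    | (2) u v x r where "t = T2" "w = u @ v" "tp = (tinit w)(r0 := (map Inp (rev u) @ [Blank], x, r))"
        "if v = [] then x = Blank \<and> r = [] else x # r = map Inp v"
    using assms(1) by (auto simp: walk_def C)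
  then show ?thesis
  proof cases
    case 0
    then show ?thesis
      by (cases w) (auto simp: walk_def step_def tinit_def write_same fun_eq_iff)
  next
    case 1
    then have "step C = (T2, (tinit w)(r0 := ([Blank], (if w = [] then Blank else Inp (hd w)), map Inp (tl w))))"
      by (cases w) (auto simp: C step_def write_same tinit_def fun_eq_iff)
    then have "walk w (step C)"
      unfolding walk_def
      by (intro disjI2) (rule exI[of _ "[]"], rule exI[of _ w],
          rule exI[of _ "if w = [] then Blank else Inp (hd w)"], rule exI[of _ "map Inp (tl w)"],
          cases w, auto)
    then show ?thesis ..
  next
    case 2
    show ?thesis
    proof (cases v)
      case Nil
      then have w: "w = u" and x: "x = Blank" "r = []" using 2 by auto
      obtain z l where zl: "map Inp (rev u) @ [Blank] = z # l" by (cases "map Inp (rev u) @ [Blank]") auto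
      have st: "step C = (TMain q0, (tinit w)(r0 := (l, z, [Blank])))"
        using 2 x zl by (auto simp: C step_def write_same fun_eq_iff)
      have "length (map Inp (rev u) @ [Blank]) = length (z # l)" by (simp only: zl)
      then have ll: "length l = length u" by simp
      then have "rep H (l, z, [Blank]) (rev (map inp w))"
        using H inp ll by (auto simp: rep_def zl[symmetric] w rev_map emb_inp comp_def)
      moreover have "rep H ([], Blank, []) []" by (simp add: rep_def)
      ultimately have "simul H (q0, sinit w) (step C)"
        using q0 dist by (auto simp: simul_def st sinit_def tinit_def)
      then show ?thesis ..
    next
      case (Cons a v')
      then have x: "x = Inp a" "r = map Inp v'" using 2 by auto
      let ?x = "if v' = [] then Blank else Inp (hd v')" and ?r = "map Inp (tl v')"
      have s: "step C = (T2, (tinit w)(r0 := (map Inp (rev (u @ [a])) @ [Blank], ?x, ?r)))"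
        using 2(1,3) x by (cases v') (auto simp: C step_def write_same fun_eq_iff)
      have w: "w = (u @ [a]) @ v'" using 2(2) Cons by simp
      have c: "if v' = [] then ?x = Blank \<and> ?r = [] else ?x # ?r = map Inp v'"
        by (cases v') auto
      have "walk w (step C)"
        unfolding walk_def
        by (rule disjI2, rule disjI2, rule exI[of _ "u @ [a]"], rule exI[of _ v'],
            rule exI[of _ ?x], rule exI[of _ ?r], simp only: s fst_conv snd_conv)
          (intro conjI refl w c)
      then show ?thesis ..
    qed
  qed
qed

lemma walk_measure:
  assumes "walk w C" and H: "length w \<le> H"
  shows "\<exists>t. simul H (q0, sinit w) ((step ^^ t) C)"
proof -
  \<comment> \<open>In state \<open>T2\<close> the list \<open>l\<close> consists of the blank and
    the symbols already passed, so \<open>length l \<le> length w + 1\<close> and the difference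
    stays positive during the walk.\<close>
  define m :: "('r, 'y, 'q) tstate \<times> ('r => 'a tape) => nat" where
    "m = (\<lambda>C. case fst C of T0 => length w + 3 | T1 => length w + 2
          | T2 => (case snd C r0 of (l, x, r) => length w + 2 - length l) | _ => 0)"
  have dec: "m (step C) < m C" if "walk w C" "walk w (step C)" for C
  proof -
    obtain t tp where C: "C = (t, tp)" by (cases C)
    show ?thesis
      using that(1) unfolding walk_def C
    proof (elim disjE exE conjE, goal_cases)
      case 1
      then show ?case by (auto simp: m_def step_def)
    next
      case (2 r)
      then show ?case by (cases r) (auto simp: m_def step_def)
    next
      case (3 r)
      then show ?case by (auto simp: m_def step_def)
    next
      case (4 u v x r)
      show ?case
      proof (cases v)
        case Nil
        then show ?thesis using 4 that(2) by (auto simp: m_def step_def C walk_def)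
      next
        case (Cons a v')
        then show ?thesis using 4 by (cases r) (auto simp: m_def step_def)
      qed
    qed
  qed
  show ?thesis using assms(1)
  proof (induction "m C" arbitrary: C rule: less_induct)
    case less
    show ?case
    proof (cases "walk w (step C)")
      case True
      then obtain t where "simul H (q0, sinit w) ((step ^^ t) (step C))"
        using less.hyps dec less.prems by blast
      then have "simul H (q0, sinit w) ((step ^^ Suc t) C)"
        by (simp add: funpow_swap1)
      then show ?thesis by blast
    next
      case False
      then have "simul H (q0, sinit w) ((step ^^ 1) C)"
        using walk_step[OF less.prems H] by fastforce
      then show ?thesis by blast
    qed
  qed
qed


lemma conf_init: "conf (T0, tinit w) = (tm_start T, input_tape w # replicate (tm_tapes T - 1) ([], Blank, []))"
proof -
  have "map (tinit w) rs = map (\<lambda>_. ([], Blank, [])) rs"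
    using dist by (auto simp: tinit_def)
  then show ?thesis by (simp add: conf_def T_def tinit_def map_replicate_const)
qed

context
  fixes w :: "'a list" and H :: nat
  assumes H: "\<And>t r. length (snd ((sstep I ^^ t) (q0, sinit w)) r) \<le> H"
begin

lemma length_w: "length w \<le> H"
  using H[of 0 r0] by (simp add: sinit_def)

lemma H_step: "length (snd (sstep I ((sstep I ^^ i) (q0, sinit w))) r) \<le> H"
  using H[of "Suc i"] by simp

text \<open>A pure invariant, from which the space bound and membership in \<open>TQ\<close> follow.
  Progress of the simulation is the business of \<open>simul_reached\<close>.\<close>

definition reach :: "('r, 'y, 'q) tstate \<times> ('r => 'a tape) => bool" where
  "reach C <-> walk w C \<or>
     (\<exists>i. simul H ((sstep I ^^ i) (q0, sinit w)) C \<or> hsimul H ((sstep I ^^ i) (q0, sinit w)) C)"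

lemma reach_step:
  assumes "reach C"
  shows "reach (step C)"
proof -
  let ?c = "\<lambda>i. (sstep I ^^ i) (q0, sinit w)"
  consider "walk w C" | i where "simul H (?c i) C" | i where "hsimul H (?c i) C"
    using assms by (auto simp: reach_def)
  then show ?thesis
  proof cases
    case 1
    have "(sstep I ^^ 0) (q0, sinit w) = (q0, sinit w)" by simp
    then show ?thesis using walk_step[OF 1 length_w] unfolding reach_def by metis
  next
    case (2 i)
    have "?c (Suc i) = sstep I (?c i)" by simp
    then show ?thesis using simul_step[OF 2 H_step] unfolding reach_def by metis
  next
    case (3 i)
    have "?c (Suc i) = sstep I (?c i)" by simp
    then show ?thesis using hsimul_step[OF 3 H_step] unfolding reach_def by metis
  qed
qed

lemma reach: "reach ((step ^^ t) (T0, tinit w))"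
  by (induction t) (auto simp: reach_step, simp add: reach_def walk_def)

lemma reach_TQ:
  assumes "reach C"
  shows "fst C \<in> TQ"
  using assms push unfolding reach_def walk_def simul_def hsimul_def
  by (elim disjE exE conjE) (auto simp: special_TQ)

lemma reach_cells:
  assumes "reach C" "r \<in> set R"
  shows "tape_cells (snd C r) \<le> H + 3"
proof -
  have hr: "hrep H tp s ==> tape_cells tp \<le> H + 3" "rep H tp s ==> tape_cells tp \<le> H + 3" for tp s
    by (auto simp: rep_def hrep_def split: prod.splits)
  consider "walk w C" | i where "simul H ((sstep I ^^ i) (q0, sinit w)) C"
    | i where "hsimul H ((sstep I ^^ i) (q0, sinit w)) C"
    using assms by (auto simp: reach_def)
  then show ?thesis
  proof cases
    case 1
    have "tape_cells (input_tape w) \<le> length w + 1" by (cases w) auto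
    moreover have "if v = [] then x = Blank \<and> r = [] else x # r = map Inp v ==>
        length r \<le> length v" for v :: "'a list" and x r
      by (cases v) auto
    ultimately show ?thesis using 1 length_w
      unfolding walk_def by (elim disjE exE conjE) (fastforce simp: tinit_def)+
  next
    case (2 i)
    then have "rep H (snd C r) (snd ((sstep I ^^ i) (q0, sinit w)) r)"
      using assms(2) unfolding simul_def by blast
    then show ?thesis by (rule hr)
  next
    case (3 i)
    then show ?thesis using assms(2) hr unfolding hsimul_def by (metis Diff_iff empty_iff insert_iff)
  qed
qed

lemma tm_run_conf: "tm_run T w t = conf ((step ^^ t) (T0, tinit w))"
proof (induction t)
  case 0
  then show ?case by (simp add: tm_run_def conf_init)
next
  case (Suc t)
  have "tm_run T w (Suc t) = tm_step T (tm_run T w t)" by (simp add: tm_run_def)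
  then show ?case using Suc tm_step_conf reach_TQ[OF reach] by simp
qed

lemma config_space_run: "config_space (tm_run T w t) \<le> length R * (H + 3)"
proof -
  have "config_space (tm_run T w t) = (\<Sum>r\<leftarrow>R. tape_cells (snd ((step ^^ t) (T0, tinit w)) r))"
    by (simp add: tm_run_conf config_space_def conf_def comp_def)
  also have "\<dots> \<le> (\<Sum>r\<leftarrow>R. H + 3)"
    by (rule sum_list_mono) (rule reach_cells[OF reach])
  finally show ?thesis by (simp add: sum_list_triv)
qed

text \<open>One step of the stack machine takes one or, for a push, two steps of the Turing
  machine.\<close>

lemma simul_reached: "\<exists>t. simul H ((sstep I ^^ i) (q0, sinit w)) ((step ^^ t) (T0, tinit w))"
proof (induction i)
  case 0
  then show ?case using walk_measure[OF _ length_w] by (auto simp: walk_def)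
next
  case (Suc i)
  let ?c = "(sstep I ^^ i) (q0, sinit w)"
  obtain t where t: "simul H ?c ((step ^^ t) (T0, tinit w))" using Suc by blast
  consider "simul H (sstep I ?c) ((step ^^ Suc t) (T0, tinit w))"
    | "simul H (sstep I ?c) ((step ^^ Suc (Suc t)) (T0, tinit w))"
    using simul_step[OF t H_step] hsimul_step[OF _ H_step] by fastforce
  then show ?case by cases (metis comp_apply funpow.simps(2))+
qed

lemma halts:
  assumes "(sstep I ^^ i) (q0, sinit w) = (q, st)" "I q = SHalt b"
  shows "\<exists>t. fst (tm_run T w t) = (if b then tm_accept T else tm_reject T)"
proof -
  obtain t where t: "simul H (q, st) ((step ^^ t) (T0, tinit w))"
    using simul_reached[of i] assms by auto
  obtain p tp where C: "(step ^^ t) (T0, tinit w) = (p, tp)" by fastforce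
  \<comment> \<open>One step further, because the state may still be \<open>TMain q\<close>; if the
    machine has already stopped, the extra step changes nothing.\<close>
  have "fst ((step ^^ Suc t) (T0, tinit w)) = (if b then TAcc else TRej)"
    using t assms(2) by (cases b) (auto simp: C simul_def step_def split: if_splits)
  then have "fst (tm_run T w (Suc t)) = num_of (if b then TAcc else TRej)"
    unfolding tm_run_conf by (simp add: conf_def)
  moreover have "num_of (if b then TAcc else TRej) = (if b then tm_accept T else tm_reject T)"
    by (simp add: T_def)
  ultimately show ?thesis by metis
qed

end

text \<open>Each tape exceeds the maximal stack height by at most three cells, so bounding the
  heights along the run bounds the space.\<close>

theorem stack_machine_PSPACE:
  fixes L :: "'a list set" and p :: "nat poly"
  assumes halt: "\<And>w. \<exists>i q st. (sstep I ^^ i) (q0, sinit w) = (q, st) \<and> I q = SHalt (w \<in> L)"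
    and height: "\<And>w t r. length (snd ((sstep I ^^ t) (q0, sinit w)) r) \<le> poly p (length w)"
  shows "L \<in> PSPACE"
proof -
  have "decides T L"
    unfolding decides_def using halts[OF height] halt by (metis (full_types))
  moreover have "config_space (tm_run T w t) \<le> poly (smult (length R) (p + [:3:])) (length w)" for w t
    using config_space_run[OF height] by simp
  ultimately show ?thesis unfolding PSPACE_def using turing_machine_T by blast
qed

end

section \<open>Alternating stack machines\<close>

datatype ('r, 'a, 'q) aop =
  AFail | ANeg 'q | AOr 'q 'q | AJmp 'q | APush 'r 'a 'q | APop 'r "'a option => 'q"

text \<open>\<open>aev J q st b m\<close>: the position has value \<open>b\<close>, and every play from it has length at most \<open>m\<close>.\<close>

inductive aev :: "('q => ('r, 'a, 'q) aop) => 'q => ('r => 'a list) => bool => nat => bool"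
  for J :: "'q => ('r, 'a, 'q) aop" where
  fail: "J q = AFail ==> aev J q st False m"
| neg: "J q = ANeg q' ==> aev J q' st b m ==> aev J q st (\<not> b) (Suc m)"
| disj: "J q = AOr q1 q2 ==> aev J q1 st b1 m ==> aev J q2 st b2 m ==> aev J q st (b1 \<or> b2) (Suc m)"
| jmp: "J q = AJmp q' ==> aev J q' st b m ==> aev J q st b (Suc m)"
| push: "J q = APush r c q' ==> aev J q' (st(r := c # st r)) b m ==> aev J q st b (Suc m)"
| pop_Nil: "J q = APop r f ==> st r = [] ==> aev J (f None) st b m ==> aev J q st b (Suc m)"
| pop_Cons: "J q = APop r f ==> st r = c # cs ==> aev J (f (Some c)) (st(r := cs)) b m ==>
    aev J q st b (Suc m)"

text \<open>The rule \<open>disj\<close> demands the same bound for both alternatives; monotonicity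
  brings them to a common one.\<close>

lemma aev_mono: "aev J q st b m ==> m \<le> m' ==> aev J q st b m'"
proof (induction arbitrary: m' rule: aev.induct)
  case (fail q st m)
  then show ?case by (simp add: aev.fail)
next
  case (neg q q' st b m)
  then obtain k where "m' = Suc k" "m \<le> k" by (cases m') auto
  then show ?case using neg by (auto intro: aev.neg)
next
  case (disj q q1 q2 st b1 m b2)
  then obtain k where "m' = Suc k" "m \<le> k" by (cases m') auto
  then show ?case using disj by (auto intro: aev.disj)
next
  case (jmp q q' st b m)
  then obtain k where "m' = Suc k" "m \<le> k" by (cases m') auto
  then show ?case using jmp by (auto intro: aev.jmp)
next
  case (push q r c q' st b m)
  then obtain k where "m' = Suc k" "m \<le> k" by (cases m') auto
  then show ?case using push.hyps(1) push.IH[of k] aev.push[of J q r c q' st b k] by (simp del: fun_upd_apply)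
next
  case (pop_Nil q r f st b m)
  then obtain k where "m' = Suc k" "m \<le> k" by (cases m') auto
  then show ?case using pop_Nil by (auto intro: aev.pop_Nil)
next
  case (pop_Cons q r f st c cs b m)
  then obtain k where "m' = Suc k" "m \<le> k" by (cases m') auto
  then show ?case using pop_Cons.hyps(1,2) pop_Cons.IH[of k] aev.pop_Cons[of J q r f st c cs b k]
    by (simp del: fun_upd_apply)
qed

fun asucc :: "('r, 'a, 'q) aop => 'q set" where
  "asucc AFail = {}"
| "asucc (ANeg q) = {q}"
| "asucc (AOr q q') = {q, q'}"
| "asucc (AJmp q) = {q}"
| "asucc (APush r c q) = {q}"
| "asucc (APop r f) = range f"

fun aregs :: "('r, 'a, 'q) aop => 'r set" where
  "aregs (APush r c q) = {r}"
| "aregs (APop r f) = {r}"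
| "aregs _ = {}"

lemma finite_aregs: "finite (aregs x)"
  by (cases x) auto

text \<open>
  Depth-first evaluation by a deterministic machine with one more stack (\<open>None\<close>), the log. It records
  how to undo every operation and which alternatives are still open, so that the position is restored
  when the value of a subgame is returned.
\<close>

datatype ('r, 'a, 'q) dsym =
  Sy 'a | UNone | UPop 'r | UPush 'r 'a | FOr 'q | FOr2 bool | FNeg

text \<open>A stack machine performs one stack operation per step, but a move of the game or its
  undoing takes two, one on the log and one on a stack. \<open>FPush\<close>, \<open>FPop\<close>
  and \<open>RFrame\<close> are the states in between.\<close>

datatype ('r, 'a, 'q) dstate =
    Fwd 'q | FPush 'r 'a 'q | FPop 'r "'a option" 'q
  | Ret bool | RFrame "('r, 'a, 'q) dsym" bool | Hlt bool

fun unS :: "('r, 'a, 'q) dsym option => 'a option" where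
  "unS (Some (Sy a)) = Some a"
| "unS _ = None"

fun dfs :: "('q => ('r, 'a, 'q) aop) => ('r, 'a, 'q) dstate =>
    ('r option, ('r, 'a, 'q) dsym, ('r, 'a, 'q) dstate) sop" where
  "dfs J (Fwd q) =
     (case J q of
        AFail => SPush None UNone (Ret False)
      | ANeg q' => SPush None FNeg (Fwd q')
      | AOr q1 q2 => SPush None (FOr q2) (Fwd q1)
      | AJmp q' => SPush None UNone (Fwd q')
      | APush r c q' => SPush None (UPop r) (FPush r c q')
      | APop r f => SPop (Some r) (\<lambda>x. FPop r (unS x) (f (unS x))))"
| "dfs J (FPush r c q) = SPush (Some r) (Sy c) (Fwd q)"
| "dfs J (FPop r x q) = SPush None (case x of None => UNone | Some c => UPush r c) (Fwd q)"
| "dfs J (Ret b) = SPop None (\<lambda>x. case x of None => Hlt b | Some u =>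
     (case u of UNone => Ret b | FOr2 b' => Ret (b' \<or> b) | FNeg => Ret (\<not> b) | _ => RFrame u b))"
| "dfs J (RFrame u b) =
     (case u of
        UPop r => SPop (Some r) (\<lambda>_. Ret b)
      | UPush r c => SPush (Some r) (Sy c) (Ret b)
      | FOr q => SPush None (FOr2 b) (Fwd q)
      | _ => SHalt b)"
| "dfs J (Hlt b) = SHalt b"

text \<open>The height bound is carried at every intermediate configuration, so that composing paths
  also composes the space bound.\<close>

definition path :: "('q => ('r, 'y, 'q) sop) => nat => 'q \<times> ('r => 'y list) => 'q \<times> ('r => 'y list) => bool" where
  "path I H c c' <-> (\<exists>t. (sstep I ^^ t) c = c' \<and> (\<forall>i \<le> t. \<forall>r. length (snd ((sstep I ^^ i) c) r) \<le> H))"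

lemma path_trans [trans]:
  assumes "path I H a b" "path I H b c"
  shows "path I H a c"
proof -
  obtain t u where t: "(sstep I ^^ t) a = b" "\<forall>i \<le> t. \<forall>r. length (snd ((sstep I ^^ i) a) r) \<le> H"
    and u: "(sstep I ^^ u) b = c" "\<forall>i \<le> u. \<forall>r. length (snd ((sstep I ^^ i) b) r) \<le> H"
    using assms unfolding path_def by blast
  have shift: "(sstep I ^^ (k + t)) a = (sstep I ^^ k) b" for k
    by (simp only: funpow_add comp_apply t(1))
  have "length (snd ((sstep I ^^ i) a) r) \<le> H" if "i \<le> u + t" for i r
  proof (cases "i \<le> t")
    case True
    then show ?thesis using t(2) by blast
  next
    case False
    then obtain k where k: "i = k + t" by (metis add.commute le_add_diff_inverse nat_le_linear)
    then show ?thesis using u(2) that by (simp add: shift)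
  qed
  then show ?thesis
    unfolding path_def using shift[of u] u(1) by (intro exI[of _ "u + t"]) blast
qed

lemma path_step:
  assumes "sstep I c = c'" "\<And>r. length (snd c r) \<le> H" "\<And>r. length (snd c' r) \<le> H"
  shows "path I H c c'"
proof -
  have "length (snd ((sstep I ^^ i) c) r) \<le> H" if "i \<le> 1" for i r
    using that assms by (cases i) auto
  then show ?thesis unfolding path_def using assms(1) by (intro exI[of _ 1]) auto
qed

definition dst :: "('r => 'a list) => ('r, 'a, 'q) dsym list => 'r option => ('r, 'a, 'q) dsym list" where
  "dst st lg = (\<lambda>r. case r of None => lg | Some r => map Sy (st r))"

lemma dst_simps [simp]:
  "dst st lg None = lg" "dst st lg (Some r) = map Sy (st r)"
  "(dst st lg)(None := lg') = dst st lg'"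
  "(dst st lg)(Some r := map Sy s) = dst (st(r := s)) lg"
  by (auto simp: dst_def fun_eq_iff split: option.splits)

lemma dst_push [simp]: "(dst st lg)(Some r := Sy c # map Sy s) = dst (st(r := c # s)) lg"
  using dst_simps(4)[of st lg r "c # s"] by simp

lemma dst_height: "(\<And>r. length (st r) \<le> H) ==> length lg \<le> H ==> length (dst st lg r) \<le> H"
  by (cases r) auto

text \<open>The stacks and the log are restored exactly: the second alternative of an
  \<open>AOr\<close> has to start from the same position as the first. A move adds at most one
  symbol to the log and to a stack while \<open>m\<close> drops by one, so height plus
  \<open>m\<close> does not grow. The remaining 1 pays for the log entry of a failing leaf.\<close>

lemma dfs_aev:
  assumes "aev J q st b m"
  shows "(\<And>r. length (st r) + m + 1 \<le> H) ==> length lg + m + 1 \<le> H ==>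
    path (dfs J) H (Fwd q, dst st lg) (Ret b, dst st lg)"
  using assms
proof (induction arbitrary: lg rule: aev.induct)
  case (fail q st m)
  have h: "length (st r) \<le> H" for r using fail(2)[of r] by simp
  have "path (dfs J) H (Fwd q, dst st lg) (Ret False, dst st (UNone # lg))"
    by (rule path_step) (use fail h in \<open>auto intro!: dst_height\<close>)
  also have "path (dfs J) H (Ret False, dst st (UNone # lg)) (Ret False, dst st lg)"
    by (rule path_step) (use fail h in \<open>auto intro!: dst_height\<close>)
  finally show ?case .
next
  case (neg q q' st b m)
  have h: "length (st r) \<le> H" "length (st r) + m + 1 \<le> H" for r using neg.prems(1)[of r] by simp_all
  have "path (dfs J) H (Fwd q, dst st lg) (Fwd q', dst st (FNeg # lg))"
    by (rule path_step) (use neg h in \<open>auto intro!: dst_height\<close>)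
  also have "path (dfs J) H (Fwd q', dst st (FNeg # lg)) (Ret b, dst st (FNeg # lg))"
    using neg h by simp
  also have "path (dfs J) H (Ret b, dst st (FNeg # lg)) (Ret (\<not> b), dst st lg)"
    by (rule path_step) (use neg h in \<open>auto intro!: dst_height\<close>)
  finally show ?case .
next
  case (disj q q1 q2 st b1 m b2)
  have h: "length (st r) \<le> H" "length (st r) + m + 1 \<le> H" for r using disj.prems(1)[of r] by simp_all
  have "path (dfs J) H (Fwd q, dst st lg) (Fwd q1, dst st (FOr q2 # lg))"
    by (rule path_step) (use disj h in \<open>auto intro!: dst_height\<close>)
  also have "path (dfs J) H (Fwd q1, dst st (FOr q2 # lg)) (Ret b1, dst st (FOr q2 # lg))"
    using disj h by simp
  also have "path (dfs J) H (Ret b1, dst st (FOr q2 # lg)) (RFrame (FOr q2) b1, dst st lg)"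
    by (rule path_step) (use disj h in \<open>auto intro!: dst_height\<close>)
  also have "path (dfs J) H (RFrame (FOr q2) b1, dst st lg) (Fwd q2, dst st (FOr2 b1 # lg))"
    by (rule path_step) (use disj h in \<open>auto intro!: dst_height\<close>)
  also have "path (dfs J) H (Fwd q2, dst st (FOr2 b1 # lg)) (Ret b2, dst st (FOr2 b1 # lg))"
    using disj h by simp
  also have "path (dfs J) H (Ret b2, dst st (FOr2 b1 # lg)) (Ret (b1 \<or> b2), dst st lg)"
    by (rule path_step) (use disj h in \<open>auto intro!: dst_height\<close>)
  finally show ?case .
next
  case (jmp q q' st b m)
  have h: "length (st r) \<le> H" "length (st r) + m + 1 \<le> H" for r using jmp.prems(1)[of r] by simp_all
  have "path (dfs J) H (Fwd q, dst st lg) (Fwd q', dst st (UNone # lg))"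
    by (rule path_step) (use jmp h in \<open>auto intro!: dst_height\<close>)
  also have "path (dfs J) H (Fwd q', dst st (UNone # lg)) (Ret b, dst st (UNone # lg))"
    using jmp h by simp
  also have "path (dfs J) H (Ret b, dst st (UNone # lg)) (Ret b, dst st lg)"
    by (rule path_step) (use jmp h in \<open>auto intro!: dst_height\<close>)
  finally show ?case .
next
  case (push q r c q' st b m)
  let ?st = "st(r := c # st r)"
  have h: "length (st r) \<le> H" "length (?st r) \<le> H" "length (?st r) + m + 1 \<le> H" for r
    using push.prems(1)[of r] by auto
  have "path (dfs J) H (Fwd q, dst st lg) (FPush r c q', dst st (UPop r # lg))"
    by (rule path_step) (use push h in \<open>auto intro!: dst_height\<close>)
  also have "path (dfs J) H (FPush r c q', dst st (UPop r # lg)) (Fwd q', dst ?st (UPop r # lg))"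
    by (rule path_step, simp) (use push.prems h in \<open>auto intro!: dst_height simp del: fun_upd_apply\<close>)
  also have "path (dfs J) H (Fwd q', dst ?st (UPop r # lg)) (Ret b, dst ?st (UPop r # lg))"
    by (rule push.IH) (use h push.prems in simp_all)
  also have "path (dfs J) H (Ret b, dst ?st (UPop r # lg)) (RFrame (UPop r) b, dst ?st lg)"
    by (rule path_step, simp) (use push.prems h in \<open>auto intro!: dst_height simp del: fun_upd_apply\<close>)
  also have "path (dfs J) H (RFrame (UPop r) b, dst ?st lg) (Ret b, dst st lg)"
    by (rule path_step, simp) (use push.prems h in \<open>auto intro!: dst_height simp del: fun_upd_apply\<close>)
  finally show ?case .
next
  case (pop_Nil q r f st b m)
  have h: "length (st r) \<le> H" "length (st r) + m + 1 \<le> H" for r using pop_Nil.prems(1)[of r] by simp_all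
  have "path (dfs J) H (Fwd q, dst st lg) (FPop r None (f None), dst st lg)"
    by (rule path_step) (use pop_Nil h in \<open>auto intro!: dst_height\<close>)
  also have "path (dfs J) H (FPop r None (f None), dst st lg) (Fwd (f None), dst st (UNone # lg))"
    by (rule path_step) (use pop_Nil h in \<open>auto intro!: dst_height\<close>)
  also have "path (dfs J) H (Fwd (f None), dst st (UNone # lg)) (Ret b, dst st (UNone # lg))"
    using pop_Nil h by simp
  also have "path (dfs J) H (Ret b, dst st (UNone # lg)) (Ret b, dst st lg)"
    by (rule path_step) (use pop_Nil h in \<open>auto intro!: dst_height\<close>)
  finally show ?case .
next
  case (pop_Cons q r f st c cs b m)
  let ?st = "st(r := cs)"
  have h: "length (st r') \<le> H" "length (?st r') \<le> H" "length (?st r') + m + 1 \<le> H" for r'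
    using pop_Cons.prems(1)[of r'] pop_Cons.hyps(2) by auto
  have st: "st = ?st(r := c # ?st r)" using pop_Cons.hyps(2) by auto
  have "path (dfs J) H (Fwd q, dst st lg) (FPop r (Some c) (f (Some c)), dst ?st lg)"
    by (rule path_step) (use pop_Cons h in \<open>auto intro!: dst_height simp del: fun_upd_apply\<close>)
  also have "path (dfs J) H (FPop r (Some c) (f (Some c)), dst ?st lg) (Fwd (f (Some c)), dst ?st (UPush r c # lg))"
    by (rule path_step) (use pop_Cons h in \<open>auto intro!: dst_height simp del: fun_upd_apply\<close>)
  also have "path (dfs J) H (Fwd (f (Some c)), dst ?st (UPush r c # lg)) (Ret b, dst ?st (UPush r c # lg))"
    by (rule pop_Cons.IH) (use h pop_Cons.prems in simp_all)
  also have "path (dfs J) H (Ret b, dst ?st (UPush r c # lg)) (RFrame (UPush r c) b, dst ?st lg)"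
    by (rule path_step) (use pop_Cons h in \<open>auto intro!: dst_height simp del: fun_upd_apply\<close>)
  also have "path (dfs J) H (RFrame (UPush r c) b, dst ?st lg) (Ret b, dst st lg)"
    by (rule path_step) (use pop_Cons h in \<open>auto intro!: dst_height simp del: fun_upd_apply\<close>, simp add: pop_Cons.hyps(2)[symmetric])
  finally show ?case .
qed

theorem alternating_PSPACE:
  fixes J :: "'q => ('r, 'a::finite, 'q) aop" and L :: "'a list set" and p :: "nat poly"
  assumes fin: "finite QA" and q0: "q0 \<in> QA" and closed: "\<And>q. q \<in> QA ==> asucc (J q) \<subseteq> QA"
    and ev: "\<And>w. aev J q0 (\<lambda>r. if r = r0 then rev w else []) (w \<in> L) (poly p (length w))"
  shows "L \<in> PSPACE"
proof -
  define R where "R = insert r0 (\<Union>q \<in> QA. aregs (J q))"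
  have finR: "finite R" unfolding R_def using fin finite_aregs by blast
  then obtain rs where rs: "distinct rs" "set rs = R - {r0}"
    using finite_distinct_list[of "R - {r0}"] by auto
  define Y :: "('r, 'a, 'q) dsym set" where
    "Y = range Sy \<union> {UNone, FNeg} \<union> UPop ` R \<union> (\<Union>r \<in> R. range (UPush r)) \<union> FOr ` QA \<union> range FOr2"
  have finY: "finite Y" using fin finR by (auto simp: Y_def)
  then obtain g :: "('r, 'a, 'q) dsym => nat" where g: "inj_on g Y"
    using finite_imp_inj_to_nat_seg[OF finY] by blast
  define emb :: "('r, 'a, 'q) dsym => 'a cell" where
    "emb = (\<lambda>y. case y of Sy a => Inp a | _ => Aux (g y))"
  define Q :: "('r, 'a, 'q) dstate set" where
    "Q = Fwd ` QA \<union> (\<Union>r \<in> R. \<Union>q \<in> QA. range (\<lambda>c. FPush r c q)) \<union>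
      (\<Union>r \<in> R. \<Union>q \<in> QA. range (\<lambda>x. FPop r x q)) \<union> range Ret \<union>
      (\<Union>u \<in> Y. range (RFrame u)) \<union> range Hlt"
  have finQ: "finite Q" using fin finR finY by (auto simp: Q_def)
  have YI: "Sy a \<in> Y" "UNone \<in> Y" "FNeg \<in> Y" "r \<in> R ==> UPop r \<in> Y" "r \<in> R ==> UPush r a \<in> Y"
    "q \<in> QA ==> FOr q \<in> Y" "FOr2 b \<in> Y" for a r q b
  proof -
    show "UPush r a \<in> Y" if "r \<in> R"
    proof -
      have "(UPush r a :: ('r, 'a, 'q) dsym) \<in> (\<Union>r \<in> R. range (UPush r))" using that by (rule UN_I) (rule rangeI)
      then show ?thesis by (simp only: Y_def Un_iff simp_thms)
    qed
  qed (simp_all add: Y_def)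
  have QI: "q \<in> QA ==> Fwd q \<in> Q" "r \<in> R ==> q \<in> QA ==> FPush r c q \<in> Q"
    "r \<in> R ==> q \<in> QA ==> FPop r x q \<in> Q" "Ret b \<in> Q" "u \<in> Y ==> RFrame u b \<in> Q" "Hlt b \<in> Q" for q r c x b u
  proof -
    show "FPush r c q \<in> Q" if "r \<in> R" "q \<in> QA"
    proof -
      have "FPush r c q \<in> (\<Union>r \<in> R. \<Union>q \<in> QA. range (\<lambda>c. FPush r c q))"
        using that(1) by (rule UN_I) (rule UN_I[OF that(2)], rule rangeI)
      then show ?thesis by (simp only: Q_def Un_iff simp_thms)
    qed
    show "FPop r x q \<in> Q" if "r \<in> R" "q \<in> QA"
    proof -
      have "FPop r x q \<in> (\<Union>r \<in> R. \<Union>q \<in> QA. range (\<lambda>x. FPop r x q))"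
        using that(1) by (rule UN_I) (rule UN_I[OF that(2)], rule rangeI)
      then show ?thesis by (simp only: Q_def Un_iff simp_thms)
    qed
    show "RFrame u b \<in> Q" if "u \<in> Y"
    proof -
      have "RFrame u b \<in> (\<Union>u \<in> Y. range (RFrame u))" using that by (rule UN_I) (rule rangeI)
      then show ?thesis by (simp only: Q_def Un_iff simp_thms)
    qed
  qed (simp_all add: Q_def)
  have YD: "UPop r \<in> Y ==> r \<in> R" "UPush r c \<in> Y ==> r \<in> R" "FOr q \<in> Y ==> q \<in> QA" for r c q
    by (auto simp: Y_def)
  have QD: "Fwd q \<in> Q ==> q \<in> QA" "FPush r c q \<in> Q ==> r \<in> R \<and> q \<in> QA"
    "FPop r x q \<in> Q ==> r \<in> R \<and> q \<in> QA" "RFrame u b \<in> Q ==> u \<in> Y" for q r c x u b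
    by (auto simp: Q_def)
  have regs: "aregs (J q) \<subseteq> R" if "q \<in> QA" for q using that by (auto simp: R_def)
  have closed_dfs:
    "(case dfs J q of SHalt b => True
      | SPush r y q' => r \<in> insert None (Some ` R) \<and> y \<in> Y \<and> q' \<in> Q
      | SPop r f => r \<in> insert None (Some ` R) \<and> f None \<in> Q \<and> (\<forall>y \<in> Y. f (Some y) \<in> Q))"
    if "q \<in> Q" for q
  proof (cases q)
    case (Fwd p)
    then have p: "p \<in> QA" using that QD by blast
    show ?thesis
    proof (cases "J p")
      case (APop r f)
      then have "r \<in> R" "\<And>x. f x \<in> QA" using closed[OF p] regs[OF p] by auto
      then show ?thesis using QI(3) by (simp add: Fwd APop)
    qed (use closed[OF p] regs[OF p] YI QI in \<open>simp_all add: Fwd\<close>)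
  next
    case (FPush r c p)
    then show ?thesis using that QD(2)[of r c p] YI QI by simp
  next
    case (FPop r x p)
    then show ?thesis using that QD(3)[of r x p] YI QI by (cases x) simp_all
  next
    case (Ret b)
    then show ?thesis using QI by (auto split: dsym.split)
  next
    case (RFrame u b)
    then have "u \<in> Y" using that QD by blast
    then have "(\<exists>r \<in> R. u = UPop r) \<or> (\<exists>r \<in> R. \<exists>c. u = UPush r c) \<or> (\<exists>q' \<in> QA. u = FOr q') \<or>
        dfs J q = SHalt b"
      using YD by (cases u) (auto simp: RFrame)
    then show ?thesis using YI QI by (auto simp: RFrame)
  next
    case (Hlt b)
    then show ?thesis by simp
  qed
  interpret stack_machine "Some r0" "None # map Some rs" Q Y "dfs J" "Fwd q0" emb Sy
  proof
    show "distinct (Some r0 # None # map Some rs)" using rs by (auto simp: distinct_map)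
    show "inj_on emb Y" using g by (auto simp: inj_on_def emb_def split: dsym.splits)
    show "Blank \<notin> emb ` Y" by (auto simp: emb_def split: dsym.splits)
    show "emb (Sy a) = Inp a" for a by (simp add: emb_def)
    have R: "insert None (Some ` R) = set (Some r0 # None # map Some rs)" using rs by (auto simp: R_def)
    show "r \<in> set (Some r0 # None # map Some rs) \<and> y \<in> Y \<and> q' \<in> Q"
      if "q \<in> Q" "dfs J q = SPush r y q'" for q r y q'
      using closed_dfs[OF that(1)] that(2) R by simp
    show "r \<in> set (Some r0 # None # map Some rs) \<and> f None \<in> Q \<and> (\<forall>y \<in> Y. f (Some y) \<in> Q)"
      if "q \<in> Q" "dfs J q = SPop r f" for q r f
      using closed_dfs[OF that(1)] that(2) R by simp
  qed (use finQ finY q0 QI YI in auto)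
  have init: "sinit w = dst (\<lambda>r. if r = r0 then rev w else []) []" for w
    by (auto simp: sinit_def dst_def fun_eq_iff rev_map split: option.splits)
  \<comment> \<open>The height of the input stack at the start, plus the length of a longest play,
    plus one for the entry that a failing leaf logs.\<close>
  let ?H = "\<lambda>w :: 'a list. poly (p + [:1, 1:]) (length w)"
  have path: "path (dfs J) (?H w) (Fwd q0, sinit w) (Hlt (w \<in> L), sinit w)" for w
  proof -
    have "path (dfs J) (?H w) (Fwd q0, sinit w) (Ret (w \<in> L), sinit w)"
      unfolding init by (rule dfs_aev[OF ev]) simp_all
    moreover have "path (dfs J) (?H w) (Ret (w \<in> L), sinit w) (Hlt (w \<in> L), sinit w)"
    proof (rule path_step)
      have "length (sinit w r) \<le> ?H w" for r by (cases r) (simp_all add: init)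
      then show "length (snd (Ret (w \<in> L), sinit w) r) \<le> ?H w"
        "length (snd (Hlt (w \<in> L), sinit w) r) \<le> ?H w" for r by simp_all
    qed (simp add: init)
    ultimately show ?thesis by (rule path_trans)
  qed
  show ?thesis
  proof (rule stack_machine_PSPACE)
    show "\<exists>i q st. (sstep (dfs J) ^^ i) (Fwd q0, sinit w) = (q, st) \<and> dfs J q = SHalt (w \<in> L)" for w
    proof -
      obtain i where "(sstep (dfs J) ^^ i) (Fwd q0, sinit w) = (Hlt (w \<in> L), sinit w)"
        using path[of w] unfolding path_def by blast
      moreover have "dfs J (Hlt (w \<in> L)) = SHalt (w \<in> L)" by simp
      ultimately show ?thesis by blast
    qed
    fix w t r
    obtain u where u: "(sstep (dfs J) ^^ u) (Fwd q0, sinit w) = (Hlt (w \<in> L), sinit w)"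
      "\<And>i r. i \<le> u ==> length (snd ((sstep (dfs J) ^^ i) (Fwd q0, sinit w)) r) \<le> ?H w"
      using path[of w] unfolding path_def by blast
    show "length (snd ((sstep (dfs J) ^^ t) (Fwd q0, sinit w)) r) \<le> ?H w"
    proof (cases "t \<le> u")
      case True
      then show ?thesis using u(2) by blast
    next
      case False
      have stay: "(sstep (dfs J) ^^ n) (Hlt b, st) = (Hlt b, st)" for n b st
        by (induction n) auto
      obtain k where k: "t = k + u" using False by (metis add.commute le_add_diff_inverse nat_le_linear)
      have "(sstep (dfs J) ^^ t) (Fwd q0, sinit w) = (sstep (dfs J) ^^ u) (Fwd q0, sinit w)"
        by (simp only: k funpow_add comp_apply u(1) stay)
      then show ?thesis using u(2)[of u r] by (simp only: le_refl simp_thms)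
    qed
  qed
qed

section \<open>A language of alternating stack programs\<close>

text \<open>
  \<open>RIn\<close> holds the reversed input, \<open>CA d\<close> and \<open>CB d\<close> are the counters of the loops of level \<open>d\<close>. All
  counters have the same length, linear in the length of the input, so that every program runs in
  polynomial time, whatever it computes.
\<close>

datatype reg = RIn | RVar nat | RPc | RCnt | CA nat | CB nat

text \<open>\<open>While\<close> pops a register until it is empty. It serves to implement
  \<open>Loop\<close> and to read the input; \<open>wfc\<close> keeps it out of ordinary
  programs.\<close>

datatype cmd =
    Skip | Fail | Flip | Push reg sym | Case reg "sym option => cmd" | Or cmd cmd | Seq cmd cmd
  | While reg "sym => cmd" | Loop nat cmd

text \<open>A control state is the list of commands still to be executed. A loop pays for each round
  with a symbol of \<open>CA d\<close>, stores it in \<open>CB d\<close> and moves all of them back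
  at the end, so that the counter is full again for the next entry.\<close>

definition ops :: "cmd list => (reg, sym, cmd list) aop" where
  "ops q = (case q of [] => AFail | a # k =>
     (case a of
        Skip => AJmp k
      | Fail => AFail
      | Flip => ANeg k
      | Push r c => APush r c k
      | Case r f => APop r (\<lambda>x. f x # k)
      | Or a b => AOr (a # k) (b # k)
      | Seq a b => AJmp (a # b # k)
      | While r f => APop r (\<lambda>x. case x of None => k | Some c => f c # a # k)
      | Loop d b =>
          AJmp (While (CA d) (\<lambda>c. Seq (Push (CB d) c) b) # While (CB d) (Push (CA d)) # k)))"

lemma ops_simps [simp]:
  "ops [] = AFail"
  "ops (Skip # k) = AJmp k"
  "ops (Fail # k) = AFail"
  "ops (Flip # k) = ANeg k"
  "ops (Push r c # k) = APush r c k"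
  "ops (Case r f # k) = APop r (\<lambda>x. f x # k)"
  "ops (Or a b # k) = AOr (a # k) (b # k)"
  "ops (Seq a b # k) = AJmp (a # b # k)"
  "ops (While r g # k) = APop r (\<lambda>x. case x of None => k | Some c => g c # While r g # k)"
  "ops (Loop d a # k) =
     AJmp (While (CA d) (\<lambda>c. Seq (Push (CB d) c) a) # While (CB d) (Push (CA d)) # k)"
  by (simp_all add: ops_def)

text \<open>A set containing the control states that occur while \<open>c\<close> runs in front of
  \<open>k\<close>, except \<open>k\<close>. It is finite because a loop returns to the same
  continuation instead of extending it.\<close>

primrec conts :: "cmd => cmd list => cmd list set" where
  "conts Skip k = {Skip # k}"
| "conts Fail k = {Fail # k}"
| "conts Flip k = {Flip # k}"
| "conts (Push r c) k = {Push r c # k}"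
| "conts (Case r f) k = insert (Case r f # k) (\<Union>x. conts (f x) k)"
| "conts (Or a b) k = insert (Or a b # k) (conts a k \<union> conts b k)"
| "conts (Seq a b) k = insert (Seq a b # k) (conts a (b # k) \<union> conts b k)"
| "conts (While r f) k = insert (While r f # k) (\<Union>c. conts (f c) (While r f # k))"
| "conts (Loop d a) k =
     (let k2 = While (CB d) (Push (CA d)) # k; k1 = While (CA d) (\<lambda>c. Seq (Push (CB d) c) a) # k2 in
      {Loop d a # k, k1, k2} \<union> (\<Union>c. {Seq (Push (CB d) c) a # k1, Push (CB d) c # a # k1, Push (CA d) c # k2})
      \<union> conts a k1)"

instance sym :: finite ..

lemma finite_conts: "finite (conts c k)"
  by (induction c arbitrary: k) (auto simp: Let_def)

lemma conts_self: "c # k \<in> conts c k"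
  by (induction c arbitrary: k) (auto simp: Let_def)

lemma range_case_option: "range (case_option a f) = insert a (range f)"
  by (simp add: UNIV_option_conv image_image)

lemma conts_closed: "q \<in> conts c k ==> asucc (ops q) \<subseteq> insert k (conts c k)"
proof (induction c arbitrary: q k)
  case (Case r f)
  consider "q = Case r f # k" | x where "q \<in> conts (f x) k" using Case.prems by auto
  then show ?case
  proof cases
    case 1
    have "f x # k \<in> (\<Union>x. conts (f x) k)" for x using conts_self by blast
    then show ?thesis using 1 by auto
  next
    case (2 x)
    then show ?thesis using Case.IH[of "f x" q k] by auto
  qed
next
  case (Or a b)
  then show ?case using conts_self[of a k] conts_self[of b k] by fastforce
next
  case (Seq a b)
  then show ?case using conts_self[of a "b # k"] conts_self[of b k] by fastforce
next
  case (While r f)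
  consider "q = While r f # k" | c where "q \<in> conts (f c) (While r f # k)" using While.prems by auto
  then show ?case
  proof cases
    case 1
    have "f c # While r f # k \<in> (\<Union>c. conts (f c) (While r f # k))" for c using conts_self by blast
    then show ?thesis
      using 1 by (simp only: ops_simps asucc.simps range_case_option conts.simps) blast
  next
    case (2 c)
    then show ?thesis using While.IH[of "f c" q "While r f # k"] by auto
  qed
next
  case (Loop d a)
  define k2 where "k2 = While (CB d) (Push (CA d)) # k"
  define k1 where "k1 = While (CA d) (\<lambda>c. Seq (Push (CB d) c) a) # k2"
  have conts: "conts (Loop d a) k = {Loop d a # k, k1, k2} \<union>
      (\<Union>c. {Seq (Push (CB d) c) a # k1, Push (CB d) c # a # k1, Push (CA d) c # k2}) \<union> conts a k1"
    by (simp add: Let_def k1_def k2_def)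
  have "asucc (ops k1) = insert k2 (range (\<lambda>c. Seq (Push (CB d) c) a # k1))"
    by (simp only: k1_def ops_simps asucc.simps range_case_option)
  moreover have "asucc (ops k2) = insert k (range (\<lambda>c. Push (CA d) c # k2))"
    by (simp only: k2_def ops_simps asucc.simps range_case_option)
  moreover have "asucc (ops (Loop d a # k)) = {k1}"
    by (simp add: k1_def k2_def)
  moreover have "a # k1 \<in> conts a k1" by (rule conts_self)
  ultimately show ?case
    using Loop.prems Loop.IH[of q k1] unfolding conts by (elim UnE UN_E insertE emptyE) auto
qed auto

section \<open>Meaning and running time of programs\<close>

fun counter :: "reg => bool" where
  "counter (CA d) = True"
| "counter (CB d) = True"
| "counter _ = False"

text \<open>Every loop has a level below \<open>d\<close>, and its body only loops of still lower
  level, so a body cannot disturb the counters that drive it. Apart from loops, commands may not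
  touch counters at all.\<close>

primrec wfc :: "cmd => nat => bool" where
  "wfc Skip d = True"
| "wfc Fail d = True"
| "wfc Flip d = True"
| "wfc (Push r c) d = (\<not> counter r)"
| "wfc (Case r f) d = (\<not> counter r \<and> (\<forall>x. wfc (f x) d))"
| "wfc (Or a b) d = (wfc a d \<and> wfc b d)"
| "wfc (Seq a b) d = (wfc a d \<and> wfc b d)"
| "wfc (While r f) d = False"
| "wfc (Loop e a) d = (e < d \<and> wfc a e)"

text \<open>
  Programs as predicate transformers: \<open>X\<close> tells which states win when the program has been executed.
\<close>

primrec sem :: "nat => cmd => ((reg => sym list) => bool) => (reg => sym list) => bool" where
  "sem n Skip = (\<lambda>X u. X u)"
| "sem n Fail = (\<lambda>X u. False)"
| "sem n Flip = (\<lambda>X u. \<not> X u)"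
| "sem n (Push r c) = (\<lambda>X u. X (u(r := c # u r)))"
| "sem n (Case r f) = (\<lambda>X u. case u r of [] => sem n (f None) X u
                        | c # cs => sem n (f (Some c)) X (u(r := cs)))"
| "sem n (Or a b) = (\<lambda>X u. sem n a X u \<or> sem n b X u)"
| "sem n (Seq a b) = (\<lambda>X. sem n a (sem n b X))"
| "sem n (While r f) = (\<lambda>X u. False)"
| "sem n (Loop d a) = (sem n a ^^ n)"

text \<open>A polynomial in the common length \<open>n\<close> of the counters. \<open>Case\<close>
  adds up its branches to bound their maximum. A loop spends three moves per round beside its body
  (pop, \<open>Seq\<close>, push), \<open>2 * n + 1\<close> on the refill, one on entering and one
  on finding \<open>CA\<close> empty: \<open>5 * n + 3\<close> in all.\<close>

primrec runtime :: "cmd => nat poly" where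
  "runtime Skip = 1"
| "runtime Fail = 1"
| "runtime Flip = 1"
| "runtime (Push r c) = 1"
| "runtime (Case r f) = 1 + (\<Sum>x \<in> UNIV. runtime (f x))"
| "runtime (Or a b) = 1 + runtime a + runtime b"
| "runtime (Seq a b) = 1 + runtime a + runtime b"
| "runtime (While r f) = 1"
| "runtime (Loop d a) = [:3, 5:] + [:0, 1:] * runtime a"

text \<open>What programs can see of the state. The counters are blanked, so that \<open>sem\<close>
  need not mention them.\<close>

definition usr :: "(reg => sym list) => reg => sym list" where
  "usr st = (\<lambda>r. if counter r then [] else st r)"

lemma usr_upd [simp]: "usr (st(r := x)) = (if counter r then usr st else (usr st)(r := x))"
  by (auto simp: usr_def fun_eq_iff)

lemma usr_app: "\<not> counter r ==> usr st r = st r"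
  by (simp add: usr_def)

definition same :: "(reg => sym list) => (reg => sym list) => bool" where
  "same st st' <-> (\<forall>r. counter r --> st' r = st r)"

definition full :: "nat => nat => (reg => sym list) => bool" where
  "full n d st <-> (\<forall>e < d. length (st (CA e)) = n \<and> st (CB e) = [])"

lemma aev_refill:
  assumes "aev ops k (st(CA d := rev (st (CB d)) @ st (CA d), CB d := [])) b m"
  shows "aev ops (While (CB d) (Push (CA d)) # k) st b (m + 2 * length (st (CB d)) + 1)"
  using assms
proof (induction "st (CB d)" arbitrary: st)
  case Nil
  then have "st(CA d := rev (st (CB d)) @ st (CA d), CB d := []) = st" by (auto simp: fun_eq_iff)
  then have "aev ops k st b m" using Nil.prems by (simp only:)
  then show ?case using Nil by (auto intro!: pop_Nil)
next
  case (Cons c cs)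
  let ?st = "st(CB d := cs, CA d := c # st (CA d))"
  have eq: "?st(CA d := rev (?st (CB d)) @ ?st (CA d), CB d := []) =
      st(CA d := rev (st (CB d)) @ st (CA d), CB d := [])"
    using Cons.hyps(2)[symmetric] by (auto simp: fun_eq_iff)
  have cs: "cs = ?st (CB d)" by simp
  have "aev ops k (?st(CA d := rev (?st (CB d)) @ ?st (CA d), CB d := [])) b m"
    using Cons.prems by (simp only: eq)
  from Cons.hyps(1)[OF cs this]
  have "aev ops (While (CB d) (Push (CA d)) # k) ?st b (m + 2 * length cs + 1)"
    by (simp only: cs[symmetric])
  then have "aev ops (Push (CA d) c # While (CB d) (Push (CA d)) # k) (st(CB d := cs)) b (Suc (m + 2 * length cs + 1))"
    by - (rule push[where r = "CA d" and c = c], simp_all)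
  then have "aev ops (While (CB d) (Push (CA d)) # k) st b (Suc (Suc (m + 2 * length cs + 1)))"
    using Cons.hyps(2)[symmetric] by - (rule pop_Cons[where r = "CB d" and c = c and cs = cs and
        f = "\<lambda>x. case x of None => k | Some c => Push (CA d) c # While (CB d) (Push (CA d)) # k"], simp_all)
  then show ?case using Cons.hyps(2)[symmetric] by simp
qed

text \<open>Continuation-passing form: \<open>k\<close> is assumed correct only for states with the
  same counters as \<open>st\<close>, which is enough since loops refill their counters. What
  \<open>c\<close> does to the other registers reaches the continuation through
  \<open>X\<close>.\<close>

lemma aev_sem:
  assumes "wfc c d" "full n d st"
    and "\<And>st'. same st st' ==> aev ops k st' (X (usr st')) m"
  shows "aev ops (c # k) st (sem n c X (usr st)) (m + poly (runtime c) n)"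
  using assms
proof (induction c arbitrary: d st k X m)
  case Skip
  then have "aev ops k st (X (usr st)) m" by (simp add: same_def)
  then show ?case by (auto intro: jmp)
next
  case Fail
  then show ?case by (auto intro: fail)
next
  case Flip
  then have "aev ops k st (X (usr st)) m" by (simp add: same_def)
  then show ?case by (auto intro: neg)
next
  case (Push r c)
  then have "aev ops k (st(r := c # st r)) (X (usr (st(r := c # st r)))) m"
    by (intro Push.prems(3)) (auto simp: same_def)
  then show ?case using Push.prems(1) by (auto intro!: push simp: usr_app simp del: fun_upd_apply)
next
  case (Case r f)
  have le: "m + poly (runtime (f x)) n \<le> m + (\<Sum>x \<in> UNIV. poly (runtime (f x)) n)" for x
    by (simp only: add_le_cancel_left) (simp add: member_le_sum[where f = "\<lambda>x. poly (runtime (f x)) n"])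
  show ?case
  proof (cases "st r")
    case Nil
    have "aev ops (f None # k) st (sem n (f None) X (usr st)) (m + poly (runtime (f None)) n)"
      by (rule Case.IH[of "f None" d]) (use Case.prems in auto)
    then have "aev ops (f None # k) st (sem n (f None) X (usr st)) (m + (\<Sum>x \<in> UNIV. poly (runtime (f x)) n))"
      by (rule aev_mono[OF _ le])
    then have "aev ops (Case r f # k) st (sem n (f None) X (usr st)) (Suc (m + (\<Sum>x \<in> UNIV. poly (runtime (f x)) n)))"
      using Nil by - (rule pop_Nil[where r = r and f = "\<lambda>x. f x # k"], simp_all)
    then show ?thesis using Nil Case.prems(1) by (simp add: poly_sum usr_app)
  next
    case (Cons c cs)
    let ?st = "st(r := cs)"
    have "aev ops (f (Some c) # k) ?st (sem n (f (Some c)) X (usr ?st)) (m + poly (runtime (f (Some c))) n)"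
      by (rule Case.IH[of "f (Some c)" d]) (use Case.prems in \<open>auto simp: full_def same_def\<close>)
    then have "aev ops (f (Some c) # k) ?st (sem n (f (Some c)) X (usr ?st)) (m + (\<Sum>x \<in> UNIV. poly (runtime (f x)) n))"
      by (rule aev_mono[OF _ le])
    then have "aev ops (Case r f # k) st (sem n (f (Some c)) X (usr ?st)) (Suc (m + (\<Sum>x \<in> UNIV. poly (runtime (f x)) n)))"
      using Cons by - (rule pop_Cons[where r = r and c = c and cs = cs and f = "\<lambda>x. f x # k"], simp_all)
    then show ?thesis using Cons Case.prems(1) by (simp add: poly_sum usr_app)
  qed
next
  case (Or a b)
  have "aev ops (a # k) st (sem n a X (usr st)) (m + poly (runtime a) n)"
    by (rule Or.IH(1)) (use Or.prems in auto)
  moreover have "aev ops (b # k) st (sem n b X (usr st)) (m + poly (runtime b) n)"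
    by (rule Or.IH(2)) (use Or.prems in auto)
  ultimately have "aev ops (Or a b # k) st (sem n a X (usr st) \<or> sem n b X (usr st))
      (Suc (m + poly (runtime a) n + poly (runtime b) n))"
    by (intro disj) (auto elim: aev_mono)
  then show ?case by (simp add: add.assoc)
next
  case (Seq a b)
  have "aev ops (a # b # k) st (sem n a (sem n b X) (usr st)) (m + poly (runtime b) n + poly (runtime a) n)"
  proof (rule Seq.IH(1))
    fix st' assume st': "same st st'"
    show "aev ops (b # k) st' (sem n b X (usr st')) (m + poly (runtime b) n)"
      by (rule Seq.IH(2)) (use Seq.prems st' in \<open>auto simp: full_def same_def\<close>)
  qed (use Seq.prems in auto)
  then have "aev ops (Seq a b # k) st (sem n a (sem n b X) (usr st))
      (Suc (m + poly (runtime b) n + poly (runtime a) n))"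
    by - (rule jmp, simp_all)
  then show ?case by (simp add: add_ac)
next
  case (While r f)
  then show ?case by simp
next
  case (Loop e a)
  let ?k2 = "While (CB e) (Push (CA e)) # k"
  let ?k1 = "While (CA e) (\<lambda>c. Seq (Push (CB e) c) a) # ?k2"
  let ?ra = "poly (runtime a) n"
  have e: "e < d" "wfc a e" using Loop.prems(1) by auto
  \<comment> \<open>Generalised to the middle of a loop: \<open>CA e\<close> holds the remaining
    rounds and \<open>CB e\<close>, reversed, the rounds already spent.\<close>
  have iter: "aev ops ?k1 st' ((sem n a ^^ length (st' (CA e))) X (usr st'))
      (m + 2 * n + 2 + length (st' (CA e)) * (?ra + 3))"
    if "\<And>r. counter r ==> r \<noteq> CA e ==> r \<noteq> CB e ==> st' r = st r"
      "rev (st' (CB e)) @ st' (CA e) = st (CA e)" for st'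
    using that
  proof (induction "st' (CA e)" arbitrary: st')
    case Nil
    let ?st = "st'(CA e := rev (st' (CB e)) @ st' (CA e), CB e := [])"
    have len: "length (st' (CB e)) = n"
      using Nil Loop.prems(2) e by (simp add: full_def flip: Nil.hyps) (metis length_rev)
    have "st (CB e) = []" using Loop.prems(2) e by (simp add: full_def)
    then have same: "same st ?st" using Nil.prems by (auto simp: same_def)
    have "aev ops k ?st (X (usr ?st)) m" by (rule Loop.prems(3)[OF same])
    then have "aev ops ?k2 st' (X (usr ?st)) (m + 2 * n + 1)" using aev_refill len by metis
    then have "aev ops ?k1 st' (X (usr ?st)) (Suc (m + 2 * n + 1))"
      using Nil.hyps[symmetric] by - (rule pop_Nil[where r = "CA e" and
        f = "\<lambda>x. case x of None => ?k2 | Some c => Seq (Push (CB e) c) a # ?k1"], simp_all)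
    then show ?case using Nil.hyps[symmetric] by simp
  next
    case (Cons c cs)
    let ?st = "st'(CA e := cs, CB e := c # st' (CB e))"
    have "aev ops (a # ?k1) ?st (sem n a ((sem n a ^^ length cs) X) (usr ?st))
        ((m + 2 * n + 2 + length cs * (?ra + 3)) + ?ra)"
    proof (rule Loop.IH[OF e(2)])
      show "full n e ?st" using Loop.prems(2) e Cons.prems(1) by (auto simp: full_def)
      fix st'' assume st'': "same ?st st''"
      have *: "st'' (CA e) = cs" "st'' (CB e) = c # st' (CB e)"
        using st'' by (auto simp: same_def)
      show "aev ops ?k1 st'' ((sem n a ^^ length cs) X (usr st'')) (m + 2 * n + 2 + length cs * (?ra + 3))"
        using Cons.hyps(1)[of st''] Cons.prems Cons.hyps(2)[symmetric] st'' * by (simp add: same_def)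
    qed
    then have "aev ops (Push (CB e) c # a # ?k1) (st'(CA e := cs)) (sem n a ((sem n a ^^ length cs) X) (usr ?st))
        (Suc ((m + 2 * n + 2 + length cs * (?ra + 3)) + ?ra))"
      by - (rule push[where r = "CB e" and c = c], simp_all)
    then have "aev ops (Seq (Push (CB e) c) a # ?k1) (st'(CA e := cs)) (sem n a ((sem n a ^^ length cs) X) (usr ?st))
        (Suc (Suc ((m + 2 * n + 2 + length cs * (?ra + 3)) + ?ra)))"
      by - (rule jmp, simp_all)
    then have "aev ops ?k1 st' (sem n a ((sem n a ^^ length cs) X) (usr ?st))
        (Suc (Suc (Suc ((m + 2 * n + 2 + length cs * (?ra + 3)) + ?ra))))"
      using Cons.hyps(2)[symmetric] by - (rule pop_Cons[where r = "CA e" and c = c and cs = cs and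
        f = "\<lambda>x. case x of None => ?k2 | Some c => Seq (Push (CB e) c) a # ?k1"], simp_all)
    then show ?case using Cons.hyps(2)[symmetric] by (simp add: add_ac eval_nat_numeral)
  qed
  have "length (st (CA e)) = n" "st (CB e) = []" using Loop.prems(2) e by (auto simp: full_def)
  then have "aev ops ?k1 st ((sem n a ^^ n) X (usr st)) (m + 2 * n + 2 + n * (?ra + 3))"
    using iter[of st] by simp
  then have "aev ops (Loop e a # k) st ((sem n a ^^ n) X (usr st)) (Suc (m + 2 * n + 2 + n * (?ra + 3)))"
    by - (rule jmp, simp_all)
  then show ?case by (simp add: algebra_simps eval_nat_numeral)
qed

section \<open>Filling the registers from the input\<close>

primrec pushes :: "(reg \<times> sym) list => cmd" where
  "pushes [] = Skip"
| "pushes (p # ps) = Seq (Push (fst p) (snd p)) (pushes ps)"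

definition pushed :: "(reg \<times> sym) list => (reg => sym list) => reg => sym list" where
  "pushed ps st = (\<lambda>r. rev (map snd (filter (\<lambda>p. fst p = r) ps)) @ st r)"

lemma aev_pushes:
  "aev ops k (pushed ps st) b m ==> aev ops (pushes ps # k) st b (m + 2 * length ps + 1)"
proof (induction ps arbitrary: st)
  case Nil
  then show ?case by (auto intro: jmp simp: pushed_def)
next
  case (Cons p ps)
  let ?st = "st(fst p := snd p # st (fst p))"
  have "pushed (p # ps) st = pushed ps ?st" by (auto simp: pushed_def fun_eq_iff)
  then have "aev ops (pushes ps # k) ?st b (m + 2 * length ps + 1)" using Cons by simp
  then have "aev ops (Push (fst p) (snd p) # pushes ps # k) st b (Suc (m + 2 * length ps + 1))"
    by - (rule push[where r = "fst p" and c = "snd p"], simp_all)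
  then have "aev ops (pushes (p # ps) # k) st b (Suc (Suc (m + 2 * length ps + 1)))"
    by - (rule jmp[where q' = "Push (fst p) (snd p) # pushes ps # k"], simp_all)
  then show ?case by simp
qed

text \<open>A symbol may be spread over several registers at once, in particular over the variable
  that receives its code and over all counters. The pushes must avoid \<open>RIn\<close>, which is
  being emptied.\<close>

lemma aev_input:
  assumes "\<And>s. fst ` set (qs s) \<subseteq> - {RIn}" "\<And>s. length (qs s) \<le> l"
    and "aev ops k ((pushed (concat (map qs (st RIn))) st)(RIn := [])) b m"
  shows "aev ops (While RIn (\<lambda>s. pushes (qs s)) # k) st b (m + length (st RIn) * (2 * l + 2) + 1)"
  using assms(3)
proof (induction "st RIn" arbitrary: st)
  case Nil
  then have "(pushed (concat (map qs (st RIn))) st)(RIn := []) = st"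
    by (auto simp: pushed_def fun_eq_iff simp flip: Nil.hyps)
  then have "aev ops k st b m" using Nil.prems by simp
  then show ?case using Nil by (auto intro!: pop_Nil)
next
  case (Cons s ss)
  let ?st = "pushed (qs s) (st(RIn := ss))"
  have qs: "filter (\<lambda>p. fst p = RIn) (qs s) = []"
    using assms(1)[of s] by (force simp: filter_empty_conv)
  then have RIn: "?st RIn = ss" by (simp add: pushed_def)
  have "(pushed (concat (map qs (?st RIn))) ?st)(RIn := []) = (pushed (concat (map qs (st RIn))) st)(RIn := [])"
    using RIn Cons.hyps(2)[symmetric] by (auto simp: pushed_def fun_eq_iff)
  then have "aev ops (While RIn (\<lambda>s. pushes (qs s)) # k) ?st b (m + length ss * (2 * l + 2) + 1)"
    using Cons.hyps(1)[of ?st] Cons.prems RIn by simp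
  then have "aev ops (pushes (qs s) # While RIn (\<lambda>s. pushes (qs s)) # k) (st(RIn := ss)) b
      ((m + length ss * (2 * l + 2) + 1) + 2 * length (qs s) + 1)"
    by (rule aev_pushes)
  then have "aev ops (pushes (qs s) # While RIn (\<lambda>s. pushes (qs s)) # k) (st(RIn := ss)) b
      (m + length (s # ss) * (2 * l + 2))"
    by (rule aev_mono) (use assms(2)[of s] in simp)
  then have "aev ops (While RIn (\<lambda>s. pushes (qs s)) # k) st b (Suc (m + length (s # ss) * (2 * l + 2)))"
    using Cons.hyps(2)[symmetric]
    by - (rule pop_Cons[where r = RIn and c = s and cs = ss and f = "\<lambda>x. case x of None => k
          | Some c => pushes (qs c) # While RIn (\<lambda>s. pushes (qs s)) # k"], simp_all)
  then show ?case using Cons.hyps(2)[symmetric] by simp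
qed

text \<open>Every variable below \<open>m\<close> is to hold the encoding of a tree:
  \<open>[Zero]\<close> encodes \<open>Lf\<close>, and with the code used for the logic the word in
  \<open>RVar 0\<close> encodes the list of input symbols.\<close>

definition start :: "nat => (sym => sym list) => sym list => reg => sym list" where
  "start m code w = (\<lambda>r. case r of
     RVar i => if i = 0 then concat (map code w) @ [Zero] else if i < m then [Zero] else [] | _ => [])"

theorem program_PSPACE:
  assumes wf: "wfc c d" and m: "m > 0"
  shows "{w. sem (length w + c0) c (\<lambda>_. False) (start m code w)} \<in> PSPACE"
proof -
  \<comment> \<open>Every variable starts with \<open>Zero\<close> and every counter with
    \<open>c0\<close> symbols. Each input symbol adds one more to each counter, whence the common
    length \<open>length w + c0\<close>.\<close>
  define ps where "ps = map (\<lambda>i. (RVar i, Zero)) [0..<m] @ concat (map (\<lambda>e. replicate c0 (CA e, Zero)) [0..<d])"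
  \<comment> \<open>\<open>rev\<close>, because the first symbol of a code has to be pushed last.
    The order of the codes needs no such care, as \<open>RIn\<close> already holds the input in
    reverse.\<close>
  define qs where "qs = (\<lambda>s. map (\<lambda>e. (CA e, Zero)) [0..<d] @ map (Pair (RVar 0)) (rev (code s)))"
  define main where "main = Seq (pushes ps) (Seq (While RIn (\<lambda>s. pushes (qs s))) c)"
  define l where "l = (\<Sum>s \<in> UNIV. length (qs s))"
  have l: "length (qs s) \<le> l" for s by (simp add: l_def member_le_sum[where f = "\<lambda>s. length (qs s)"])
  define st0 :: "sym list => reg => sym list" where "st0 = (\<lambda>w r. if r = RIn then rev w else [])"
  define st1 where "st1 = (\<lambda>w. pushed ps (st0 w))"
  define st2 where "st2 = (\<lambda>w. (pushed (concat (map qs (st1 w RIn))) (st1 w))(RIn := []))"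
  have st1_RIn: "st1 w RIn = rev w" for w
    by (auto simp: st1_def pushed_def st0_def ps_def filter_empty_conv)
  have ev1: "aev ops [c] (st2 w) (sem (length w + c0) c (\<lambda>_. False) (usr (st2 w)))
      (poly (runtime c) (length w + c0))" for w
  proof -
    have RVar: "filter (\<lambda>p. fst p = CA e) (map (Pair (RVar 0)) xs) = []" for e and xs :: "sym list" 
      by (auto simp: filter_empty_conv)
    have 1: "length (filter (\<lambda>p. fst p = CA e) (map (\<lambda>e. (CA e, Zero)) [0..<d])) = 1" if "e < d" for e
    proof -
      have "filter (\<lambda>p. fst p = CA e) (map (\<lambda>e. (CA e, Zero)) [0..<d]) = [(CA e, Zero)]"
        using that
      proof (induction d)
        case (Suc d)
        show ?case
        proof (cases "e = d")
          case True
          then show ?thesis by (auto simp: filter_empty_conv)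
        next
          case False
          then show ?thesis using Suc by simp
        qed
      qed simp
      then show ?thesis by simp
    qed
    have 2: "length (filter (\<lambda>p. fst p = CA e) (concat (map qs xs))) = length xs" if "e < d" for e xs
      by (induction xs) (use 1[OF that] RVar in \<open>auto simp: qs_def\<close>)
    have 3: "length (filter (\<lambda>p. fst p = CA e) ps) = c0" if "e < d" for e
    proof -
      have "length (filter (\<lambda>p. fst p = CA e) (concat (map (\<lambda>e. replicate c0 (CA e, Zero)) [0..<d]))) = c0"
        using that
      proof (induction d)
        case (Suc d)
        show ?case
        proof (cases "e = d")
          case True
          then show ?thesis by (auto simp: filter_empty_conv)
        next
          case False
          then show ?thesis using Suc by simp
        qed
      qed simp
      then show ?thesis by (simp add: ps_def filter_empty_conv)
    qed
    have 4: "filter (\<lambda>p. fst p = CB e) (concat (map qs xs)) = []" "filter (\<lambda>p. fst p = CB e) ps = []" for e xs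
      by (auto simp: filter_empty_conv qs_def ps_def)
    have "full (length w + c0) d (st2 w)"
      using 2 3 4 by (auto simp: full_def st2_def pushed_def st1_RIn) (auto simp: st1_def pushed_def st0_def)
    then have "aev ops [c] (st2 w) (sem (length w + c0) c (\<lambda>_. False) (usr (st2 w)))
      (0 + poly (runtime c) (length w + c0))"
      by (rule aev_sem[OF wf]) (auto intro: fail)
    then show ?thesis by simp
  qed
  have usr: "usr (st2 w) = start m code w" for w
  proof
    fix r
    have conc: "filter (\<lambda>p. fst p = r) (concat (map qs xs)) = (if r = RVar 0 then map (Pair (RVar 0)) (concat (map (rev \<circ> code) xs)) else [])"
      if "\<not> counter r" for xs
      using that by (induction xs) (auto simp: qs_def filter_empty_conv comp_def)
    have RVar: "filter (\<lambda>p. fst p = RVar i) (map (\<lambda>i. (RVar i, Zero)) [0..<m]) = (if i < m then [(RVar i, Zero)] else [])" for i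
      by (induction m) (auto simp: less_Suc_eq)
    have filt: "filter (\<lambda>p. fst p = r) ps = (case r of RVar i => if i < m then [(RVar i, Zero)] else [] | _ => [])"
      if "\<not> counter r"
      using that by (cases r) (auto simp: ps_def RVar filter_empty_conv)
    have rc: "rev (concat (map (rev \<circ> code) (rev w))) = concat (map code w)"
      by (induction w) auto
    show "usr (st2 w) r = start m code w r"
    proof (cases "counter r")
      case True
      then show ?thesis by (cases r) (auto simp: usr_def start_def)
    next
      case False
      then show ?thesis
        using conc[of "rev w"] filt rc m
        by (cases r) (auto simp: usr_def st2_def pushed_def st1_RIn start_def comp_def, auto simp: st1_def pushed_def st0_def)
    qed
  qed
  let ?p = "pcompose (runtime c) [:c0, 1:] + [:0, 2 * l + 2:] + [:2 * length ps + 4:]"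
  have ev: "aev ops [main] (st0 w) (sem (length w + c0) c (\<lambda>_. False) (start m code w)) (poly ?p (length w))" for w
  proof -
    let ?b = "sem (length w + c0) c (\<lambda>_. False) (start m code w)"
    let ?t = "poly (runtime c) (length w + c0)"
    have "aev ops [While RIn (\<lambda>s. pushes (qs s)), c] (st1 w) ?b (?t + length (st1 w RIn) * (2 * l + 2) + 1)"
    proof (rule aev_input)
      show "fst ` set (qs s) \<subseteq> - {RIn}" for s by (auto simp: qs_def)
      have "aev ops [c] (st2 w) ?b ?t" using ev1[of w] by (simp only: usr)
      then show "aev ops [c] ((pushed (concat (map qs (st1 w RIn))) (st1 w))(RIn := [])) ?b ?t"
        by (simp only: st2_def)
    qed (rule l)
    then have "aev ops [Seq (While RIn (\<lambda>s. pushes (qs s))) c] (st1 w) ?b (Suc (?t + length w * (2 * l + 2) + 1))"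
      by - (rule jmp, simp_all add: st1_RIn)
    then have "aev ops [pushes ps, Seq (While RIn (\<lambda>s. pushes (qs s))) c] (st0 w) ?b
        (Suc (?t + length w * (2 * l + 2) + 1) + 2 * length ps + 1)"
      unfolding st1_def by (rule aev_pushes)
    then have "aev ops [main] (st0 w) ?b (Suc (Suc (?t + length w * (2 * l + 2) + 1) + 2 * length ps + 1))"
      by - (rule jmp, simp_all add: main_def)
    moreover have "Suc (Suc (?t + length w * (2 * l + 2) + 1) + 2 * length ps + 1) = poly ?p (length w)"
      by (simp add: poly_pcompose algebra_simps)
    ultimately show ?thesis by metis
  qed
  show ?thesis
  proof (rule alternating_PSPACE[where J = ops and QA = "insert [] (conts main [])" and ?q0.0 = "[main]" and ?r0.0 = RIn and p = ?p])
    show "asucc (ops q) \<subseteq> insert [] (conts main [])" if "q \<in> insert [] (conts main [])" for q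
      using that conts_closed[of q main "[]"] by auto
    show "aev ops [main] (\<lambda>r. if r = RIn then rev w else [])
      (w \<in> {w. sem (length w + c0) c (\<lambda>_. False) (start m code w)}) (poly ?p (length w))" for w
      using ev[of w] by (simp add: st0_def)
  qed (simp_all add: finite_conts conts_self)
qed

section \<open>A logic of trees with bounded quantifiers and jumps\<close>

datatype tr = Lf | Nd tr tr

text \<open>Preorder, with one bit per node. The code is prefix free, so a tree can be matched
  against the front of a longer word, and concatenated encodings split in only one way.\<close>

primrec enc :: "tr => sym list" where
  "enc Lf = [Zero]"
| "enc (Nd a b) = One # enc a @ enc b"

definition sz :: "tr => nat" where "sz t = length (enc t)"

lemma sz_simps [simp]: "sz Lf = 1" "sz (Nd a b) = 1 + sz a + sz b"
  by (simp_all add: sz_def)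

lemma enc_prefix_free: "enc a @ r = enc b @ s <-> a = b \<and> r = s"
proof (induction a arbitrary: b r s)
  case Lf
  then show ?case by (cases b) auto
next
  case (Nd a1 a2)
  then show ?case by (cases b) auto
qed

text \<open>
  Variables are global registers. \<open>FJ p\<close> continues with the formula \<open>p\<close> of the program, in the
  current valuation; the fuel \<open>d\<close> bounds the number of jumps, and a jump without fuel is false.
\<close>

datatype frm =
  FL nat | FN nat nat nat | FEq nat nat | FNot frm | FOr frm frm | FEx nat frm | FJ nat

primrec eval :: "nat => (nat => (nat => tr) => bool) => frm => (nat => tr) => bool" where
  "eval N J (FL i) V = (V i = Lf)"
| "eval N J (FN i j k) V = (V i = Nd (V j) (V k))"
| "eval N J (FEq i j) V = (V i = V j)"
| "eval N J (FNot \<phi>) V = (\<not> eval N J \<phi> V)"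
| "eval N J (FOr \<phi> \<psi>) V = (eval N J \<phi> V \<or> eval N J \<psi> V)"
| "eval N J (FEx v \<phi>) V = (\<exists>x. sz x \<le> N \<and> eval N J \<phi> (V(v := x)))"
| "eval N J (FJ p) V = J p V"

primrec jump :: "(nat => frm) => nat => nat => nat => (nat => tr) => bool" where
  "jump B N 0 = (\<lambda>p V. False)"
| "jump B N (Suc d) = (\<lambda>p. eval N (jump B N d) (B p))"

text \<open>The variables of an atom have to be distinct because an atom is tested by consuming its
  registers in place.\<close>

primrec wff :: "nat => nat => frm => bool" where
  "wff m q (FL i) = (i < m)"
| "wff m q (FN i j k) = (i < m \<and> j < m \<and> k < m \<and> i \<noteq> j \<and> i \<noteq> k \<and> j \<noteq> k)"
| "wff m q (FEq i j) = (i < m \<and> j < m \<and> i \<noteq> j)"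
| "wff m q (FNot \<phi>) = wff m q \<phi>"
| "wff m q (FOr \<phi> \<psi>) = (wff m q \<phi> \<and> wff m q \<psi>)"
| "wff m q (FEx v \<phi>) = (v < m \<and> wff m q \<phi>)"
| "wff m q (FJ p) = (p < q)"

lemma eval_cong:
  assumes "\<And>p V. p < q ==> (\<And>i. i < m ==> sz (V i) \<le> N) ==> J p V = J' p V"
  shows "wff m q \<phi> ==> (\<And>i. i < m ==> sz (V i) \<le> N) ==> eval N J \<phi> V = eval N J' \<phi> V"
proof (induction \<phi> arbitrary: V)
  case (FEx v \<phi>)
  have "eval N J \<phi> (V(v := x)) = eval N J' \<phi> (V(v := x))" if "sz x \<le> N" for x
    by (rule FEx.IH) (use FEx.prems that in auto)
  then show ?case by auto
qed (use assms in auto)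

section \<open>Compiling formulas into programs\<close>

primrec iter :: "nat => nat => cmd => cmd" where
  "iter b 0 c = c"
| "iter b (Suc k) c = Loop (b + k) (iter b k c)"

text \<open>This is how polynomially many rounds arise from counters of linear length: by nesting
  \<open>k\<close> loops.\<close>

lemma sem_iter: "sem n (iter b k c) = sem n c ^^ (n ^ k)"
  by (induction k) (simp_all add: funpow_mult mult.commute)

lemma wfc_mono: "wfc c d ==> d \<le> d' ==> wfc c d'"
  by (induction c arbitrary: d) auto

lemma wfc_iter: "wfc c b ==> wfc (iter b k c) (b + k)"
  by (induction k) auto

text \<open>A play that fails is lost, so flipping just before failing wins outright, and the
  continuation is never run.\<close>

definition accept :: cmd where "accept = Seq Flip Fail"

lemma sem_accept [simp]: "sem n accept X u = True"
  by (simp add: accept_def)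

text \<open>Once \<open>RVar j\<close> is empty the step does nothing, so the surplus rounds of the
  surrounding loop are harmless.\<close>

definition eat_step :: "nat => nat => cmd" where
  "eat_step j i = Case (RVar j) (\<lambda>x. case x of None => Skip
     | Some c => Case (RVar i) (\<lambda>y. if y = Some c then Skip else Fail))"

lemma sem_eat_iter:
  assumes "i \<noteq> j" "length (u (RVar j)) \<le> t"
  shows "(sem n (eat_step j i) ^^ t) X u <->
    (\<exists>rest. u (RVar i) = u (RVar j) @ rest \<and> X (u(RVar j := [], RVar i := rest)))"
  using assms(2)
proof (induction t arbitrary: u)
  case 0
  then have "u(RVar j := [], RVar i := u (RVar i)) = u" by (auto simp: fun_eq_iff)
  then show ?case using 0 by (simp del: fun_upd_apply)
next
  case (Suc t)
  show ?case
  proof (cases "u (RVar j)")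
    case Nil
    then show ?thesis using Suc.IH[of u] by (simp add: eat_step_def del: fun_upd_apply)
  next
    case (Cons c cs)
    show ?thesis
    proof (cases "u (RVar i)")
      case Nil
      then show ?thesis using Cons assms(1) by (simp add: eat_step_def)
    next
      case (Cons c' cs')
      let ?u = "u(RVar j := cs, RVar i := cs')"
      have step: "(sem n (eat_step j i) ^^ Suc t) X u <-> c' = c \<and> (sem n (eat_step j i) ^^ t) X ?u"
        using Cons \<open>u (RVar j) = c # cs\<close> assms(1) by (simp add: eat_step_def)
      have "?u (RVar i) = cs'" "?u (RVar j) = cs" "\<And>r. ?u(RVar j := [], RVar i := r) = u(RVar j := [], RVar i := r)"
        using assms(1) by (auto simp: fun_eq_iff)
      then show ?thesis
        using step Suc.IH[of ?u] Suc.prems Cons \<open>u (RVar j) = c # cs\<close> by (auto simp del: fun_upd_apply)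
    qed
  qed
qed

definition clear_step :: "nat => cmd" where
  "clear_step v = Case (RVar v) (\<lambda>_. Skip)"

lemma sem_clear_iter:
  assumes "length (u (RVar v)) \<le> t"
  shows "(sem n (clear_step v) ^^ t) X u = X (u(RVar v := []))"
  using assms
proof (induction t arbitrary: u)
  case 0
  then have "u(RVar v := []) = u" by (auto simp: fun_eq_iff)
  then show ?case by simp
next
  case (Suc t)
  show ?case
  proof (cases "u (RVar v)")
    case Nil
    then show ?thesis using Suc by (simp add: clear_step_def del: fun_upd_apply)
  next
    case (Cons c cs)
    have "(u(RVar v := cs))(RVar v := []) = u(RVar v := [])" by simp
    then show ?thesis using Suc.IH[of "u(RVar v := cs)"] Suc.prems Cons
      by (simp add: clear_step_def fun_upd_same del: fun_upd_apply)
  qed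
qed

text \<open>
  A tree is guessed bottom-up: \<open>RVar v\<close> holds the concatenation of the encodings of the trees built so
  far and \<open>RCnt\<close> their number.
\<close>

definition guess_step :: "nat => cmd" where
  "guess_step v = Or Skip (Or (Seq (Push (RVar v) Zero) (Push RCnt Zero))
     (Case RCnt (\<lambda>x. case x of None => Fail | Some _ =>
       Case RCnt (\<lambda>y. case y of None => Fail | Some _ => Seq (Push RCnt Zero) (Push (RVar v) One)))))"

definition guess_end :: cmd where
  "guess_end = Case RCnt (\<lambda>x. case x of None => Fail | Some _ =>
     Case RCnt (\<lambda>y. case y of None => Skip | Some _ => Fail))"

definition gst :: "(reg => sym list) => nat => tr list => reg => sym list" where
  "gst u v ts = u(RVar v := concat (map enc ts), RCnt := replicate (length ts) Zero)"

definition gnext :: "tr list => tr list => bool" where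
  "gnext ts ts' <-> ts' = ts \<or> ts' = Lf # ts \<or> (\<exists>a b r. ts = a # b # r \<and> ts' = Nd a b # r)"

lemma sem_guess_step: "sem n (guess_step v) X (gst u v ts) <-> (\<exists>ts'. gnext ts ts' \<and> X (gst u v ts'))"
proof -
  have 1: "(gst u v ts)(RVar v := Zero # gst u v ts (RVar v), RCnt := Zero # gst u v ts RCnt) = gst u v (Lf # ts)"
    by (auto simp: gst_def fun_eq_iff)
  have 2: "(gst u v (a # b # r))(RCnt := Zero # replicate (length r) Zero, RVar v := One # gst u v (a # b # r) (RVar v))
      = gst u v (Nd a b # r)" for a b r
    by (auto simp: gst_def fun_eq_iff)
  have RCnt: "gst u v ts RCnt = replicate (length ts) Zero" for ts by (simp add: gst_def)
  have 3: "sem n (Case RCnt (\<lambda>x. case x of None => Fail | Some _ =>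
       Case RCnt (\<lambda>y. case y of None => Fail | Some _ => Seq (Push RCnt Zero) (Push (RVar v) One)))) X (gst u v ts)
     <-> (\<exists>a b r. ts = a # b # r \<and> X (gst u v (Nd a b # r)))"
  proof (cases "\<exists>a b r. ts = a # b # r")
    case True
    then obtain a b r where ts: "ts = a # b # r" by blast
    then show ?thesis using 2[of a b r] by (simp add: RCnt)
  next
    case False
    then show ?thesis by (cases ts rule: list.exhaust; cases "tl ts") (auto simp: RCnt)
  qed
  show ?thesis
    using 1 3 by (auto simp: guess_step_def gnext_def)
qed

primrec greach :: "nat => tr list => tr list => bool" where
  "greach 0 ts ts' = (ts' = ts)"
| "greach (Suc t) ts ts' = (\<exists>s. gnext ts s \<and> greach t s ts')"

lemma greach_trans: "greach s a b ==> greach t b c ==> greach (s + t) a c"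
  by (induction s arbitrary: a) auto

lemma sem_guess_iter:
  "(sem n (guess_step v) ^^ t) X (gst u v ts) <-> (\<exists>ts'. greach t ts ts' \<and> X (gst u v ts'))"
  by (induction t arbitrary: ts) (auto simp: sem_guess_step)

text \<open>A round adds at most one symbol to the stored encodings; this is the upper bound on the
  size of guessed trees.\<close>

lemma greach_bound:
  "greach t ts ts' ==> length (concat (map enc ts')) \<le> length (concat (map enc ts)) + t"
proof (induction t arbitrary: ts)
  case (Suc t)
  then obtain s where s: "gnext ts s" "greach t s ts'" by auto
  have "length (concat (map enc s)) \<le> length (concat (map enc ts)) + 1"
    using s(1) by (auto simp: gnext_def)
  then show ?case using Suc.IH[OF s(2)] by simp
qed simp

text \<open>One round per node, children before their parent. The right subtree is built first,
  because new trees are put at the front.\<close>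

lemma greach_tree: "greach (sz x) ts (x # ts)"
proof (induction x arbitrary: ts)
  case Lf
  then show ?case by (simp add: gnext_def)
next
  case (Nd a b)
  have "greach (sz b + sz a) ts (a # b # ts)"
    using greach_trans[OF Nd.IH(2) Nd.IH(1)] .
  moreover have "greach (Suc 0) (a # b # ts) (Nd a b # ts)" by (simp add: gnext_def)
  ultimately have "greach ((sz b + sz a) + Suc 0) ts (Nd a b # ts)" by (rule greach_trans)
  then show ?case by (simp add: add_ac)
qed

lemma greach_stay: "greach t ts ts"
  by (induction t) (auto simp: gnext_def)

text \<open>A tree smaller than \<open>t\<close> is built in \<open>sz x\<close> rounds and the
  others are idle; so the loop realises exactly the bounded quantifier.\<close>

lemma greach_single: "greach t [] [x] <-> sz x \<le> t"
proof
  assume "greach t [] [x]"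
  then show "sz x \<le> t" using greach_bound[of t "[]" "[x]"] by (simp add: sz_def)
next
  assume "sz x \<le> t"
  then show "greach t [] [x]"
    using greach_trans[OF greach_tree[of x "[]"] greach_stay[of "t - sz x"]] by simp
qed

lemma sem_guess_end: "sem n guess_end X (gst u v ts) <-> (\<exists>x. ts = [x] \<and> X (u(RVar v := enc x, RCnt := [])))"
proof -
  have RCnt: "gst u v ts RCnt = replicate (length ts) Zero" by (simp add: gst_def)
  show ?thesis
  proof (cases ts)
    case Nil
    then show ?thesis using RCnt by (simp add: guess_end_def)
  next
    case (Cons a r)
    then show ?thesis using RCnt by (cases r) (auto simp: guess_end_def gst_def)
  qed
qed

context
  fixes k :: nat
begin

definition eat :: "nat => nat => cmd" where "eat j i = iter 0 k (eat_step j i)"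

definition guess :: "nat => cmd" where
  "guess v = Seq (iter 0 k (clear_step v)) (Seq (iter 0 k (guess_step v)) guess_end)"

lemma sem_eat:
  assumes "i \<noteq> j" "length (u (RVar j)) \<le> n ^ k"
  shows "sem n (eat j i) X u <-> (\<exists>rest. u (RVar i) = u (RVar j) @ rest \<and> X (u(RVar j := [], RVar i := rest)))"
  using sem_eat_iter[of i j u "n ^ k" n X, OF assms] by (simp only: eat_def sem_iter)

lemma sem_guess:
  assumes "length (u (RVar v)) \<le> n ^ k" "u RCnt = []"
  shows "sem n (guess v) X u <-> (\<exists>x. sz x \<le> n ^ k \<and> X (u(RVar v := enc x)))"
proof -
  have g: "u(RVar v := []) = gst u v []" "u(RVar v := enc x, RCnt := []) = u(RVar v := enc x)" for x
    using assms(2) by (auto simp: gst_def fun_eq_iff)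
  have "sem n (guess v) X u <-> (\<exists>ts. greach (n ^ k) [] ts \<and> (\<exists>x. ts = [x] \<and> X (u(RVar v := enc x))))"
    using assms(1) by (simp add: guess_def sem_iter sem_clear_iter g(1) sem_guess_iter sem_guess_end g(2))
  then show ?thesis using greach_single by blast
qed

definition if_empty :: "nat => cmd" where
  "if_empty i = Case (RVar i) (\<lambda>x. if x = None then accept else Fail)"

lemma sem_if_empty: "sem n (if_empty i) X u <-> u (RVar i) = []"
  by (simp add: if_empty_def split: list.splits)

primrec set_p :: "nat => cmd" where
  "set_p 0 = Skip"
| "set_p (Suc p) = Seq (Push RPc Zero) (set_p p)"

lemma sem_set_p: "sem n (set_p p) X u = X (u(RPc := replicate p Zero @ u RPc))"
proof (induction p arbitrary: u)
  case (Suc p)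
  then show ?case by (simp add: replicate_app_Cons_same fun_upd_same del: fun_upd_apply)
qed simp

text \<open>Atoms destroy the registers that they test. This does no harm: nothing is evaluated
  after an atom, which ends in \<open>accept\<close> or \<open>Fail\<close>, and the alternatives of
  an \<open>Or\<close> start from the same state. Only a jump passes control to what
  follows.\<close>

primrec compile :: "frm => cmd" where
  "compile (FL i) = Case (RVar i) (\<lambda>x. if x = Some Zero then accept else Fail)"
| "compile (FN i j l) = Case (RVar i) (\<lambda>x. if x = Some One then Seq (eat j i) (Seq (eat l i) (if_empty i)) else Fail)"
| "compile (FEq i j) = Seq (eat j i) (if_empty i)"
| "compile (FNot \<phi>) = Seq Flip (compile \<phi>)"
| "compile (FOr \<phi> \<psi>) = Or (compile \<phi>) (compile \<psi>)"
| "compile (FEx v \<phi>) = Seq (guess v) (compile \<phi>)"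
| "compile (FJ p) = set_p p"

definition ust :: "nat => nat => (nat => tr) => reg => sym list" where
  "ust m p V = (\<lambda>r. case r of RVar i => if i < m then enc (V i) else [] | RPc => replicate p Zero | _ => [])"

lemma ust_simps [simp]:
  "ust m p V (RVar i) = (if i < m then enc (V i) else [])" "ust m p V RPc = replicate p Zero" "ust m p V RCnt = []"
  by (simp_all add: ust_def)

text \<open>The meaning of a jump is left to \<open>X\<close>: the interpretation of
  \<open>FJ\<close> is \<open>X\<close> in the state with the program counter set.\<close>

lemma sem_compile:
  assumes "wff m q \<phi>" "\<And>i. i < m ==> sz (V i) \<le> n ^ k"
  shows "sem n (compile \<phi>) X (ust m 0 V) = eval (n ^ k) (\<lambda>p V. X (ust m p V)) \<phi> V"
  using assms
proof (induction \<phi> arbitrary: V)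
  case (FL i)
  then show ?case by (cases "V i") auto
next
  case (FN i j l)
  then have len: "length (enc (V j)) \<le> n ^ k" "length (enc (V l)) \<le> n ^ k" by (auto simp: sz_def)
  have eq: "enc a @ enc b = enc c @ enc d <-> a = c \<and> b = d" for a b c d
    using enc_prefix_free[of a "enc b" c "enc d"] enc_prefix_free[of b "[]" d "[]"] by auto
  show ?case using FN.prems len
    by (cases "V i") (auto simp: sem_eat sem_if_empty eq)
next
  case (FEq i j)
  then have "length (enc (V j)) \<le> n ^ k" by (auto simp: sz_def)
  then show ?case
    using FEq.prems enc_prefix_free[of "V i" "[]" "V j" "[]"] by (auto simp: sem_eat sem_if_empty)
next
  case (FEx v \<phi>)
  have v: "v < m" "wff m q \<phi>" "length (enc (V v)) \<le> n ^ k" using FEx.prems by (auto simp: sz_def)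
  have upd: "(ust m 0 V)(RVar v := enc x) = ust m 0 (V(v := x))" for x
    using v(1) by (auto simp: ust_def fun_eq_iff split: reg.splits)
  have "sem n (compile \<phi>) X (ust m 0 (V(v := x))) = eval (n ^ k) (\<lambda>p V. X (ust m p V)) \<phi> (V(v := x))"
    if "sz x \<le> n ^ k" for x
    by (rule FEx.IH) (use v FEx.prems that in auto)
  then show ?case using v by (auto simp: sem_guess upd)
next
  case (FJ p)
  have "(ust m 0 V)(RPc := replicate p Zero) = ust m p V"
    by (auto simp: ust_def fun_eq_iff split: reg.splits)
  then show ?case by (simp add: sem_set_p)
qed auto

lemma wfc_compile: "wfc (compile \<phi>) k"
proof (induction \<phi>)
  case (FJ p)
  then show ?case by (induction p) auto
next
  case (FN i j l)
  have "wfc (eat j i) k" for i j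
    unfolding eat_def using wfc_iter[of "eat_step j i" 0 k] by (simp add: eat_step_def split: option.splits)
  then show ?case by (simp add: accept_def if_empty_def)
next
  case (FEq i j)
  have "wfc (eat j i) k" for i j
    unfolding eat_def using wfc_iter[of "eat_step j i" 0 k] by (simp add: eat_step_def split: option.splits)
  then show ?case by (simp add: accept_def if_empty_def)
next
  case (FEx v \<phi>)
  have "wfc (iter 0 k (clear_step v)) k" "wfc (iter 0 k (guess_step v)) k"
    using wfc_iter[of "clear_step v" 0 k] wfc_iter[of "guess_step v" 0 k]
    by (simp_all add: clear_step_def guess_step_def split: option.splits)
  then show ?case using FEx by (simp add: guess_def guess_end_def split: option.splits)
qed (simp_all add: accept_def)

text \<open>\<open>RPc\<close> is a unary program counter, empty again when the selected body
  starts, so that the body can set it for the next round.\<close>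

primrec dispatch :: "cmd list => cmd" where
  "dispatch [] = Fail"
| "dispatch (c # cs) = Case RPc (\<lambda>x. case x of None => c | Some _ => dispatch cs)"

lemma sem_dispatch: "p < length cs ==> sem n (dispatch cs) X (ust m p V) = sem n (cs ! p) X (ust m 0 V)"
proof (induction cs arbitrary: p)
  case (Cons c cs)
  show ?case
  proof (cases p)
    case (Suc p')
    have "(ust m (Suc p') V)(RPc := replicate p' Zero) = ust m p' V"
      by (auto simp: ust_def fun_eq_iff split: reg.splits)
    then show ?thesis using Cons Suc by simp
  qed simp
qed simp

lemma wfc_dispatch: "(\<And>c. c \<in> set cs ==> wfc c d) ==> wfc (dispatch cs) d"
  by (induction cs) (auto split: option.splits)

text \<open>A round of the dispatcher is a unit of fuel: it evaluates one body and hands over at a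
  jump. The final postcondition is \<open>False\<close>, the value of a jump without fuel.\<close>

lemma sem_dispatch_iter:
  assumes wf: "\<And>p. p < q ==> wff m q (B p)"
  shows "p < q ==> (\<And>i. i < m ==> sz (V i) \<le> n ^ k) ==>
    (sem n (dispatch (map (\<lambda>p. compile (B p)) [0..<q])) ^^ d) (\<lambda>_. False) (ust m p V) = jump B (n ^ k) d p V"
proof (induction d arbitrary: p V)
  case (Suc d)
  let ?M = "sem n (dispatch (map (\<lambda>p. compile (B p)) [0..<q]))"
  have "(?M ^^ Suc d) (\<lambda>_. False) (ust m p V) = sem n (compile (B p)) ((?M ^^ d) (\<lambda>_. False)) (ust m 0 V)"
    using Suc.prems(1) by (simp add: sem_dispatch)
  also have "\<dots> = eval (n ^ k) (\<lambda>p V. (?M ^^ d) (\<lambda>_. False) (ust m p V)) (B p) V"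
    by (rule sem_compile[OF wf]) (use Suc.prems in auto)
  also have "\<dots> = eval (n ^ k) (jump B (n ^ k) d) (B p) V"
    by (rule eval_cong[OF Suc.IH wf]) (use Suc.prems in auto)
  finally show ?case by simp
qed simp

end

text \<open>Numbers are lists of leaves, so that their order and length can be tested by procedures
  on lists.\<close>

primrec num :: "nat => tr" where
  "num 0 = Lf"
| "num (Suc n) = Nd Lf (num n)"

definition lst :: "tr list => tr" where
  "lst xs = foldr Nd xs Lf"

lemma lst_simps [simp]: "lst [] = Lf" "lst (x # xs) = Nd x (lst xs)"
  by (simp_all add: lst_def)

primrec sc :: "sym => tr" where
  "sc Zero = num 0"
| "sc One = num 1"
| "sc Minus = num 2"
| "sc Comma = num 3"
| "sc Open = num 4"
| "sc Close = num 5"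

lemma sz_num: "sz (num n) = 2 * n + 1"
  by (induction n) auto

lemma sz_lst_le: "(\<And>x. x \<in> set xs ==> sz x \<le> b) ==> sz (lst xs) \<le> length xs * (b + 1) + 1"
  by (induction xs) fastforce+

lemma sz_sc: "sz (sc s) \<le> 11"
  by (cases s) (simp_all only: sc.simps sz_num)

text \<open>Loop levels below \<open>k\<close> serve guessing and comparing, the \<open>j\<close>
  levels above them the fuel. The conditions on \<open>k\<close> and \<open>c0\<close> make the
  input tree, of size at most \<open>12 * length w + 1\<close>, fit below
  \<open>(length w + c0) ^ 2\<close> and thus into the bound on tree sizes.\<close>

theorem logic_PSPACE:
  assumes wf: "\<And>p. p < q ==> wff m q (B p)" and "m > 0" "q > 0" "k \<ge> 2" "c0 \<ge> 12"
  shows "{w. jump B ((length w + c0) ^ k) ((length w + c0) ^ j) 0 ((\<lambda>_. Lf)(0 := lst (map sc w)))} \<in> PSPACE"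
proof -
  let ?c = "Seq (iter k j (dispatch (map (\<lambda>p. compile k (B p)) [0..<q]))) Fail"
  let ?code = "\<lambda>s. One # enc (sc s)"
  have "wfc (dispatch (map (\<lambda>p. compile k (B p)) [0..<q])) k"
    by (rule wfc_dispatch) (auto simp: wfc_compile)
  then have wfc: "wfc ?c (k + j)" by (simp add: wfc_iter)
  have start: "start m ?code w = ust m 0 ((\<lambda>_. Lf)(0 := lst (map sc w)))" for w
  proof -
    have "enc (lst (map sc w)) = concat (map ?code w) @ [Zero]" by (induction w) auto
    then show ?thesis using \<open>m > 0\<close> by (auto simp: start_def ust_def fun_eq_iff split: reg.splits)
  qed
  have "sem (length w + c0) ?c (\<lambda>_. False) (start m ?code w) =
      jump B ((length w + c0) ^ k) ((length w + c0) ^ j) 0 ((\<lambda>_. Lf)(0 := lst (map sc w)))" for w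
  proof -
    let ?n = "length w + c0"
    have "sz (lst (map sc w)) \<le> length (map sc w) * (11 + 1) + 1"
      by (rule sz_lst_le) (auto simp: sz_sc)
    also have "\<dots> \<le> ?n * ?n"
    proof -
      have "length w * 12 + 1 \<le> ?n * 12" using assms(5) by simp
      also have "\<dots> \<le> ?n * ?n" using assms(5) by (intro mult_le_mono2) simp
      finally show ?thesis by simp
    qed
    also have "\<dots> = ?n ^ 2" by (simp add: power2_eq_square)
    also have "\<dots> \<le> ?n ^ k" using assms(4,5) by (intro power_increasing) auto
    finally have "sz (((\<lambda>_. Lf)(0 := lst (map sc w))) i) \<le> ?n ^ k" for i
      using assms(5) by simp
    then show ?thesis
      using sem_dispatch_iter[of q m B 0 "(\<lambda>_. Lf)(0 := lst (map sc w))" ?n k, OF wf \<open>q > 0\<close>]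
      by (simp only: sem_iter start sem.simps) blast
  qed
  then show ?thesis using program_PSPACE[OF wfc \<open>m > 0\<close>, of c0 ?code] by simp
qed

section \<open>Strategies as games on histories\<close>

text \<open>The restricted function keeps the result in \<open>En M\<close>. In \<open>stp\<close>
  it always goes together with \<open>affordable\<close>, which makes the truncated subtraction
  exact.\<close>

definition upd_en :: "rbcgs => nat set => nat => nat list => endowment => endowment" where
  "upd_en M C s \<sigma> e = (\<lambda>(a, V) \<in> Agt M \<times> Res M.
     if a \<in> C then e (a, V) + produced M V s (\<sigma> ! a) - consumed M V s (\<sigma> ! a) else e (a, V))"

definition affordable :: "rbcgs => nat set => nat => nat list => endowment => bool" where
  "affordable M C s \<sigma> e <-> (\<forall>a \<in> C. \<forall>V \<in> Res M. consumed M V s (\<sigma> ! a) \<le> e (a, V))"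

text \<open>One step of a computation in which the coalition acts as in the joint action \<open>\<alpha>\<close>.\<close>

definition stp :: "rbcgs => nat set => nat set => nat list => nat \<times> endowment => nat \<times> endowment => bool" where
  "stp M A B \<alpha> c c' <-> (\<exists>\<sigma> \<in> joint M (fst c). (\<forall>a \<in> A. \<sigma> ! a = \<alpha> ! a) \<and>
     affordable M (A \<union> B) (fst c) \<sigma> (snd c) \<and>
     c' = (succ M (fst c) \<sigma>, upd_en M (A \<union> B) (fst c) \<sigma> (snd c)))"

text \<open>Computations and their sequences of actions are listed in reverse order here.\<close>

fun rchain :: "rbcgs => nat set => nat set => endowment => nat list list => (nat \<times> endowment) list => bool" where
  "rchain M A B \<eta> [] [c] = (snd c = \<eta>)"
| "rchain M A B \<eta> (\<alpha> # \<alpha>s) (c' # c # \<pi>) = (stp M A B \<alpha> c c' \<and> rchain M A B \<eta> \<alpha>s (c # \<pi>))"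
| "rchain M A B \<eta> _ _ = False"

text \<open>
  The proponents do not see the endowments of their opponents, so a position of the game is a
  sequence of states with the actions chosen so far, and the choice of an action has to be good for
  all computations with this sequence of states.
\<close>

definition good :: "rbcgs => nat set => nat set => endowment => ((nat \<times> endowment) list => bool) =>
    nat list => nat list list => nat list => bool" where
  "good M A B \<eta> W ss \<alpha>s \<alpha> <-> \<alpha> \<in> joint M (hd ss) \<and>
     (\<forall>\<pi>. map fst \<pi> = ss \<and> rchain M A B \<eta> \<alpha>s \<pi> \<and> (\<forall>c. \<not> stp M A B \<alpha> (hd \<pi>) c) --> W \<pi>)"

text \<open>When the rounds are used up everything is accepted, which is right as soon as
  \<open>k\<close> exceeds the diminishing resource of some bounded agent: no computation is that
  long. All states are tried as successors; on histories without a chain, \<open>good\<close> asks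
  only for an available action.\<close>

primrec game :: "rbcgs => nat set => nat set => endowment => ((nat \<times> endowment) list => bool) =>
    nat => nat list => nat list list => bool" where
  "game M A B \<eta> W 0 ss \<alpha>s = True"
| "game M A B \<eta> W (Suc k) ss \<alpha>s =
     (\<exists>\<alpha>. good M A B \<eta> W ss \<alpha>s \<alpha> \<and> (\<forall>s' \<in> St M. game M A B \<eta> W k (s' # ss) (\<alpha> # \<alpha>s)))"

text \<open>The recursive, reversed form of \<open>computation\<close>. The joint action
  \<open>\<alpha>\<close> merely represents the choice of \<open>F\<close> for the agents in
  \<open>A\<close>.\<close>

fun rcomp :: "rbcgs => nat set => nat set => endowment => (nat list => nat => nat) => (nat \<times> endowment) list => bool" where
  "rcomp M A B \<eta> F [] = False"
| "rcomp M A B \<eta> F [c] = (fst c \<in> St M \<and> snd c = \<eta>)"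
| "rcomp M A B \<eta> F (c' # c # \<pi>) = (rcomp M A B \<eta> F (c # \<pi>) \<and>
     (\<exists>\<alpha>. length \<alpha> = nAgt M \<and> F (rev (map fst (c # \<pi>))) = restrict ((!) \<alpha>) A \<and> stp M A B \<alpha> c c'))"

lemma restrict_nth_eq: "restrict ((!) \<sigma>) A = restrict ((!) \<alpha>) A <-> (\<forall>a \<in> A. \<sigma> ! a = \<alpha> ! a)"
  by (metis restrict_apply' restrict_ext)

context
  fixes M :: rbcgs and A B :: "nat set"
  assumes M: "is_rbcgs M" and A: "A \<subseteq> Agt M" and B: "B \<subseteq> Agt M"
begin

section \<open>Outcomes as reversed chains\<close>

lemma joint_nonempty: "s \<in> St M ==> joint M s \<noteq> {}"
proof -
  assume s: "s \<in> St M"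
  have "map (\<lambda>a. SOME x. x \<in> avail M s a) [0..<nAgt M] \<in> joint M s"
    using M s unfolding is_rbcgs_def joint_def Agt_def by (auto intro: some_in_eq[THEN iffD2])
  then show ?thesis by blast
qed

lemma upd_en_En: "upd_en M C s \<sigma> e \<in> En M"
  by (auto simp: upd_en_def En_def)

lemma stp_range: "stp M A B \<alpha> c c' ==> fst c \<in> St M ==> fst c' \<in> St M \<and> snd c' \<in> En M"
  using M upd_en_En by (auto simp: stp_def is_rbcgs_def)

lemma computation_snoc:
  assumes "\<pi> \<noteq> []"
  shows "computation M \<eta> A F B (\<pi> @ [c']) <-> computation M \<eta> A F B \<pi> \<and>
     (\<exists>\<alpha>. length \<alpha> = nAgt M \<and> F (map fst \<pi>) = restrict ((!) \<alpha>) A \<and> stp M A B \<alpha> (last \<pi>) c')"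
proof -
  define R where "R = (\<lambda>\<tau> i. (let s = fst (\<tau> ! i); e = snd (\<tau> ! i); s' = fst (\<tau> ! Suc i); e' = snd (\<tau> ! Suc i) in
        \<exists>\<sigma> \<in> joint M s.
          F (map fst (take (Suc i) \<tau>)) = restrict ((!) \<sigma>) A \<and>
          s' = succ M s \<sigma> \<and>
          (\<forall>a \<in> A \<union> B. \<forall>V \<in> Res M. e (a, V) \<ge> consumed M V s (\<sigma> ! a)) \<and>
          (\<forall>a \<in> A \<union> B. \<forall>V \<in> Res M.
             e' (a, V) = e (a, V) + produced M V s (\<sigma> ! a) - consumed M V s (\<sigma> ! a)) \<and>
          (\<forall>a \<in> Agt M - (A \<union> B). \<forall>V \<in> Res M. e' (a, V) = e (a, V))))"
  have comp: "computation M \<eta> A F B \<tau> <-> ext_computation M \<tau> \<and> snd (\<tau> ! 0) = \<eta> \<and> (\<forall>i. Suc i < length \<tau> --> R \<tau> i)" for \<tau>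
    by (simp add: computation_def R_def)
  obtain k where k: "length \<pi> = Suc k" using assms by (cases \<pi>) auto
  have last: "last \<pi> = \<pi> ! k" using assms k by (simp add: last_conv_nth)
  \<comment> \<open>The pointwise equations in \<open>computation\<close> determine the new
    endowment because both sides are extensional on \<open>Agt M \<times> Res M\<close>.\<close>
  have upd: "snd c' \<in> En M ==> snd c' = upd_en M (A \<union> B) s \<sigma> e <->
      (\<forall>a \<in> A \<union> B. \<forall>V \<in> Res M. snd c' (a, V) = e (a, V) + produced M V s (\<sigma> ! a) - consumed M V s (\<sigma> ! a)) \<and>
      (\<forall>a \<in> Agt M - (A \<union> B). \<forall>V \<in> Res M. snd c' (a, V) = e (a, V))" for s \<sigma> e
  proof
    assume c': "snd c' \<in> En M" and e: "(\<forall>a \<in> A \<union> B. \<forall>V \<in> Res M. snd c' (a, V) = e (a, V) + produced M V s (\<sigma> ! a) - consumed M V s (\<sigma> ! a)) \<and>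
      (\<forall>a \<in> Agt M - (A \<union> B). \<forall>V \<in> Res M. snd c' (a, V) = e (a, V))"
    show "snd c' = upd_en M (A \<union> B) s \<sigma> e"
    proof (rule PiE_ext)
      show "snd c' \<in> (Agt M \<times> Res M) \<rightarrow>\<^sub>E UNIV" using c' by (simp add: En_def)
      show "upd_en M (A \<union> B) s \<sigma> e \<in> (Agt M \<times> Res M) \<rightarrow>\<^sub>E UNIV" using upd_en_En by (simp add: En_def)
    qed (use e in \<open>auto simp: upd_en_def\<close>)
  next
    assume "snd c' = upd_en M (A \<union> B) s \<sigma> e"
    then show "(\<forall>a \<in> A \<union> B. \<forall>V \<in> Res M. snd c' (a, V) = e (a, V) + produced M V s (\<sigma> ! a) - consumed M V s (\<sigma> ! a)) \<and>
      (\<forall>a \<in> Agt M - (A \<union> B). \<forall>V \<in> Res M. snd c' (a, V) = e (a, V))"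
      using A B by (auto simp: upd_en_def)
  qed
  have Rk: "R (\<pi> @ [c']) k <-> (\<exists>\<alpha>. length \<alpha> = nAgt M \<and> F (map fst \<pi>) = restrict ((!) \<alpha>) A \<and> stp M A B \<alpha> (last \<pi>) c')"
    if "snd c' \<in> En M"
  proof -
    have "R (\<pi> @ [c']) k <-> (\<exists>\<sigma> \<in> joint M (fst (last \<pi>)). F (map fst \<pi>) = restrict ((!) \<sigma>) A \<and>
       affordable M (A \<union> B) (fst (last \<pi>)) \<sigma> (snd (last \<pi>)) \<and>
       c' = (succ M (fst (last \<pi>)) \<sigma>, upd_en M (A \<union> B) (fst (last \<pi>)) \<sigma> (snd (last \<pi>))))"
      using k upd[OF that] unfolding R_def last
      by (auto simp: nth_append Let_def affordable_def prod_eq_iff)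
    also have "\<dots> <-> (\<exists>\<alpha>. length \<alpha> = nAgt M \<and> F (map fst \<pi>) = restrict ((!) \<alpha>) A \<and> stp M A B \<alpha> (last \<pi>) c')"
      unfolding stp_def by (auto simp: restrict_nth_eq[symmetric]) (auto simp: joint_def)
    finally show ?thesis .
  qed
  have Ri: "R (\<pi> @ [c']) i = R \<pi> i" if "Suc i < length \<pi>" for i
    using that by (simp add: R_def nth_append)
  have all: "(\<forall>i. Suc i < length (\<pi> @ [c']) --> R (\<pi> @ [c']) i) <->
      (\<forall>i. Suc i < length \<pi> --> R \<pi> i) \<and> R (\<pi> @ [c']) k"
    using Ri k by (auto simp: less_Suc_eq)
  have path_snoc: "is_path M (map fst \<pi> @ [fst c']) <-> is_path M (map fst \<pi>) \<and> fst c' \<in> St M \<and>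
      (\<exists>\<sigma> \<in> joint M (fst (last \<pi>)). fst c' = succ M (fst (last \<pi>)) \<sigma>)"
  proof -
    let ?Q = "\<lambda>ss i. \<exists>\<sigma> \<in> joint M (ss ! i). ss ! Suc i = succ M (ss ! i) \<sigma>"
    have "?Q (map fst \<pi> @ [fst c']) i = ?Q (map fst \<pi>) i" if "Suc i < length \<pi>" for i
      using that by (simp add: nth_append)
    moreover have "?Q (map fst \<pi> @ [fst c']) k <-> (\<exists>\<sigma> \<in> joint M (fst (last \<pi>)). fst c' = succ M (fst (last \<pi>)) \<sigma>)"
      using k by (simp add: nth_append last)
    ultimately have "(\<forall>i. Suc i < length (map fst \<pi> @ [fst c']) --> ?Q (map fst \<pi> @ [fst c']) i) <->
        (\<forall>i. Suc i < length (map fst \<pi>) --> ?Q (map fst \<pi>) i) \<and>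
        (\<exists>\<sigma> \<in> joint M (fst (last \<pi>)). fst c' = succ M (fst (last \<pi>)) \<sigma>)"
      using k by (auto simp: less_Suc_eq)
    then show ?thesis using assms unfolding is_path_def by auto
  qed
  show ?thesis
  proof
    assume c: "computation M \<eta> A F B (\<pi> @ [c'])"
    then have "snd c' \<in> En M" by (cases c') (auto simp: comp ext_computation_def)
    then show "computation M \<eta> A F B \<pi> \<and>
     (\<exists>\<alpha>. length \<alpha> = nAgt M \<and> F (map fst \<pi>) = restrict ((!) \<alpha>) A \<and> stp M A B \<alpha> (last \<pi>) c')"
      using c assms Rk path_snoc all k unfolding comp ext_computation_def
      by (auto simp: nth_append)
  next
    assume c: "computation M \<eta> A F B \<pi> \<and>
     (\<exists>\<alpha>. length \<alpha> = nAgt M \<and> F (map fst \<pi>) = restrict ((!) \<alpha>) A \<and> stp M A B \<alpha> (last \<pi>) c')"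
    then obtain \<alpha> where \<alpha>: "stp M A B \<alpha> (last \<pi>) c'" by blast
    have "fst (last \<pi>) \<in> St M"
      using c assms unfolding comp ext_computation_def by (metis SigmaE fst_conv last_in_set subsetD)
    then have c': "fst c' \<in> St M" "snd c' \<in> En M" using stp_range[OF \<alpha>] by auto
    have "\<exists>\<sigma> \<in> joint M (fst (last \<pi>)). fst c' = succ M (fst (last \<pi>)) \<sigma>"
      using \<alpha> by (auto simp: stp_def)
    then show "computation M \<eta> A F B (\<pi> @ [c'])"
      using c assms Rk[OF c'(2)] path_snoc all k c' unfolding comp ext_computation_def
      by (cases c') (auto simp: nth_append)
  qed
qed

lemma computation_single: "\<eta> \<in> En M ==> computation M \<eta> A F B [c] <-> fst c \<in> St M \<and> snd c = \<eta>"
  by (cases c) (auto simp: computation_def ext_computation_def is_path_def)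

lemma computation_rcomp: "\<eta> \<in> En M ==> computation M \<eta> A F B (rev \<pi>) <-> rcomp M A B \<eta> F \<pi>"
proof (induction \<pi> rule: induct_list012)
  case 1
  then show ?case by (simp add: computation_def ext_computation_def)
next
  case (2 c)
  then show ?case by (simp add: computation_single)
next
  case (3 c' c \<pi>)
  then show ?case
    using computation_snoc[of "rev (c # \<pi>)" \<eta> F c'] by (auto simp: rev_map)
qed

lemma computation_prefix:
  "computation M \<eta> A F B (\<pi> @ \<tau>) ==> \<pi> \<noteq> [] ==> computation M \<eta> A F B \<pi>"
proof (induction \<tau> rule: rev_induct)
  case (snoc c \<tau>)
  then show ?case using computation_snoc[of "\<pi> @ \<tau>" \<eta> F c] by simp
qed simp

text \<open>Nonempty prefixes of computations are computations, so maximality can be tested on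
  extensions by a single step.\<close>

lemma out_rcomp:
  assumes "\<eta> \<in> En M"
  shows "\<pi> \<in> out M s \<eta> A F B <-> rcomp M A B \<eta> F (rev \<pi>) \<and> fst (\<pi> ! 0) = s \<and>
    (\<forall>c. \<not> rcomp M A B \<eta> F (c # rev \<pi>))"
proof -
  have rc: "rcomp M A B \<eta> F (rev \<tau>) <-> computation M \<eta> A F B \<tau>" for \<tau>
    using computation_rcomp[OF assms, of F "rev \<tau>"] by simp
  have "(\<exists>\<pi>'. computation M \<eta> A F B \<pi>' \<and> strict_prefix \<pi> \<pi>') <-> (\<exists>c. computation M \<eta> A F B (\<pi> @ [c]))"
  proof
    assume "\<exists>\<pi>'. computation M \<eta> A F B \<pi>' \<and> strict_prefix \<pi> \<pi>'"
    then obtain c \<tau> where "computation M \<eta> A F B (\<pi> @ c # \<tau>)"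
      by (metis strict_prefixE')
    then have "computation M \<eta> A F B ((\<pi> @ [c]) @ \<tau>)" by simp
    then show "\<exists>c. computation M \<eta> A F B (\<pi> @ [c])" using computation_prefix by blast
  next
    assume "\<exists>c. computation M \<eta> A F B (\<pi> @ [c])"
    then show "\<exists>\<pi>'. computation M \<eta> A F B \<pi>' \<and> strict_prefix \<pi> \<pi>'"
      by (metis strict_prefixI' )
  qed
  then show ?thesis using rc[of \<pi>] rc[of "\<pi> @ [c]" for c] by (auto simp: out_def)
qed

lemma rcomp_nonempty: "rcomp M A B \<eta> F \<pi> ==> \<pi> \<noteq> []"
  by (cases \<pi>) auto

lemma rcomp_St: "rcomp M A B \<eta> F \<pi> ==> set (map fst \<pi>) \<subseteq> St M"
proof (induction \<pi> rule: induct_list012)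
  case (3 c' c \<pi>)
  then obtain \<alpha> where "stp M A B \<alpha> c c'" "set (map fst (c # \<pi>)) \<subseteq> St M" by auto
  then show ?case using stp_range[of \<alpha> c c'] by auto
qed auto

lemma rchain_length: "rchain M A B \<eta> \<alpha>s \<pi> ==> length \<pi> = Suc (length \<alpha>s)"
  by (induction M A B \<eta> \<alpha>s \<pi> rule: rchain.induct) auto

lemma stp_dim:
  assumes "stp M A B \<alpha> c c'" "fst c \<in> St M" "a \<in> A \<union> B"
  shows "snd c' (a, 0) < snd c (a, 0)"
proof -
  obtain \<sigma> where \<sigma>: "\<sigma> \<in> joint M (fst c)" "affordable M (A \<union> B) (fst c) \<sigma> (snd c)"
    "c' = (succ M (fst c) \<sigma>, upd_en M (A \<union> B) (fst c) \<sigma> (snd c))"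
    using assms(1) by (auto simp: stp_def)
  have a: "a \<in> Agt M" using assms(3) A B by blast
  have 0: "0 \<in> Res M" using M by (auto simp: is_rbcgs_def Res_def)
  have "\<sigma> ! a \<in> avail M (fst c) a" using \<sigma>(1) a by (auto simp: joint_def)
  then have "cost M (fst c) (\<sigma> ! a) 0 \<le> -1" using M assms(2) a by (auto simp: is_rbcgs_def)
  then have "produced M 0 (fst c) (\<sigma> ! a) = 0" "consumed M 0 (fst c) (\<sigma> ! a) \<ge> 1"
    by (auto simp: produced_def consumed_def)
  moreover have "consumed M 0 (fst c) (\<sigma> ! a) \<le> snd c (a, 0)"
    using \<sigma>(2) 0 assms(3) by (auto simp: affordable_def)
  ultimately show ?thesis using \<sigma>(3) a 0 assms(3) by (auto simp: upd_en_def)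
qed

text \<open>Every action has cost at most -1 in the resource 0, so the supply of a single bounded
  agent limits the number of steps.\<close>

lemma rchain_dim:
  assumes "a \<in> A \<union> B"
  shows "rchain M A B \<eta> \<alpha>s \<pi> ==> set (map fst \<pi>) \<subseteq> St M ==> snd (hd \<pi>) (a, 0) + length \<alpha>s \<le> \<eta> (a, 0)"
proof (induction \<pi> arbitrary: \<alpha>s rule: induct_list012)
  case (2 c)
  then show ?case by (cases \<alpha>s) auto
next
  case (3 c' c \<pi>)
  then obtain \<alpha> \<beta>s where \<alpha>s: "\<alpha>s = \<alpha> # \<beta>s" by (cases \<alpha>s) auto
  have "snd c' (a, 0) < snd c (a, 0)" using 3 \<alpha>s stp_dim[of \<alpha> c c' a] assms by auto
  moreover have "snd c (a, 0) + length \<beta>s \<le> \<eta> (a, 0)" using 3 \<alpha>s by auto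
  ultimately show ?case using \<alpha>s by simp
qed auto

text \<open>The actions chosen on the way to a history. The choice at the history itself is not yet
  among them, so the list is shorter by one than a nonempty history.\<close>

fun hist :: "(nat list => nat list list => nat list) => nat list => nat list list" where
  "hist P [] = []"
| "hist P (s # ss) = (if ss = [] then [] else P ss (hist P ss) # hist P ss)"

lemma stp_cong: "(\<And>a. a \<in> A ==> \<alpha> ! a = \<beta> ! a) ==> stp M A B \<alpha> = stp M A B \<beta>"
  by (auto simp: stp_def fun_eq_iff)

text \<open>Links a choice function of the game with a strategy. Histories are reversed for
  \<open>P\<close> and in natural order for \<open>F\<close>.\<close>

definition plays :: "(nat list => nat list list => nat list) => (nat list => nat => nat) => bool" where
  "plays P F <-> (\<forall>ss. set ss \<subseteq> St M --> ss \<noteq> [] --> length (P ss (hist P ss)) = nAgt M \<and>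
     F (rev ss) = restrict ((!) (P ss (hist P ss))) A)"

text \<open>Any joint action representing the choice of \<open>F\<close> agrees on \<open>A\<close>
  with the one chosen by \<open>P\<close>, and \<open>stp\<close> looks at nothing else.\<close>

lemma rcomp_step:
  assumes "plays P F" "set (map fst (c # \<pi>)) \<subseteq> St M"
  shows "rcomp M A B \<eta> F (c' # c # \<pi>) <-> rcomp M A B \<eta> F (c # \<pi>) \<and>
    stp M A B (P (map fst (c # \<pi>)) (hist P (map fst (c # \<pi>)))) c c'"
proof -
  let ?\<beta> = "P (map fst (c # \<pi>)) (hist P (map fst (c # \<pi>)))"
  have p: "length ?\<beta> = nAgt M" "F (rev (map fst (c # \<pi>))) = restrict ((!) ?\<beta>) A"
    using assms unfolding plays_def by blast+
  have "(\<exists>\<alpha>. length \<alpha> = nAgt M \<and> F (rev (map fst (c # \<pi>))) = restrict ((!) \<alpha>) A \<and> stp M A B \<alpha> c c') <->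
      stp M A B ?\<beta> c c'"
  proof
    assume "\<exists>\<alpha>. length \<alpha> = nAgt M \<and> F (rev (map fst (c # \<pi>))) = restrict ((!) \<alpha>) A \<and> stp M A B \<alpha> c c'"
    then obtain \<alpha> where \<alpha>: "restrict ((!) \<alpha>) A = restrict ((!) ?\<beta>) A" "stp M A B \<alpha> c c'"
      using p(2) by metis
    have "stp M A B \<alpha> = stp M A B ?\<beta>"
      using \<alpha>(1) by (intro stp_cong) (simp only: restrict_nth_eq)
    then show "stp M A B ?\<beta> c c'" using \<alpha>(2) by (simp only:)
  next
    assume "stp M A B ?\<beta> c c'"
    then show "\<exists>\<alpha>. length \<alpha> = nAgt M \<and> F (rev (map fst (c # \<pi>))) = restrict ((!) \<alpha>) A \<and> stp M A B \<alpha> c c'"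
      using p by blast
  qed
  then show ?thesis by (simp only: rcomp.simps)
qed

lemma rcomp_rchain:
  assumes "plays P F"
  shows "set (map fst \<pi>) \<subseteq> St M ==>
    rcomp M A B \<eta> F \<pi> <-> \<pi> \<noteq> [] \<and> rchain M A B \<eta> (hist P (map fst \<pi>)) \<pi>"
proof (induction \<pi> rule: induct_list012)
  case (3 c' c \<pi>)
  then have St: "set (map fst (c # \<pi>)) \<subseteq> St M" by simp
  have h: "hist P (map fst (c' # c # \<pi>)) =
      P (map fst (c # \<pi>)) (hist P (map fst (c # \<pi>))) # hist P (map fst (c # \<pi>))" by simp
  show ?case unfolding h rchain.simps rcomp_step[OF assms St] using 3(2)[OF St] by blast
qed simp_all

lemma out_rchain:
  assumes "plays P F" "\<eta> \<in> En M"
  shows "\<pi> \<in> out M s \<eta> A F B <-> \<pi> \<noteq> [] \<and> set (map fst \<pi>) \<subseteq> St M \<and> fst (hd \<pi>) = s \<and>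
    rchain M A B \<eta> (hist P (map fst (rev \<pi>))) (rev \<pi>) \<and>
    (\<forall>c. \<not> stp M A B (P (map fst (rev \<pi>)) (hist P (map fst (rev \<pi>)))) (hd (rev \<pi>)) c)"
proof -
  have St: "rcomp M A B \<eta> F (rev \<pi>) ==> \<pi> \<noteq> [] \<and> set (map fst \<pi>) \<subseteq> St M"
    using rcomp_St[of \<eta> F "rev \<pi>"] rcomp_nonempty[of \<eta> F "rev \<pi>"] by simp
  have max: "rcomp M A B \<eta> F (c' # rev \<pi>) <-> rcomp M A B \<eta> F (rev \<pi>) \<and>
      stp M A B (P (map fst (rev \<pi>)) (hist P (map fst (rev \<pi>)))) (hd (rev \<pi>)) c'"
    if \<pi>: "\<pi> \<noteq> []" "set (map fst \<pi>) \<subseteq> St M" for c'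
  proof -
    obtain c \<tau> where c: "rev \<pi> = c # \<tau>" using \<pi>(1) by (metis neq_Nil_conv rev_is_Nil_conv)
    have "set (map fst (c # \<tau>)) \<subseteq> St M" using \<pi>(2) unfolding c[symmetric] by simp
    then show ?thesis unfolding c using rcomp_step[OF assms(1)] by simp
  qed
  show ?thesis
  proof (cases "\<pi> \<noteq> [] \<and> set (map fst \<pi>) \<subseteq> St M")
    case True
    then have \<pi>: "\<pi> \<noteq> []" "set (map fst \<pi>) \<subseteq> St M" "set (map fst (rev \<pi>)) \<subseteq> St M" by simp_all
    show ?thesis
      unfolding out_rcomp[OF assms(2)] max[OF \<pi>(1,2)] rcomp_rchain[OF assms(1) \<pi>(3)]
      using \<pi> hd_conv_nth[OF \<pi>(1)] by (simp only: rev_is_Nil_conv simp_thms) blast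
  next
    case False
    then show ?thesis using out_rcomp[OF assms(2), of \<pi> s F] St by blast
  qed
qed

text \<open>A strategy wins the game by extending its choices to joint actions. Conversely, a choice
  function is read off a won game, and \<open>k\<close> is large enough for every outcome to end
  within the game.\<close>

theorem game_strategy:
  assumes \<eta>: "\<eta> \<in> En M" and s: "s \<in> St M" and a: "a \<in> A \<union> B" and k: "\<eta> (a, 0) < k"
  shows "game M A B \<eta> W k [s] [] <-> (\<exists>F. strategy M A F \<and> (\<forall>\<pi> \<in> out M s \<eta> A F B. W (rev \<pi>)))"
proof
  assume "\<exists>F. strategy M A F \<and> (\<forall>\<pi> \<in> out M s \<eta> A F B. W (rev \<pi>))"
  then obtain F where F: "strategy M A F" "\<And>\<pi>. \<pi> \<in> out M s \<eta> A F B ==> W (rev \<pi>)" by blast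
  have ex: "\<exists>\<alpha> \<in> joint M (hd ss). F (rev ss) = restrict ((!) \<alpha>) A" if "set ss \<subseteq> St M" "ss \<noteq> []" for ss
  proof -
    have last: "last (rev ss) = hd ss" "hd ss \<in> St M" using that by (auto simp: last_rev)
    obtain \<beta> where \<beta>: "\<beta> \<in> joint M (hd ss)" using joint_nonempty[OF last(2)] by blast
    have Fss: "F (rev ss) \<in> (\<Pi>\<^sub>E a\<in>A. avail M (hd ss) a)"
      using F(1) that last(1) unfolding strategy_def by (metis in_listsI rev_is_Nil_conv set_rev subsetD)
    \<comment> \<open>The agents outside \<open>A\<close> borrow their actions from an arbitrary
      joint action \<open>\<beta>\<close>.\<close>
    let ?\<alpha> = "map (\<lambda>a. if a \<in> A then F (rev ss) a else \<beta> ! a) [0..<nAgt M]"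
    have nth: "?\<alpha> ! a = (if a \<in> A then F (rev ss) a else \<beta> ! a)" if "a \<in> Agt M" for a
      using that by (simp add: Agt_def)
    have "?\<alpha> \<in> joint M (hd ss)" using \<beta> Fss nth by (auto simp: joint_def)
    moreover have "F (rev ss) = restrict ((!) ?\<alpha>) A"
    proof (rule PiE_ext[OF Fss])
      have "?\<alpha> ! a = F (rev ss) a" if "a \<in> A" for a using that A nth by auto
      then show "restrict ((!) ?\<alpha>) A \<in> (\<Pi>\<^sub>E a\<in>A. avail M (hd ss) a)"
        using Fss by (auto simp del: nth_map)
      show "F (rev ss) a = restrict ((!) ?\<alpha>) A a" if "a \<in> A" for a
        using that A nth by auto
    qed
    ultimately show ?thesis by blast
  qed
  define P where "P = (\<lambda>ss (\<alpha>s :: nat list list). SOME \<alpha>. \<alpha> \<in> joint M (hd ss) \<and> F (rev ss) = restrict ((!) \<alpha>) A)"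
  have P: "P ss \<alpha>s \<in> joint M (hd ss) \<and> F (rev ss) = restrict ((!) (P ss \<alpha>s)) A" if "set ss \<subseteq> St M" "ss \<noteq> []" for ss \<alpha>s
    unfolding P_def by (rule someI_ex) (use ex[OF that] in blast)
  have "length \<alpha> = nAgt M" if "\<alpha> \<in> joint M s" for \<alpha> s using that by (simp add: joint_def)
  then have plays: "plays P F" using P unfolding plays_def by blast
  have "game M A B \<eta> W k ss (hist P ss)" if "set ss \<subseteq> St M" "ss \<noteq> []" "last ss = s" for k ss
    using that
  proof (induction k arbitrary: ss)
    case (Suc k)
    have "good M A B \<eta> W ss (hist P ss) (P ss (hist P ss))"
      unfolding good_def
    proof (intro conjI allI impI)
      show "P ss (hist P ss) \<in> joint M (hd ss)" using P Suc.prems by blast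
      fix \<pi> assume \<pi>: "map fst \<pi> = ss \<and> rchain M A B \<eta> (hist P ss) \<pi> \<and> (\<forall>c. \<not> stp M A B (P ss (hist P ss)) (hd \<pi>) c)"
      have "rev \<pi> \<in> out M s \<eta> A F B"
      proof -
        have "\<pi> \<noteq> []" using \<pi> Suc.prems by auto
        moreover from this have "fst (hd (rev \<pi>)) = s" using \<pi> Suc.prems by (metis hd_rev last_map)
        moreover have "set (map fst (rev \<pi>)) \<subseteq> St M" using \<pi> Suc.prems(1) by (metis rev_map set_rev)
        ultimately show ?thesis
          using \<pi> unfolding out_rchain[OF plays \<eta>] rev_rev_ident by simp
      qed
      then show "W \<pi>" using F(2) by fastforce
    qed
    moreover have "game M A B \<eta> W k (s' # ss) (P ss (hist P ss) # hist P ss)" if "s' \<in> St M" for s'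
      using Suc.IH[of "s' # ss"] Suc.prems that by simp
    ultimately show ?case by auto
  qed simp
  from this[of "[s]" k] show "game M A B \<eta> W k [s] []" using s by simp
next
  assume g: "game M A B \<eta> W k [s] []"
  define Q where "Q = (\<lambda>ss \<alpha>s \<alpha>. good M A B \<eta> W ss \<alpha>s \<alpha> \<and> (\<forall>s' \<in> St M. game M A B \<eta> W (k - length ss) (s' # ss) (\<alpha> # \<alpha>s)))"
  \<comment> \<open>Off the won positions any joint action serves; it only has to make
    \<open>F\<close> a strategy on all histories.\<close>
  define P where "P = (\<lambda>ss \<alpha>s. if \<exists>\<alpha>. Q ss \<alpha>s \<alpha> then SOME \<alpha>. Q ss \<alpha>s \<alpha> else SOME \<alpha>. \<alpha> \<in> joint M (hd ss))"
  have QP: "Q ss \<alpha>s (P ss \<alpha>s)" if "\<exists>\<alpha>. Q ss \<alpha>s \<alpha>" for ss \<alpha>s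
    using someI_ex[OF that] that by (simp add: P_def)
  have joint: "P ss \<alpha>s \<in> joint M (hd ss)" if "set ss \<subseteq> St M" "ss \<noteq> []" for ss \<alpha>s
  proof (cases "\<exists>\<alpha>. Q ss \<alpha>s \<alpha>")
    case True
    then show ?thesis using QP[OF True] by (auto simp: Q_def good_def)
  next
    case False
    have "hd ss \<in> St M" using that by (cases ss) auto
    then have "\<exists>\<alpha>. \<alpha> \<in> joint M (hd ss)" using joint_nonempty by blast
    from someI_ex[OF this] show ?thesis using False unfolding P_def by (simp only: if_False)
  qed
  define F where "F = (\<lambda>ss. restrict ((!) (P (rev ss) (hist P (rev ss)))) A)"
  have plays: "plays P F" using joint unfolding plays_def F_def by (auto simp: joint_def)
  have strat: "strategy M A F"
    unfolding strategy_def
  proof (intro ballI impI)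
    fix ss assume ss: "ss \<in> lists (St M)" "ss \<noteq> []"
    then have "P (rev ss) (hist P (rev ss)) \<in> joint M (hd (rev ss))"
      by (intro joint) auto
    then show "F ss \<in> (\<Pi>\<^sub>E a\<in>A. avail M (last ss) a)"
      using A by (auto simp: F_def joint_def hd_rev)
  qed
  \<comment> \<open>Following the choices of \<open>P\<close>, a history of length \<open>i\<close>
    is a won position with \<open>k - i + 1\<close> rounds to go.\<close>
  have game: "game M A B \<eta> W (Suc (k - length ss)) ss (hist P ss)"
    if "set ss \<subseteq> St M" "ss \<noteq> []" "last ss = s" "length ss \<le> k" for ss
    using that
  proof (induction ss)
    case (Cons s' ss)
    show ?case
    proof (cases "ss = []")
      case True
      then show ?thesis using Cons.prems g by simp
    next
      case False
      then have "game M A B \<eta> W (Suc (k - length ss)) ss (hist P ss)" using Cons by auto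
      then have "\<exists>\<alpha>. Q ss (hist P ss) \<alpha>" by (auto simp: Q_def)
      from QP[OF this] have "game M A B \<eta> W (k - length ss) (s' # ss) (P ss (hist P ss) # hist P ss)"
        using Cons.prems by (simp add: Q_def)
      moreover have "k - length ss = Suc (k - length (s' # ss))" using Cons.prems by simp
      ultimately show ?thesis using False by simp
    qed
  qed simp
  have "W (rev \<pi>)" if "\<pi> \<in> out M s \<eta> A F B" for \<pi>
  proof -
    let ?V = "rev \<pi>" and ?ss = "map fst (rev \<pi>)"
    have \<pi>: "\<pi> \<noteq> []" "set ?ss \<subseteq> St M" "fst (hd \<pi>) = s" "rchain M A B \<eta> (hist P ?ss) ?V"
      "\<And>c. \<not> stp M A B (P ?ss (hist P ?ss)) (hd ?V) c"
      using that unfolding out_rchain[OF plays \<eta>] by auto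
    have "length ?ss \<le> k" using rchain_dim[OF a \<pi>(4,2)] rchain_length[OF \<pi>(4)] k by simp
    moreover have "?ss \<noteq> []" "last ?ss = s" using \<pi>(1,3) by (auto simp: last_rev last_map hd_map)
    ultimately have "game M A B \<eta> W (Suc (k - length ?ss)) ?ss (hist P ?ss)" using \<pi>(2) game by blast
    then have "\<exists>\<alpha>. Q ?ss (hist P ?ss) \<alpha>" by (auto simp: Q_def)
    from QP[OF this] have "good M A B \<eta> W ?ss (hist P ?ss) (P ?ss (hist P ?ss))" by (simp add: Q_def)
    then show ?thesis using \<pi>(4,5) unfolding good_def by blast
  qed
  then show "\<exists>F. strategy M A F \<and> (\<forall>\<pi> \<in> out M s \<eta> A F B. W (rev \<pi>))" using strat by blast
qed

text \<open>With no resource-bounded agent every computation can be extended, so there is no maximal one.\<close>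

lemma out_unbounded:
  assumes "A = {}" "B = {}" "\<eta> \<in> En M"
  shows "\<exists>F. strategy M A F \<and> out M s \<eta> A F B = {}"
proof -
  let ?F = "\<lambda>(ss :: nat list) (a :: nat). undefined :: nat"
  have "\<pi> \<notin> out M s \<eta> A ?F B" for \<pi>
  proof
    assume \<pi>: "\<pi> \<in> out M s \<eta> A ?F B"
    then have rc: "rcomp M A B \<eta> ?F (rev \<pi>)" using out_rcomp[OF assms(3)] by blast
    then obtain c \<tau> where c: "rev \<pi> = c # \<tau>" using rcomp_nonempty by (meson neq_Nil_conv)
    have "fst c \<in> St M" using rcomp_St[OF rc] by (auto simp: c)
    then obtain \<sigma> where \<sigma>: "\<sigma> \<in> joint M (fst c)" using joint_nonempty by blast
    have "rcomp M A B \<eta> ?F ((succ M (fst c) \<sigma>, upd_en M (A \<union> B) (fst c) \<sigma> (snd c)) # c # \<tau>)"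
    proof -
      have "stp M A B \<sigma> c (succ M (fst c) \<sigma>, upd_en M (A \<union> B) (fst c) \<sigma> (snd c))"
        using \<sigma> assms(1,2) by (auto simp: stp_def affordable_def)
      moreover have "length \<sigma> = nAgt M" using \<sigma> by (simp add: joint_def)
      moreover have "(\<lambda>a. undefined) = restrict ((!) \<sigma>) A" using assms(1) by (simp add: restrict_def)
      ultimately show ?thesis using rc unfolding c rcomp.simps by blast
    qed
    then show False using \<pi> out_rcomp[OF assms(3)] c by metis
  qed
  moreover have "strategy M A ?F" by (auto simp: strategy_def assms(1))
  ultimately show ?thesis by blast
qed

end

section \<open>Programming in the logic\<close>

definition FAnd :: "frm => frm => frm" where "FAnd \<phi> \<psi> = FNot (FOr (FNot \<phi>) (FNot \<psi>))"
definition FImp :: "frm => frm => frm" where "FImp \<phi> \<psi> = FOr (FNot \<phi>) \<psi>"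
definition FIff :: "frm => frm => frm" where "FIff \<phi> \<psi> = FAnd (FImp \<phi> \<psi>) (FImp \<psi> \<phi>)"
definition FAll :: "nat => frm => frm" where "FAll v \<phi> = FNot (FEx v (FNot \<phi>))"
definition Mat :: "nat => nat => nat => frm => frm" where
  "Mat l h t \<phi> = FEx h (FEx t (FAnd (FN l h t) \<phi>))"
definition FMk :: "nat => nat => nat => frm => frm" where
  "FMk v a b \<phi> = FEx v (FAnd (FN v a b) \<phi>)"
definition FNil :: "nat => frm => frm" where "FNil v \<phi> = FEx v (FAnd (FL v) \<phi>)"

primrec mv :: "(nat \<times> nat) list => frm => frm" where
  "mv [] \<phi> = \<phi>"
| "mv (m # ms) \<phi> = FEx (fst m) (FAnd (FEq (fst m) (snd m)) (mv ms \<phi>))"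

text \<open>
  Register conventions: arguments are passed in 0, 1, ..., the registers from 8 to 39 are local,
  40 to 45 hold the numbers from 0 to 5, 46 to 55 are global, and those from 60 on are needed to
  pass arguments.
\<close>

definition call :: "nat => nat list => frm" where
  "call p vs = mv (zip [60..<60 + length vs] vs) (mv (zip [0..<length vs] [60..<60 + length vs]) (FJ p))"

text \<open>Going through the registers from 60 on makes the passing of arguments simultaneous, even
  if an argument sits in a low register. The copies left there are part of the exact result.\<close>

definition callenv :: "nat list => (nat => tr) => nat => tr" where
  "callenv vs V = (\<lambda>i. if i < length vs then V (vs ! i)
     else if 60 \<le> i \<and> i < 60 + length vs then V (vs ! (i - 60)) else V i)"

definition ok :: "nat => (nat => tr) => bool" where
  "ok N V <-> (\<forall>i. sz (V i) \<le> N) \<and> V 40 = num 0 \<and> V 41 = num 1 \<and> V 42 = num 2 \<and>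
     V 43 = num 3 \<and> V 44 = num 4 \<and> V 45 = num 5"

lemma okD: "ok N V ==> sz (V i) \<le> N" by (simp add: ok_def)

lemma ok_const:
  assumes "ok N V"
  shows "V 40 = num 0" "V 41 = num 1" "V 42 = num 2" "V 43 = num 3" "V 44 = num 4" "V 45 = num 5"
  using assms by (simp_all add: ok_def)

lemma ok_upd [simp]: "ok N V ==> sz x \<le> N ==> v < 40 \<or> 45 < v ==> ok N (V(v := x))"
  by (auto simp: ok_def)

lemma ok_callenv [simp]: "ok N V ==> length vs \<le> 8 ==> ok N (callenv vs V)"
  by (auto simp: ok_def callenv_def)

lemma ok_pos: "ok N V ==> 1 \<le> N"
  using okD[of N V 40] by (simp add: ok_def sz_num)

lemma eval_FAnd [simp]: "eval N J (FAnd \<phi> \<psi>) V = (eval N J \<phi> V \<and> eval N J \<psi> V)"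
  by (simp add: FAnd_def)

lemma eval_FImp [simp]: "eval N J (FImp \<phi> \<psi>) V = (eval N J \<phi> V --> eval N J \<psi> V)"
  by (simp add: FImp_def)

lemma eval_FIff [simp]: "eval N J (FIff \<phi> \<psi>) V = (eval N J \<phi> V <-> eval N J \<psi> V)"
  by (auto simp: FIff_def)

lemma eval_FAll [simp]: "eval N J (FAll v \<phi>) V = (\<forall>x. sz x \<le> N --> eval N J \<phi> (V(v := x)))"
  by (simp add: FAll_def)

lemma sz_pos: "1 \<le> sz t"
  by (cases t) auto

lemma eval_Mat_sz:
  assumes "sz (V l) \<le> N" "l \<noteq> h" "l \<noteq> t" "h \<noteq> t"
  shows "eval N J (Mat l h t \<phi>) V = (\<exists>a b. V l = Nd a b \<and> eval N J \<phi> (V(h := a, t := b)))"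
  using assms by (auto simp: Mat_def)

lemma eval_Mat [simp]:
  "ok N V ==> l \<noteq> h ==> l \<noteq> t ==> h \<noteq> t ==>
   eval N J (Mat l h t \<phi>) V = (\<exists>a b. sz a \<le> N \<and> sz b \<le> N \<and> V l = Nd a b \<and> eval N J \<phi> (V(h := a, t := b)))"
  using okD[of N V l] by (auto simp: eval_Mat_sz)

lemma eval_FMk [simp]:
  "v \<noteq> a ==> v \<noteq> b ==> eval N J (FMk v a b \<phi>) V =
     (sz (Nd (V a) (V b)) \<le> N \<and> eval N J \<phi> (V(v := Nd (V a) (V b))))"
  by (auto simp: FMk_def)

lemma eval_FNil [simp]: "ok N V ==> eval N J (FNil v \<phi>) V = eval N J \<phi> (V(v := Lf))"
  using ok_pos[of N V] by (auto simp: FNil_def)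

lemma eval_mv:
  assumes "length ds = length ss" "distinct ds" "set ds \<inter> set ss = {}" "\<And>i. sz (V i) \<le> N"
  shows "eval N J (mv (zip ds ss) \<phi>) V =
    eval N J \<phi> (\<lambda>i. case map_of (zip ds ss) i of None => V i | Some s => V s)"
  using assms
proof (induction ds ss arbitrary: V rule: list_induct2)
  case (Cons d ds s ss)
  have "eval N J (mv (zip (d # ds) (s # ss)) \<phi>) V = eval N J (mv (zip ds ss) \<phi>) (V(d := V s))"
    using Cons.prems by auto
  also have "\<dots> = eval N J \<phi> (\<lambda>i. case map_of (zip ds ss) i of None => (V(d := V s)) i | Some s' => (V(d := V s)) s')"
    by (rule Cons.IH) (use Cons.prems in auto)
  also have "(\<lambda>i. case map_of (zip ds ss) i of None => (V(d := V s)) i | Some s' => (V(d := V s)) s')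
      = (\<lambda>i. case map_of (zip (d # ds) (s # ss)) i of None => V i | Some s => V s)"
  proof
    fix i
    show "(case map_of (zip ds ss) i of None => (V(d := V s)) i | Some s' => (V(d := V s)) s')
        = (case map_of (zip (d # ds) (s # ss)) i of None => V i | Some s => V s)"
    proof (cases "map_of (zip ds ss) i")
      case None
      then show ?thesis by auto
    next
      case (Some s')
      then have "s' \<in> set ss" "i \<in> set ds" by (meson in_set_zipE map_of_SomeD)+
      then show ?thesis using Cons.prems Some by auto
    qed
  qed
  finally show ?case .
qed simp

lemma map_of_zip_upt:
  "map_of (zip [a..<a + length vs] vs) i = (if a \<le> i \<and> i < a + length vs then Some (vs ! (i - a)) else None)"
proof -
  have d: "distinct (map fst (zip [a..<a + length vs] vs))" by simp
  show ?thesis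
  proof (cases "a \<le> i \<and> i < a + length vs")
    case True
    then have "(i, vs ! (i - a)) \<in> set (zip [a..<a + length vs] vs)"
      by (auto simp: set_zip intro!: exI[of _ "i - a"])
    then show ?thesis using True map_of_is_SomeI[OF d] by simp
  next
    case False
    then have "i \<notin> fst ` set (zip [a..<a + length vs] vs)" by (auto dest: set_zip_leftD)
    then have "map_of (zip [a..<a + length vs] vs) i = None" by (simp only: map_of_eq_None_iff not_False_eq_True)
    then show ?thesis by (simp only: False if_False)
  qed
qed

lemma eval_call [simp]:
  assumes "ok N V" "\<forall>v \<in> set vs. v < 60" "length vs \<le> 8"
  shows "eval N J (call p vs) V = J p (callenv vs V)"
proof -
  let ?V = "\<lambda>i. case map_of (zip [60..<60 + length vs] vs) i of None => V i | Some s => V s"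
  have "eval N J (call p vs) V = eval N J (mv (zip [0..<length vs] [60..<60 + length vs]) (FJ p)) ?V"
    unfolding call_def by (rule eval_mv) (use assms okD in auto)
  also have "\<dots> = eval N J (FJ p) (\<lambda>i. case map_of (zip [0..<length vs] [60..<60 + length vs]) i of None => ?V i | Some s => ?V s)"
    by (rule eval_mv) (use assms okD in \<open>auto split: option.splits\<close>)
  also have "(\<lambda>i. case map_of (zip [0..<length vs] [60..<60 + length vs]) i of None => ?V i | Some s => ?V s) = callenv vs V"
    using map_of_zip_upt[of 0 "[60..<60 + length vs]"] assms(3)
    by (auto simp: callenv_def fun_eq_iff map_of_zip_upt)
  finally show ?thesis by simp
qed

text \<open>
  Inputs are represented by trees with the tags 0 (number in binary), 1 (integer), 2 (number in
  unary) and 3 (list); \<open>tnum\<close> and \<open>tlst\<close> match the tags 0 and 3.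
\<close>

definition tnum :: "nat => nat => frm => frm" where
  "tnum x u \<phi> = Mat x 38 u (FAnd (FEq 38 40) \<phi>)"
definition tlst :: "nat => nat => frm => frm" where
  "tlst x c \<phi> = Mat x 39 c (FAnd (FEq 39 43) \<phi>)"

abbreviation (input) "p_mem \<equiv> 1 :: nat"
abbreviation (input) "p_nth \<equiv> 2 :: nat"
abbreviation (input) "p_suf \<equiv> 3 :: nat"
abbreviation (input) "p_len \<equiv> 4 :: nat"
abbreviation (input) "p_dbl \<equiv> 5 :: nat"
abbreviation (input) "p_bits \<equiv> 6 :: nat"
abbreviation (input) "p_canon \<equiv> 7 :: nat"
abbreviation (input) "p_app \<equiv> 8 :: nat"
abbreviation (input) "p_ones \<equiv> 9 :: nat"
abbreviation (input) "p_ser \<equiv> 10 :: nat"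
abbreviation (input) "p_serl \<equiv> 11 :: nat"
abbreviation (input) "p_mapcons \<equiv> 12 :: nat"
abbreviation (input) "p_concatmap \<equiv> 13 :: nat"
abbreviation (input) "p_prod \<equiv> 14 :: nat"
abbreviation (input) "p_incr \<equiv> 15 :: nat"
abbreviation (input) "p_wfval \<equiv> 16 :: nat"
abbreviation (input) "p_wfav \<equiv> 17 :: nat"
abbreviation (input) "p_wfcost \<equiv> 18 :: nat"
abbreviation (input) "p_wfsucc \<equiv> 19 :: nat"
abbreviation (input) "p_wfen \<equiv> 20 :: nat"
abbreviation (input) "p_wffm \<equiv> 21 :: nat"
abbreviation (input) "p_add \<equiv> 22 :: nat"
abbreviation (input) "p_row \<equiv> 23 :: nat"
abbreviation (input) "p_upd \<equiv> 24 :: nat"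
abbreviation (input) "p_step \<equiv> 25 :: nat"
abbreviation (input) "p_chain \<equiv> 26 :: nat"
abbreviation (input) "p_second \<equiv> 27 :: nat"
abbreviation (input) "p_win \<equiv> 28 :: nat"
abbreviation (input) "p_game \<equiv> 29 :: nat"
abbreviation (input) "p_sat \<equiv> 30 :: nat"
abbreviation (input) "p_check \<equiv> 31 :: nat"

section \<open>The procedures of the model checker\<close>

definition "f_mem = Mat 1 8 9 (FOr (FEq 0 8) (call p_mem [0, 9]))"
text \<open>The index in register 1 can be any tree: it is read as a list, of which only the length
  counts.\<close>

definition "f_nth = Mat 0 8 9 (FOr (FAnd (FL 1) (FEq 2 8)) (Mat 1 10 11 (call p_nth [9, 11, 2])))"
definition "f_suf = FOr (FEq 0 1) (Mat 0 8 9 (call p_suf [9, 1]))"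
definition "f_len = FOr (FAnd (FL 0) (FL 1))
  (Mat 0 8 9 (Mat 1 10 11 (FAnd (FL 10) (call p_len [9, 11]))))"
definition "f_dbl = FOr (FAnd (FL 0) (FL 1)) (Mat 0 8 9 (Mat 1 10 11 (Mat 11 12 13
  (FAnd (FL 8) (FAnd (FL 10) (FAnd (FL 12) (call p_dbl [9, 13])))))))"
definition "f_bits = FOr (FAnd (FL 0) (FL 1)) (FAnd (FNot (FL 0)) (Mat 1 8 9 (FEx 10 (FEx 11
  (FAnd (call p_dbl [10, 11]) (FAnd
    (FOr (FAnd (FEq 8 40) (FEq 0 11)) (FAnd (FEq 8 41) (Mat 0 12 13 (FAnd (FL 12) (FEq 13 11)))))
    (call p_bits [10, 9])))))))"
text \<open>Recognises words of the form \<open>bits k\<close> without computing \<open>k\<close>,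
  which for a cost can be too large to be written as \<open>num k\<close>.\<close>

definition "f_canon = FOr (FL 0) (Mat 0 8 9 (FOr (FAnd (FEq 8 41) (FL 9))
  (FAnd (FOr (FEq 8 40) (FEq 8 41)) (FAnd (FNot (FL 9)) (call p_canon [9])))))"
definition "f_app = FOr (FAnd (FL 0) (FEq 1 2))
  (Mat 0 8 9 (Mat 2 10 11 (FAnd (FEq 8 10) (call p_app [9, 1, 11]))))"
definition "f_ones = FOr (FAnd (FL 0) (FL 1))
  (Mat 0 8 9 (Mat 1 10 11 (FAnd (FL 8) (FAnd (FEq 10 41) (call p_ones [9, 11])))))"

definition serb :: "nat => nat => nat => frm" where
  "serb b w r = FMk 15 43 r (call p_app [b, 15, w])"

text \<open>Difference lists: registers 1 and 2 hold the word before and after the part that belongs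
  to the tree in register 0. An integer with sign 1 has to be nonzero, so there is no minus
  zero.\<close>

definition "f_ser = Mat 0 8 9
  (FOr (FAnd (FEq 8 40) (FEx 10 (FAnd (call p_bits [9, 10]) (serb 10 1 2))))
  (FOr (FAnd (FEq 8 41) (Mat 9 10 11 (FAnd (call p_canon [11])
         (FOr (FAnd (FEq 10 40) (serb 11 1 2))
              (FAnd (FEq 10 41) (FAnd (FNot (FL 11)) (Mat 1 12 13 (FAnd (FEq 12 42) (serb 11 13 2)))))))))
  (FOr (FAnd (FEq 8 42) (FEx 10 (FEx 11
         (FAnd (call p_bits [10, 9]) (FAnd (call p_ones [10, 11]) (serb 11 1 2))))))
       (FAnd (FEq 8 43) (Mat 1 10 11 (FAnd (FEq 10 44) (FMk 12 45 2 (call p_serl [9, 11, 12]))))))))"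
definition "f_serl = FOr (FAnd (FL 0) (FEq 1 2))
  (Mat 0 8 9 (FEx 10 (FAnd (call p_ser [8, 1, 10]) (call p_serl [9, 10, 2]))))"

definition "f_mapcons = FOr (FAnd (FL 1) (FL 2))
  (Mat 1 8 9 (Mat 2 10 11 (FAnd (FN 10 0 8) (call p_mapcons [0, 9, 11]))))"
definition "f_concatmap = FOr (FAnd (FL 0) (FL 2)) (Mat 0 8 9 (FEx 10 (FEx 11
  (FAnd (call p_mapcons [8, 1, 10]) (FAnd (call p_concatmap [9, 1, 11]) (call p_app [10, 11, 2]))))))"
text \<open>Lists the joint actions in the order of \<open>product_lists\<close>, which is that of
  the transition table.\<close>

definition "f_prod = FOr (FAnd (FL 0) (Mat 1 8 9 (FAnd (FL 8) (FL 9))))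
  (Mat 0 8 9 (Mat 8 10 11 (FEx 12 (FAnd (call p_prod [9, 12]) (call p_concatmap [11, 12, 1])))))"

text \<open>Numbers are lists of leaves, so being smaller means being a suffix of the tail.\<close>

definition lt :: "nat => nat => nat => nat => frm" where
  "lt x y h t = Mat y h t (call p_suf [t, x])"

definition "f_incr = FOr (FL 0) (Mat 0 8 9 (tnum 8 10 (FAnd (lt 10 1 11 12)
  (FAnd (FAll 13 (FImp (call p_mem [13, 9]) (tnum 13 14 (lt 10 14 15 16)))) (call p_incr [9, 1])))))"

definition fset :: "nat => nat => nat => frm" where
  "fset x n c = tlst x c (call p_incr [c, n])"

definition "f_wfval = FAnd (call p_len [52, 54]) (FAll 8 (FImp (call p_mem [8, 52]) (fset 8 48 9)))"
definition "f_wfav = FAnd (call p_len [49, 48]) (FAll 8 (FImp (call p_mem [8, 49])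
  (tlst 8 9 (FAnd (call p_len [9, 46]) (FAll 10 (FImp (call p_mem [10, 9])
    (tlst 10 11 (FAnd (FNot (FL 11)) (call p_incr [11, 55])))))))))"
definition "f_avl = FEx 20 (FEx 21 (FAnd (call p_mem [20, 14]) (tlst 20 22
  (FAnd (call p_mem [21, 22]) (tnum 21 23 (FEq 23 15))))))"
definition "f_wfcost = FAnd (call p_len [50, 48]) (FAll 8 (FImp (lt 8 48 9 10) (FEx 11 (FEx 12
  (FAnd (call p_nth [50, 8, 11]) (FAnd (call p_nth [49, 8, 12]) (tlst 11 13 (tlst 12 14
    (FAnd (call p_len [13, 55]) (FAll 15 (FImp (lt 15 55 9 10) (FEx 16
      (FAnd (call p_nth [13, 15, 16]) (tlst 16 17
        (FOr (FAnd f_avl (FAnd (call p_len [17, 47])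
               (FAnd (FAll 18 (FImp (call p_mem [18, 17]) (Mat 18 24 25 (FEq 24 41))))
                     (Mat 17 26 27 (Mat 26 28 29 (Mat 29 30 31 (FEq 30 41)))))))
             (FAnd (FNot f_avl) (FL 17)))))))))))))))))"
definition "f_wfsucc = FAnd (call p_len [51, 48]) (FAll 8 (FImp (lt 8 48 9 10) (FEx 11 (FEx 12
  (FAnd (call p_nth [51, 8, 11]) (FAnd (call p_nth [49, 8, 12]) (tlst 11 13 (tlst 12 14
    (FAnd (FEx 15 (FAnd (call p_prod [14, 15]) (FEx 16 (FAnd (call p_len [15, 16]) (call p_len [13, 16])))))
      (FAll 17 (FImp (call p_mem [17, 13]) (tnum 17 18 (lt 18 48 19 20)))))))))))))"
definition "f_wfen = tlst 0 8 (FAnd (call p_len [8, 46]) (FAll 9 (FImp (call p_mem [9, 8])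
  (tlst 9 10 (FAnd (call p_len [10, 47]) (FAll 11 (FImp (call p_mem [11, 10]) (Mat 11 12 13 (FEq 12 42)))))))))"
definition "f_wffm = tlst 0 8 (Mat 8 9 10 (tnum 9 11
  (FOr (FAnd (FEq 11 40) (Mat 10 12 13 (FAnd (FL 13) (tnum 12 14 (lt 14 54 15 16)))))
  (FOr (FAnd (FEq 11 41) (Mat 10 12 13 (FAnd (FL 13) (call p_wffm [12]))))
  (FOr (FAnd (FEq 11 42) (Mat 10 12 13 (Mat 13 14 15
         (FAnd (FL 15) (FAnd (call p_wffm [12]) (call p_wffm [14]))))))
       (Mat 10 12 13 (Mat 13 14 15 (Mat 15 16 17 (Mat 17 18 19
         (FAnd (fset 12 46 20) (FAnd (fset 14 46 21)
           (FAnd (FOr (tlst 16 22 (FL 22)) (call p_wfen [16])) (FAnd (call p_wffm [18])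
           (FOr (FAnd (FEq 11 43) (FL 19))
                (FAnd (FOr (FEq 11 44) (FEq 11 45)) (Mat 19 23 24 (FAnd (FL 24) (call p_wffm [23]))))))))))))))))))"

text \<open>Splits off a digit and treats the empty list as an infinite supply of zeros, so that
  numbers of different lengths can be added.\<close>

definition dig :: "nat => nat => nat => frm => frm" where
  "dig x b y \<phi> = FEx b (FEx y (FAnd (FOr (FN x b y) (FAnd (FL x) (FAnd (FL b) (FL y)))) \<phi>))"

text \<open>A ripple-carry adder, least significant digit first. Register 0 is the incoming carry.
  The nested equivalences are the parity of the carry and the two digits, and register 14, the
  outgoing carry, is their majority.\<close>

definition "f_add = FOr (FAnd (FL 0) (FAnd (FL 1) (FAnd (FL 2) (FL 3))))
  (dig 1 8 9 (dig 2 10 11 (dig 3 12 13 (FEx 14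
    (FAnd (FIff (FNot (FL 12)) (FIff (FNot (FL 0)) (FIff (FNot (FL 8)) (FNot (FL 10)))))
    (FAnd (FIff (FL 14) (FOr (FAnd (FL 0) (FL 8)) (FOr (FAnd (FL 0) (FL 10)) (FAnd (FL 8) (FL 10)))))
      (call p_add [14, 9, 11, 13])))))))"

text \<open>There is no subtraction: a negative cost is treated by adding its absolute value to the
  new entry. The new entries are guessed, so they have to be canonical for their encoding to be
  unique.\<close>

definition "f_row = FAnd (call p_len [3, 47]) (FAll 8 (FImp (lt 8 47 9 10) (FEx 11 (FEx 12
  (FAnd (call p_nth [2, 8, 11]) (FAnd (call p_nth [3, 8, 12]) (Mat 11 13 14 (Mat 12 15 16
    (FAnd (FEq 15 42) (FAnd (call p_canon [16]) (FEx 17 (FEx 18 (FEx 19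
      (FAnd (call p_nth [50, 0, 17]) (tlst 17 20 (FAnd (call p_nth [20, 1, 18]) (tlst 18 21
        (FAnd (call p_nth [21, 8, 19]) (Mat 19 22 23 (Mat 23 24 25
          (FOr (FAnd (FEq 24 40) (call p_add [40, 14, 25, 16]))
               (FAnd (FEq 24 41) (call p_add [40, 16, 25, 14])))))))))))))))))))))))"
definition "f_upd = tlst 2 8 (tlst 3 9 (FAnd (call p_len [9, 46]) (FAll 10 (FImp (lt 10 46 11 12) (FEx 13 (FEx 14
  (FAnd (call p_nth [8, 10, 13]) (FAnd (call p_nth [9, 10, 14]) (FMk 15 40 10 (tlst 4 16 (tlst 5 17
    (FOr (FAnd (FOr (call p_mem [15, 16]) (call p_mem [15, 17]))
               (FEx 18 (FAnd (call p_nth [1, 10, 18]) (tnum 18 19 (tlst 13 20 (tlst 14 21 (call p_row [0, 19, 20, 21])))))))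
         (FAnd (FNot (FOr (call p_mem [15, 16]) (call p_mem [15, 17]))) (FEq 13 14))))))))))))))"
text \<open>Register 11 is a guessed index into the list of joint actions, used a second time to
  find the successor in the transition table.\<close>

definition "f_step = FEx 8 (FAnd (call p_nth [49, 0, 8]) (tlst 8 9 (FEx 10 (FAnd (call p_prod [9, 10]) (FEx 11 (FEx 12
  (FAnd (call p_nth [10, 11, 12])
  (FAnd (FEx 13 (FAnd (call p_nth [51, 0, 13]) (tlst 13 14 (FEx 15 (FAnd (call p_nth [14, 11, 15]) (tnum 15 16 (FEq 16 3)))))))
  (FAnd (tlst 5 17 (FAll 18 (FImp (call p_mem [18, 17]) (tnum 18 19 (FEx 20
          (FAnd (call p_nth [12, 19, 20]) (call p_nth [2, 19, 20])))))))
        (call p_upd [0, 12, 1, 4, 5, 6]))))))))))"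
definition "f_chain = FOr
  (FAnd (FL 0) (Mat 1 8 9 (FAnd (FL 9) (Mat 8 10 11 (FAnd (FEq 11 3) (Mat 2 12 13 (FAnd (FL 13) (FEq 12 10))))))))
  (Mat 0 8 9 (Mat 1 10 11 (Mat 2 12 13 (Mat 10 14 15 (FAnd (FEq 14 12) (Mat 11 16 17 (Mat 16 18 19
    (FAnd (call p_chain [9, 11, 13, 3, 4, 5]) (call p_step [18, 19, 8, 14, 15, 4, 5])))))))))"
definition "f_second = Mat 0 8 9 (Mat 9 10 11 (FOr (FAnd (FL 11) (FEq 8 1)) (call p_second [9, 1])))"

definition sat_all :: "nat => nat => frm" where
  "sat_all l f = FAll 30 (FImp (call p_mem [30, l]) (Mat 30 31 32 (call p_sat [31, 32, f])))"

definition "f_win = tlst 1 8 (Mat 8 9 10 (tnum 9 11 (Mat 10 12 13 (Mat 13 14 15 (Mat 15 16 17 (Mat 17 18 19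
  (FOr (FAnd (FEq 11 43) (FEx 20 (FAnd (call p_second [0, 20]) (Mat 20 21 22 (call p_sat [21, 22, 18])))))
       (Mat 19 23 24
  (FOr (FAnd (FEq 11 44) (FEx 25 (FAnd (call p_suf [0, 25]) (Mat 25 26 27 (Mat 26 28 29
         (FAnd (call p_sat [28, 29, 23]) (sat_all 27 18)))))))
       (FAnd (FEq 11 45) (FOr
         (FEx 25 (FAnd (call p_suf [0, 25]) (Mat 25 26 27 (Mat 26 28 29
           (FAnd (call p_sat [28, 29, 23]) (FAnd (call p_sat [28, 29, 18]) (sat_all 27 23)))))))
         (sat_all 0 23))))))))))))"
text \<open>Register 0 is the clock, with one list element per remaining round. Registers 1 and 2
  hold the states and actions so far, 3 the initial endowment, 4 and 5 the two sets of agents, 6 the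
  modal formula.\<close>

definition "f_game = FOr (FL 0) (Mat 0 8 9 (Mat 1 10 11 (FEx 12
  (FAnd (FEx 23 (FAnd (call p_nth [49, 10, 23]) (tlst 23 25 (FEx 26 (FAnd (call p_prod [25, 26]) (call p_mem [12, 26]))))))
  (FAnd (FAll 13 (FImp
          (FAnd (call p_chain [2, 13, 1, 3, 4, 5]) (Mat 13 17 18 (Mat 17 19 20
            (FAll 21 (FAll 22 (FNot (call p_step [19, 20, 12, 21, 22, 4, 5])))))))
          (call p_win [13, 6])))
        (FAll 14 (FImp (lt 14 48 27 28) (FMk 15 14 1 (FMk 16 12 2 (call p_game [9, 15, 16, 3, 4, 5, 6]))))))))))"
text \<open>If both sets of agents are empty there is no maximal computation, and the modality is
  true. Otherwise the clock of the game is register 53, the input word itself, whose length exceeds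
  every amount of the diminishing resource.\<close>

definition "f_sat = tlst 2 8 (Mat 8 9 10 (tnum 9 11
  (FOr (FAnd (FEq 11 40) (Mat 10 12 13 (tnum 12 14 (FEx 15 (FAnd (call p_nth [52, 14, 15])
         (tlst 15 16 (FMk 17 40 0 (call p_mem [17, 16]))))))))
  (FOr (FAnd (FEq 11 41) (Mat 10 12 13 (FNot (call p_sat [0, 1, 12]))))
  (FOr (FAnd (FEq 11 42) (Mat 10 12 13 (Mat 13 14 15 (FAnd (call p_sat [0, 1, 12]) (call p_sat [0, 1, 14])))))
       (FAnd (FOr (FEq 11 43) (FOr (FEq 11 44) (FEq 11 45)))
         (Mat 10 12 13 (Mat 13 14 15 (Mat 15 16 17 (tlst 12 18 (tlst 14 19
           (FOr (FAnd (FL 18) (FL 19))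
             (FEx 20 (FAnd
               (tlst 16 21 (FOr (FAnd (FL 21) (FEq 20 1)) (FAnd (FNot (FL 21)) (FEq 20 16))))
               (FNil 22 (FMk 23 0 22 (call p_game [53, 23, 22, 20, 12, 14, 2])))))))))))))))))"

text \<open>The word is parsed by guessing a typed tree and checking that its serialisation is the
  word.\<close>

definition "f_check = FEx 8 (FNil 9 (FAnd (call p_ser [8, 0, 9])
  (tlst 8 10 (Mat 10 11 12 (Mat 12 13 14 (Mat 14 15 16 (Mat 16 17 18 (FAnd (FL 18)
  (tlst 11 19 (Mat 19 20 21 (Mat 21 22 23 (Mat 23 24 25 (Mat 25 26 27 (Mat 27 28 29 (Mat 29 30 31
    (Mat 31 32 33 (Mat 33 34 35 (Mat 35 36 37 (FAnd (FL 37)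
  (tnum 20 46 (tnum 22 47 (tnum 24 48 (tnum 26 54 (tnum 28 55
    (tlst 30 52 (tlst 32 49 (tlst 34 50 (tlst 36 51 (tnum 13 14
  (FAnd (FNot (FL 46)) (FAnd (FNot (FL 47)) (FAnd (FNot (FL 48)) (FAnd (FNot (FL 55))
  (FAnd (call p_wfval []) (FAnd (call p_wfav []) (FAnd (call p_wfcost []) (FAnd (call p_wfsucc [])
  (FAnd (lt 14 48 9 10) (FAnd (call p_wfen [15]) (FAnd (call p_wffm [17])
    (call p_sat [14, 15, 17])))))))))))))))))))))))))))))))))))))))))"

text \<open>Initially all registers but 0 hold \<open>Lf\<close>, in particular 39 and 40.\<close>

definition "f_main = FMk 41 39 40 (FMk 42 39 41 (FMk 43 39 42 (FMk 44 39 43 (FMk 45 39 44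
  (FEx 53 (FAnd (FEq 53 0) (FJ p_check)))))))"

definition bodies :: "frm list" where
  "bodies = [f_main, f_mem, f_nth, f_suf, f_len, f_dbl, f_bits, f_canon, f_app, f_ones, f_ser, f_serl,
     f_mapcons, f_concatmap, f_prod, f_incr, f_wfval, f_wfav, f_wfcost, f_wfsucc, f_wfen, f_wffm,
     f_add, f_row, f_upd, f_step, f_chain, f_second, f_win, f_game, f_sat, f_check]"

definition prog :: "nat => frm" where "prog p = bodies ! p"

lemma prog_simps:
  "prog 0 = f_main" "prog p_mem = f_mem" "prog p_nth = f_nth" "prog p_suf = f_suf" "prog p_len = f_len"
  "prog p_dbl = f_dbl" "prog p_bits = f_bits" "prog p_canon = f_canon" "prog p_app = f_app"
  "prog p_ones = f_ones" "prog p_ser = f_ser" "prog p_serl = f_serl" "prog p_mapcons = f_mapcons"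
  "prog p_concatmap = f_concatmap" "prog p_prod = f_prod" "prog p_incr = f_incr" "prog p_wfval = f_wfval"
  "prog p_wfav = f_wfav" "prog p_wfcost = f_wfcost" "prog p_wfsucc = f_wfsucc" "prog p_wfen = f_wfen"
  "prog p_wffm = f_wffm" "prog p_add = f_add" "prog p_row = f_row" "prog p_upd = f_upd"
  "prog p_step = f_step" "prog p_chain = f_chain" "prog p_second = f_second" "prog p_win = f_win"
  "prog p_game = f_game" "prog p_sat = f_sat" "prog p_check = f_check"
  by (simp_all add: prog_def bodies_def)

lemma wff_call:
  assumes "p < q" "\<forall>v \<in> set vs. v < 60" "length vs \<le> 8"
  shows "wff 70 q (call p vs)"
proof -
  have mv: "wff 70 q \<phi> ==> (\<And>m. m \<in> set ms ==> fst m < 70 \<and> snd m < 70 \<and> fst m \<noteq> snd m) ==>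
      wff 70 q (mv ms \<phi>)" for ms \<phi>
    by (induction ms) (simp_all add: FAnd_def)
  have "fst m < 70 \<and> snd m < 70 \<and> fst m \<noteq> snd m" if "m \<in> set (zip [60..<60 + length vs] vs)" for m
  proof -
    have "fst m \<in> {60..<60 + length vs}" "snd m \<in> set vs"
      using that by (metis prod.collapse set_zip_leftD set_upt, metis prod.collapse set_zip_rightD)
    then show ?thesis using assms(2,3) by auto
  qed
  moreover have "fst m < 70 \<and> snd m < 70 \<and> fst m \<noteq> snd m"
    if "m \<in> set (zip [0..<length vs] [60..<60 + length vs])" for m
  proof -
    have "fst m \<in> {0..<length vs}" "snd m \<in> {60..<60 + length vs}"
      using that by (metis prod.collapse set_zip_leftD set_upt, metis prod.collapse set_zip_rightD set_upt)
    then show ?thesis using assms(3) by auto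
  qed
  ultimately show ?thesis unfolding call_def using assms(1) by (intro mv) simp_all
qed

lemma wff_macros:
  "wff m q (FAnd \<phi> \<psi>) = (wff m q \<phi> \<and> wff m q \<psi>)"
  "wff m q (FImp \<phi> \<psi>) = (wff m q \<phi> \<and> wff m q \<psi>)"
  "wff m q (FIff \<phi> \<psi>) = (wff m q \<phi> \<and> wff m q \<psi>)"
  "wff m q (FAll v \<phi>) = (v < m \<and> wff m q \<phi>)"
  "wff m q (Mat l h t \<phi>) = (l < m \<and> h < m \<and> t < m \<and> l \<noteq> h \<and> l \<noteq> t \<and> h \<noteq> t \<and> wff m q \<phi>)"
  "wff m q (FMk l h t \<phi>) = (l < m \<and> h < m \<and> t < m \<and> l \<noteq> h \<and> l \<noteq> t \<and> h \<noteq> t \<and> wff m q \<phi>)"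
  "wff m q (FNil v \<phi>) = (v < m \<and> wff m q \<phi>)"
  by (auto simp: FAnd_def FImp_def FIff_def FAll_def Mat_def FMk_def FNil_def)

lemma wff_prog: "p < 32 ==> wff 70 32 (prog p)"
proof -
  have "\<forall>\<phi> \<in> set bodies. wff 70 32 \<phi>"
    unfolding bodies_def list.set ball_simps
    by (intro conjI)
      (simp_all add: f_main_def f_mem_def f_nth_def f_suf_def f_len_def f_dbl_def f_bits_def
        f_canon_def f_app_def f_ones_def f_ser_def f_serl_def f_mapcons_def f_concatmap_def f_prod_def
        f_incr_def f_wfval_def f_wfav_def f_wfcost_def f_wfsucc_def f_wfen_def f_wffm_def f_add_def
        f_row_def f_upd_def f_step_def f_chain_def f_second_def f_win_def f_game_def f_sat_def f_check_def
        wff_macros tnum_def tlst_def serb_def lt_def fset_def f_avl_def dig_def sat_all_def wff_call)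
  moreover assume "p < 32"
  then have "p < length bodies" by (simp add: bodies_def)
  ultimately show ?thesis by (simp add: prog_def)
qed

declare One_nat_def [simp del]

lemma one_less_Suc [simp]: "1 < Suc n <-> 0 < n"
  by (simp add: One_nat_def)

lemma nth_Cons_1 [simp]: "(x # xs) ! 1 = xs ! 0"
  by (simp add: One_nat_def)

section \<open>Correctness of the procedures on lists and numbers\<close>

primrec els :: "tr => tr list" where
  "els Lf = []"
| "els (Nd a b) = a # els b"

text \<open>Every tree is a list in exactly one way, so procedures on lists need no type test and
  their specifications hold for all trees.\<close>

lemma lst_els [simp]: "lst (els t) = t"
  by (induction t) auto

lemma els_lst [simp]: "els (lst xs) = xs"
  by (induction xs) auto

lemma lst_eq_iff [simp]: "lst xs = lst ys <-> xs = ys"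
  by (metis els_lst)

lemma lst_eq_Nd [simp]: "lst xs = Nd a b <-> (\<exists>ys. xs = a # ys \<and> b = lst ys)" 
  by (cases xs) auto

lemma lst_eq_Lf [simp]: "lst xs = Lf <-> xs = []" "Lf = lst xs <-> xs = []"
  by (cases xs; auto)+

lemma els_num [simp]: "els (num k) = replicate k Lf"
  by (induction k) auto

lemma num_lst: "num k = lst (replicate k Lf)"
  by (induction k) auto

lemma num_eq_iff [simp]: "num i = num j <-> i = j"
  by (metis els_num length_replicate)

lemma num_Suc1 [simp]: "num (k + 1) = Nd Lf (num k)"
  by (simp flip: Suc_eq_plus1)

lemma num_numeral: "num (numeral k) = Nd Lf (num (pred_numeral k))"
  by (simp add: numeral_eq_Suc)

lemma num_1 [simp]: "num 1 = Nd Lf Lf"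
  by (simp add: One_nat_def)

lemma num_eq_Lf [simp]: "num k = Lf <-> k = 0" "Lf = num k <-> k = 0"
  by (cases k; simp)+

lemma callenv_app: "callenv vs V i = (if i < length vs then V (vs ! i)
     else if 60 \<le> i \<and> i < 60 + length vs then V (vs ! (i - 60)) else V i)"
  by (simp add: callenv_def)

lemma fuel_Suc: "sz t \<le> d ==> \<exists>d'. d = Suc d'"
  using sz_pos[of t] by (cases d) auto

lemma sz_Nd_le: "sz (Nd a b) \<le> N ==> sz a \<le> N \<and> sz b \<le> N"
  by simp

lemma ok_Nd: "ok N V ==> V l = Nd a b ==> sz a \<le> N \<and> sz b \<le> N"
  using okD[of N V l] by simp

text \<open>The pattern of the proofs that follow: induction on the tree that the procedure
  consumes, whose size also bounds the fuel.\<close>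

lemma jump_mem: "ok N V ==> V 1 = t ==> sz t \<le> d ==> jump prog N d p_mem V <-> V 0 \<in> set (els (V 1))"
    (is "_ ==> _ ==> _ ==> ?P V d")
proof (induction t arbitrary: V d)
  case Lf
  obtain d' where [simp]: "d = Suc d'" using fuel_Suc[OF Lf(3)] by blast
  show ?case using Lf by (simp add: prog_simps f_mem_def)
next
  case (Nd a b)
  note c = ok_Nd[OF Nd.prems(1,2)]
  obtain d' where [simp]: "d = Suc d'" using fuel_Suc[OF Nd.prems(3)] by blast
  have IH: "\<And>V d. ok N V ==> V 1 = b ==> sz b \<le> d ==> ?P V d"
    using Nd.IH(2) .
  have fuel: "sz b \<le> d'" using Nd.prems(3) by simp
  show ?case using Nd.prems(1,2) c fuel
    by (auto simp: prog_simps f_mem_def IH callenv_app)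
qed

lemma jump_nth: "ok N V ==> V 0 = t ==> sz t \<le> d ==> jump prog N d p_nth V <->
    length (els (V 1)) < length (els (V 0)) \<and> V 2 = els (V 0) ! length (els (V 1))"
    (is "_ ==> _ ==> _ ==> ?P V d")
proof (induction t arbitrary: V d)
  case Lf
  obtain d' where [simp]: "d = Suc d'" using fuel_Suc[OF Lf(3)] by blast
  show ?case using Lf by (simp add: prog_simps f_nth_def)
next
  case (Nd a b)
  note c = ok_Nd[OF Nd.prems(1,2)]
  obtain d' where [simp]: "d = Suc d'" using fuel_Suc[OF Nd.prems(3)] by blast
  have IH: "\<And>V d. ok N V ==> V 0 = b ==> sz b \<le> d ==> ?P V d"
    using Nd.IH(2) .
  have fuel: "sz b \<le> d'" using Nd.prems(3) by simp
  show ?case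
  proof (cases "V 1")
    case Lf
    then show ?thesis using Nd.prems(1,2) c fuel
      by (auto simp: prog_simps f_nth_def)
  next
    case (Nd a' b')
    then show ?thesis using Nd.prems(1,2) c fuel ok_Nd[OF Nd.prems(1) Nd]
      by (auto simp: prog_simps f_nth_def IH callenv_app)
  qed
qed

lemma jump_suf: "ok N V ==> V 0 = t ==> sz t \<le> d ==> jump prog N d p_suf V <-> suffix (els (V 1)) (els (V 0))"
    (is "_ ==> _ ==> _ ==> ?P V d")
proof (induction t arbitrary: V d)
  case Lf
  obtain d' where [simp]: "d = Suc d'" using fuel_Suc[OF Lf(3)] by blast
  have "V 0 = V 1 <-> els (V 1) = []" using Lf by (cases "V 1") auto
  then show ?case using Lf by (auto simp: prog_simps f_suf_def)
next
  case (Nd a b)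
  note c = ok_Nd[OF Nd.prems(1,2)]
  obtain d' where [simp]: "d = Suc d'" using fuel_Suc[OF Nd.prems(3)] by blast
  have IH: "\<And>V d. ok N V ==> V 0 = b ==> sz b \<le> d ==> ?P V d"
    using Nd.IH(2) .
  have fuel: "sz b \<le> d'" using Nd.prems(3) by simp
  have "V 0 = V 1 <-> els (V 1) = a # els b" by (metis Nd.prems(2) els.simps(2) lst_els)
  then show ?case using Nd.prems(1,2) c fuel
    by (auto simp: prog_simps f_suf_def IH callenv_app suffix_Cons)
qed

lemma jump_len: "ok N V ==> V 0 = t ==> sz t \<le> d ==> jump prog N d p_len V <-> V 1 = num (length (els (V 0)))"
    (is "_ ==> _ ==> _ ==> ?P V d")
proof (induction t arbitrary: V d)
  case Lf
  obtain d' where [simp]: "d = Suc d'" using fuel_Suc[OF Lf(3)] by blast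
  show ?case using Lf by (simp add: prog_simps f_len_def)
next
  case (Nd a b)
  note c = ok_Nd[OF Nd.prems(1,2)]
  obtain d' where [simp]: "d = Suc d'" using fuel_Suc[OF Nd.prems(3)] by blast
  have IH: "\<And>V d. ok N V ==> V 0 = b ==> sz b \<le> d ==> ?P V d"
    using Nd.IH(2) .
  have fuel: "sz b \<le> d'" using Nd.prems(3) by simp
  have "sz a' \<le> N \<and> sz b' \<le> N" if "V 1 = Nd a' b'" for a' b' using ok_Nd[OF Nd.prems(1) that] .
  then show ?case using Nd.prems(1,2) c fuel
    by (auto simp: prog_simps f_len_def IH callenv_app)
qed

lemma jump_dbl: "ok N V ==> V 0 = t ==> sz t \<le> d ==> jump prog N d p_dbl V <-> (\<exists>k. V 0 = num k \<and> V 1 = num (2 * k))"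
    (is "_ ==> _ ==> _ ==> ?P V d")
proof (induction t arbitrary: V d)
  case Lf
  obtain d' where [simp]: "d = Suc d'" using fuel_Suc[OF Lf(3)] by blast
  show ?case using Lf by (auto simp: prog_simps f_dbl_def)
next
  case (Nd a b)
  note c = ok_Nd[OF Nd.prems(1,2)]
  obtain d' where [simp]: "d = Suc d'" using fuel_Suc[OF Nd.prems(3)] by blast
  have IH: "\<And>V d. ok N V ==> V 0 = b ==> sz b \<le> d ==> ?P V d"
    using Nd.IH(2) .
  have fuel: "sz b \<le> d'" using Nd.prems(3) by simp
  have s: "sz a' \<le> N \<and> sz b' \<le> N" if "V 1 = Nd a' b'" for a' b' using ok_Nd[OF Nd.prems(1) that] .
  have "jump prog N d p_dbl V <-> a = Lf \<and> (\<exists>b'. V 1 = Nd Lf (Nd Lf b') \<and> (\<exists>k. b = num k \<and> b' = num (2 * k)))"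
    using Nd.prems(1,2) c fuel s by (fastforce simp: prog_simps f_dbl_def IH callenv_app)
  also have "\<dots> <-> (\<exists>k. V 0 = num k \<and> V 1 = num (2 * k))"
  proof
    assume "a = Lf \<and> (\<exists>b'. V 1 = Nd Lf (Nd Lf b') \<and> (\<exists>k. b = num k \<and> b' = num (2 * k)))"
    then obtain k where "a = Lf" "b = num k" "V 1 = Nd Lf (Nd Lf (num (2 * k)))" by blast
    then have "V 0 = num (Suc k) \<and> V 1 = num (2 * Suc k)" using Nd.prems(2) by simp
    then show "\<exists>k. V 0 = num k \<and> V 1 = num (2 * k)" by blast
  next
    assume "\<exists>k. V 0 = num k \<and> V 1 = num (2 * k)"
    then obtain k where "V 0 = num k" "V 1 = num (2 * k)" by blast
    then show "a = Lf \<and> (\<exists>b'. V 1 = Nd Lf (Nd Lf b') \<and> (\<exists>k. b = num k \<and> b' = num (2 * k)))"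
      using Nd.prems(2) by (cases k) auto
  qed
  finally show ?case .
qed

lemma jump_app: "ok N V ==> V 0 = t ==> sz t \<le> d ==> jump prog N d p_app V <-> els (V 2) = els (V 0) @ els (V 1)"
    (is "_ ==> _ ==> _ ==> ?P V d")
proof (induction t arbitrary: V d)
  case Lf
  obtain d' where [simp]: "d = Suc d'" using fuel_Suc[OF Lf(3)] by blast
  have "V 1 = V 2 <-> els (V 2) = els (V 1)" by (metis lst_els)
  then show ?case using Lf by (simp add: prog_simps f_app_def)
next
  case (Nd a b)
  note c = ok_Nd[OF Nd.prems(1,2)]
  obtain d' where [simp]: "d = Suc d'" using fuel_Suc[OF Nd.prems(3)] by blast
  have IH: "\<And>V d. ok N V ==> V 0 = b ==> sz b \<le> d ==> ?P V d"
    using Nd.IH(2) .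
  have fuel: "sz b \<le> d'" using Nd.prems(3) by simp
  show ?case
  proof (cases "V 2")
    case Lf
    then show ?thesis using Nd.prems(1,2) c fuel
      by (auto simp: prog_simps f_app_def)
  next
    case (Nd a' b')
    then show ?thesis using Nd.prems(1,2) c fuel ok_Nd[OF Nd.prems(1) Nd]
      by (auto simp: prog_simps f_app_def IH callenv_app)
  qed
qed

lemma jump_ones: "ok N V ==> V 0 = t ==> sz t \<le> d ==> jump prog N d p_ones V <->
    (\<exists>k. V 0 = num k \<and> V 1 = lst (replicate k (num 1)))"
    (is "_ ==> _ ==> _ ==> ?P V d")
proof (induction t arbitrary: V d)
  case Lf
  obtain d' where [simp]: "d = Suc d'" using fuel_Suc[OF Lf(3)] by blast
  show ?case using Lf by (auto simp: prog_simps f_ones_def)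
next
  case (Nd a b)
  note c = ok_Nd[OF Nd.prems(1,2)]
  obtain d' where [simp]: "d = Suc d'" using fuel_Suc[OF Nd.prems(3)] by blast
  have IH: "\<And>V d. ok N V ==> V 0 = b ==> sz b \<le> d ==> ?P V d"
    using Nd.IH(2) .
  have fuel: "sz b \<le> d'" using Nd.prems(3) by simp
  have s: "sz a' \<le> N \<and> sz b' \<le> N" if "V 1 = Nd a' b'" for a' b' using ok_Nd[OF Nd.prems(1) that] .
  have "jump prog N d p_ones V <-> a = Lf \<and> (\<exists>b'. V 1 = Nd (num 1) b' \<and> (\<exists>k. b = num k \<and> b' = lst (replicate k (num 1))))"
    using Nd.prems(1,2) c fuel s ok_const[OF Nd.prems(1)]
    by (auto simp: prog_simps f_ones_def IH callenv_app)
  also have "\<dots> <-> (\<exists>k. V 0 = num k \<and> V 1 = lst (replicate k (num 1)))"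
  proof
    assume "a = Lf \<and> (\<exists>b'. V 1 = Nd (num 1) b' \<and> (\<exists>k. b = num k \<and> b' = lst (replicate k (num 1))))"
    then obtain k where "a = Lf" "b = num k" "V 1 = Nd (num 1) (lst (replicate k (num 1)))" by blast
    then have "V 0 = num (Suc k) \<and> V 1 = lst (replicate (Suc k) (num 1))" using Nd.prems(2) by simp
    then show "\<exists>k. V 0 = num k \<and> V 1 = lst (replicate k (num 1))" by blast
  next
    assume "\<exists>k. V 0 = num k \<and> V 1 = lst (replicate k (num 1))"
    then obtain k where "V 0 = num k" "V 1 = lst (replicate k (num 1))" by blast
    then show "a = Lf \<and> (\<exists>b'. V 1 = Nd (num 1) b' \<and> (\<exists>k. b = num k \<and> b' = lst (replicate k (num 1))))"
      using Nd.prems(2) by (cases k) auto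
  qed
  finally show ?case .
qed

lemma jump_mapcons: "ok N V ==> V 1 = t ==> sz t \<le> d ==> jump prog N d p_mapcons V <->
    els (V 2) = map (Nd (V 0)) (els (V 1))"
    (is "_ ==> _ ==> _ ==> ?P V d")
proof (induction t arbitrary: V d)
  case Lf
  obtain d' where [simp]: "d = Suc d'" using fuel_Suc[OF Lf(3)] by blast
  show ?case using Lf by (cases "V 2") (auto simp: prog_simps f_mapcons_def)
next
  case (Nd a b)
  note c = ok_Nd[OF Nd.prems(1,2)]
  obtain d' where [simp]: "d = Suc d'" using fuel_Suc[OF Nd.prems(3)] by blast
  have IH: "\<And>V d. ok N V ==> V 1 = b ==> sz b \<le> d ==> ?P V d"
    using Nd.IH(2) .
  have fuel: "sz b \<le> d'" using Nd.prems(3) by simp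
  show ?case
  proof (cases "V 2")
    case Lf
    then show ?thesis using Nd.prems(1,2) c fuel
      by (auto simp: prog_simps f_mapcons_def)
  next
    case (Nd a' b')
    then show ?thesis using Nd.prems(1,2) c fuel ok_Nd[OF Nd.prems(1) Nd]
      by (auto simp: prog_simps f_mapcons_def IH callenv_app)
  qed
qed

lemma els_eq: "els x = xs <-> x = lst xs"
  by (metis els_lst lst_els)

text \<open>No register exceeds the size \<open>N\<close>, so fuel \<open>N\<close> covers all these
  procedures uniformly.\<close>

lemma base_jumps:
  assumes "ok N V" "N \<le> d"
  shows "jump prog N d p_mem V <-> V 0 \<in> set (els (V 1))"
    and "jump prog N d p_nth V <-> length (els (V 1)) < length (els (V 0)) \<and> V 2 = els (V 0) ! length (els (V 1))"
    and "jump prog N d p_suf V <-> suffix (els (V 1)) (els (V 0))"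
    and "jump prog N d p_len V <-> V 1 = num (length (els (V 0)))"
    and "jump prog N d p_dbl V <-> (\<exists>k. V 0 = num k \<and> V 1 = num (2 * k))"
    and "jump prog N d p_app V <-> els (V 2) = els (V 0) @ els (V 1)"
    and "jump prog N d p_ones V <-> (\<exists>k. V 0 = num k \<and> V 1 = lst (replicate k (num 1)))"
    and "jump prog N d p_mapcons V <-> els (V 2) = map (Nd (V 0)) (els (V 1))"
proof -
  have fuel: "sz (V i) \<le> d" for i using okD[OF assms(1), of i] assms(2) by simp
  show "jump prog N d p_mem V <-> V 0 \<in> set (els (V 1))" by (rule jump_mem[OF assms(1) refl fuel])
  show "jump prog N d p_nth V <-> length (els (V 1)) < length (els (V 0)) \<and> V 2 = els (V 0) ! length (els (V 1))"
    by (rule jump_nth[OF assms(1) refl fuel])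
  show "jump prog N d p_suf V <-> suffix (els (V 1)) (els (V 0))" by (rule jump_suf[OF assms(1) refl fuel])
  show "jump prog N d p_len V <-> V 1 = num (length (els (V 0)))" by (rule jump_len[OF assms(1) refl fuel])
  show "jump prog N d p_dbl V <-> (\<exists>k. V 0 = num k \<and> V 1 = num (2 * k))" by (rule jump_dbl[OF assms(1) refl fuel])
  show "jump prog N d p_app V <-> els (V 2) = els (V 0) @ els (V 1)" by (rule jump_app[OF assms(1) refl fuel])
  show "jump prog N d p_ones V <-> (\<exists>k. V 0 = num k \<and> V 1 = lst (replicate k (num 1)))"
    by (rule jump_ones[OF assms(1) refl fuel])
  show "jump prog N d p_mapcons V <-> els (V 2) = map (Nd (V 0)) (els (V 1))"
    by (rule jump_mapcons[OF assms(1) refl fuel])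
qed

lemma sz_lst_append: "sz (lst xs) \<le> sz (lst (xs @ ys))" "sz (lst ys) \<le> sz (lst (xs @ ys))"
  by (induction xs) (auto simp: sz_pos intro: le_SucI)

lemma sz_lst_mono: "list_all2 (\<lambda>x y. sz x \<le> sz y) xs ys ==> sz (lst xs) \<le> sz (lst ys)"
  by (induction rule: list_all2_induct) auto

text \<open>The intermediate lists in registers 10 and 11 are quantified and hence have to fit into
  \<open>N\<close>. They do, as the result in register 2 is their concatenation.\<close>

lemma jump_concatmap: "ok N V ==> V 0 = t ==> sz t + N \<le> d ==> jump prog N d p_concatmap V <->
    els (V 2) = concat (map (\<lambda>x. map (Nd x) (els (V 1))) (els (V 0)))"
    (is "_ ==> _ ==> _ ==> ?P V d")
proof (induction t arbitrary: V d)
  case Lf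
  obtain d' where [simp]: "d = Suc d'" using Lf(3) by (cases d) auto
  show ?case using Lf(1,2) by (auto simp: prog_simps f_concatmap_def els_eq)
next
  case (Nd a b)
  note c = ok_Nd[OF Nd.prems(1,2)]
  obtain d' where [simp]: "d = Suc d'" using Nd.prems(3) by (cases d) auto
  have IH: "\<And>V d. ok N V ==> V 0 = b ==> sz b + N \<le> d ==> ?P V d"
    using Nd.IH(2) .
  have fuel: "sz b + N \<le> d'" "N \<le> d'" using Nd.prems(3) by simp_all
  let ?x = "map (Nd a) (els (V 1))" and ?y = "concat (map (\<lambda>x. map (Nd x) (els (V 1))) (els b))"
  have "jump prog N d p_concatmap V <->
      sz (lst ?x) \<le> N \<and> sz (lst ?y) \<le> N \<and> els (V 2) = ?x @ ?y"
    using Nd.prems(1,2) c fuel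
    by (auto simp: prog_simps f_concatmap_def IH base_jumps callenv_app els_eq cong: conj_cong)
  moreover have "sz (lst ?x) \<le> N \<and> sz (lst ?y) \<le> N" if "els (V 2) = ?x @ ?y"
    using okD[OF Nd.prems(1), of 2] sz_lst_append(1)[of ?x ?y] sz_lst_append(2)[of ?y ?x] that
    by (simp add: els_eq)
  ultimately show ?case using Nd.prems(2) by auto
qed

primrec cont :: "tr => tr" where
  "cont Lf = Lf"
| "cont (Nd a b) = b"

text \<open>Intermediate products have to fit into \<open>N\<close>. As no factor is empty, a copy
  of each of them, lengthened by one action, occurs in the next product, so none is larger than the
  result.\<close>

lemma jump_prod: "ok N V ==> V 0 = t ==> sz t + 2 * N \<le> d ==> (\<forall>x \<in> set (els t). cont x \<noteq> Lf) ==>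
    jump prog N d p_prod V <->
    els (V 1) = map lst (product_lists (map (\<lambda>x. els (cont x)) (els (V 0))))"
    (is "_ ==> _ ==> _ ==> _ ==> ?P V d")
proof (induction t arbitrary: V d)
  case Lf
  obtain d' where [simp]: "d = Suc d'" using Lf(3) by (cases d) auto
  show ?case using Lf(1,2) okD[of N V 1] by (auto simp: prog_simps f_prod_def els_eq)
next
  case (Nd a b)
  note c = ok_Nd[OF Nd.prems(1,2)]
  obtain d' where [simp]: "d = Suc d'" using Nd.prems(3) by (cases d) auto
  have IH: "\<And>V d. ok N V ==> V 0 = b ==> sz b + 2 * N \<le> d ==> (\<forall>x \<in> set (els b). cont x \<noteq> Lf) ==> ?P V d"
    using Nd.IH(2) .
  obtain tg xs where a: "a = Nd tg xs" "xs \<noteq> Lf" using Nd.prems(4) by (cases a) auto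
  have fuel: "sz b + 2 * N \<le> d'" "\<forall>x \<in> set (els b). cont x \<noteq> Lf" using Nd.prems(3,4) by simp_all
  have c': "sz tg \<le> N" "sz xs \<le> N" using c a by simp_all
  have fuel': "sz xs + N \<le> d'" using Nd.prems(3) c' by simp
  have concatmap: "ok N V' ==> V' 0 = xs ==> jump prog N d' p_concatmap V' <->
    els (V' 2) = concat (map (\<lambda>x. map (Nd x) (els (V' 1))) (els (V' 0)))" for V'
    using jump_concatmap[of N V' xs d'] fuel' by blast
  let ?p = "map lst (product_lists (map (\<lambda>x. els (cont x)) (els b)))"
  have "jump prog N d p_prod V <-> sz (lst ?p) \<le> N \<and> els (V 1) = concat (map (\<lambda>x. map (Nd x) ?p) (els xs))"
    using Nd.prems(1,2) c c' a fuel
    by (auto simp: prog_simps f_prod_def IH concatmap callenv_app els_eq cong: conj_cong)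
  moreover have "concat (map (\<lambda>x. map (Nd x) ?p) (els xs)) = map lst (product_lists (map (\<lambda>x. els (cont x)) (els (V 0))))"
    using Nd.prems(2) a by (simp add: map_concat comp_def)
  moreover have "sz (lst ?p) \<le> N" if "els (V 1) = concat (map (\<lambda>x. map (Nd x) ?p) (els xs))"
  proof -
    obtain x xs' where "els xs = x # xs'" using a(2) by (cases xs) auto
    then have "els (V 1) = map (Nd x) ?p @ concat (map (\<lambda>x. map (Nd x) ?p) xs')" using that by simp
    then obtain ys where ys: "els (V 1) = map (Nd x) ?p @ ys" by blast
    have "sz (lst ?p) \<le> sz (lst (map (Nd x) ?p))"
      by (rule sz_lst_mono) (simp add: list_all2_conv_all_nth)
    also have "\<dots> \<le> sz (V 1)" using ys sz_lst_append(1)[of "map (Nd x) ?p" ys] by (simp add: els_eq)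
    finally show ?thesis using okD[OF Nd.prems(1), of 1] by simp
  qed
  ultimately show ?case by metis
qed

primrec bval :: "tr list => nat" where
  "bval [] = 0"
| "bval (x # xs) = of_bool (x \<noteq> Lf) + 2 * bval xs"

primrec hdt :: "tr => tr" where
  "hdt Lf = Lf"
| "hdt (Nd a b) = a"

lemma eval_dig [simp]:
  assumes "ok N V" "x \<noteq> b" "x \<noteq> y" "b \<noteq> y"
  shows "eval N J (dig x b y \<phi>) V = eval N J \<phi> (V(b := hdt (V x), y := cont (V x)))"
proof (cases "V x")
  case Lf
  then show ?thesis using assms ok_pos[OF assms(1)] by (auto simp: dig_def)
next
  case (Nd l r)
  then show ?thesis using assms ok_Nd[OF assms(1) Nd] by (auto simp: dig_def)
qed

lemma bval_dig: "bval (els x) = of_bool (hdt x \<noteq> Lf) + 2 * bval (els (cont x))"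
  by (cases x) auto

lemma sz_hdt_cont: "sz (hdt x) \<le> sz x" "sz (cont x) \<le> sz x" "x \<noteq> Lf ==> sz (cont x) < sz x"
  by (cases x; simp)+

text \<open>The fuel counts all three numbers because any of them may be the longest; unless all are
  empty, a round makes at least one shorter.\<close>

lemma jump_add: "ok N V ==> sz (V 1) + sz (V 2) + sz (V 3) \<le> d ==> jump prog N d p_add V <->
    of_bool (V 0 \<noteq> Lf) + bval (els (V 1)) + bval (els (V 2)) = bval (els (V 3))"
proof (induction d arbitrary: V)
  case 0
  then show ?case using sz_pos[of "V 1"] by simp
next
  case (Suc d)
  let ?p = "of_bool (V 0 \<noteq> Lf) :: nat" and ?q = "of_bool (hdt (V 1) \<noteq> Lf) :: nat"
    and ?r = "of_bool (hdt (V 2) \<noteq> Lf) :: nat" and ?s = "of_bool (hdt (V 3) \<noteq> Lf) :: nat"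
  let ?x = "cont (V 1)" and ?y = "cont (V 2)" and ?z = "cont (V 3)"
  let ?par = "(hdt (V 3) \<noteq> Lf) = ((V 0 \<noteq> Lf) = ((hdt (V 1) \<noteq> Lf) = (hdt (V 2) \<noteq> Lf)))"
  let ?maj = "V 0 = Lf \<and> hdt (V 1) = Lf \<or> V 0 = Lf \<and> hdt (V 2) = Lf \<or> hdt (V 1) = Lf \<and> hdt (V 2) = Lf"
  let ?zero = "V 0 = Lf \<and> V 1 = Lf \<and> V 2 = Lf \<and> V 3 = Lf"
  have N: "sz (V i) \<le> N" "11 \<le> N" for i
    using okD[OF Suc.prems(1)] okD[OF Suc.prems(1), of 45] ok_const(6)[OF Suc.prems(1)] by (auto simp: sz_num)
  have N': "sz (hdt (V i)) \<le> N" "sz (cont (V i)) \<le> N" for i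
    using N(1)[of i] sz_hdt_cont[of "V i"] by simp_all
  have unf: "jump prog N (Suc d) p_add V <-> ?zero \<or>
      (\<exists>c. sz c \<le> N \<and> ?par \<and> ((c = Lf) = ?maj) \<and> jump prog N d p_add (callenv [14, 9, 11, 13]
        (V(8 := hdt (V 1), 9 := ?x, 10 := hdt (V 2), 11 := ?y, 12 := hdt (V 3), 13 := ?z, 14 := c))))"
    using Suc.prems(1) N N' by (simp add: prog_simps f_add_def callenv_app cong: conj_cong)
  show ?case
  proof (cases "V 1 = Lf \<and> V 2 = Lf \<and> V 3 = Lf")
    case True
    then show ?thesis unfolding unf by auto
  next
    case False
    then have fuel: "sz ?x + sz ?y + sz ?z \<le> d"
      using Suc.prems(2) sz_hdt_cont[of "V 1"] sz_hdt_cont[of "V 2"] sz_hdt_cont[of "V 3"] by auto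
    define p q r s where "p = (V 0 \<noteq> Lf)" and "q = (hdt (V 1) \<noteq> Lf)" and "r = (hdt (V 2) \<noteq> Lf)"
      and "s = (hdt (V 3) \<noteq> Lf)"
    define x y z where "x = bval (els ?x)" and "y = bval (els ?y)" and "z = bval (els ?z)"
    define maj where "maj = ?maj"
    define par where "par = ?par"
    have "jump prog N (Suc d) p_add V <->
        (\<exists>c. sz c \<le> N \<and> par \<and> ((c = Lf) = maj) \<and> of_bool (c \<noteq> Lf) + x + y = z)"
    proof -
      have "jump prog N d p_add (callenv [14, 9, 11, 13]
          (V(8 := hdt (V 1), 9 := ?x, 10 := hdt (V 2), 11 := ?y, 12 := hdt (V 3), 13 := ?z, 14 := c))) <->
          of_bool (c \<noteq> Lf) + x + y = z" if "sz c \<le> N" for c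
        using Suc.prems(1) N N' fuel that
        by (subst Suc.IH) (simp_all add: callenv_app x_def y_def z_def)
      moreover have "\<not> ?zero" using False by blast
      ultimately show ?thesis unfolding unf maj_def par_def by blast
    qed
    also have "\<dots> <-> par \<and> of_bool (\<not> maj) + x + y = z"
    proof
      assume "\<exists>c. sz c \<le> N \<and> par \<and> ((c = Lf) = maj) \<and> of_bool (c \<noteq> Lf) + x + y = z"
      then show "par \<and> of_bool (\<not> maj) + x + y = z" by (elim exE conjE) (simp split: if_splits)
    next
      assume a: "par \<and> of_bool (\<not> maj) + x + y = z"
      have "sz (if maj then Lf else Nd Lf Lf) \<le> N" using N(2) by simp
      then show "\<exists>c. sz c \<le> N \<and> par \<and> ((c = Lf) = maj) \<and> of_bool (c \<noteq> Lf) + x + y = z"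
        using a by (intro exI[of _ "if maj then Lf else Nd Lf Lf"]) (cases maj; simp)
    qed
    also have "\<dots> <-> of_bool p + (of_bool q + 2 * x) + (of_bool r + 2 * y) = of_bool s + 2 * z"
    proof -
      have "par <-> s = (p = (q = r))" "maj <-> \<not> p \<and> \<not> q \<or> \<not> p \<and> \<not> r \<or> \<not> q \<and> \<not> r"
        by (simp_all add: par_def maj_def p_def q_def r_def s_def)
      then show ?thesis by (cases p; cases q; cases r; cases s; simp; presburger)
    qed
    also have "\<dots> <-> of_bool (V 0 \<noteq> Lf) + bval (els (V 1)) + bval (els (V 2)) = bval (els (V 3))"
      unfolding bval_dig[of "V 1"] bval_dig[of "V 2"] bval_dig[of "V 3"]
      by (simp only: p_def q_def r_def s_def x_def y_def z_def)
    finally show ?thesis .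
  qed
qed

lemma bits_0 [simp]: "bits 0 = []"
  by (simp add: bits.simps)

lemma bits_eq_Nil [simp]: "bits k = [] <-> k = 0"
  by (subst bits.simps) simp

lemma bits_pos: "0 < k ==> bits k = (if odd k then One else Zero) # bits (k div 2)"
  by (subst bits.simps) simp

lemma bits_double: "bits (2 * k) = (if k = 0 then [] else Zero # bits k)" "bits (2 * k + 1) = One # bits k"
  using bits_pos[of "2 * k"] bits_pos[of "2 * k + 1"] by simp_all

lemma bits_Cons: "x # xs = map sc (bits k) <-> k \<noteq> 0 \<and> xs = map sc (bits (k div 2)) \<and> x = (if odd k then num 1 else Lf)"
  using bits_pos[of k] by (cases "k = 0") auto

lemma sz_3: "ok N V ==> 11 \<le> N"
  using okD[of N V 45] ok_const(6)[of N V] by (simp add: sz_num)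

lemma jump_canon: "ok N V ==> V 0 = t ==> sz t \<le> d ==> jump prog N d p_canon V <-> (\<exists>k. V 0 = lst (map sc (bits k)))"
    (is "_ ==> _ ==> _ ==> ?P V d")
proof (induction t arbitrary: V d)
  case Lf
  obtain d' where [simp]: "d = Suc d'" using fuel_Suc[OF Lf(3)] by blast
  show ?case using Lf(1,2) by (auto simp: prog_simps f_canon_def intro: exI[of _ 0])
next
  case (Nd a b)
  note c = ok_Nd[OF Nd.prems(1,2)]
  obtain d' where [simp]: "d = Suc d'" using fuel_Suc[OF Nd.prems(3)] by blast
  have IH: "\<And>V d. ok N V ==> V 0 = b ==> sz b \<le> d ==> ?P V d"
    using Nd.IH(2) .
  have fuel: "sz b \<le> d'" using Nd.prems(3) by simp
  have "jump prog N d p_canon V <-> a = num 1 \<and> b = Lf \<or> (a = Lf \<or> a = num 1) \<and> b \<noteq> Lf \<and> (\<exists>k. b = lst (map sc (bits k)))"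
    using Nd.prems(1,2) c fuel ok_const[OF Nd.prems(1)]
    by (auto simp: prog_simps f_canon_def IH callenv_app)
  also have "\<dots> <-> (\<exists>k. a # els b = map sc (bits k))"
  proof
    assume "a = num 1 \<and> b = Lf \<or> (a = Lf \<or> a = num 1) \<and> b \<noteq> Lf \<and> (\<exists>k. b = lst (map sc (bits k)))"
    then consider "a = num 1" "b = Lf" | k where "a = Lf" "b = lst (map sc (bits k))" "k \<noteq> 0"
      | k where "a = num 1" "b = lst (map sc (bits k))" by fastforce
    then show "\<exists>k. a # els b = map sc (bits k)"
    proof cases
      case 1
      then show ?thesis using bits_double(2)[of 0] by (intro exI[of _ 1]) simp
    next
      case (2 k)
      then show ?thesis using bits_double(1)[of k] by (intro exI[of _ "2 * k"]) simp
    next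
      case (3 k)
      then show ?thesis using bits_double(2)[of k] by (intro exI[of _ "2 * k + 1"]) simp
    qed
  next
    assume "\<exists>k. a # els b = map sc (bits k)"
    then obtain k where k: "k \<noteq> 0" "els b = map sc (bits (k div 2))" "a = (if odd k then num 1 else Lf)"
      by (auto simp: bits_Cons)
    then have "b = lst (map sc (bits (k div 2)))" by (simp add: els_eq)
    moreover have "odd k" if "b = Lf"
    proof -
      have "k div 2 = 0" using that calculation by simp
      then show ?thesis using k(1) by presburger
    qed
    ultimately show "a = num 1 \<and> b = Lf \<or> (a = Lf \<or> a = num 1) \<and> b \<noteq> Lf \<and> (\<exists>k. b = lst (map sc (bits k)))"
      using k(3) by (cases "odd k") auto
  qed
  also have "\<dots> <-> (\<exists>k. V 0 = lst (map sc (bits k)))"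
    using Nd.prems(2) by (metis els.simps(2) els_eq)
  finally show ?case .
qed

lemma jump_bits: "ok N V ==> V 1 = t ==> sz t + N \<le> d ==> jump prog N d p_bits V <->
    (\<exists>k. V 0 = num k \<and> V 1 = lst (map sc (bits k)))"
    (is "_ ==> _ ==> _ ==> ?P V d")
proof (induction t arbitrary: V d)
  case Lf
  obtain d' where [simp]: "d = Suc d'" using Lf(3) by (cases d) auto
  show ?case using Lf(1,2) by (auto simp: prog_simps f_bits_def)
next
  case (Nd a b)
  note c = ok_Nd[OF Nd.prems(1,2)]
  obtain d' where [simp]: "d = Suc d'" using Nd.prems(3) by (cases d) auto
  have IH: "\<And>V d. ok N V ==> V 1 = b ==> sz b + N \<le> d ==> ?P V d"
    using Nd.IH(2) .
  have fuel: "sz b + N \<le> d'" "N \<le> d'" using Nd.prems(3) by simp_all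
  have "jump prog N d p_bits V <-> V 0 \<noteq> Lf \<and> (\<exists>x y. sz x \<le> N \<and> sz y \<le> N \<and>
      (\<exists>k. x = num k \<and> y = num (2 * k)) \<and> (a = Lf \<and> V 0 = y \<or> a = num 1 \<and> V 0 = Nd Lf y) \<and>
      (\<exists>k. x = num k \<and> b = lst (map sc (bits k))))"
  proof -
    have Nd0: "(\<exists>u. sz u \<le> N \<and> (\<exists>v. sz v \<le> N \<and> V 0 = Nd u v \<and> u = Lf \<and> v = y)) <-> V 0 = Nd Lf y" for y
      using okD[OF Nd.prems(1), of 0] sz_3[OF Nd.prems(1)] by auto
    show ?thesis
      using Nd.prems(1,2) c fuel ok_const[OF Nd.prems(1)] okD[OF Nd.prems(1), of 0] sz_3[OF Nd.prems(1)]
      by (simp add: prog_simps f_bits_def IH base_jumps callenv_app Nd0 cong: conj_cong)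
  qed
  also have "\<dots> <-> (\<exists>k. V 0 = num k \<and> a # els b = map sc (bits k))"
  proof
    assume "V 0 \<noteq> Lf \<and> (\<exists>x y. sz x \<le> N \<and> sz y \<le> N \<and>
      (\<exists>k. x = num k \<and> y = num (2 * k)) \<and> (a = Lf \<and> V 0 = y \<or> a = num 1 \<and> V 0 = Nd Lf y) \<and>
      (\<exists>k. x = num k \<and> b = lst (map sc (bits k))))"
    then obtain k where k: "V 0 \<noteq> Lf" "a = Lf \<and> V 0 = num (2 * k) \<or> a = num 1 \<and> V 0 = Nd Lf (num (2 * k))"
      "b = lst (map sc (bits k))" by auto
    show "\<exists>k. V 0 = num k \<and> a # els b = map sc (bits k)"
    proof (cases "a = Lf")
      case True
      then show ?thesis using k bits_double(1)[of k] by (intro exI[of _ "2 * k"]) auto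
    next
      case False
      then show ?thesis using k bits_double(2)[of k] by (intro exI[of _ "2 * k + 1"]) auto
    qed
  next
    assume "\<exists>k. V 0 = num k \<and> a # els b = map sc (bits k)"
    then obtain k where k: "V 0 = num k" "k \<noteq> 0" "els b = map sc (bits (k div 2))" "a = (if odd k then num 1 else Lf)"
      by (auto simp: bits_Cons)
    have "sz (num k) \<le> N" using okD[OF Nd.prems(1), of 0] k(1) by simp
    then have "sz (num (k div 2)) \<le> N" "sz (num (2 * (k div 2))) \<le> N" by (auto simp: sz_num)
    moreover have "a = Lf \<and> V 0 = num (2 * (k div 2)) \<or> a = num 1 \<and> V 0 = Nd Lf (num (2 * (k div 2)))"
    proof (cases "odd k")
      case True
      then have "k = 2 * (k div 2) + 1" by presburger
      then have "num k = Nd Lf (num (2 * (k div 2)))" using num_Suc1[of "2 * (k div 2)"] by (simp only:)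
      then show ?thesis using k(1,4) True by simp
    next
      case False
      then show ?thesis using k(1,4) by simp
    qed
    moreover have "b = lst (map sc (bits (k div 2)))" using k(3) by (simp only: els_eq)
    moreover have "V 0 \<noteq> Lf" using k(1,2) by simp
    ultimately show "V 0 \<noteq> Lf \<and> (\<exists>x y. sz x \<le> N \<and> sz y \<le> N \<and>
      (\<exists>k. x = num k \<and> y = num (2 * k)) \<and> (a = Lf \<and> V 0 = y \<or> a = num 1 \<and> V 0 = Nd Lf y) \<and>
      (\<exists>k. x = num k \<and> b = lst (map sc (bits k))))"
      by blast
  qed
  also have "\<dots> <-> (\<exists>k. V 0 = num k \<and> V 1 = lst (map sc (bits k)))"
    using Nd.prems(2) by (metis els.simps(2) els_eq)
  finally show ?case .
qed

section \<open>Inputs as trees\<close>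

text \<open>Typed inputs: unlike \<open>input\<close>, this distinguishes indices from costs.\<close>

datatype tin = TN nat | TI int | TU nat | TL "tin list"

text \<open>Indices become lists of leaves: they are bounded by the lengths of tables and thus stay
  small. Costs are in binary because they are so in the input, endowments because they can grow
  exponentially along a computation, although the input has them in unary.\<close>

primrec tt :: "tin => tr" where
  "tt (TN k) = Nd (num 0) (num k)"
| "tt (TI z) = Nd (num 1) (Nd (if z < 0 then num 1 else num 0) (lst (map sc (bits (nat \<bar>z\<bar>)))))"
| "tt (TU k) = Nd (num 2) (lst (map sc (bits k)))"
| "tt (TL xs) = Nd (num 3) (lst (map tt xs))"

primrec erase :: "tin => input" where
  "erase (TN k) = Bin (int k)"
| "erase (TI z) = Bin z"
| "erase (TU k) = Unary k"
| "erase (TL xs) = Lst (map erase xs)"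

lemma sc_inj [simp]: "sc a = sc b <-> a = b"
  by (cases a; cases b) (simp_all add: num_eq_iff del: num.simps num_1)

lemma map_sc_inj [simp]: "map sc xs = map sc ys <-> xs = ys"
  by (rule inj_map_eq_map) (simp add: inj_def)

lemma bits_inj [simp]: "bits a = bits b <-> a = b"
proof (induction a arbitrary: b rule: less_induct)
  case (less a)
  show ?case
  proof (cases "a = 0 \<or> b = 0")
    case True
    then show ?thesis by (metis bits_0 bits_eq_Nil)
  next
    case False
    then have "bits a = bits b <-> odd a = odd b \<and> a div 2 = b div 2"
      using less[of "a div 2" "b div 2"] bits_pos[of a] bits_pos[of b] by auto
    also have "\<dots> <-> a = b" by presburger
    finally show ?thesis .
  qed
qed

lemma tt_inj [simp]: "tt x = tt y <-> x = y"
proof (induction x arbitrary: y)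
  case (TN k)
  show ?case by (cases y) (simp_all add: num_numeral)
next
  case (TI z)
  show ?case by (cases y) (auto simp: num_numeral nat_eq_iff)
next
  case (TU k)
  show ?case by (cases y) (auto simp: num_numeral)
next
  case (TL xs)
  show ?case
  proof (cases y)
    case (TL ys)
    have "map tt xs = map tt ys <-> xs = ys"
      using TL.IH by (induction xs arbitrary: ys) (auto simp: Cons_eq_map_conv)
    then show ?thesis using TL by simp
  qed (simp_all add: num_numeral)
qed

definition consw :: "sym list => tr => tr" where
  "consw w r = lst (map sc w @ els r)"

lemma els_consw: "els (consw w r) = map sc w @ els r"
  by (simp add: consw_def)

lemma consw_simps [simp]: "consw [] r = r" "consw (s # w) r = Nd (sc s) (consw w r)"
  "consw (u @ v) r = consw u (consw v r)"
  by (simp_all add: consw_def)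

lemma sz_consw: "sz r \<le> sz (consw w r)"
  by (induction w) auto

lemma sz_consw': "sz (lst (map sc w)) \<le> sz (consw w r)"
  using sz_lst_append(1)[of "map sc w" "els r"] by (simp add: consw_def)

definition serb_ok :: "tr => tr => tr => bool" where
  "serb_ok b w r <-> els w = els b @ sc Comma # els r"

lemma eval_serb:
  assumes "ok N V" "N \<le> d" "b < 15" "w < 15" "r < 15"
  shows "eval N (jump prog N d) (serb b w r) V <-> serb_ok (V b) (V w) (V r)"
proof -
  have "sz (Nd (num 3) (V r)) \<le> N" if "serb_ok (V b) (V w) (V r)"
  proof -
    have "sz (lst (sc Comma # els (V r))) \<le> sz (lst (els (V w)))"
      using that unfolding serb_ok_def by (simp only: sz_lst_append)
    then show ?thesis using okD[OF assms(1), of w] by simp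
  qed
  then show ?thesis
    using assms ok_const[OF assms(1)]
    by (auto simp: serb_def base_jumps callenv_app serb_ok_def simp del: sz_simps)
qed

lemma serb_ok_bits: "serb_ok (lst (map sc u)) w r <-> w = consw (u @ [Comma]) r"
  by (simp add: serb_ok_def consw_def els_eq)

definition ser_ok :: "tr => tr => tr => bool" where
  "ser_ok t w r <-> (\<exists>x. t = tt x \<and> w = consw (serialize (erase x)) r)"

definition serl_ok :: "tr => tr => tr => bool" where
  "serl_ok l w r <-> (\<exists>xs. l = lst (map tt xs) \<and> w = consw (concat (map (\<lambda>x. serialize (erase x)) xs)) r)"

lemma serl_ok_simps:
  "serl_ok Lf w r <-> w = r"
  "serl_ok (Nd a b) w r <-> (\<exists>m. ser_ok a w m \<and> serl_ok b m r)"
proof -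
  show "serl_ok Lf w r <-> w = r" by (auto simp: serl_ok_def)
  show "serl_ok (Nd a b) w r <-> (\<exists>m. ser_ok a w m \<and> serl_ok b m r)"
  proof
    assume "serl_ok (Nd a b) w r"
    then obtain x xs where "a = tt x" "b = lst (map tt xs)"
      "w = consw (concat (map (\<lambda>x. serialize (erase x)) (x # xs))) r"
      by (force simp: serl_ok_def Cons_eq_map_conv dest!: sym[of "Nd a b"])
    then show "\<exists>m. ser_ok a w m \<and> serl_ok b m r"
      by (auto simp: serl_ok_def ser_ok_def)
  next
    assume "\<exists>m. ser_ok a w m \<and> serl_ok b m r"
    then obtain x xs where "a = tt x" "b = lst (map tt xs)"
      "w = consw (serialize (erase x)) (consw (concat (map (\<lambda>x. serialize (erase x)) xs)) r)"
      by (auto simp: serl_ok_def ser_ok_def)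
    then show "serl_ok (Nd a b) w r"
      unfolding serl_ok_def by (intro exI[of _ "x # xs"]) simp
  qed
qed

lemma serl_ok_sz: "ser_ok a w m ==> sz m \<le> sz w"
  by (auto simp: ser_ok_def sz_consw)

text \<open>Inversion by the tag, with one disjunct for each case of \<open>f_ser\<close>.\<close>

lemma ser_ok_Nd: "ser_ok (Nd a b) w r <->
    a = num 0 \<and> (\<exists>k. b = num k \<and> w = consw (bits k @ [Comma]) r) \<or>
    a = num 1 \<and> (\<exists>s k. b = Nd s (lst (map sc (bits k))) \<and>
      (s = num 0 \<and> w = consw (bits k @ [Comma]) r \<or> s = num 1 \<and> k \<noteq> 0 \<and> w = consw (Minus # bits k @ [Comma]) r)) \<or>
    a = num 2 \<and> (\<exists>k. b = lst (map sc (bits k)) \<and> w = consw (replicate k One @ [Comma]) r) \<or>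
    a = num 3 \<and> (\<exists>w'. w = Nd (sc Open) w' \<and> serl_ok b w' (Nd (sc Close) r))"
    (is "_ <-> ?R")
proof
  assume "ser_ok (Nd a b) w r"
  then obtain x where x: "Nd a b = tt x" "w = consw (serialize (erase x)) r" by (auto simp: ser_ok_def)
  show ?R
  proof (cases x)
    case (TN k)
    then show ?thesis using x by simp
  next
    case (TI z)
    then show ?thesis using x
      by (intro disjI2[OF disjI1] conjI exI[of _ "if z < 0 then num 1 else num 0"] exI[of _ "nat \<bar>z\<bar>"]) auto
  next
    case (TU k)
    then show ?thesis using x by auto
  next
    case (TL xs)
    have "serl_ok b (consw (concat (map (\<lambda>x. serialize (erase x)) xs) @ [Close]) r) (Nd (sc Close) r)"
      using x TL by (auto simp: serl_ok_def)
    then show ?thesis using x TL by (simp add: comp_def)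
  qed
next
  assume ?R
  then consider k where "a = num 0" "b = num k" "w = consw (bits k @ [Comma]) r"
    | k where "a = num 1" "b = Nd (num 0) (lst (map sc (bits k)))" "w = consw (bits k @ [Comma]) r"
    | k where "a = num 1" "b = Nd (num 1) (lst (map sc (bits k)))" "k \<noteq> 0" "w = consw (Minus # bits k @ [Comma]) r"
    | k where "a = num 2" "b = lst (map sc (bits k))" "w = consw (replicate k One @ [Comma]) r"
    | w' where "a = num 3" "w = Nd (sc Open) w'" "serl_ok b w' (Nd (sc Close) r)" by blast
  then show "ser_ok (Nd a b) w r"
  proof cases
    case (1 k)
    then show ?thesis unfolding ser_ok_def by (intro exI[of _ "TN k"]) simp
  next
    case (2 k)
    then show ?thesis unfolding ser_ok_def by (intro exI[of _ "TI (int k)"]) simp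
  next
    case (3 k)
    then show ?thesis unfolding ser_ok_def by (intro exI[of _ "TI (- int k)"]) simp
  next
    case (4 k)
    then show ?thesis unfolding ser_ok_def by (intro exI[of _ "TU k"]) simp
  next
    case (5 w')
    then obtain xs where "b = lst (map tt xs)" "w' = consw (concat (map (\<lambda>x. serialize (erase x)) xs)) (Nd (sc Close) r)"
      by (auto simp: serl_ok_def)
    then show ?thesis using 5 unfolding ser_ok_def by (intro exI[of _ "TL xs"]) (simp add: comp_def)
  qed
qed

lemma bits_canon_N:
  assumes "ok N V" "2 * N \<le> d"
  shows "jump prog N d p_bits V <-> (\<exists>k. V 0 = num k \<and> V 1 = lst (map sc (bits k)))"
    and "jump prog N d p_canon V <-> (\<exists>k. V 0 = lst (map sc (bits k)))"
proof -
  have fuel: "sz (V 1) + N \<le> d" "sz (V 0) \<le> d" using okD[OF assms(1), of 1] okD[OF assms(1), of 0] assms(2) by simp_all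
  show "jump prog N d p_bits V <-> (\<exists>k. V 0 = num k \<and> V 1 = lst (map sc (bits k)))"
    by (rule jump_bits[OF assms(1) refl fuel(1)])
  show "jump prog N d p_canon V <-> (\<exists>k. V 0 = lst (map sc (bits k)))"
    by (rule jump_canon[OF assms(1) refl fuel(2)])
qed

lemma map_sc_ones: "lst (replicate k (num 1)) = lst (map sc (replicate k One))"
  by (simp only: map_replicate sc.simps)

lemma ser_ok_Lf [simp]: "\<not> ser_ok Lf w r"
proof -
  have "tt x \<noteq> Lf" for x by (cases x) simp_all
  then show ?thesis unfolding ser_ok_def by metis
qed

lemma sz_consw_N:
  assumes "ok N V" "V i = consw (u @ [Comma]) r"
  shows "sz (lst (map sc u)) \<le> N"
  using okD[OF assms(1), of i] sz_consw'[of u "consw [Comma] r"] assms(2) by simp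

lemma eval_ser_num:
  assumes ok: "ok N V" and fuel: "2 * N \<le> d"
  shows "eval N (jump prog N d) (FEx 10 (FAnd (call p_bits [9, 10]) (serb 10 1 2))) V <->
        (\<exists>k. V 9 = num k \<and> V 1 = consw (bits k @ [Comma]) (V 2))"
proof -
  have "N \<le> d" using fuel by simp
  then have "eval N (jump prog N d) (FEx 10 (FAnd (call p_bits [9, 10]) (serb 10 1 2))) V <->
      (\<exists>x. sz x \<le> N \<and> (\<exists>k. V 9 = num k \<and> x = lst (map sc (bits k))) \<and> serb_ok x (V 1) (V 2))"
    using ok fuel by (simp add: bits_canon_N eval_serb callenv_app cong: conj_cong)
  also have "\<dots> <-> (\<exists>k. sz (lst (map sc (bits k))) \<le> N \<and> V 9 = num k \<and> V 1 = consw (bits k @ [Comma]) (V 2))"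
    using serb_ok_bits by blast
  also have "\<dots> <-> (\<exists>k. V 9 = num k \<and> V 1 = consw (bits k @ [Comma]) (V 2))"
    using sz_consw_N[OF ok] by blast
  finally show ?thesis .
qed

lemma eval_ser_int:
  assumes ok: "ok N V" and fuel: "2 * N \<le> d"
  shows "eval N (jump prog N d) (Mat 9 10 11 (FAnd (call p_canon [11])
         (FOr (FAnd (FEq 10 40) (serb 11 1 2))
              (FAnd (FEq 10 41) (FAnd (FNot (FL 11)) (Mat 1 12 13 (FAnd (FEq 12 42) (serb 11 13 2)))))))) V <->
        (\<exists>s k. V 9 = Nd s (lst (map sc (bits k))) \<and>
          (s = num 0 \<and> V 1 = consw (bits k @ [Comma]) (V 2) \<or>
           s = num 1 \<and> k \<noteq> 0 \<and> V 1 = consw (Minus # bits k @ [Comma]) (V 2)))"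
    proof -
      have "N \<le> d" using fuel by simp
      have w1: "sz u \<le> N \<and> sz v \<le> N" if "V 1 = Nd u v" for u v using ok_Nd[OF ok that] .
      have "eval N (jump prog N d) (Mat 9 10 11 (FAnd (call p_canon [11])
         (FOr (FAnd (FEq 10 40) (serb 11 1 2))
              (FAnd (FEq 10 41) (FAnd (FNot (FL 11)) (Mat 1 12 13 (FAnd (FEq 12 42) (serb 11 13 2)))))))) V <->
        (\<exists>s k. V 9 = Nd s (lst (map sc (bits k))) \<and>
          (s = num 0 \<and> serb_ok (lst (map sc (bits k))) (V 1) (V 2) \<or>
           s = num 1 \<and> k \<noteq> 0 \<and> (\<exists>v. V 1 = Nd (num 2) v \<and> serb_ok (lst (map sc (bits k))) v (V 2))))"
        using ok fuel \<open>N \<le> d\<close> w1 ok_const[OF ok] sz_3[OF ok] ok_Nd[OF ok, of 9]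
        by (auto simp: bits_canon_N eval_serb callenv_app cong: conj_cong)
      also have "\<dots> <-> (\<exists>s k. V 9 = Nd s (lst (map sc (bits k))) \<and>
          (s = num 0 \<and> V 1 = consw (bits k @ [Comma]) (V 2) \<or>
           s = num 1 \<and> k \<noteq> 0 \<and> V 1 = consw (Minus # bits k @ [Comma]) (V 2)))"
        unfolding serb_ok_bits by (simp only: consw_simps sc.simps) blast
      finally show ?thesis .
    qed

lemma eval_ser_un:
  assumes ok: "ok N V" and fuel: "2 * N \<le> d"
  shows "eval N (jump prog N d) (FEx 10 (FEx 11
         (FAnd (call p_bits [10, 9]) (FAnd (call p_ones [10, 11]) (serb 11 1 2))))) V <->
        (\<exists>k. V 9 = lst (map sc (bits k)) \<and> V 1 = consw (replicate k One @ [Comma]) (V 2))"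
    (is "eval _ _ ?\<phi> _ <-> _")
proof -
  have "N \<le> d" using fuel by simp
  then have "eval N (jump prog N d) ?\<phi> V <->
      (\<exists>x. sz x \<le> N \<and> (\<exists>y. sz y \<le> N \<and> (\<exists>k. x = num k \<and> V 9 = lst (map sc (bits k))) \<and>
         (\<exists>k. x = num k \<and> y = lst (replicate k (num 1))) \<and> serb_ok y (V 1) (V 2)))"
    using ok fuel by (simp add: bits_canon_N base_jumps eval_serb callenv_app cong: conj_cong del: num_1)
  also have "\<dots> <-> (\<exists>k. V 9 = lst (map sc (bits k)) \<and> V 1 = consw (replicate k One @ [Comma]) (V 2))"
    (is "_ <-> ?R")
  proof
    assume ?R
    then obtain k where k: "V 9 = lst (map sc (bits k))" "V 1 = consw (replicate k One @ [Comma]) (V 2)" by blast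
    \<comment> \<open>Register 10 holds \<open>k\<close> as a list of leaves. It fits into
      \<open>N\<close> because the word spells out \<open>k\<close> ones: here the parser relies on
      the unary notation of endowments.\<close>
    have "sz (num k) \<le> sz (lst (map sc (replicate k One)))" by (induction k) auto
    moreover have "sz (lst (map sc (replicate k One))) \<le> N" by (rule sz_consw_N[OF ok k(2)])
    moreover have "serb_ok (lst (map sc (replicate k One))) (V 1) (V 2)" using k(2) unfolding serb_ok_bits .
    ultimately show "\<exists>x. sz x \<le> N \<and> (\<exists>y. sz y \<le> N \<and> (\<exists>k. x = num k \<and> V 9 = lst (map sc (bits k))) \<and>
         (\<exists>k. x = num k \<and> y = lst (replicate k (num 1))) \<and> serb_ok y (V 1) (V 2))"
      using k(1) map_sc_ones[of k]
      by (intro exI[of _ "num k"] exI[of _ "lst (map sc (replicate k One))"] conjI exI[of _ k]) auto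
  next
    assume "\<exists>x. sz x \<le> N \<and> (\<exists>y. sz y \<le> N \<and> (\<exists>k. x = num k \<and> V 9 = lst (map sc (bits k))) \<and>
         (\<exists>k. x = num k \<and> y = lst (replicate k (num 1))) \<and> serb_ok y (V 1) (V 2))"
    then obtain k where "V 9 = lst (map sc (bits k))" "serb_ok (lst (replicate k (num 1))) (V 1) (V 2)"
      by (auto simp: num_eq_iff)
    then show ?R unfolding map_sc_ones serb_ok_bits by blast
  qed
  finally show ?thesis .
qed

lemma eval_ser_lst:
  assumes ok: "ok N V" and fuel: "2 * sz (V 9) + 1 + 3 * N \<le> d"
    and IHl: "\<And>V' d. ok N V' ==> V' 0 = V 9 ==> 2 * sz (V 9) + 1 + 3 * N \<le> d ==> jump prog N d p_serl V' <-> serl_ok (V' 0) (V' 1) (V' 2)"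
  shows "eval N (jump prog N d) (Mat 1 10 11 (FAnd (FEq 10 44) (FMk 12 45 2 (call p_serl [9, 11, 12])))) V <->
        (\<exists>w'. V 1 = Nd (sc Open) w' \<and> serl_ok (V 9) w' (Nd (sc Close) (V 2)))"
    proof -
      have w1: "sz u \<le> N \<and> sz v \<le> N" if "V 1 = Nd u v" for u v using ok_Nd[OF ok that] .
      have "eval N (jump prog N d) (Mat 1 10 11 (FAnd (FEq 10 44) (FMk 12 45 2 (call p_serl [9, 11, 12])))) V <->
        (\<exists>w'. V 1 = Nd (num 4) w' \<and> sz (Nd (num 5) (V 2)) \<le> N \<and> serl_ok (V 9) w' (Nd (num 5) (V 2)))"
        using ok fuel w1 ok_const[OF ok]
        by (auto simp: IHl callenv_app simp del: sz_simps num_1 num_numeral cong: conj_cong)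
      moreover have "sz (Nd (num 5) (V 2)) \<le> N" if "V 1 = Nd (num 4) w'" "serl_ok (V 9) w' (Nd (num 5) (V 2))" for w'
        using that w1[OF that(1)] unfolding serl_ok_def by (metis order_trans sz_consw)
      ultimately show ?thesis by (simp only: sc.simps) blast
    qed

text \<open>The two procedures call each other, hence a single induction. The summand
  \<open>3 * N\<close> is left over for the procedures on numbers.\<close>

lemma jump_ser_serl:
  "ok N V ==> V 0 = t ==> 2 * sz t + 3 * N \<le> d ==> jump prog N d p_ser V <-> ser_ok (V 0) (V 1) (V 2)"
  "ok N V ==> V 0 = t ==> 2 * sz t + 1 + 3 * N \<le> d ==> jump prog N d p_serl V <-> serl_ok (V 0) (V 1) (V 2)"
proof (induction t arbitrary: V d)
  case Lf
  {
    case 1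
    obtain d' where [simp]: "d = Suc d'" using 1(3) by (cases d) auto
    show ?case using 1(1,2) by (simp add: prog_simps f_ser_def)
  next
    case 2
    obtain d' where [simp]: "d = Suc d'" using 2(3) by (cases d) auto
    show ?case using 2(1,2) by (auto simp: prog_simps f_serl_def serl_ok_simps)
  }
next
  case (Nd a b)
  have IH: "\<And>V d. ok N V ==> V 0 = a ==> 2 * sz a + 3 * N \<le> d ==> jump prog N d p_ser V <-> ser_ok (V 0) (V 1) (V 2)"
    using Nd.IH(1) .
  have IHl: "\<And>V d. ok N V ==> V 0 = b ==> 2 * sz b + 1 + 3 * N \<le> d ==> jump prog N d p_serl V <-> serl_ok (V 0) (V 1) (V 2)"
    using Nd.IH(4) .
  {
    case 1
    note ok = 1(1)
    note c = ok_Nd[OF 1(1,2)]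
    obtain d' where [simp]: "d = Suc d'" using 1(3) by (cases d) auto
    let ?V = "V(8 := a, 9 := b)"
    have ok': "ok N ?V" using ok c by simp
    have fuel: "2 * N \<le> d'" "2 * sz (?V 9) + 1 + 3 * N \<le> d'" using 1(3) by simp_all
    have l: "eval N (jump prog N d') (Mat 1 10 11 (FAnd (FEq 10 44) (FMk 12 45 2 (call p_serl [9, 11, 12])))) ?V <->
        (\<exists>w'. ?V 1 = Nd (sc Open) w' \<and> serl_ok (?V 9) w' (Nd (sc Close) (?V 2)))"
      by (rule eval_ser_lst[OF ok' fuel(2)]) (simp only: IHl fun_upd_same)
    have "jump prog N d p_ser V <-> eval N (jump prog N d') f_ser V" by (simp add: prog_simps)
    also have "\<dots> <-> ser_ok (Nd a b) (V 1) (V 2)"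
    proof -
      have mat: "eval N J (Mat 0 8 9 \<phi>) V <-> eval N J \<phi> ?V" for J \<phi>
        using okD[OF ok, of 0] 1(2) by (simp add: eval_Mat_sz)
      have or: "eval N J (FOr \<phi> \<psi>) ?V <-> eval N J \<phi> ?V \<or> eval N J \<psi> ?V" for J \<phi> \<psi> by simp
      have eq: "eval N J (FEq 8 40) ?V <-> a = num 0" "eval N J (FEq 8 41) ?V <-> a = num 1"
        "eval N J (FEq 8 42) ?V <-> a = num 2" "eval N J (FEq 8 43) ?V <-> a = num 3" for J
        using ok_const[OF ok] by simp_all
      have upd: "?V 9 = b" "?V 1 = V 1" "?V 2 = V 2" by simp_all
      show ?thesis
        unfolding f_ser_def ser_ok_Nd mat or eval_FAnd eq eval_ser_num[OF ok' fuel(1)] eval_ser_int[OF ok' fuel(1)]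
          eval_ser_un[OF ok' fuel(1)] l upd ..
    qed
    finally show ?case using 1(2) by simp
  next
    case 2
    note ok = 2(1)
    note c = ok_Nd[OF 2(1,2)]
    obtain d' where [simp]: "d = Suc d'" using 2(3) by (cases d) auto
    have fuel: "2 * sz b + 1 + 3 * N \<le> d'" "2 * sz a + 3 * N \<le> d'" using 2(3) by simp_all
    have "jump prog N d p_serl V <-> (\<exists>m. sz m \<le> N \<and> ser_ok a (V 1) m \<and> serl_ok b m (V 2))"
      using 2(1,2) c fuel by (auto simp: prog_simps f_serl_def IH IHl callenv_app cong: conj_cong)
    also have "\<dots> <-> serl_ok (Nd a b) (V 1) (V 2)"
      unfolding serl_ok_simps using serl_ok_sz okD[OF ok, of 1] by (meson order_trans)
    finally show ?case using 2(2) by simp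
  }
qed

section \<open>Well-formed inputs\<close>

text \<open>
  The following rules compute the truth value of a formula from outside to inside, leaving it as
  a schematic variable.
\<close>

lemma ev_and: "eval N J \<phi> V = P ==> (P ==> eval N J \<psi> V = Q) ==> eval N J (FAnd \<phi> \<psi>) V = (P \<and> Q)"
  by auto

lemma ev_or: "eval N J \<phi> V = P ==> eval N J \<psi> V = Q ==> eval N J (FOr \<phi> \<psi>) V = (P \<or> Q)"
  by simp

lemma ev_imp: "eval N J \<phi> V = P ==> eval N J \<psi> V = Q ==> eval N J (FImp \<phi> \<psi>) V = (P --> Q)"
  by simp

lemma ev_not: "eval N J \<phi> V = P ==> eval N J (FNot \<phi>) V = (\<not> P)"
  by simp

lemma ev_eq: "V i = x ==> V j = y ==> eval N J (FEq i j) V = (x = y)"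
  by simp

lemma ev_L: "V i = x ==> eval N J (FL i) V = (x = Lf)"
  by simp

declare tt.simps [simp del]

lemma sz_tt_mem: "x \<in> set xs ==> sz (lst (map tt xs)) \<le> N ==> sz (tt x) \<le> N"
  by (induction xs) auto

lemma sz_lst_mem: "x \<in> set xs ==> sz x \<le> sz (lst xs)"
  by (induction xs) auto

lemma sz_num_less: "k < m ==> sz (num m) \<le> N ==> sz (num k) \<le> N"
  by (simp add: sz_num)

lemma ev_tlst:
  assumes "ok N V" "V x = tt t" "x \<noteq> 39" "x \<noteq> c" "c \<noteq> 39" "c \<noteq> 43"
    "\<And>xs. t = TL xs ==> sz (lst (map tt xs)) \<le> N ==> eval N J \<phi> (V(39 := num 3, c := lst (map tt xs))) = P xs"
  shows "eval N J (tlst x c \<phi>) V <-> (\<exists>xs. t = TL xs \<and> P xs)"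
proof -
  have "sz (tt t) \<le> N" using okD[OF assms(1), of x] assms(2) by simp
  then have "eval N J (tlst x c \<phi>) V <-> (\<exists>b. tt t = Nd (num 3) b \<and> sz b \<le> N \<and> eval N J \<phi> (V(39 := num 3, c := b)))"
    unfolding tlst_def using assms(1-6) ok_const(4)[OF assms(1)] by (auto simp: eval_Mat_sz simp del: eval_Mat)
  also have "\<dots> <-> (\<exists>xs. t = TL xs \<and> P xs)"
  proof (cases t)
    case (TL xs)
    then have "sz (lst (map tt xs)) \<le> N" using \<open>sz (tt t) \<le> N\<close> by (simp add: tt.simps)
    then show ?thesis using TL assms(7)[OF TL] by (auto simp: tt.simps)
  qed (simp_all add: tt.simps num_numeral)
  finally show ?thesis .
qed

lemma ev_tnum:
  assumes "ok N V" "V x = tt t" "x \<noteq> 38" "x \<noteq> u" "u \<noteq> 38" "u \<noteq> 40"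
    "\<And>k. t = TN k ==> sz (num k) \<le> N ==> eval N J \<phi> (V(38 := num 0, u := num k)) = P k"
  shows "eval N J (tnum x u \<phi>) V <-> (\<exists>k. t = TN k \<and> P k)"
proof -
  have "sz (tt t) \<le> N" using okD[OF assms(1), of x] assms(2) by simp
  then have "eval N J (tnum x u \<phi>) V <-> (\<exists>b. tt t = Nd (num 0) b \<and> sz b \<le> N \<and> eval N J \<phi> (V(38 := num 0, u := b)))"
    unfolding tnum_def using assms(1-6) ok_const(1)[OF assms(1)] by (auto simp: eval_Mat_sz simp del: eval_Mat)
  also have "\<dots> <-> (\<exists>k. t = TN k \<and> P k)"
  proof (cases t)
    case (TN k)
    then have "sz (num k) \<le> N" using \<open>sz (tt t) \<le> N\<close> by (simp add: tt.simps)
    then show ?thesis using TN assms(7)[OF TN] by (auto simp: tt.simps)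
  qed (simp_all add: tt.simps num_numeral)
  finally show ?thesis .
qed

lemma ev_nth2:
  assumes "ok N V" "3 * N \<le> d" "V l = lst xs" "V i = num k" "V l' = lst ys" "V i' = num k'"
    "distinct [a, b, l, i]" "distinct [a, b, l', i']" "max a (max b (max l (max i (max l' i')))) < 60"
    "a < 40 \<or> 45 < a" "b < 40 \<or> 45 < b"
    "k < length xs ==> k' < length ys ==> sz (xs ! k) \<le> N ==> sz (ys ! k') \<le> N ==>
       eval N (jump prog N d) \<phi> (V(a := xs ! k, b := ys ! k')) = P"
  shows "eval N (jump prog N d) (FEx a (FEx b (FAnd (call p_nth [l, i, a]) (FAnd (call p_nth [l', i', b]) \<phi>)))) V <->
    k < length xs \<and> k' < length ys \<and> P"
proof -
  have ne: "a \<noteq> b" "l \<noteq> a" "l \<noteq> b" "i \<noteq> a" "i \<noteq> b" "l' \<noteq> a" "l' \<noteq> b" "i' \<noteq> a" "i' \<noteq> b"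
    using assms(7,8) by auto
  have szx: "k < length xs ==> sz (xs ! k) \<le> N"
    using sz_lst_mem[of "xs ! k" xs] okD[OF assms(1), of l] assms(3) by (auto intro: order_trans)
  have "eval N (jump prog N d) (FEx a (FEx b (FAnd (call p_nth [l, i, a]) (FAnd (call p_nth [l', i', b]) \<phi>)))) V <->
    (\<exists>x. sz x \<le> N \<and> (\<exists>y. sz y \<le> N \<and> (k < length xs \<and> x = xs ! k) \<and> (k' < length ys \<and> y = ys ! k') \<and>
       eval N (jump prog N d) \<phi> (V(a := x, b := y))))"
    using assms(1-6,9-11) ne szx by (simp add: base_jumps callenv_app cong: conj_cong)
  also have "\<dots> <-> k < length xs \<and> k' < length ys \<and> P"
    using assms(12) sz_lst_mem[of "xs ! k" xs] sz_lst_mem[of "ys ! k'" ys] okD[OF assms(1), of l] okD[OF assms(1), of l']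
    by (auto simp: assms(3,5) intro: order_trans)
  finally show ?thesis .
qed

lemma ev_nth:
  assumes "ok N V" "3 * N \<le> d" "V l = lst xs" "V i = num k"
    "distinct [a, l, i]" "max a (max l i) < 60" "a < 40 \<or> 45 < a"
    "k < length xs ==> sz (xs ! k) \<le> N ==> eval N (jump prog N d) \<phi> (V(a := xs ! k)) = P"
  shows "eval N (jump prog N d) (FEx a (FAnd (call p_nth [l, i, a]) \<phi>)) V <-> k < length xs \<and> P"
proof -
  have "eval N (jump prog N d) (FEx a (FAnd (call p_nth [l, i, a]) \<phi>)) V <->
    (\<exists>x. sz x \<le> N \<and> (k < length xs \<and> x = xs ! k) \<and> eval N (jump prog N d) \<phi> (V(a := x)))"
    using assms(1-7) by (simp add: base_jumps callenv_app cong: conj_cong)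
  also have "\<dots> <-> k < length xs \<and> P"
    using assms(8) sz_lst_mem[of "xs ! k" xs] okD[OF assms(1), of l] by (auto simp: assms(3) intro: order_trans)
  finally show ?thesis .
qed

lemma ev_all_mem:
  assumes "ok N V" "3 * N \<le> d" "V l = lst xs" "v \<noteq> l" "max v l < 60" "v < 40 \<or> 45 < v"
    "\<And>x. x \<in> set xs ==> sz x \<le> N ==> eval N (jump prog N d) \<phi> (V(v := x)) = P x"
  shows "eval N (jump prog N d) (FAll v (FImp (call p_mem [v, l]) \<phi>)) V <-> (\<forall>x \<in> set xs. P x)"
proof -
  have "eval N (jump prog N d) (FAll v (FImp (call p_mem [v, l]) \<phi>)) V <->
    (\<forall>x. sz x \<le> N --> x \<in> set xs --> eval N (jump prog N d) \<phi> (V(v := x)))"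
    using assms(1-6) by (simp add: base_jumps callenv_app)
  also have "\<dots> <-> (\<forall>x \<in> set xs. P x)"
    using assms(7) sz_lst_mem[of _ xs] okD[OF assms(1), of l] by (auto simp: assms(3) intro: order_trans)
  finally show ?thesis .
qed

lemma ev_all_memt:
  assumes "ok N V" "3 * N \<le> d" "V l = lst (map tt xs)" "v \<noteq> l" "max v l < 60" "v < 40 \<or> 45 < v"
    "\<And>x. x \<in> set xs ==> sz (tt x) \<le> N ==> eval N (jump prog N d) \<phi> (V(v := tt x)) = P x"
  shows "eval N (jump prog N d) (FAll v (FImp (call p_mem [v, l]) \<phi>)) V <-> (\<forall>x \<in> set xs. P x)"
proof -
  have "eval N (jump prog N d) (FAll v (FImp (call p_mem [v, l]) \<phi>)) V <->
      (\<forall>x \<in> set (map tt xs). eval N (jump prog N d) \<phi> (V(v := x)))"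
    by (rule ev_all_mem[OF assms(1-6)]) simp
  also have "\<dots> <-> (\<forall>x \<in> set xs. P x)"
    using assms(3,7) sz_tt_mem[of _ xs N] okD[OF assms(1), of l] by simp
  finally show ?thesis .
qed

lemma ev_lt:
  assumes "ok N V" "3 * N \<le> d" "V x = num a" "V y = num b" "distinct [x, y, h, t]" "max (max x y) (max h t) < 60"
    "h < 40 \<or> 45 < h" "t < 40 \<or> 45 < t"
  shows "eval N (jump prog N d) (lt x y h t) V <-> a < b"
proof -
  have "suffix (replicate i c) (replicate j c) <-> i \<le> j" for i j and c :: tr
    using suffix_length_le[of "replicate i c" "replicate j c"]
    by (auto simp: suffix_def intro!: exI[of _ "replicate (j - i) c"] simp flip: replicate_add)
  then show ?thesis
    using assms okD[OF assms(1), of y]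
    by (cases b) (auto simp: lt_def base_jumps callenv_app eval_Mat_sz)
qed

text \<open>The quantifier ranges over all trees, but a suffix of a list of leaves is again a list
  of leaves, so the guard leaves exactly the numbers below \<open>m\<close>.\<close>

lemma ev_all_lt:
  assumes "ok N V" "3 * N \<le> d" "V n = num m" "distinct [v, n, h, t]" "max (max v n) (max h t) < 60"
    "h < 40 \<or> 45 < h" "t < 40 \<or> 45 < t" "v < 40 \<or> 45 < v"
    "\<And>k. k < m ==> sz (num k) \<le> N ==> eval N (jump prog N d) \<phi> (V(v := num k)) = P k"
  shows "eval N (jump prog N d) (FAll v (FImp (lt v n h t) \<phi>)) V <-> (\<forall>k < m. P k)"
proof -
  have "eval N (jump prog N d) (lt v n h t) (V(v := x)) <-> (\<exists>k < m. x = num k)" if "sz x \<le> N" for x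
  proof -
    have "eval N (jump prog N d) (lt v n h t) (V(v := x)) <-> (\<exists>m'. m = Suc m' \<and> suffix (els x) (replicate m' Lf))"
      using assms(1-8) that okD[OF assms(1), of n] by (cases m) (auto simp: lt_def base_jumps callenv_app eval_Mat_sz)
    also have "\<dots> <-> (\<exists>k < m. x = num k)"
    proof
      assume "\<exists>m'. m = Suc m' \<and> suffix (els x) (replicate m' Lf)"
      then obtain m' ys where "m = Suc m'" "replicate m' Lf = ys @ els x" by (auto simp: suffix_def)
      have "length (els x) \<le> m'" using arg_cong[OF \<open>replicate m' Lf = ys @ els x\<close>, of length] by simp
      moreover have "\<forall>y \<in> set (els x). y = Lf"
        using arg_cong[OF \<open>replicate m' Lf = ys @ els x\<close>, of set] by (auto split: if_splits)
      then have "x = num (length (els x))"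
        by (metis els_num els_eq lst_els replicate_length_same)
      ultimately have "length (els x) < m" "x = num (length (els x))" using \<open>m = Suc m'\<close> by simp_all
      then show "\<exists>k < m. x = num k" by blast
    next
      assume "\<exists>k < m. x = num k"
      then obtain k where "k < m" "x = num k" by blast
      then have "replicate (m - 1) Lf = replicate (m - 1 - k) Lf @ els x"
        by (simp flip: replicate_add)
      then show "\<exists>m'. m = Suc m' \<and> suffix (els x) (replicate m' Lf)"
        using \<open>k < m\<close> unfolding suffix_def by (intro exI[of _ "m - 1"]) auto
    qed
    finally show ?thesis .
  qed
  then have "eval N (jump prog N d) (FAll v (FImp (lt v n h t) \<phi>)) V <->
      (\<forall>x. sz x \<le> N --> (\<exists>k < m. x = num k) --> eval N (jump prog N d) \<phi> (V(v := x)))"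
    by simp
  also have "\<dots> <-> (\<forall>k < m. P k)"
    using assms(9) sz_num_less[of _ m N] okD[OF assms(1), of n] assms(3) by auto
  finally show ?thesis .
qed

lemma ev_len:
  assumes "ok N V" "3 * N \<le> d" "V l = lst xs" "V n = num k" "max l n < 60"
  shows "eval N (jump prog N d) (call p_len [l, n]) V <-> k = length xs"
  using assms by (simp add: base_jumps callenv_app)

lemma ev_Mat:
  assumes "ok N V" "V l = x" "distinct [l, h, t]"
    "\<And>a b. x = Nd a b ==> sz a \<le> N ==> sz b \<le> N ==> eval N J \<phi> (V(h := a, t := b)) = P a b"
  shows "eval N J (Mat l h t \<phi>) V <-> (\<exists>a b. x = Nd a b \<and> P a b)"
  using assms by (auto simp: ok_Nd)

lemma ev_Matt:
  assumes "ok N V" "V l = lst (map tt xs)" "distinct [l, h, t]"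
    "\<And>y ys. xs = y # ys ==> sz (tt y) \<le> N ==> sz (lst (map tt ys)) \<le> N ==>
       eval N J \<phi> (V(h := tt y, t := lst (map tt ys))) = P y ys"
  shows "eval N J (Mat l h t \<phi>) V <-> (\<exists>y ys. xs = y # ys \<and> P y ys)"
proof (cases xs)
  case Nil
  then show ?thesis using assms by auto
next
  case (Cons y ys)
  have "sz (lst (map tt xs)) \<le> N" using okD[OF assms(1), of l] assms(2) by simp
  then have "sz (tt y) \<le> N" "sz (lst (map tt ys)) \<le> N" using Cons by simp_all
  then show ?thesis using assms(1-3) assms(4)[OF Cons] Cons by auto
qed

primrec incr :: "nat => tin list => bool" where
  "incr n [] = True"
| "incr n (x # xs) = (\<exists>k. x = TN k \<and> k < n \<and> (\<forall>y \<in> set xs. \<exists>j. y = TN j \<and> k < j) \<and> incr n xs)"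

definition tset :: "nat set => tin" where
  "tset S = TL (map TN (sorted_list_of_set S))"

text \<open>Sets are encoded by \<open>sorted_list_of_set\<close>, and the strictly increasing lists
  are precisely its values on finite sets.\<close>

lemma incr_iff: "incr n xs <-> (\<exists>S \<subseteq> {..<n}. xs = map TN (sorted_list_of_set S))"
proof -
  have "incr n xs <-> (\<exists>ks. xs = map TN ks \<and> set ks \<subseteq> {..<n} \<and> sorted_wrt (<) ks)"
  proof (induction xs)
    case (Cons x xs)
    show ?case
    proof
      assume "incr n (x # xs)"
      then obtain k ks where "x = TN k" "k < n" "\<forall>y \<in> set xs. \<exists>j. y = TN j \<and> k < j"
        "xs = map TN ks" "set ks \<subseteq> {..<n}" "sorted_wrt (<) ks"
        using Cons by auto
      then show "\<exists>ks. x # xs = map TN ks \<and> set ks \<subseteq> {..<n} \<and> sorted_wrt (<) ks"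
        by (intro exI[of _ "k # ks"]) auto
    next
      assume "\<exists>ks. x # xs = map TN ks \<and> set ks \<subseteq> {..<n} \<and> sorted_wrt (<) ks"
      then obtain k ks where "x = TN k" "xs = map TN ks" "k < n" "set ks \<subseteq> {..<n}" "sorted_wrt (<) ks" "\<forall>j \<in> set ks. k < j"
        by (auto simp: Cons_eq_map_conv)
      then show "incr n (x # xs)" using Cons by auto
    qed
  qed simp
  also have "\<dots> <-> (\<exists>S \<subseteq> {..<n}. xs = map TN (sorted_list_of_set S))"
  proof
    assume "\<exists>ks. xs = map TN ks \<and> set ks \<subseteq> {..<n} \<and> sorted_wrt (<) ks"
    then obtain ks where "xs = map TN ks" "set ks \<subseteq> {..<n}" "sorted_wrt (<) ks" by blast
    then show "\<exists>S \<subseteq> {..<n}. xs = map TN (sorted_list_of_set S)"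
      by (intro exI[of _ "set ks"]) (auto simp: strict_sorted_iff sorted_list_of_set.idem_if_sorted_distinct)
  next
    assume "\<exists>S \<subseteq> {..<n}. xs = map TN (sorted_list_of_set S)"
    then obtain S where "S \<subseteq> {..<n}" "xs = map TN (sorted_list_of_set S)" by blast
    moreover then have "finite S" by (meson finite_lessThan finite_subset)
    ultimately show "\<exists>ks. xs = map TN ks \<and> set ks \<subseteq> {..<n} \<and> sorted_wrt (<) ks"
      by (intro exI[of _ "sorted_list_of_set S"]) auto
  qed
  finally show ?thesis .
qed

lemma N_facts: "ok N V ==> 11 \<le> N" "ok N V ==> 7 \<le> N" "ok N V ==> 5 \<le> N"
  "ok N V ==> 3 \<le> N" "ok N V ==> 1 \<le> N"
  using sz_3[of N V] by auto

lemma ev_call: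
  assumes "ok N V" "\<forall>v \<in> set vs. v < 60" "length vs \<le> 8" "J p (callenv vs V) = P"
  shows "eval N J (call p vs) V = P"
  using assms by simp

lemma jump_incr:
  "ok N V ==> V 0 = lst (map tt xs) ==> V 1 = num n ==> length xs + 1 + 3 * N \<le> d ==>
    jump prog N d p_incr V <-> incr n xs"
proof (induction xs arbitrary: V d)
  case Nil
  obtain d' where "d = Suc d'" using Nil(4) by (cases d) auto
  then show ?case using Nil by (simp add: prog_simps f_incr_def)
next
  case (Cons x xs)
  obtain d' where d: "d = Suc d'" using Cons.prems(4) by (cases d) auto
  have fuel: "3 * N \<le> d'" "length xs + 1 + 3 * N \<le> d'" using Cons.prems(4) d by simp_all
  note ok = Cons.prems(1) and r = Cons.prems(2,3)
  note c = ok_const[OF ok] N_facts[OF ok]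
  have IH: "\<And>V d. ok N V ==> V 0 = lst (map tt xs) ==> V 1 = num n ==> length xs + 1 + 3 * N \<le> d ==>
    jump prog N d p_incr V <-> incr n xs" using Cons.IH .
  have "eval N (jump prog N d') f_incr V <-> incr n (x # xs)"
    unfolding f_incr_def
    apply (rule trans)
     apply (rule ev_or)
      apply (rule ev_L, rule r)
     apply (rule ev_Matt[OF ok r(1)], simp)
     apply (rule ev_and ev_tnum ev_all_memt ev_lt ev_call IH | (simp add: ok fuel c r sz_num callenv_app; fail))+
    done
  then show ?case unfolding d jump.simps prog_simps .
qed

lemma length_sz: "length xs + 1 \<le> sz (lst xs)"
proof (induction xs)
  case (Cons x xs)
  then show ?case using sz_pos[of x] by simp
qed simp

lemma jump_incr':
  assumes "ok N V" "V 0 = lst (map tt xs)" "V 1 = num n" "4 * N \<le> d"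
  shows "jump prog N d p_incr V <-> incr n xs"
  by (rule jump_incr[OF assms(1-3)])
    (use assms(4) okD[OF assms(1), of 0] assms(2) length_sz[of "map tt xs"] in simp)

lemma ev_tnum_eq:
  assumes "ok N V" "V x = y" "V i = num k" "x \<noteq> 38" "x \<noteq> u" "u \<noteq> 38" "u \<noteq> 40" "i \<noteq> u" "i \<noteq> 38"
  shows "eval N J (tnum x u (FEq u i)) V <-> y = tt (TN k)"
  using assms okD[OF assms(1), of x] ok_const(1)[OF assms(1)]
  unfolding tnum_def by (auto simp: eval_Mat_sz tt.simps simp del: eval_Mat)

lemma ev_avl:
  assumes "ok N V" "3 * N \<le> d" "V 14 = lst (map tt al)" "V 15 = num \<alpha>"
  shows "eval N (jump prog N d) f_avl V <-> (\<exists>xs. TL xs \<in> set al \<and> TN \<alpha> \<in> set xs)"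
proof -
  note c = N_facts[OF assms(1)]
  have N: "N \<le> d" using assms(2) by simp
  have ev: "eval N (jump prog N d) (tlst 20 22 (FAnd (call p_mem [21, 22]) (tnum 21 23 (FEq 23 15)))) (V(20 := tt x, 21 := y)) <->
      (\<exists>xs. x = TL xs \<and> y \<in> set (map tt xs) \<and> y = tt (TN \<alpha>))" if "sz (tt x) \<le> N" "sz y \<le> N" for x y
    apply (insert that)
    apply (rule ev_tlst | (simp add: assms c sz_num; fail))+
    apply (simp add: ev_tnum_eq assms c sz_num N base_jumps callenv_app)
    done
  have sz: "sz x \<le> N" if "x \<in> set (map tt al)" for x
    using sz_lst_mem[OF that] okD[OF assms(1), of 14] assms(3) by simp
  have "eval N (jump prog N d) f_avl V <->
      (\<exists>x. sz x \<le> N \<and> (\<exists>y. sz y \<le> N \<and> x \<in> set (map tt al) \<and>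
        eval N (jump prog N d) (tlst 20 22 (FAnd (call p_mem [21, 22]) (tnum 21 23 (FEq 23 15)))) (V(20 := x, 21 := y))))"
    using assms N unfolding f_avl_def by (simp add: base_jumps callenv_app cong: conj_cong)
  also have "\<dots> <-> (\<exists>x \<in> set al. \<exists>y. sz y \<le> N \<and> (\<exists>xs. x = TL xs \<and> y \<in> set (map tt xs) \<and> y = tt (TN \<alpha>)))"
  proof -
    have "(\<exists>x. sz x \<le> N \<and> (\<exists>y. sz y \<le> N \<and> x \<in> set (map tt al) \<and> E x y)) <->
        (\<exists>x \<in> set al. sz (tt x) \<le> N \<and> (\<exists>y. sz y \<le> N \<and> E (tt x) y))" for E
      by auto
    moreover have "sz (tt x) \<le> N" if "x \<in> set al" for x using sz that by simp
    ultimately show ?thesis using ev by (simp cong: bex_cong conj_cong)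
  qed
  also have "\<dots> <-> (\<exists>xs. TL xs \<in> set al \<and> TN \<alpha> \<in> set xs)"
  proof -
    have "sz (tt (TN \<alpha>)) \<le> N" if "TL xs \<in> set al" "TN \<alpha> \<in> set xs" for xs
    proof -
      have "sz (tt (TL xs)) \<le> N" using sz_tt_mem[OF that(1)] okD[OF assms(1), of 14] assms(3) by simp
      then show ?thesis using sz_tt_mem[OF that(2)] by (simp add: tt.simps)
    qed
    then show ?thesis by fastforce
  qed
  finally show ?thesis .
qed

primrec tag :: "tin => nat" where
  "tag (TN k) = 0" | "tag (TI z) = 1" | "tag (TU k) = 2" | "tag (TL xs) = 3"

lemma tt_tag: "tt t = Nd (num (tag t)) (cont (tt t))"
  by (cases t) (simp_all add: tt.simps)

lemma ev_tag:
  assumes "ok N V" "V l = tt t" "V i = num j" "distinct [l, h, u]" "distinct [i, h, u]"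
  shows "eval N J (Mat l h u (FEq h i)) V <-> tag t = j"
proof -
  have "eval N J (Mat l h u (FEq h i)) V <-> (\<exists>a b. tt t = Nd a b \<and> a = num j)"
    using assms okD[OF assms(1), of l] by (auto simp: eval_Mat_sz simp del: eval_Mat)
  then show ?thesis by (subst (asm) tt_tag) auto
qed

text \<open>Defined for every tag, since the formula reads the sign field without looking at the
  tag; on integers it is negativity, by \<open>negt_TI\<close>.\<close>

definition negt :: "tin => bool" where
  "negt t <-> (\<exists>a b. cont (tt t) = Nd a b \<and> a = num 1)"

lemma negt_TI: "negt (TI z) <-> z < 0"
  by (simp add: negt_def tt.simps)

lemma ev_negt:
  assumes "ok N V" "V 26 = tt t"
  shows "eval N J (Mat 26 28 29 (Mat 29 30 31 (FEq 30 41))) V <-> negt t"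
proof -
  have sz: "sz (tt t) \<le> N" using okD[OF assms(1), of 26] assms(2) by simp
  then have "sz (num (tag t)) \<le> N" "sz (cont (tt t)) \<le> N" by (subst (asm) tt_tag, simp)+
  then show ?thesis
    using assms tt_tag[of t] ok_const(2)[OF assms(1)] by (auto simp: negt_def simp del: num_1 dest: sz_Nd_le)
qed

primrec unL :: "tin => tin list" where
  "unL (TL xs) = xs" | "unL (TN k) = []" | "unL (TI z) = []" | "unL (TU k) = []"

lemma product_lists_map: "product_lists (map (map f) xss) = map (map f) (product_lists xss)"
  by (induction xss) (simp_all add: map_concat comp_def)

lemma ev_prod:
  assumes "ok N V" "3 * N \<le> d" "V l = lst (map tt al)" "l \<noteq> v" "max l v < 60" "v < 40 \<or> 45 < v"
    "\<forall>x \<in> set al. \<exists>xs. x = TL xs \<and> xs \<noteq> []"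
    "sz (lst (map (\<lambda>xs. lst (map tt xs)) (product_lists (map unL al)))) \<le> N ==>
      eval N (jump prog N d) \<phi> (V(v := lst (map (\<lambda>xs. lst (map tt xs)) (product_lists (map unL al))))) = P"
  shows "eval N (jump prog N d) (FEx v (FAnd (call p_prod [l, v]) \<phi>)) V <->
    sz (lst (map (\<lambda>xs. lst (map tt xs)) (product_lists (map unL al)))) \<le> N \<and> P"
proof -
  let ?p = "map (\<lambda>xs. lst (map tt xs)) (product_lists (map unL al))"
  have cont: "cont (tt x) = lst (map tt (unL x))" if "x \<in> set al" for x
    using that assms(7) by (auto simp: tt.simps)
  have "map (\<lambda>x. els (cont x)) (map tt al) = map (map tt) (map unL al)"
    using cont by simp
  then have p: "map lst (product_lists (map (\<lambda>x. els (cont x)) (map tt al))) = ?p"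
    by (simp only: product_lists_map) simp
  have "eval N (jump prog N d) (call p_prod [l, v]) (V(v := x)) <-> x = lst ?p" if "sz x \<le> N" for x
  proof -
    have "ok N (callenv [l, v] (V(v := x)))" using assms(1,6) that by simp
    then have "jump prog N d p_prod (callenv [l, v] (V(v := x))) <-> els x = ?p"
      using assms(2-5) okD[OF assms(1), of l] cont assms(7) p
      by (subst jump_prod[OF _ refl]) (auto simp: callenv_app)
    then show ?thesis using assms(1-6) that by (simp add: els_eq)
  qed
  then have "eval N (jump prog N d) (FEx v (FAnd (call p_prod [l, v]) \<phi>)) V <->
      (\<exists>x. sz x \<le> N \<and> x = lst ?p \<and> eval N (jump prog N d) \<phi> (V(v := x)))"
    by (auto simp del: eval_call)
  then show ?thesis using assms(8) by auto
qed

lemma jump_wfval: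
  assumes ok: "ok N V" and fuel: "5 * N \<le> d"
    and r: "V 52 = lst (map tt vs)" "V 54 = num nP" "V 48 = num nS"
  shows "jump prog N d p_wfval V <-> nP = length vs \<and> (\<forall>x \<in> set vs. \<exists>xs. x = TL xs \<and> incr nS xs)"
proof -
  note c = ok_const[OF ok] N_facts[OF ok]
  obtain d' where d: "d = Suc d'" using fuel c(7) by (cases d) auto
  have f: "4 * N \<le> d'" "3 * N \<le> d'" using fuel c(7) d by simp_all
  have "eval N (jump prog N d') f_wfval V <-> nP = length (map tt vs) \<and> (\<forall>x \<in> set vs. \<exists>xs. x = TL xs \<and> incr nS xs)"
    unfolding f_wfval_def fset_def
    by (rule ev_and ev_len ev_all_memt ev_tlst ev_call jump_incr' | (simp add: ok f c r sz_num callenv_app; fail))+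
  then show ?thesis unfolding d jump.simps prog_simps by simp
qed

lemma jump_wfav:
  assumes ok: "ok N V" and fuel: "5 * N \<le> d"
    and r: "V 49 = lst (map tt av)" "V 48 = num nS" "V 46 = num nA" "V 55 = num nC"
  shows "jump prog N d p_wfav V <-> nS = length av \<and> (\<forall>x \<in> set av. \<exists>xs. x = TL xs \<and> nA = length xs \<and>
     (\<forall>y \<in> set xs. \<exists>l. y = TL l \<and> l \<noteq> [] \<and> incr nC l))"
proof -
  note c = ok_const[OF ok] N_facts[OF ok]
  obtain d' where d: "d = Suc d'" using fuel c(7) by (cases d) auto
  have f: "4 * N \<le> d'" "3 * N \<le> d'" using fuel c(7) d by simp_all
  have "eval N (jump prog N d') f_wfav V <-> nS = length (map tt av) \<and> (\<forall>x \<in> set av. \<exists>xs. x = TL xs \<and> nA = length (map tt xs) \<and>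
     (\<forall>y \<in> set xs. \<exists>l. y = TL l \<and> lst (map tt l) \<noteq> Lf \<and> incr nC l))"
    unfolding f_wfav_def
    by (rule ev_and ev_len ev_all_memt ev_tlst ev_call jump_incr' ev_not ev_L | (simp add: ok f c r sz_num callenv_app; fail))+
  then show ?thesis unfolding d jump.simps prog_simps by simp
qed

lemma jump_wfcost:
  assumes ok: "ok N V" and fuel: "5 * N \<le> d"
    and r: "V 50 = lst (map tt cs)" "V 49 = lst (map tt av)" "V 48 = num nS" "V 55 = num nC" "V 47 = num nR"
  shows "jump prog N d p_wfcost V <-> nS = length cs \<and> (\<forall>s < nS. s < length cs \<and> s < length av \<and>
     (\<exists>xs. cs ! s = TL xs \<and> (\<exists>al. av ! s = TL al \<and> nC = length xs \<and> (\<forall>\<alpha> < nC. \<alpha> < length xs \<and>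
       (\<exists>r. xs ! \<alpha> = TL r \<and>
          ((\<exists>l. TL l \<in> set al \<and> TN \<alpha> \<in> set l) \<and> nR = length r \<and> (\<forall>x \<in> set r. tag x = 1) \<and> (\<exists>y ys. r = y # ys \<and> negt y) \<or>
           \<not> (\<exists>l. TL l \<in> set al \<and> TN \<alpha> \<in> set l) \<and> r = []))))))"
    (is "_ <-> ?R")
proof -
  note c = ok_const[OF ok] N_facts[OF ok]
  obtain d' where d: "d = Suc d'" using fuel c(7) by (cases d) auto
  have f: "4 * N \<le> d'" "3 * N \<le> d'" using fuel c(7) d by simp_all
  have "eval N (jump prog N d') f_wfcost V <-> ?R"
    unfolding f_wfcost_def
    apply (rule trans)
    apply (rule ev_and ev_or ev_len ev_nth2 ev_nth ev_all_memt ev_tlst ev_not ev_L ev_all_lt ev_tag ev_negt ev_Matt ev_avl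
      | (simp add: ok f c r sz_num callenv_app del: num_1; fail))+
    apply (simp cong: conj_cong)
    done
  then show ?thesis unfolding d jump.simps prog_simps by simp
qed

text \<open>A row of successors can be compared with the list of joint actions only if that list
  fits into \<open>N\<close>. The condition therefore remains part of the result and is discharged
  later for genuine inputs.\<close>

lemma jump_wfsucc:
  assumes ok: "ok N V" and fuel: "5 * N \<le> d"
    and r: "V 51 = lst (map tt su)" "V 49 = lst (map tt av)" "V 48 = num nS"
    and av: "\<And>s al x. s < length av ==> av ! s = TL al ==> x \<in> set al ==> \<exists>xs. x = TL xs \<and> xs \<noteq> []"
  shows "jump prog N d p_wfsucc V <-> nS = length su \<and> (\<forall>s < nS. s < length su \<and> s < length av \<and>
     (\<exists>xs. su ! s = TL xs \<and> (\<exists>al. av ! s = TL al \<and>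
       (sz (lst (map (\<lambda>xs. lst (map tt xs)) (product_lists (map unL al)))) \<le> N \<and>
         length (product_lists (map unL al)) = length xs) \<and>
       (\<forall>x \<in> set xs. \<exists>k. x = TN k \<and> k < nS))))"
    (is "_ <-> ?R")
proof -
  note c = ok_const[OF ok] N_facts[OF ok]
  obtain d' where d: "d = Suc d'" using fuel c(7) by (cases d) auto
  have f: "4 * N \<le> d'" "3 * N \<le> d'" using fuel c(7) d by simp_all
  have N: "N \<le> d'" using f by simp
  have len: "eval N (jump prog N d') (FEx 16 (FAnd (call p_len [15, 16]) (call p_len [13, 16]))) V' <-> length xs = length ys"
    if "ok N V'" "V' 15 = lst xs" "V' 13 = lst ys" for V' xs ys
  proof -
    have "sz (num (length xs)) \<le> N"
    proof -
      have "sz (num (length xs)) \<le> sz (lst xs)" 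
        using length_sz[of xs]
      proof (induction xs)
        case (Cons x xs)
        then show ?case using sz_pos[of x] length_sz[of xs] by simp
      qed simp
      then show ?thesis using okD[OF that(1), of 15] that(2) by simp
    qed
    then show ?thesis using that N by (auto simp: base_jumps callenv_app cong: conj_cong)
  qed
  have "eval N (jump prog N d') f_wfsucc V <-> ?R"
    unfolding f_wfsucc_def
    apply (rule trans)
    apply (rule len ev_and ev_or ev_len ev_nth2 ev_all_memt ev_tlst ev_tnum ev_lt ev_not ev_L ev_all_lt ev_prod
      | (simp add: ok f c r sz_num callenv_app av; fail))+
    apply (simp cong: conj_cong)
    done
  then show ?thesis unfolding d jump.simps prog_simps by simp
qed

lemma jump_wfen:
  assumes ok: "ok N V" and fuel: "5 * N \<le> d"
    and r: "V 0 = tt t" "V 46 = num nA" "V 47 = num nR"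
  shows "jump prog N d p_wfen V <-> (\<exists>xs. t = TL xs \<and> nA = length xs \<and> (\<forall>x \<in> set xs. \<exists>ys. x = TL ys \<and> nR = length ys \<and>
     (\<forall>y \<in> set ys. tag y = 2)))"
    (is "_ <-> ?R")
proof -
  note c = ok_const[OF ok] N_facts[OF ok]
  obtain d' where d: "d = Suc d'" using fuel c(7) by (cases d) auto
  have f: "4 * N \<le> d'" "3 * N \<le> d'" using fuel c(7) d by simp_all
  have "eval N (jump prog N d') f_wfen V <-> ?R"
    unfolding f_wfen_def
    apply (rule trans)
    apply (rule ev_and ev_len ev_all_memt ev_tlst ev_tag
      | (simp add: ok f c r sz_num callenv_app; fail))+
    done
  then show ?thesis unfolding d jump.simps prog_simps by simp
qed

section \<open>Formulas and models as typed inputs\<close>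

definition ten :: "rbcgs => endowment => tin" where
  "ten M \<eta> = TL (map (\<lambda>a. TL (map (\<lambda>k. TU (\<eta> (a, k))) [0..<nRes M])) [0..<nAgt M])"

fun tbound :: "rbcgs => bound => tin" where
  "tbound M Current = TL []"
| "tbound M (Fixed \<zeta>) = ten M \<zeta>"

primrec tform :: "rbcgs => fm => tin" where
  "tform M (Prop p) = TL [TN 0, TN p]"
| "tform M (Neg \<phi>) = TL [TN 1, tform M \<phi>]"
| "tform M (Conj \<phi> \<psi>) = TL [TN 2, tform M \<phi>, tform M \<psi>]"
| "tform M (Next A B b \<phi>) = TL [TN 3, tset A, tset B, tbound M b, tform M \<phi>]"
| "tform M (Until A B b \<phi> \<psi>) = TL [TN 4, tset A, tset B, tbound M b, tform M \<phi>, tform M \<psi>]"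
| "tform M (Release A B b \<phi> \<psi>) = TL [TN 5, tset A, tset B, tbound M b, tform M \<phi>, tform M \<psi>]"

definition isset :: "nat => tin => bool" where "isset n t <-> (\<exists>S \<subseteq> {..<n}. t = tset S)"
definition isen :: "rbcgs => tin => bool" where "isen M t <-> (\<exists>\<eta> \<in> En M. t = ten M \<eta>)"
definition isfm :: "rbcgs => tin => bool" where "isfm M t <-> (\<exists>\<phi>. formula_over M \<phi> \<and> t = tform M \<phi>)"

lemma isset_iff: "isset n t <-> (\<exists>xs. t = TL xs \<and> incr n xs)"
  by (auto simp: isset_def incr_iff tset_def)

primrec unU :: "tin => nat" where
  "unU (TU k) = k" | "unU (TN k) = 0" | "unU (TI z) = 0" | "unU (TL xs) = 0"

lemma tag_2: "tag t = 2 <-> t = TU (unU t)"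
  by (cases t) auto

lemma isen_iff: "isen M t <-> (\<exists>xs. t = TL xs \<and> nAgt M = length xs \<and>
   (\<forall>x \<in> set xs. \<exists>ys. x = TL ys \<and> nRes M = length ys \<and> (\<forall>y \<in> set ys. tag y = 2)))" (is "_ <-> ?R")
proof
  assume "isen M t"
  then show ?R by (auto simp: isen_def ten_def)
next
  assume ?R
  then obtain xs where xs: "t = TL xs" "nAgt M = length xs"
    "\<And>x. x \<in> set xs ==> \<exists>ys. x = TL ys \<and> nRes M = length ys \<and> (\<forall>y \<in> set ys. tag y = 2)" by blast
  define \<eta> where "\<eta> = (\<lambda>(a, V) \<in> Agt M \<times> Res M. unU (unL (xs ! a) ! V))"
  have "xs ! a = TL (map (\<lambda>k. TU (\<eta> (a, k))) [0..<nRes M])" if a: "a < nAgt M" for a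
  proof -
    obtain ys where ys: "xs ! a = TL ys" "nRes M = length ys" "\<forall>y \<in> set ys. tag y = 2"
      using xs(3)[of "xs ! a"] xs(2) a by auto
    have "ys = map (\<lambda>k. TU (\<eta> (a, k))) [0..<nRes M]"
    proof (rule nth_equalityI)
      fix V assume "V < length ys"
      moreover then have "ys ! V = TU (unU (ys ! V))" using ys(3) tag_2 by simp
      ultimately show "ys ! V = map (\<lambda>k. TU (\<eta> (a, k))) [0..<nRes M] ! V"
        using ys(1,2) a by (simp add: \<eta>_def Agt_def Res_def)
    qed (simp add: ys(2))
    then show ?thesis using ys(1) by simp
  qed
  then have "t = ten M \<eta>"
    using xs(1,2) unfolding ten_def by (auto intro!: nth_equalityI)
  moreover have "\<eta> \<in> En M" unfolding En_def \<eta>_def by simp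
  ultimately show "isen M t" unfolding isen_def by blast
qed

lemma isbound_iff: "t = TL [] \<or> isen M t <-> (\<exists>b. bound_over M b \<and> t = tbound M b)"
proof -
  have "(\<exists>b. P b) <-> P Current \<or> (\<exists>\<zeta>. P (Fixed \<zeta>))" for P by (metis bound.exhaust)
  then show ?thesis by (auto simp: isen_def)
qed

text \<open>One unfolding of \<open>isfm\<close>, nested in the way in which the matches of
  \<open>f_wffm\<close> take the list apart.\<close>

lemma isfm_iff: "isfm M t <-> (\<exists>xs. t = TL xs \<and> (\<exists>y ys. xs = y # ys \<and> (\<exists>k. y = TN k \<and>
  (k = 0 \<and> (\<exists>a b. ys = a # b \<and> b = [] \<and> (\<exists>p. a = TN p \<and> p < nProp M)) \<or>
   k = 1 \<and> (\<exists>a b. ys = a # b \<and> b = [] \<and> isfm M a) \<or>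
   k = 2 \<and> (\<exists>a b. ys = a # b \<and> (\<exists>c e. b = c # e \<and> e = [] \<and> isfm M a \<and> isfm M c)) \<or>
   (\<exists>a b. ys = a # b \<and> (\<exists>c e. b = c # e \<and> (\<exists>f g. e = f # g \<and> (\<exists>h i. g = h # i \<and>
     isset (nAgt M) a \<and> isset (nAgt M) c \<and> (f = TL [] \<or> isen M f) \<and> isfm M h \<and>
     (k = 3 \<and> i = [] \<or> (k = 4 \<or> k = 5) \<and> (\<exists>j l. i = j # l \<and> l = [] \<and> isfm M j))))))))))"
  (is "_ <-> ?R")
proof
  assume "isfm M t"
  then obtain \<phi> where "formula_over M \<phi>" "t = tform M \<phi>" by (auto simp: isfm_def)
  moreover have "formula_over M \<psi> ==> isfm M (tform M \<psi>)" for \<psi> by (auto simp: isfm_def)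
  moreover have "S \<subseteq> Agt M ==> isset (nAgt M) (tset S)" for S by (auto simp: isset_def Agt_def)
  moreover have "bound_over M b ==> tbound M b = TL [] \<or> isen M (tbound M b)" for b unfolding isbound_iff by blast
  ultimately show ?R by (cases \<phi>) (simp_all add: Props_def)
next
  assume ?R
  then obtain xs y ys k where "t = TL xs" "xs = y # ys" "y = TN k" and
   c: "k = 0 \<and> (\<exists>a b. ys = a # b \<and> b = [] \<and> (\<exists>p. a = TN p \<and> p < nProp M)) \<or>
   k = 1 \<and> (\<exists>a b. ys = a # b \<and> b = [] \<and> isfm M a) \<or>
   k = 2 \<and> (\<exists>a b. ys = a # b \<and> (\<exists>c e. b = c # e \<and> e = [] \<and> isfm M a \<and> isfm M c)) \<or>
   (\<exists>a b. ys = a # b \<and> (\<exists>c e. b = c # e \<and> (\<exists>f g. e = f # g \<and> (\<exists>h i. g = h # i \<and>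
     isset (nAgt M) a \<and> isset (nAgt M) c \<and> (f = TL [] \<or> isen M f) \<and> isfm M h \<and>
     (k = 3 \<and> i = [] \<or> (k = 4 \<or> k = 5) \<and> (\<exists>j l. i = j # l \<and> l = [] \<and> isfm M j))))))"
    by (elim exE conjE) (rule that)
  then have t: "t = TL (TN k # ys)" by simp
  show "isfm M t"
    using c unfolding isbound_iff
  proof (elim disjE conjE exE)
    fix a b p assume "k = 0" "ys = a # b" "b = []" "a = TN p" "p < nProp M"
    then show ?thesis unfolding isfm_def t by (intro exI[of _ "Prop p"]) (simp add: Props_def)
  next
    fix a b assume "k = 1" "ys = a # b" "b = []" "isfm M a"
    moreover then obtain \<phi> where "a = tform M \<phi>" "formula_over M \<phi>" unfolding isfm_def by blast
    ultimately show ?thesis unfolding isfm_def t by (intro exI[of _ "Neg \<phi>"]) simp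
  next
    fix a b c e assume "k = 2" "ys = a # b" "b = c # e" "e = []" "isfm M a" "isfm M c"
    moreover then obtain \<phi> \<psi> where "a = tform M \<phi>" "formula_over M \<phi>" "c = tform M \<psi>" "formula_over M \<psi>"
      unfolding isfm_def by blast
    ultimately show ?thesis unfolding isfm_def t by (intro exI[of _ "Conj \<phi> \<psi>"]) simp
  next
    fix a b c e f g h i bd assume "ys = a # b" "b = c # e" "e = f # g" "g = h # i" "isset (nAgt M) a"
      "isset (nAgt M) c" "bound_over M bd" "f = tbound M bd" "isfm M h" "k = 3" "i = []"
    moreover then obtain A B \<phi> where "a = tset A" "A \<subseteq> Agt M" "c = tset B" "B \<subseteq> Agt M" "h = tform M \<phi>" "formula_over M \<phi>"
      unfolding isset_def isfm_def Agt_def by blast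
    ultimately show ?thesis unfolding isfm_def t by (intro exI[of _ "Next A B bd \<phi>"]) simp
  next
    fix a b c e f g h i j l bd assume "ys = a # b" "b = c # e" "e = f # g" "g = h # i" "isset (nAgt M) a"
      "isset (nAgt M) c" "bound_over M bd" "f = tbound M bd" "isfm M h" "i = j # l" "l = []" "isfm M j" and k: "k = 4"
    moreover then obtain A B \<phi> \<psi> where "a = tset A" "A \<subseteq> Agt M" "c = tset B" "B \<subseteq> Agt M" "h = tform M \<phi>" "formula_over M \<phi>"
        "j = tform M \<psi>" "formula_over M \<psi>"
      unfolding isset_def isfm_def Agt_def by blast
    ultimately show ?thesis unfolding isfm_def t by (intro exI[of _ "Until A B bd \<phi> \<psi>"]) simp
  next
    fix a b c e f g h i j l bd assume "ys = a # b" "b = c # e" "e = f # g" "g = h # i" "isset (nAgt M) a"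
      "isset (nAgt M) c" "bound_over M bd" "f = tbound M bd" "isfm M h" "i = j # l" "l = []" "isfm M j" and k: "k = 5"
    moreover then obtain A B \<phi> \<psi> where "a = tset A" "A \<subseteq> Agt M" "c = tset B" "B \<subseteq> Agt M" "h = tform M \<phi>" "formula_over M \<phi>"
        "j = tform M \<psi>" "formula_over M \<psi>"
      unfolding isset_def isfm_def Agt_def by blast
    ultimately show ?thesis unfolding isfm_def t by (intro exI[of _ "Release A B bd \<phi> \<psi>"]) simp
  qed
qed

lemma jump_wffm:
  "ok N V ==> V 0 = tt t ==> V 46 = num (nAgt M) ==> V 47 = num (nRes M) ==> V 54 = num (nProp M) ==>
    size t + 6 * N \<le> d ==> jump prog N d p_wffm V <-> isfm M t"
proof (induction t arbitrary: V d rule: measure_induct_rule[where f = size])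
  case (less t)
  note ok = less.prems(1) and r = less.prems(2-5)
  note c = ok_const[OF ok] N_facts[OF ok]
  obtain d' where d: "d = Suc d'" using less.prems(6) c(7) by (cases d) auto
  have f: "4 * N \<le> d'" "3 * N \<le> d'" "5 * N \<le> d'" using less.prems(6) c(7) d by simp_all
  have IH: "\<And>V x. ok N V ==> V 0 = tt x ==> V 46 = num (nAgt M) ==> V 47 = num (nRes M) ==> V 54 = num (nProp M) ==>
    size x < size t ==> jump prog N d' p_wffm V <-> isfm M x"
    using less.IH less.prems(6) d by simp
  have set: "eval N (jump prog N d') (fset x 46 cc) V' <-> isset (nAgt M) y"
    if "ok N V'" "V' x = tt y" "V' 46 = num (nAgt M)" "x \<noteq> 39" "x \<noteq> cc" "cc \<noteq> 39" "cc \<noteq> 43" "cc < 40" "cc < 60" "cc \<noteq> 46" "46 \<noteq> cc" for V' x cc y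
    unfolding fset_def isset_iff
    by (rule ev_tlst ev_call jump_incr' | (simp add: that f c sz_num callenv_app; fail))+
  have en: "jump prog N d' p_wfen V' <-> isen M y"
    if "ok N V'" "V' 0 = tt y" "V' 46 = num (nAgt M)" "V' 47 = num (nRes M)" for V' y
    unfolding isen_iff using jump_wfen[OF that(1) f(3) that(2-4)] .
  have "eval N (jump prog N d') f_wffm V <-> isfm M t"
    unfolding f_wffm_def
    apply (rule trans)
     apply (rule ev_and ev_or set IH en ev_tlst ev_tnum ev_lt ev_not ev_L ev_eq ev_call ev_Matt
      | (simp add: ok f c r sz_num callenv_app del: num_1; fail))+
    apply (subst isfm_iff[of M t])
    apply (simp del: num_1)
    done
  then show ?case unfolding d jump.simps prog_simps by simp
qed

definition jl :: "rbcgs => nat => nat list list" where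
  "jl M s = product_lists (map (\<lambda>a. sorted_list_of_set (avail M s a)) [0..<nAgt M])"

definition valT :: "rbcgs => tin list" where
  "valT M = map (\<lambda>p. tset (val M p)) [0..<nProp M]"

definition avR :: "rbcgs => nat => tin list" where
  "avR M s = map (\<lambda>a. tset (avail M s a)) [0..<nAgt M]"

definition avT :: "rbcgs => tin list" where
  "avT M = map (\<lambda>s. TL (avR M s)) [0..<nSt M]"

definition costR :: "rbcgs => nat => nat => tin list" where
  "costR M s \<alpha> = (if \<exists>a \<in> Agt M. \<alpha> \<in> avail M s a then map (\<lambda>k. TI (cost M s \<alpha> k)) [0..<nRes M] else [])"

definition costT :: "rbcgs => tin list" where
  "costT M = map (\<lambda>s. TL (map (\<lambda>\<alpha>. TL (costR M s \<alpha>)) [0..<nAct M])) [0..<nSt M]"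

definition succR :: "rbcgs => nat => tin list" where
  "succR M s = map (\<lambda>\<sigma>. TN (succ M s \<sigma>)) (jl M s)"

definition succT :: "rbcgs => tin list" where
  "succT M = map (\<lambda>s. TL (succR M s)) [0..<nSt M]"

lemmas tables = valT_def avR_def avT_def costR_def costT_def succR_def succT_def jl_def

lemma unL_tset [simp]: "unL (tset S) = map TN (sorted_list_of_set S)"
  by (simp add: tset_def)

lemma product_avR: "product_lists (map unL (avR M s)) = map (map TN) (jl M s)"
  unfolding avR_def jl_def product_lists_map[symmetric] by (simp add: comp_def)

lemma set_jl:
  assumes "\<And>a. a \<in> Agt M ==> finite (avail M s a)"
  shows "set (jl M s) = joint M s"
  using assms unfolding jl_def joint_def product_lists_set
  by (auto simp: list_all2_conv_all_nth Agt_def)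

lemma distinct_product_lists: "(\<And>xs. xs \<in> set xss ==> distinct xs) ==> distinct (product_lists xss)"
proof (induction xss)
  case (Cons xs xss)
  have "distinct xs" using Cons.prems by simp
  have d: "distinct (product_lists xss)" using Cons by simp
  have "distinct (concat (map (\<lambda>x. map (Cons x) (product_lists xss)) ys))" if "distinct ys" for ys
    using that by (induction ys) (auto simp: distinct_map d)
  then show ?case using \<open>distinct xs\<close> by simp
qed simp

lemma distinct_jl: "distinct (jl M s)"
  unfolding jl_def by (rule distinct_product_lists) auto

lemma is_rbcgs_finite: "is_rbcgs M ==> s \<in> St M ==> a \<in> Agt M ==> finite (avail M s a)"
  unfolding is_rbcgs_def Act_def by (meson finite_lessThan finite_subset)

primrec unN :: "tin => nat" where
  "unN (TN k) = k" | "unN (TU k) = 0" | "unN (TI z) = 0" | "unN (TL xs) = 0"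

primrec unI :: "tin => int" where
  "unI (TI z) = z" | "unI (TN k) = 0" | "unI (TU k) = 0" | "unI (TL xs) = 0"

definition unset :: "tin => nat set" where "unset t = set (map unN (unL t))"

lemma unset_tset: "isset n t ==> tset (unset t) = t \<and> unset t \<subseteq> {..<n}"
proof -
  assume "isset n t"
  then obtain S where S: "S \<subseteq> {..<n}" "t = tset S" by (auto simp: isset_def)
  then have "finite S" using finite_subset by blast
  then have "unset t = S" using S by (simp add: unset_def comp_def)
  then show ?thesis using S by simp
qed

lemma tag_1: "tag t = 1 <-> t = TI (unI t)"
  by (cases t) auto

text \<open>Reads a model off its tables. A successor is found through the position of the joint
  action in the list \<open>J s\<close>; beyond the tables the values are arbitrary.\<close>

definition decode :: "nat => nat => nat => nat => nat => tin list => tin list => tin list => tin list => rbcgs" where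
  "decode nA nR nS nP nC vs av cs su = (let
     A = (\<lambda>s a. unset (unL (av ! s) ! a));
     J = (\<lambda>s. product_lists (map (\<lambda>a. sorted_list_of_set (A s a)) [0..<nA]))
   in \<lparr>nAgt = nA, nRes = nR, nSt = nS, nProp = nP, nAct = nC, val = \<lambda>p. unset (vs ! p), avail = A,
     cost = \<lambda>s \<alpha> V. unI (unL (unL (cs ! s) ! \<alpha>) ! V),
     succ = \<lambda>s \<sigma>. unN (the (map_of (zip (J s) (unL (su ! s))) \<sigma>))\<rparr>)"

text \<open>The conditions are the results of the well-formedness procedures. Having the given
  tables is all that is required of the model, as only the tables are encoded.\<close>

lemma decode:
  fixes vs av cs su :: "tin list"
  assumes pos: "nA \<noteq> 0" "nR \<noteq> 0" "nS \<noteq> 0" "nC \<noteq> 0"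
    and v: "nP = length vs" "\<forall>x \<in> set vs. \<exists>xs. x = TL xs \<and> incr nS xs"
    and a: "nS = length av" "\<forall>x \<in> set av. \<exists>xs. x = TL xs \<and> nA = length xs \<and>
      (\<forall>y \<in> set xs. \<exists>l. y = TL l \<and> l \<noteq> [] \<and> incr nC l)"
    and c: "nS = length cs" "\<forall>s < nS. s < length cs \<and> s < length av \<and>
     (\<exists>xs. cs ! s = TL xs \<and> (\<exists>al. av ! s = TL al \<and> nC = length xs \<and> (\<forall>\<alpha> < nC. \<alpha> < length xs \<and>
       (\<exists>r. xs ! \<alpha> = TL r \<and>
          ((\<exists>l. TL l \<in> set al \<and> TN \<alpha> \<in> set l) \<and> nR = length r \<and> (\<forall>x \<in> set r. tag x = 1) \<and> (\<exists>y ys. r = y # ys \<and> negt y) \<or>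
           \<not> (\<exists>l. TL l \<in> set al \<and> TN \<alpha> \<in> set l) \<and> r = [])))))"
    and s: "nS = length su" "\<forall>s < nS. s < length su \<and> s < length av \<and>
     (\<exists>xs. su ! s = TL xs \<and> (\<exists>al. av ! s = TL al \<and>
       (P s al \<and> length (product_lists (map unL al)) = length xs) \<and>
       (\<forall>x \<in> set xs. \<exists>k. x = TN k \<and> k < nS)))"
  shows "\<exists>M. is_rbcgs M \<and> nAgt M = nA \<and> nRes M = nR \<and> nSt M = nS \<and> nProp M = nP \<and> nAct M = nC \<and>
    valT M = vs \<and> avT M = av \<and> costT M = cs \<and> succT M = su"
proof -
  define M where "M = decode nA nR nS nP nC vs av cs su"
  have M: "nAgt M = nA" "nRes M = nR" "nSt M = nS" "nProp M = nP" "nAct M = nC" "val M = (\<lambda>p. unset (vs ! p))"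
    "avail M = (\<lambda>s a. unset (unL (av ! s) ! a))" "cost M = (\<lambda>s \<alpha> V. unI (unL (unL (cs ! s) ! \<alpha>) ! V))"
    unfolding M_def decode_def Let_def by simp_all
  have succ: "succ M = (\<lambda>s \<sigma>. unN (the (map_of (zip (jl M s) (unL (su ! s))) \<sigma>)))"
    unfolding jl_def M(1,7) unfolding M_def decode_def Let_def by simp
  have vT: "tset (val M p) = vs ! p" "val M p \<subseteq> {..<nS}" if p: "p < nP" for p
  proof -
    have "isset nS (vs ! p)" using v p unfolding isset_iff by simp
    then show "tset (val M p) = vs ! p" "val M p \<subseteq> {..<nS}" using unset_tset[of nS "vs ! p"] by (simp_all add: M)
  qed
  have aT: "TL (avR M s) = av ! s" "length (avR M s) = nA" if s: "s < nS" for s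
  proof -
    obtain xs where xs: "av ! s = TL xs" "nA = length xs" "\<forall>y \<in> set xs. \<exists>l. y = TL l \<and> l \<noteq> [] \<and> incr nC l"
      using a s by (metis nth_mem)
    have "tset (avail M s a) = xs ! a" if "a < nA" for a
    proof -
      have "isset nC (xs ! a)" using xs that unfolding isset_iff by (metis nth_mem)
      then show ?thesis using unset_tset[of nC "xs ! a"] xs by (simp add: M)
    qed
    then have "avR M s = xs" unfolding avR_def M(1) using xs(2) by (auto intro: nth_equalityI)
    then show "TL (avR M s) = av ! s" "length (avR M s) = nA" using xs by simp_all
  qed
  have av: "avail M s a \<noteq> {} \<and> avail M s a \<subseteq> {..<nC}" if s: "s < nS" and a': "a < nA" for s a
  proof -
    obtain xs where xs: "av ! s = TL xs" "nA = length xs" "\<forall>y \<in> set xs. \<exists>l. y = TL l \<and> l \<noteq> [] \<and> incr nC l"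
      using a s by (metis nth_mem)
    then obtain l where l: "xs ! a = TL l" "l \<noteq> []" "incr nC l" using a' by (metis nth_mem)
    then have "isset nC (xs ! a)" unfolding isset_iff by blast
    then show ?thesis using unset_tset[of nC "xs ! a"] xs l by (simp add: M unset_def)
  qed
  have al: "(\<exists>l. TL l \<in> set al \<and> TN \<alpha> \<in> set l) <-> (\<exists>a \<in> Agt M. \<alpha> \<in> avail M s a)"
    if "s < nS" "av ! s = TL al" for s al \<alpha>
  proof -
    have "al = avR M s" using aT(1)[OF that(1)] that(2) by simp
    moreover have "TN \<alpha> \<in> set (map TN (sorted_list_of_set (avail M s a))) <-> \<alpha> \<in> avail M s a" if "a \<in> Agt M" for a
      using av[OF \<open>s < nS\<close>, of a] that finite_subset[of _ "{..<nC}"] by (auto simp: Agt_def M)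
    moreover have "(\<exists>l. TL l \<in> set (avR M s) \<and> TN \<alpha> \<in> set l) <->
        (\<exists>a \<in> Agt M. TN \<alpha> \<in> set (map TN (sorted_list_of_set (avail M s a))))"
      unfolding avR_def tset_def by (fastforce simp: Agt_def)
    ultimately show ?thesis by simp
  qed
  have cT: "TL (map (\<lambda>\<alpha>. TL (costR M s \<alpha>)) [0..<nC]) = cs ! s"
    and neg: "\<And>a \<alpha>. a \<in> Agt M ==> \<alpha> \<in> avail M s a ==> cost M s \<alpha> 0 \<le> - 1" if s: "s < nS" for s
  proof -
    obtain xs al' where xs: "cs ! s = TL xs" "av ! s = TL al'" "nC = length xs"
      and all: "\<forall>\<alpha> < nC. \<alpha> < length xs \<and> (\<exists>r. xs ! \<alpha> = TL r \<and>
          ((\<exists>l. TL l \<in> set al' \<and> TN \<alpha> \<in> set l) \<and> nR = length r \<and> (\<forall>x \<in> set r. tag x = 1) \<and> (\<exists>y ys. r = y # ys \<and> negt y) \<or>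
           \<not> (\<exists>l. TL l \<in> set al' \<and> TN \<alpha> \<in> set l) \<and> r = []))"
      using c(2)[rule_format, OF s] by (elim exE conjE) (rule that)
    have r: "\<exists>r. xs ! \<alpha> = TL r \<and>
          ((\<exists>a \<in> Agt M. \<alpha> \<in> avail M s a) \<and> nR = length r \<and> (\<forall>x \<in> set r. tag x = 1) \<and> (\<exists>y ys. r = y # ys \<and> negt y) \<or>
           \<not> (\<exists>a \<in> Agt M. \<alpha> \<in> avail M s a) \<and> r = [])" if "\<alpha> < nC" for \<alpha>
      using all[rule_format, OF that] unfolding al[OF s xs(2)] by (rule conjunct2)
    have row: "xs ! \<alpha> = TL (costR M s \<alpha>) \<and> ((\<exists>a \<in> Agt M. \<alpha> \<in> avail M s a) --> cost M s \<alpha> 0 \<le> - 1)" if \<alpha>: "\<alpha> < nC" for \<alpha>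
    proof (cases "\<exists>a \<in> Agt M. \<alpha> \<in> avail M s a")
      case True
      then obtain r where r: "xs ! \<alpha> = TL r" "nR = length r" "\<forall>x \<in> set r. tag x = 1" "\<exists>y ys. r = y # ys \<and> negt y"
        using r[OF \<alpha>] by blast
      have TI: "r ! V = TI (cost M s \<alpha> V)" if "V < nR" for V
      proof -
        have "tag (r ! V) = 1" using r(2,3) that by simp
        then obtain z where "r ! V = TI z" unfolding tag_1 ..
        then show ?thesis using r(1) xs(1) by (simp add: M)
      qed
      have "costR M s \<alpha> = map (\<lambda>k. TI (cost M s \<alpha> k)) [0..<nR]" unfolding costR_def M(2) using True by simp
      also have "\<dots> = r" by (rule nth_equalityI) (use TI r(2) in simp_all)
      finally have "costR M s \<alpha> = r" .
      moreover have "cost M s \<alpha> 0 < 0"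
      proof -
        obtain y ys where "r = y # ys" "negt y" using r(4) by blast
        then show ?thesis using TI[of 0] pos(2) negt_TI[of "cost M s \<alpha> 0"] by simp
      qed
      ultimately show ?thesis using r(1) by simp
    next
      case False
      then show ?thesis using r[OF \<alpha>] unfolding costR_def by auto
    qed
    have "xs = map (\<lambda>\<alpha>. TL (costR M s \<alpha>)) [0..<nC]"
      by (rule nth_equalityI) (use row xs(3) in simp_all)
    then show "TL (map (\<lambda>\<alpha>. TL (costR M s \<alpha>)) [0..<nC]) = cs ! s"
      using xs(1) by simp
    show "cost M s \<alpha> 0 \<le> - 1" if "a \<in> Agt M" "\<alpha> \<in> avail M s a" for a \<alpha>
    proof -
      have "\<alpha> < nC" using av[OF s, of a] that by (auto simp: Agt_def M)
      then show ?thesis using row[of \<alpha>] that by blast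
    qed
  qed
  have jl: "joint M s = set (jl M s)" if "s < nS" for s
    using av[OF that] finite_subset[of _ "{..<nC}"] by (intro set_jl[symmetric]) (auto simp: Agt_def M)
  have sT: "TL (succR M s) = su ! s" "\<sigma> \<in> set (jl M s) ==> succ M s \<sigma> < nS" if s': "s < nS" for s \<sigma>
  proof -
    obtain xs al' where xs: "su ! s = TL xs" "av ! s = TL al'" "length (product_lists (map unL al')) = length xs"
      "\<And>x. x \<in> set xs ==> \<exists>k. x = TN k \<and> k < nS"
      using s(2) s' by blast
    have "al' = avR M s" using aT(1)[OF s'] xs(2) by simp
    then have len: "length xs = length (jl M s)" using xs(3) product_avR[of M s] by simp
    \<comment> \<open>Joint actions occur once in \<open>jl M s\<close>, so the lookup returns the
      entry at the same position.\<close>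
    have nth: "succ M s (jl M s ! i) = unN (xs ! i)" if "i < length xs" for i
      using map_of_zip_nth[of "jl M s" xs i] distinct_jl len that xs(1) by (simp add: succ)
    have TN: "TN (succ M s (jl M s ! i)) = xs ! i \<and> succ M s (jl M s ! i) < nS" if "i < length xs" for i
      using xs(4)[of "xs ! i"] nth[OF that] that by auto
    have "succR M s = xs" unfolding succR_def by (rule nth_equalityI) (use TN len in simp_all)
    then show "TL (succR M s) = su ! s" using xs(1) by simp
    show "succ M s \<sigma> < nS" if "\<sigma> \<in> set (jl M s)"
      using that TN len by (metis in_set_conv_nth)
  qed
  have "valT M = vs" unfolding valT_def M(4) using v(1) vT by (auto intro: nth_equalityI)
  moreover have "avT M = av" unfolding avT_def M(3) using a(1) aT by (auto intro: nth_equalityI)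
  moreover have "costT M = cs" unfolding costT_def M(3,5) using c(1) cT by (auto intro!: nth_equalityI)
  moreover have "succT M = su" unfolding succT_def M(3) using s(1) sT by (auto intro: nth_equalityI)
  moreover have "is_rbcgs M"
    unfolding is_rbcgs_def using pos vT(2) av neg jl sT(2)
    by (auto simp: Agt_def Res_def St_def Act_def Props_def M(1-5))
  ultimately show ?thesis using M(1-5) by blast
qed

section \<open>Computations and the game in the logic\<close>

text \<open>A call changes only the parameter registers and those from 60 on, so the model can stay
  in global registers and is never passed.\<close>

definition menv :: "rbcgs => (nat => tr) => bool" where
  "menv M V <-> V 46 = num (nAgt M) \<and> V 47 = num (nRes M) \<and> V 48 = num (nSt M) \<and>
     V 49 = lst (map tt (avT M)) \<and> V 50 = lst (map tt (costT M)) \<and> V 51 = lst (map tt (succT M)) \<and>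
     V 52 = lst (map tt (valT M))"

lemma menv_upd [simp]: "v < 46 \<or> 52 < v ==> menv M (V(v := x)) = menv M V"
  by (auto simp: menv_def)

lemma menv_callenv [simp]: "length vs \<le> 8 ==> menv M (callenv vs V) = menv M V"
  by (simp add: menv_def callenv_app)

lemma menvD:
  assumes "menv M V"
  shows "V 46 = num (nAgt M)" "V 47 = num (nRes M)" "V 48 = num (nSt M)"
    "V 49 = lst (map tt (avT M))" "V 50 = lst (map tt (costT M))" "V 51 = lst (map tt (succT M))"
    "V 52 = lst (map tt (valT M))"
  using assms by (simp_all add: menv_def)

lemma ev_ex: "(\<And>x. sz x \<le> N ==> eval N J \<phi> (V(v := x)) = P x) ==> eval N J (FEx v \<phi>) V <-> (\<exists>x. sz x \<le> N \<and> P x)"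
  by (simp cong: conj_cong)

lemma ev_and0: "eval N J \<phi> V = P ==> eval N J \<psi> V = Q ==> eval N J (FAnd \<phi> \<psi>) V = (P \<and> Q)"
  by simp

lemma ev_nthc:
  assumes "ok N V" "3 * N \<le> d" "V l = lst xs" "V i = num k" "V v = x" "max l (max i v) < 60"
  shows "eval N (jump prog N d) (call p_nth [l, i, v]) V <-> k < length xs \<and> x = xs ! k"
  using assms by (simp add: base_jumps callenv_app)

lemma ev_memc:
  assumes "ok N V" "3 * N \<le> d" "V l = lst xs" "V v = x" "max l v < 60"
  shows "eval N (jump prog N d) (call p_mem [v, l]) V <-> x \<in> set xs"
  using assms by (simp add: base_jumps callenv_app)

text \<open>For a guessed register, whose content is not known to have the form \<open>tt t\<close>:
  the elements are arbitrary trees.\<close>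

lemma ev_tlstr:
  assumes "ok N V" "V x = y" "x \<noteq> 39" "x \<noteq> c" "c \<noteq> 39" "c \<noteq> 43"
    "\<And>zs. y = Nd (num 3) (lst zs) ==> sz (lst zs) \<le> N ==> eval N J \<phi> (V(39 := num 3, c := lst zs)) = P zs"
  shows "eval N J (tlst x c \<phi>) V <-> (\<exists>zs. y = Nd (num 3) (lst zs) \<and> P zs)"
proof -
  have "sz y \<le> N" using okD[OF assms(1), of x] assms(2) by simp
  then have "eval N J (tlst x c \<phi>) V <-> (\<exists>b. y = Nd (num 3) b \<and> sz b \<le> N \<and> eval N J \<phi> (V(39 := num 3, c := b)))"
    unfolding tlst_def using assms(1-6) ok_const(4)[OF assms(1)] by (auto simp: eval_Mat_sz simp del: eval_Mat)
  also have "\<dots> <-> (\<exists>zs. y = Nd (num 3) (lst zs) \<and> P zs)"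
  proof -
    have "(\<exists>b. Q b) <-> (\<exists>zs. Q (lst zs))" for Q by (metis lst_els)
    then show ?thesis using assms(7) \<open>sz y \<le> N\<close> by (auto dest: sz_Nd_le)
  qed
  finally show ?thesis .
qed

lemma bval_bits [simp]: "bval (map sc (bits k)) = k"
proof (induction k rule: less_induct)
  case (less k)
  show ?case
  proof (cases "k = 0")
    case False
    have "sc Zero = Lf" "sc One \<noteq> Lf" by simp_all
    then show ?thesis using False less[of "k div 2"] by (simp add: bits_pos[of k])
  qed simp
qed

lemma ev_add:
  assumes "ok N V" "3 * N \<le> d" "V c = num 0" "V x = lst (map sc (bits i))" "V y = lst (map sc (bits j))"
    "V z = lst (map sc (bits k))" "max c (max x (max y z)) < 60"
  shows "eval N (jump prog N d) (call p_add [c, x, y, z]) V <-> i + j = k"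
proof -
  have "sz (V x) + sz (V y) + sz (V z) \<le> d"
    using okD[OF assms(1), of x] okD[OF assms(1), of y] okD[OF assms(1), of z] assms(2) by linarith
  then show ?thesis using assms by (simp add: jump_add callenv_app)
qed

definition costrel :: "int => nat => nat => bool" where
  "costrel z e e' <-> (if z < 0 then e' + nat \<bar>z\<bar> = e else e + nat \<bar>z\<bar> = e')"

lemma ev_cost:
  assumes "ok N V" "3 * N \<le> d" "V 19 = tt (TI z)" "V 14 = lst (map sc (bits e))" "V 16 = lst (map sc (bits e'))"
  shows "eval N (jump prog N d) (Mat 19 22 23 (Mat 23 24 25
          (FOr (FAnd (FEq 24 40) (call p_add [40, 14, 25, 16]))
               (FAnd (FEq 24 41) (call p_add [40, 16, 25, 14]))))) V <-> costrel z e e'" (is "eval _ _ ?\<phi> _ <-> _")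
proof -
  have sz: "sz (tt (TI z)) \<le> N" using okD[OF assms(1), of 19] assms(3) by simp
  define s where "s = (if z < 0 then num 1 else num 0)"
  let ?b = "lst (map sc (bits (nat \<bar>z\<bar>)))"
  have tt: "tt (TI z) = Nd (num 1) (Nd s ?b)" by (simp add: tt.simps s_def)
  have "sz (num 1) \<le> N" "sz s \<le> N" "sz ?b \<le> N" "sz (Nd s ?b) \<le> N" using sz unfolding tt by simp_all
  then have ok: "ok N (V(22 := num 1, 23 := Nd s ?b, 24 := s, 25 := ?b))" (is "ok N ?V")
    using assms(1) by simp
  have "eval N (jump prog N d) ?\<phi> V <-> eval N (jump prog N d)
      (FOr (FAnd (FEq 24 40) (call p_add [40, 14, 25, 16])) (FAnd (FEq 24 41) (call p_add [40, 16, 25, 14]))) ?V"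
    using assms(1,3) \<open>sz (num 1) \<le> N\<close> \<open>sz s \<le> N\<close> \<open>sz ?b \<le> N\<close> \<open>sz (Nd s ?b) \<le> N\<close> sz
    unfolding tt by (simp add: eval_Mat_sz del: eval_Mat num_1 eval_FAnd sz_simps eval.simps(5))
  also have "\<dots> <-> (s = num 0 \<and> e + nat \<bar>z\<bar> = e' \<or> s = num 1 \<and> e' + nat \<bar>z\<bar> = e)"
    apply (rule ev_or ev_and0 ev_eq ev_add | (simp add: ok ok_const[OF assms(1)] assms(2,4,5) del: num_1; fail))+
    done
  also have "\<dots> <-> costrel z e e'" by (auto simp: costrel_def s_def)
  finally show ?thesis .
qed

lemma nth_tables:
  "s < nSt M ==> avT M ! s = TL (avR M s)"
  "s < nSt M ==> succT M ! s = TL (succR M s)"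
  "s < nSt M ==> costT M ! s = TL (map (\<lambda>\<alpha>. TL (costR M s \<alpha>)) [0..<nAct M])"
  "p < nProp M ==> valT M ! p = tset (val M p)"
  "length (avT M) = nSt M" "length (succT M) = nSt M" "length (costT M) = nSt M" "length (valT M) = nProp M"
  by (simp_all add: tables)

lemma ev_lookup:
  assumes ok: "ok N V" and d: "3 * N \<le> d" and m: "menv M V"
    and r: "V 0 = num s" "V 1 = num \<alpha>" "V 8 = num k" "V 14 = lst (map sc (bits e))" "V 16 = lst (map sc (bits e'))"
    and s: "s < nSt M" and a: "a \<in> Agt M" "\<alpha> \<in> avail M s a" "\<alpha> < nAct M" and k: "k < nRes M"
  shows "eval N (jump prog N d) (FEx 17 (FEx 18 (FEx 19
      (FAnd (call p_nth [50, 0, 17]) (tlst 17 20 (FAnd (call p_nth [20, 1, 18]) (tlst 18 21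
        (FAnd (call p_nth [21, 8, 19]) (Mat 19 22 23 (Mat 23 24 25
          (FOr (FAnd (FEq 24 40) (call p_add [40, 14, 25, 16]))
               (FAnd (FEq 24 41) (call p_add [40, 16, 25, 14]))))))))))))) V <-> costrel (cost M s \<alpha> k) e e'"
proof -
  note c = ok_const[OF ok] N_facts[OF ok]
  let ?T = "tt (costT M ! s)" and ?R = "tt (TL (costR M s \<alpha>))" and ?C = "tt (TI (cost M s \<alpha> k))"
  have R: "costR M s \<alpha> = map (\<lambda>k. TI (cost M s \<alpha> k)) [0..<nRes M]" using a by (auto simp: costR_def)
  have Rk: "costR M s \<alpha> ! k = TI (cost M s \<alpha> k)" "length (costR M s \<alpha>) = nRes M" using k by (simp_all add: R)
  have "sz ?T \<le> N"
    using sz_tt_mem[OF nth_mem, of s "costT M" N] okD[OF ok, of 50] menvD(5)[OF m] s by (simp add: nth_tables(7))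
  moreover then have "sz ?R \<le> N"
    using sz_tt_mem[of "TL (costR M s \<alpha>)" "map (\<lambda>\<alpha>. TL (costR M s \<alpha>)) [0..<nAct M]" N] a(3) s by (simp add: nth_tables tt.simps)
  moreover then have "sz ?C \<le> N"
    using sz_tt_mem[of "TI (cost M s \<alpha> k)" "costR M s \<alpha>" N] k R by (simp add: tt.simps)
  ultimately have sz: "sz ?T \<le> N" "sz ?R \<le> N" "sz ?C \<le> N" .
  show ?thesis
    apply (rule trans)
     apply (rule ev_ex ev_and ev_nthc ev_tlst ev_cost | (simp add: ok d r c menvD[OF m] sz_num s nth_tables a(3) k Rk; fail))+
    using sz s a(3) k r by (auto simp: nth_tables Rk)
qed

lemma ev_all_lt':
  assumes "ok N V" "3 * N \<le> d" "V n = num m" "distinct [v, n, h, t]" "max (max v n) (max h t) < 60"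
    "h < 40 \<or> 45 < h" "t < 40 \<or> 45 < t" "v < 40 \<or> 45 < v"
    "\<And>k. k < m ==> sz (num k) \<le> N ==> sz (tt (TN k)) \<le> N ==> eval N (jump prog N d) \<phi> (V(v := num k)) = P k"
  shows "eval N (jump prog N d) (FAll v (FImp (lt v n h t) \<phi>)) V <-> (\<forall>k < m. P k)"
proof (rule ev_all_lt[OF assms(1-8)])
  fix k assume k: "k < m" "sz (num k) \<le> N"
  have "sz (num m) \<le> N" using okD[OF assms(1), of n] assms(3) by simp
  then have "sz (tt (TN k)) \<le> N" using k(1) by (simp add: sz_num tt.simps)
  then show "eval N (jump prog N d) \<phi> (V(v := num k)) = P k" using assms(9) k by blast
qed

lemma ev_MatU:
  assumes "ok N V" "V l = tt (TU e)" "distinct [l, h, u]"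
    "sz (lst (map sc (bits e))) \<le> N ==> eval N J \<phi> (V(h := num 2, u := lst (map sc (bits e)))) = P"
  shows "eval N J (Mat l h u \<phi>) V = P"
  using assms okD[OF assms(1), of l] by (simp add: tt.simps)

lemma ev_canon:
  assumes "ok N V" "3 * N \<le> d" "V v = b" "v < 60"
    "\<And>k. b = lst (map sc (bits k)) ==> eval N (jump prog N d) \<phi> V = P k"
  shows "eval N (jump prog N d) (FAnd (call p_canon [v]) \<phi>) V <-> (\<exists>k. b = lst (map sc (bits k)) \<and> P k)"
  using assms by (auto simp: bits_canon_N callenv_app)

lemma jump_row:
  assumes ok: "ok N V" and d: "5 * N \<le> d" and m: "menv M V"
    and r: "V 0 = num s" "V 1 = num \<alpha>" "V 2 = lst (map tt (map (\<lambda>k. TU (e k)) [0..<nRes M]))" "V 3 = lst ws"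
    and s: "s < nSt M" and a: "a \<in> Agt M" "\<alpha> \<in> avail M s a" "\<alpha> < nAct M"
  shows "jump prog N d p_row V <-> nRes M = length ws \<and>
    (\<forall>k < nRes M. \<exists>e'. ws ! k = tt (TU e') \<and> costrel (cost M s \<alpha> k) (e k) e')"
proof -
  note c = ok_const[OF ok] N_facts[OF ok]
  obtain d' where d': "d = Suc d'" using d c(7) by (cases d) auto
  have f: "4 * N \<le> d'" "3 * N \<le> d'" using d c(7) d' by simp_all
  have "eval N (jump prog N d') f_row V <-> nRes M = length ws \<and>
    (\<forall>k < nRes M. \<exists>e'. ws ! k = tt (TU e') \<and> costrel (cost M s \<alpha> k) (e k) e')"
    unfolding f_row_def
    apply (rule trans)
     apply (rule ev_canon ev_and ev_len ev_all_lt ev_nth2 ev_MatU[where l = 11] ev_Mat ev_eq ev_lookup[where M = M and s = s and \<alpha> = \<alpha> and a = a]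
      | (simp add: ok f r c menvD[OF m] m sz_num s a; fail))+
    apply (simp add: tt.simps cong: conj_cong)
    apply blast
    done
  then show ?thesis unfolding d' jump.simps prog_simps .
qed

definition rowE :: "rbcgs => endowment => nat => tin list" where
  "rowE M e a = map (\<lambda>k. TU (e (a, k))) [0..<nRes M]"

lemma ten_rowE: "ten M e = TL (map (\<lambda>a. TL (rowE M e a)) [0..<nAgt M])"
  by (simp add: ten_def rowE_def)

lemma ev_mkn:
  assumes "V z = num 0" "V i = num a" "v \<noteq> z" "v \<noteq> i" "sz (tt (TN a)) \<le> N" "eval N J \<phi> (V(v := tt (TN a))) = P"
  shows "eval N J (FMk v z i \<phi>) V = P"
  using assms by (simp add: tt.simps)

text \<open>On natural numbers, \<open>e' + nat \<bar>z\<bar> = e\<close> already contains that the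
  cost can be paid.\<close>

lemma costrel_iff: "costrel (cost M s \<alpha> k) e e' <->
    consumed M k s \<alpha> \<le> e \<and> e' = e + produced M k s \<alpha> - consumed M k s \<alpha>"
  unfolding costrel_def consumed_def produced_def by (auto simp: max_def min_def)

lemma map_upt_iff: "zs = map g [0..<n] <-> n = length zs \<and> (\<forall>a < n. zs ! a = g a)"
  unfolding list_eq_iff_nth_eq by (simp cong: conj_cong) blast

lemma rowE_upd:
  assumes "a < nAgt M" "nRes M = length ws" "a \<in> C"
  shows "(\<forall>k < nRes M. \<exists>e'. ws ! k = tt (TU e') \<and> costrel (cost M s (\<sigma> ! a) k) (e (a, k)) e') <->
    (\<forall>k < nRes M. consumed M k s (\<sigma> ! a) \<le> e (a, k)) \<and> ws = map tt (rowE M (upd_en M C s \<sigma> e) a)"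
proof -
  let ?f = "\<lambda>k. e (a, k) + produced M k s (\<sigma> ! a) - consumed M k s (\<sigma> ! a)"
  have "rowE M (upd_en M C s \<sigma> e) a = map (\<lambda>k. TU (?f k)) [0..<nRes M]"
    unfolding rowE_def by (rule map_cong) (use assms in \<open>simp_all add: upd_en_def Agt_def Res_def\<close>)
  then have eq: "map tt (rowE M (upd_en M C s \<sigma> e) a) = map (\<lambda>k. tt (TU (?f k))) [0..<nRes M]"
    by (simp add: comp_def)
  have W: "ws = map tt (rowE M (upd_en M C s \<sigma> e) a) <-> (\<forall>k < nRes M. ws ! k = tt (TU (?f k)))"
    unfolding eq map_upt_iff using assms(2) by simp
  have R: "(\<exists>e'. z = tt (TU e') \<and> costrel (cost M s (\<sigma> ! a) k) (e (a, k)) e') <->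
      consumed M k s (\<sigma> ! a) \<le> e (a, k) \<and> z = tt (TU (?f k))" for z k
    unfolding costrel_iff by (intro iffI; elim exE conjE) simp_all
  show ?thesis unfolding W R by (rule iffI) simp_all
qed

lemma ev_TL:
  assumes "ok N V" "V x = tt (TL xs)" "x \<noteq> 39" "x \<noteq> c" "c \<noteq> 39" "c \<noteq> 43"
    "sz (lst (map tt xs)) \<le> N ==> eval N J \<phi> (V(39 := num 3, c := lst (map tt xs))) = P"
  shows "eval N J (tlst x c \<phi>) V = P"
proof -
  have "eval N J (tlst x c \<phi>) V <-> (\<exists>ys. TL xs = TL ys \<and> P)"
    by (rule ev_tlst[OF assms(1-6)]) (use assms(7) in simp)
  then show ?thesis by simp
qed

lemma ev_TN:
  assumes "ok N V" "V x = tt (TN k)" "x \<noteq> 38" "x \<noteq> u" "u \<noteq> 38" "u \<noteq> 40"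
    "sz (num k) \<le> N ==> eval N J \<phi> (V(38 := num 0, u := num k)) = P"
  shows "eval N J (tnum x u \<phi>) V = P"
proof -
  have "eval N J (tnum x u \<phi>) V <-> (\<exists>j. TN k = TN j \<and> P)"
    by (rule ev_tnum[OF assms(1-6)]) (use assms(7) in simp)
  then show ?thesis by simp
qed

lemma joint_avail:
  assumes "is_rbcgs M" "s < nSt M" "\<sigma> \<in> joint M s" "a < nAgt M"
  shows "\<sigma> ! a \<in> avail M s a \<and> \<sigma> ! a < nAct M"
proof -
  have "\<sigma> ! a \<in> avail M s a" using assms(3,4) unfolding joint_def Agt_def by blast
  moreover have "avail M s a \<subseteq> Act M" using assms(1,2,4) unfolding is_rbcgs_def St_def Agt_def by blast
  ultimately show ?thesis unfolding Act_def by blast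
qed

text \<open>The new endowment in register 3 is a guess and may be any tree; the procedure pins it
  down to the encoding of the updated endowment.\<close>

lemma jump_upd:
  assumes M: "is_rbcgs M" and ok: "ok N V" and d: "6 * N \<le> d" and m: "menv M V"
    and r: "V 0 = num s" "V 1 = lst (map tt (map TN \<sigma>))" "V 2 = tt (ten M e)" "V 3 = y" "V 4 = tt (tset A)" "V 5 = tt (tset B)"
    and s: "s < nSt M" and \<sigma>: "\<sigma> \<in> joint M s" and fin: "finite A" "finite B" and sub: "A \<union> B \<subseteq> Agt M" and e: "e \<in> En M"
  shows "jump prog N d p_upd V <-> affordable M (A \<union> B) s \<sigma> e \<and> y = tt (ten M (upd_en M (A \<union> B) s \<sigma> e))"
proof -
  note c = ok_const[OF ok] N_facts[OF ok]
  obtain d' where d': "d = Suc d'" using d c(7) by (cases d) auto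
  have f: "5 * N \<le> d'" "4 * N \<le> d'" "3 * N \<le> d'" using d c(7) d' by simp_all
  have len: "length \<sigma> = nAgt M" using \<sigma> by (simp add: joint_def)
  have av: "\<sigma> ! a \<in> avail M s a" "\<sigma> ! a < nAct M" if "a < nAgt M" for a
    using joint_avail[OF M s \<sigma> that] by simp_all
  have row: "jump prog N d' p_row V' <-> nRes M = length ws \<and>
      (\<forall>k < nRes M. \<exists>e'. ws ! k = tt (TU e') \<and> costrel (cost M s (\<sigma> ! a) k) (e (a, k)) e')"
    if "ok N V'" "menv M V'" "V' 10 = num a" "V' 0 = num s" "V' 1 = num \<alpha>" "\<alpha> = \<sigma> ! a"
      "V' 2 = lst (map tt xs)" "xs = rowE M e a" "V' 3 = lst ws" "a < nAgt M" for V' a \<alpha> xs ws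
    using jump_row[OF that(1) f(1) that(2,4,5) _ that(9) s, of "\<lambda>k. e (a, k)" a] av[OF that(10)] that(6-8,10)
    by (simp add: rowE_def Agt_def)
  have mem: "tt (TN k) \<in> set (map tt (map TN (sorted_list_of_set S))) <-> k \<in> S" if "finite S" for k S
    using that by auto
  have row_eq: "(a \<in> A \<union> B \<and> (\<exists>ws. z = Nd (num 3) (lst ws) \<and> nRes M = length ws \<and>
        (\<forall>k < nRes M. \<exists>e'. ws ! k = tt (TU e') \<and> costrel (cost M s (\<sigma> ! a) k) (e (a, k)) e')) \<or>
        a \<notin> A \<union> B \<and> z = tt (TL (rowE M e a))) <->
      (a \<in> A \<union> B --> (\<forall>k < nRes M. consumed M k s (\<sigma> ! a) \<le> e (a, k))) \<and>
      z = tt (TL (rowE M (upd_en M (A \<union> B) s \<sigma> e) a))" if "a < nAgt M" for a z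
  proof (cases "a \<in> A \<union> B")
    case True
    show ?thesis
    proof -
      let ?r = "rowE M (upd_en M (A \<union> B) s \<sigma> e) a"
      have "(\<exists>ws. z = Nd (num 3) (lst ws) \<and> nRes M = length ws \<and>
          (\<forall>k < nRes M. \<exists>e'. ws ! k = tt (TU e') \<and> costrel (cost M s (\<sigma> ! a) k) (e (a, k)) e')) <->
        (\<exists>ws. z = Nd (num 3) (lst ws) \<and> nRes M = length ws \<and>
          (\<forall>k < nRes M. consumed M k s (\<sigma> ! a) \<le> e (a, k)) \<and> ws = map tt ?r)"
        by (rule ex_cong1, rule conj_cong[OF refl], rule conj_cong[OF refl], rule rowE_upd[OF that _ True])
      also have "\<dots> <-> (\<forall>k < nRes M. consumed M k s (\<sigma> ! a) \<le> e (a, k)) \<and> z = tt (TL ?r)"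
      proof -
        have "nRes M = length (map tt ?r)" by (simp add: rowE_def)
        then show ?thesis unfolding tt.simps(4) by blast
      qed
      finally show ?thesis using True by blast
    qed
  next
    case False
    have "rowE M (upd_en M (A \<union> B) s \<sigma> e) a = rowE M e a"
      unfolding rowE_def by (rule map_cong) (use False that in \<open>simp_all add: upd_en_def Agt_def Res_def\<close>)
    then show ?thesis using False by simp
  qed
  have "eval N (jump prog N d') f_upd V <-> (\<exists>zs. y = Nd (num 3) (lst zs) \<and> nAgt M = length zs \<and>
      (\<forall>a < nAgt M. a \<in> A \<union> B \<and> (\<exists>ws. zs ! a = Nd (num 3) (lst ws) \<and> nRes M = length ws \<and>
        (\<forall>k < nRes M. \<exists>e'. ws ! k = tt (TU e') \<and> costrel (cost M s (\<sigma> ! a) k) (e (a, k)) e')) \<or>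
        a \<notin> A \<union> B \<and> zs ! a = tt (TL (rowE M e a))))"
    unfolding f_upd_def
    apply (rule trans)
     apply (rule ev_TL[where x = 2] ev_tlstr[where x = 3] ev_and ev_or ev_not ev_len ev_all_lt' ev_nth2 ev_nth ev_mkn ev_TL[where x = 4] ev_TL[where x = 5] ev_memc
        ev_TN ev_TL[where x = 13] ev_tlstr[where x = 14] ev_eq ev_call row
      | (simp add: ok f r c menvD[OF m] m sz_num s callenv_app ten_rowE len tset_def; fail))+
    apply (simp only: mem fin flip: map_map)
    apply (simp add: len eq_commute[of "tt (TL (rowE M e _))"] cong: conj_cong)
    done
  also have "\<dots> <-> (\<exists>zs. y = Nd (num 3) (lst zs) \<and> nAgt M = length zs \<and> (\<forall>a < nAgt M.
      (a \<in> A \<union> B --> (\<forall>k < nRes M. consumed M k s (\<sigma> ! a) \<le> e (a, k))) \<and>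
      zs ! a = tt (TL (rowE M (upd_en M (A \<union> B) s \<sigma> e) a))))"
    using row_eq by (simp cong: conj_cong)
  also have "\<dots> <-> affordable M (A \<union> B) s \<sigma> e \<and> y = tt (ten M (upd_en M (A \<union> B) s \<sigma> e))"
  proof -
    have aff: "affordable M (A \<union> B) s \<sigma> e <->
        (\<forall>a < nAgt M. a \<in> A \<union> B --> (\<forall>k < nRes M. consumed M k s (\<sigma> ! a) \<le> e (a, k)))"
      using sub unfolding affordable_def Agt_def Res_def by blast
    let ?g = "\<lambda>a. tt (TL (rowE M (upd_en M (A \<union> B) s \<sigma> e) a))"
    have "tt (ten M (upd_en M (A \<union> B) s \<sigma> e)) = Nd (num 3) (lst (map ?g [0..<nAgt M]))"
      by (simp only: ten_rowE tt.simps(4)[of "map _ _"] map_map comp_def)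
    then have y: "y = tt (ten M (upd_en M (A \<union> B) s \<sigma> e)) <-> (\<exists>zs. y = Nd (num 3) (lst zs) \<and> nAgt M = length zs \<and>
        (\<forall>a < nAgt M. zs ! a = ?g a))"
      unfolding map_upt_iff[symmetric] by (simp only:) blast
    have "(\<exists>zs. X zs \<and> Y zs \<and> (\<forall>a < n. P a \<and> Q zs a)) <-> (\<forall>a < n. P a) \<and> (\<exists>zs. X zs \<and> Y zs \<and> (\<forall>a < n. Q zs a))"
      for X Y :: "tr list => bool" and P Q and n :: nat
      by blast
    then show ?thesis unfolding aff y .
  qed
  finally show ?thesis unfolding d' jump.simps prog_simps .
qed

definition acts :: "nat list => tr" where "acts \<sigma> = lst (map tt (map TN \<sigma>))"

lemma acts_inj [simp]: "acts \<sigma> = acts \<tau> <-> \<sigma> = \<tau>"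
proof -
  have "inj (\<lambda>x. tt (TN x))" by (simp add: inj_def)
  then show ?thesis by (simp add: acts_def comp_def inj_map_eq_map)
qed

definition setL :: "nat set => tin list" where "setL S = map TN (sorted_list_of_set S)"

lemma tset_setL: "tset S = TL (setL S)"
  by (simp add: tset_def setL_def)

lemma ev_nth_acts:
  assumes "ok N V" "3 * N \<le> d" "V l = acts \<sigma>" "V i = num k"
    "distinct [a, l, i]" "max a (max l i) < 60" "a < 40 \<or> 45 < a"
    "k < length \<sigma> ==> sz (tt (TN (\<sigma> ! k))) \<le> N ==> eval N (jump prog N d) \<phi> (V(a := tt (TN (\<sigma> ! k)))) = P"
  shows "eval N (jump prog N d) (FEx a (FAnd (call p_nth [l, i, a]) \<phi>)) V <-> k < length \<sigma> \<and> P"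
proof -
  have "eval N (jump prog N d) (FEx a (FAnd (call p_nth [l, i, a]) \<phi>)) V <-> k < length (map tt (map TN \<sigma>)) \<and> P"
    by (rule ev_nth[OF assms(1,2) assms(3)[unfolded acts_def] assms(4-7)]) (use assms(8) in simp)
  then show ?thesis by simp
qed

lemma ev_nthc_acts:
  assumes "ok N V" "3 * N \<le> d" "V l = acts \<sigma>" "V i = num k" "V v = tt (TN j)" "max l (max i v) < 60"
  shows "eval N (jump prog N d) (call p_nth [l, i, v]) V <-> k < length \<sigma> \<and> j = \<sigma> ! k"
  using ev_nthc[OF assms(1,2) assms(3)[unfolded acts_def] assms(4-6)] by (auto cong: conj_cong)

text \<open>The guessed index matters only through its number of elements, and \<open>num k\<close>
  is a witness of admissible size for every position \<open>k\<close>.\<close>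

lemma ev_ex_nth:
  assumes "ok N V" "3 * N \<le> d" "V l = lst xs" "distinct [a, b, l]" "max a (max l b) < 60" "a < 40 \<or> 45 < a" "b < 40 \<or> 45 < b"
    "\<And>x k. length (els x) = k ==> sz x \<le> N ==> k < length xs ==> sz (xs ! k) \<le> N ==>
      eval N (jump prog N d) \<phi> (V(a := x, b := xs ! k)) = P k"
  shows "eval N (jump prog N d) (FEx a (FEx b (FAnd (call p_nth [l, a, b]) \<phi>))) V <-> (\<exists>k < length xs. P k)"
proof -
  have ne: "a \<noteq> b" "l \<noteq> a" "l \<noteq> b" using assms(4) by auto
  have szx: "k < length xs ==> sz (xs ! k) \<le> N" for k
    using sz_lst_mem[of "xs ! k" xs] okD[OF assms(1), of l] assms(3) by (auto intro: order_trans)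
  have szn: "sz (num (length xs)) \<le> N"
  proof -
    have "sz (num (length xs)) \<le> sz (lst xs)"
    proof (induction xs)
      case (Cons x xs)
      then show ?case using sz_pos[of x] by simp
    qed simp
    then show ?thesis using okD[OF assms(1), of l] assms(3) by simp
  qed
  have "eval N (jump prog N d) (FEx a (FEx b (FAnd (call p_nth [l, a, b]) \<phi>))) V <->
    (\<exists>x. sz x \<le> N \<and> (\<exists>y. sz y \<le> N \<and> (length (els x) < length xs \<and> y = xs ! length (els x)) \<and>
       eval N (jump prog N d) \<phi> (V(a := x, b := y))))"
    using assms(1-3,5-7) ne szx by (simp add: base_jumps callenv_app cong: conj_cong)
  also have "\<dots> <-> (\<exists>x. sz x \<le> N \<and> length (els x) < length xs \<and> P (length (els x)))"
    by (rule ex_cong1) (use assms(8)[OF refl] szx in auto)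
  also have "\<dots> <-> (\<exists>k < length xs. P k)"
  proof
    assume "\<exists>k < length xs. P k"
    then obtain k where k: "k < length xs" "P k" by blast
    then have "sz (num k) \<le> N" using sz_num_less[OF k(1) szn] by simp
    then show "\<exists>x. sz x \<le> N \<and> length (els x) < length xs \<and> P (length (els x))"
      using k by (intro exI[of _ "num k"]) simp
  qed blast
  finally show ?thesis .
qed

lemma ev_nthl:
  assumes "ok N V" "3 * N \<le> d" "V l = lst xs" "length (els (V i)) = k"
    "distinct [a, l, i]" "max a (max l i) < 60" "a < 40 \<or> 45 < a"
    "k < length xs ==> sz (xs ! k) \<le> N ==> eval N (jump prog N d) \<phi> (V(a := xs ! k)) = P"
  shows "eval N (jump prog N d) (FEx a (FAnd (call p_nth [l, i, a]) \<phi>)) V <-> k < length xs \<and> P"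
proof -
  have "eval N (jump prog N d) (FEx a (FAnd (call p_nth [l, i, a]) \<phi>)) V <->
    (\<exists>x. sz x \<le> N \<and> (k < length xs \<and> x = xs ! k) \<and> eval N (jump prog N d) \<phi> (V(a := x)))"
    using assms(1-7) by (simp add: base_jumps callenv_app cong: conj_cong)
  also have "\<dots> <-> k < length xs \<and> P"
    using assms(8) sz_lst_mem[of "xs ! k" xs] okD[OF assms(1), of l] by (auto simp: assms(3) intro: order_trans)
  finally show ?thesis .
qed

lemma ev_prodM:
  assumes "is_rbcgs M" "s < nSt M" "ok N V" "3 * N \<le> d" "V l = lst (map tt (avR M s))" "l \<noteq> v" "max l v < 60" "v < 40 \<or> 45 < v"
    "sz (lst (map acts (jl M s))) \<le> N" "eval N (jump prog N d) \<phi> (V(v := lst (map acts (jl M s)))) = P"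
  shows "eval N (jump prog N d) (FEx v (FAnd (call p_prod [l, v]) \<phi>)) V = P"
proof -
  have ne: "\<forall>x \<in> set (avR M s). \<exists>xs. x = TL xs \<and> xs \<noteq> []"
  proof
    fix x assume "x \<in> set (avR M s)"
    then obtain a where a: "a < nAgt M" "x = tset (avail M s a)" by (auto simp: avR_def)
    then have "finite (avail M s a)" "avail M s a \<noteq> {}"
      using is_rbcgs_finite[OF assms(1), of s a] assms(1,2) by (auto simp: St_def Agt_def is_rbcgs_def)
    then show "\<exists>xs. x = TL xs \<and> xs \<noteq> []" using a(2) by (simp add: tset_def)
  qed
  have "map (\<lambda>xs. lst (map tt xs)) (product_lists (map unL (avR M s))) = map acts (jl M s)"
    unfolding product_avR by (simp add: acts_def)
  then have "eval N (jump prog N d) (FEx v (FAnd (call p_prod [l, v]) \<phi>)) V <-> sz (lst (map acts (jl M s))) \<le> N \<and> P"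
    using ev_prod[OF assms(3-8) ne, of \<phi> P] assms(10) by simp
  then show ?thesis using assms(9) by simp
qed

lemma jump_step:
  assumes M: "is_rbcgs M" and ok: "ok N V" and d: "7 * N \<le> d" and m: "menv M V"
    and r: "V 0 = num s" "V 1 = tt (ten M e)" "V 2 = acts \<alpha>" "V 3 = x" "V 4 = y" "V 5 = tt (tset A)" "V 6 = tt (tset B)"
    and s: "s < nSt M" and sub: "A \<subseteq> Agt M" "B \<subseteq> Agt M" and e: "e \<in> En M" and \<alpha>: "length \<alpha> = nAgt M"
    and psz: "sz (lst (map acts (jl M s))) \<le> N"
  shows "jump prog N d p_step V <-> (\<exists>c. stp M A B \<alpha> (s, e) c \<and> x = num (fst c) \<and> y = tt (ten M (snd c)))"
proof -
  note c = ok_const[OF ok] N_facts[OF ok]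
  obtain d' where d': "d = Suc d'" using d c(7) by (cases d) auto
  have f: "6 * N \<le> d'" "5 * N \<le> d'" "4 * N \<le> d'" "3 * N \<le> d'" using d c(7) d' by simp_all
  have fin: "finite A" "finite B" using sub finite_subset[of _ "{..<nAgt M}"] by (auto simp: Agt_def)
  have sub': "A \<union> B \<subseteq> Agt M" using sub by blast
  have jl: "set (jl M s) = joint M s"
    using is_rbcgs_finite[OF M, of s] s by (intro set_jl) (simp add: St_def)
  have len: "length (jl M s ! k) = nAgt M" if "k < length (jl M s)" for k
    using that jl nth_mem[OF that] unfolding joint_def by simp
  have succR: "length (succR M s) = length (jl M s)" "k < length (jl M s) ==> succR M s ! k = TN (succ M s (jl M s ! k))" for k
    by (simp_all add: succR_def)
  have upd: "jump prog N d' p_upd V' <-> affordable M (A \<union> B) s \<sigma> e \<and> y = tt (ten M (upd_en M (A \<union> B) s \<sigma> e))"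
    if "ok N V'" "menv M V'" "V' 1 = acts \<sigma>" "V' 0 = num s" "V' 2 = tt (ten M e)" "V' 3 = y"
      "V' 4 = tt (tset A)" "V' 5 = tt (tset B)" "\<sigma> \<in> set (jl M s)" for V' \<sigma>
    by (rule jump_upd[OF M that(1) f(1) that(2,4) that(3)[unfolded acts_def] that(5-8) s _ fin sub' e]) (use that(9) jl in simp)
  have setA: "(\<forall>x \<in> set (setL A). \<exists>j. x = TN j \<and> Q j) <-> (\<forall>a \<in> A. Q a)" for Q
    using fin(1) by (simp add: setL_def)
  have "eval N (jump prog N d') f_step V <-> (\<exists>k < length (jl M s). num (succ M s (jl M s ! k)) = x \<and> (\<forall>a \<in> A. jl M s ! k ! a = \<alpha> ! a) \<and>
      affordable M (A \<union> B) s (jl M s ! k) e \<and> y = tt (ten M (upd_en M (A \<union> B) s (jl M s ! k) e)))"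
    unfolding f_step_def
    apply (rule trans)
     apply (rule ev_nth[where a = 8] ev_TL[where x = 8] ev_prodM[OF M s] ev_ex_nth ev_and ev_nth[where a = 13] ev_TL[where x = 13] ev_nthl[where a = 15]
        ev_TN[where x = 15] ev_eq ev_TL[where x = 5] ev_all_memt ev_tnum ev_nth_acts[where a = 20] ev_nthc_acts ev_call upd
      | (simp add: ok f r c menvD[OF m] m sz_num s callenv_app nth_tables tset_setL psz succR; fail))+
    apply (simp add: nth_tables s succR setA cong: conj_cong)
    apply (intro ex_cong1 conj_cong refl ball_cong)
    using sub(1) len \<alpha> by (auto simp: Agt_def)
  also have "\<dots> <-> (\<exists>\<sigma> \<in> set (jl M s). num (succ M s \<sigma>) = x \<and> (\<forall>a \<in> A. \<sigma> ! a = \<alpha> ! a) \<and>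
      affordable M (A \<union> B) s \<sigma> e \<and> y = tt (ten M (upd_en M (A \<union> B) s \<sigma> e)))"
  proof -
    have "(\<exists>k < length xs. P (xs ! k)) <-> (\<exists>x \<in> set xs. P x)" for P and xs :: "nat list list"
      by (metis in_set_conv_nth)
    then show ?thesis .
  qed
  also have "\<dots> <-> (\<exists>c. stp M A B \<alpha> (s, e) c \<and> x = num (fst c) \<and> y = tt (ten M (snd c)))"
    unfolding jl stp_def by auto
  finally show ?thesis unfolding d' jump.simps prog_simps .
qed

section \<open>Computations as trees\<close>

definition ctree :: "rbcgs => (nat \<times> endowment) list => tr" where
  "ctree M \<pi> = lst (map (\<lambda>c. Nd (num (fst c)) (tt (ten M (snd c)))) \<pi>)"

lemma ctree_simps [simp]: "ctree M [] = Lf" "ctree M (c # \<pi>) = Nd (Nd (num (fst c)) (tt (ten M (snd c)))) (ctree M \<pi>)"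
  by (simp_all add: ctree_def)

lemma rchain_Nil: "rchain M A B \<eta> [] \<pi> <-> (\<exists>s. \<pi> = [(s, \<eta>)])"
  by (cases "(M, A, B, \<eta>, [] :: nat list list, \<pi>)" rule: rchain.cases) auto

lemma rchain_Cons: "rchain M A B \<eta> (\<alpha> # \<alpha>s) \<pi> <->
    (\<exists>c' c \<pi>'. \<pi> = c' # c # \<pi>' \<and> stp M A B \<alpha> c c' \<and> rchain M A B \<eta> \<alpha>s (c # \<pi>'))"
  by (cases "(M, A, B, \<eta>, \<alpha> # \<alpha>s, \<pi>)" rule: rchain.cases) auto

lemma rchain_En:
  assumes "is_rbcgs M" "A \<subseteq> Agt M" "B \<subseteq> Agt M" "\<eta> \<in> En M"
  shows "rchain M A B \<eta> \<alpha>s \<pi> ==> set (map fst \<pi>) \<subseteq> St M ==> snd ` set \<pi> \<subseteq> En M"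
proof (induction \<alpha>s arbitrary: \<pi>)
  case Nil
  then show ?case using assms by (auto simp: rchain_Nil)
next
  case (Cons \<alpha> \<alpha>s)
  then obtain c' c \<pi>' where p: "\<pi> = c' # c # \<pi>'" "stp M A B \<alpha> c c'" "rchain M A B \<eta> \<alpha>s (c # \<pi>')"
    by (auto simp: rchain_Cons)
  have "snd ` set (c # \<pi>') \<subseteq> En M" by (rule Cons.IH[OF p(3)]) (use Cons.prems(2) p(1) in simp)
  moreover have "snd c' \<in> En M" using stp_range[OF assms(1-3) p(2)] Cons.prems(2) p(1) by simp
  ultimately show ?case using p(1) by simp
qed

text \<open>The encoding shows only the entries in \<open>Agt M \<times> Res M\<close>;
  extensionality of the elements of \<open>En M\<close> settles the others.\<close>

lemma ten_inj:
  assumes "e \<in> En M" "e' \<in> En M" "ten M e = ten M e'"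
  shows "e = e'"
proof
  fix x :: "nat \<times> nat"
  obtain a k where x: "x = (a, k)" by (cases x)
  show "e x = e' x"
  proof (cases "x \<in> Agt M \<times> Res M")
    case True
    then show ?thesis using assms(3) x by (simp add: ten_def Agt_def Res_def)
  next
    case False
    then show ?thesis using PiE_arb[OF assms(1)[unfolded En_def] False] PiE_arb[OF assms(2)[unfolded En_def] False] by simp
  qed
qed

lemma ev_MatE:
  assumes "ok N V" "V l = Nd a b" "distinct [l, h, t]"
    "sz a \<le> N ==> sz b \<le> N ==> eval N J \<phi> (V(h := a, t := b)) = P"
  shows "eval N J (Mat l h t \<phi>) V = P"
  using assms ok_Nd[OF assms(1,2)] by auto

lemma jump_chain:
  assumes M: "is_rbcgs M" and sub: "A \<subseteq> Agt M" "B \<subseteq> Agt M" and \<eta>: "\<eta> \<in> En M"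
    and psz: "\<And>s. s < nSt M ==> sz (lst (map acts (jl M s))) \<le> N"
  shows "ok N V ==> menv M V ==> V 0 = lst (map acts \<alpha>s) ==> V 1 = x ==> V 2 = lst (map num ss) ==>
    V 3 = tt (ten M \<eta>) ==> V 4 = tt (tset A) ==> V 5 = tt (tset B) ==> set ss \<subseteq> {..<nSt M} ==>
    (\<And>\<alpha>. \<alpha> \<in> set \<alpha>s ==> length \<alpha> = nAgt M) ==> length \<alpha>s + 8 * N \<le> d ==>
    jump prog N d p_chain V <-> (\<exists>\<pi>. x = ctree M \<pi> \<and> map fst \<pi> = ss \<and> rchain M A B \<eta> \<alpha>s \<pi>)"
proof (induction \<alpha>s arbitrary: V x ss d)
  case Nil
  note ok = Nil(1) and r = Nil(3-8)
  note c = N_facts[OF ok]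
  obtain d' where d': "d = Suc d'" using Nil(11) c(1) by (cases d) auto
  have "eval N (jump prog N d') f_chain V <-> (\<exists>a b. x = Nd a b \<and> b = Lf \<and> (\<exists>a' b'. a = Nd a' b' \<and> b' = tt (ten M \<eta>) \<and>
      (\<exists>z u. lst (map num ss) = Nd z u \<and> u = Lf \<and> z = a')))"
    unfolding f_chain_def
    apply (rule trans)
     apply (rule ev_or)
      apply (rule ev_and0 ev_L ev_Mat[where l = 1] ev_Mat[where l = 8] ev_Mat[where l = 2] ev_eq | (simp add: ok r; fail))+
     apply (rule ev_Mat[where l = 0] | (simp add: ok r; fail))+
    done
  also have "\<dots> <-> (\<exists>s. x = Nd (Nd (num s) (tt (ten M \<eta>))) Lf \<and> ss = [s])"
    by auto
  also have "\<dots> <-> (\<exists>\<pi>. x = ctree M \<pi> \<and> map fst \<pi> = ss \<and> rchain M A B \<eta> [] \<pi>)"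
  proof
    assume "\<exists>s. x = Nd (Nd (num s) (tt (ten M \<eta>))) Lf \<and> ss = [s]"
    then obtain s where "x = Nd (Nd (num s) (tt (ten M \<eta>))) Lf" "ss = [s]" by blast
    then show "\<exists>\<pi>. x = ctree M \<pi> \<and> map fst \<pi> = ss \<and> rchain M A B \<eta> [] \<pi>"
      by (intro exI[of _ "[(s, \<eta>)]"]) simp
  qed (auto simp: rchain_Nil)
  finally show ?case unfolding d' jump.simps prog_simps .
next
  case (Cons \<alpha> \<alpha>s)
  note ok = Cons.prems(1) and m = Cons.prems(2) and r = Cons.prems(3-8) and ss = Cons.prems(9)
  note c = N_facts[OF ok]
  obtain d' where d': "d = Suc d'" using Cons.prems(11) c(1) by (cases d) auto
  have f: "length \<alpha>s + 8 * N \<le> d'" "7 * N \<le> d'" using Cons.prems(11) c(1) d' by simp_all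
  have \<alpha>: "length \<alpha> = nAgt M" "\<And>\<beta>. \<beta> \<in> set \<alpha>s ==> length \<beta> = nAgt M" using Cons.prems(10) by simp_all
  have IH: "\<And>V x ss. ok N V ==> menv M V ==> V 0 = lst (map acts \<alpha>s) ==> V 1 = x ==> V 2 = lst (map num ss) ==>
    V 3 = tt (ten M \<eta>) ==> V 4 = tt (tset A) ==> V 5 = tt (tset B) ==> set ss \<subseteq> {..<nSt M} ==>
    jump prog N d' p_chain V <-> (\<exists>\<pi>. x = ctree M \<pi> \<and> map fst \<pi> = ss \<and> rchain M A B \<eta> \<alpha>s \<pi>)"
    using Cons.IH \<alpha>(2) f(1) by blast
  let ?S = "\<lambda>u v y z. \<exists>s e c. u = num s \<and> v = tt (ten M e) \<and> s < nSt M \<and> e \<in> En M \<and>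
    stp M A B \<alpha> (s, e) c \<and> y = num (fst c) \<and> z = tt (ten M (snd c))"
  have step: "jump prog N d' p_step V' <-> ?S u v y z"
    if "ok N V'" "menv M V'" "V' 0 = u" "V' 1 = v" "V' 2 = acts \<alpha>" "V' 3 = y" "V' 4 = z" "V' 5 = tt (tset A)" "V' 6 = tt (tset B)"
      and se: "\<exists>s e. u = num s \<and> v = tt (ten M e) \<and> s < nSt M \<and> e \<in> En M" for V' u v y z
  proof -
    from se obtain s e where se: "u = num s" "v = tt (ten M e)" "s < nSt M" "e \<in> En M" by blast
    have "jump prog N d' p_step V' <-> (\<exists>c. stp M A B \<alpha> (s, e) c \<and> y = num (fst c) \<and> z = tt (ten M (snd c)))"
      by (rule jump_step[OF M that(1) f(2) that(2) that(3)[unfolded se(1)] that(4)[unfolded se(2)] that(5-9) se(3) sub se(4) \<alpha>(1) psz[OF se(3)]])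
    also have "\<dots> <-> ?S u v y z"
      using se ten_inj[OF se(4)] by auto
    finally show ?thesis .
  qed
  \<comment> \<open>The procedure for steps is specified only for proper states and endowments. That
    \<open>u\<close> and \<open>v\<close> encode such is known from the chain already recognised in
    the tail, which is why \<open>f_chain\<close> tests the tail before the step.\<close>
  have ex: "\<exists>s e. u = num s \<and> v = tt (ten M e) \<and> s < nSt M \<and> e \<in> En M"
    if q: "q = Nd h t" "h = Nd u v" and pe: "\<exists>\<pi>. q = ctree M \<pi> \<and> map fst \<pi> = ss' \<and> rchain M A B \<eta> \<alpha>s \<pi>" and st: "set ss' \<subseteq> {..<nSt M}" for q h t u v ss'
  proof -
    obtain \<pi> where p: "q = ctree M \<pi>" "map fst \<pi> = ss'" "rchain M A B \<eta> \<alpha>s \<pi>" using pe by blast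
    obtain c \<pi>' where c: "\<pi> = c # \<pi>'" using q(1) p(1) by (cases \<pi>) simp_all
    have "snd ` set \<pi> \<subseteq> En M" using rchain_En[OF M sub \<eta> p(3)] st p(2) by (simp add: St_def)
    then show ?thesis using q st p(1,2) c by auto
  qed
  have "eval N (jump prog N d') f_chain V <-> (\<exists>\<pi>. x = ctree M \<pi> \<and> map fst \<pi> = ss \<and> rchain M A B \<eta> (\<alpha> # \<alpha>s) \<pi>)"
  proof (cases ss)
    case Nil
    have "eval N (jump prog N d') f_chain V <-> False"
      using ok r Nil unfolding f_chain_def by auto
    then show ?thesis using Nil by (simp add: rchain_Cons)
  next
    case (Cons s' ss')
    have ss': "set ss' \<subseteq> {..<nSt M}" using ss Cons by simp
    have "eval N (jump prog N d') f_chain V <-> False \<or> (\<exists>p q. x = Nd p q \<and> (\<exists>y z. p = Nd y z \<and> y = num s' \<and>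
       (\<exists>h t. q = Nd h t \<and> (\<exists>u v. h = Nd u v \<and> (\<exists>\<pi>. q = ctree M \<pi> \<and> map fst \<pi> = ss' \<and> rchain M A B \<eta> \<alpha>s \<pi>) \<and> ?S u v y z))))"
      unfolding f_chain_def
      apply (rule ev_or)
       apply (use ok r in simp)
      apply (rule ev_MatE[where l = 0] ev_MatE[where l = 2] ev_Mat[where l = 1] ev_Mat[where l = 10] ev_Mat[where l = 11] ev_Mat[where l = 16]
         ev_and ev_eq ev_call IH step | (rule ex[OF _ _ _ ss'], assumption, assumption, assumption) | (simp add: ok r m Cons callenv_app ss'; fail))+
      done
    also have "\<dots> <-> (\<exists>\<pi>. x = ctree M \<pi> \<and> map fst \<pi> = ss \<and> rchain M A B \<eta> (\<alpha> # \<alpha>s) \<pi>)"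
    proof
      assume "False \<or> (\<exists>p q. x = Nd p q \<and> (\<exists>y z. p = Nd y z \<and> y = num s' \<and>
       (\<exists>h t. q = Nd h t \<and> (\<exists>u v. h = Nd u v \<and> (\<exists>\<pi>. q = ctree M \<pi> \<and> map fst \<pi> = ss' \<and> rchain M A B \<eta> \<alpha>s \<pi>) \<and> ?S u v y z))))"
      then obtain p q y z h t u v \<pi> s e c where "x = Nd p q" "p = Nd y z" "y = num s'" "q = Nd h t" "h = Nd u v"
        and p0: "q = ctree M \<pi>" "map fst \<pi> = ss'" "rchain M A B \<eta> \<alpha>s \<pi>"
        and se: "u = num s" "v = tt (ten M e)" "s < nSt M" "e \<in> En M"
        and c: "stp M A B \<alpha> (s, e) c" "y = num (fst c)" "z = tt (ten M (snd c))"
        by (elim disjE FalseE exE conjE) (rule that)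
      then have x: "x = Nd (Nd (num s') z) (Nd (Nd u v) t)" and p: "Nd (Nd u v) t = ctree M \<pi>" "map fst \<pi> = ss'" "rchain M A B \<eta> \<alpha>s \<pi>"
        and c: "stp M A B \<alpha> (s, e) c" "num s' = num (fst c)" "z = tt (ten M (snd c))" by simp_all
      obtain c0 \<pi>' where c0: "\<pi> = c0 # \<pi>'" using p(1) by (cases \<pi>) simp_all
      have "snd ` set \<pi> \<subseteq> En M" using rchain_En[OF M sub \<eta> p(3)] ss' p(2) by (simp add: St_def)
      then have "snd c0 = e" using p(1) c0 se ten_inj[of "snd c0" M e] by simp
      then have "c0 = (s, e)" using p(1) c0 se by (simp add: prod_eq_iff)
      then show "\<exists>\<pi>. x = ctree M \<pi> \<and> map fst \<pi> = ss \<and> rchain M A B \<eta> (\<alpha> # \<alpha>s) \<pi>"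
        using x p c c0 Cons by (intro exI[of _ "c # \<pi>"]) simp
    next
      assume "\<exists>\<pi>. x = ctree M \<pi> \<and> map fst \<pi> = ss \<and> rchain M A B \<eta> (\<alpha> # \<alpha>s) \<pi>"
      then obtain \<pi> where x0: "x = ctree M \<pi>" "map fst \<pi> = s' # ss'" and rc: "rchain M A B \<eta> (\<alpha> # \<alpha>s) \<pi>"
        unfolding Cons by (elim exE conjE) (rule that)
      obtain c' c \<pi>' where pi: "\<pi> = c' # c # \<pi>'" and p: "stp M A B \<alpha> c c'" "rchain M A B \<eta> \<alpha>s (c # \<pi>')"
        using rc unfolding rchain_Cons by (elim exE conjE) (rule that)
      have x: "x = ctree M (c' # c # \<pi>')" "map fst (c' # c # \<pi>') = s' # ss'" using x0 pi by simp_all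
      have "fst c < nSt M" using x(2) ss' by auto
      moreover have "snd c \<in> En M" using rchain_En[OF M sub \<eta> p(2)] ss' x(2) by (auto simp: St_def)
      ultimately have S: "?S (num (fst c)) (tt (ten M (snd c))) (num s') (tt (ten M (snd c')))"
        using p(1) x(2) by (intro exI[of _ "fst c"] exI[of _ "snd c"] exI[of _ c']) simp
      moreover have "\<exists>\<pi>. ctree M (c # \<pi>') = ctree M \<pi> \<and> map fst \<pi> = ss' \<and> rchain M A B \<eta> \<alpha>s \<pi>"
        using p(2) x(2) by (intro exI[of _ "c # \<pi>'"]) simp
      moreover have "x = Nd (Nd (num s') (tt (ten M (snd c')))) (ctree M (c # \<pi>'))" using x by simp
      ultimately show "False \<or> (\<exists>p q. x = Nd p q \<and> (\<exists>y z. p = Nd y z \<and> y = num s' \<and>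
       (\<exists>h t. q = Nd h t \<and> (\<exists>u v. h = Nd u v \<and> (\<exists>\<pi>. q = ctree M \<pi> \<and> map fst \<pi> = ss' \<and> rchain M A B \<eta> \<alpha>s \<pi>) \<and> ?S u v y z))))"
        apply -
        apply (rule disjI2, rule exI, rule exI, rule conjI, assumption)
        apply (rule exI, rule exI, rule conjI, rule refl, rule conjI, rule refl)
        apply (rule exI, rule exI, rule conjI, rule ctree_simps(2), rule exI, rule exI, rule conjI, rule refl)
        apply (rule conjI, assumption, assumption)
        done
    qed
    finally show ?thesis .
  qed
  then show ?case unfolding d' jump.simps prog_simps .
qed

text \<open>\<open>b\<close> bounds the number of bits of an entry and \<open>n\<close> the amount
  of the diminishing resource. Along a computation the former may grow while the latter never
  does.\<close>

definition nice :: "rbcgs => nat => nat => endowment => bool" where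
  "nice M n b e <-> e \<in> En M \<and> (\<forall>a < nAgt M. \<forall>k < nRes M. e (a, k) < 2 ^ b) \<and> (\<forall>a < nAgt M. e (a, 0) < n)"

text \<open>What is required of the size bound \<open>N\<close>: computations and histories of up to
  \<open>n\<close> steps and the lists of joint actions are within reach of the quantifiers. The
  clock \<open>cl\<close> gives the game \<open>n\<close> rounds, and \<open>m\<close> is the number
  of bits that an entry may ever need.\<close>

locale bounded_model =
  fixes M :: rbcgs and N n m :: nat and cl :: tr
  assumes M: "is_rbcgs M"
    and prod_sz: "s < nSt M ==> sz (lst (map acts (jl M s))) \<le> N"
    and cost_bound: "s < nSt M ==> a \<in> Agt M ==> \<alpha> \<in> avail M s a ==> k < nRes M ==> nat \<bar>cost M s \<alpha> k\<bar> < 2 ^ n"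
    and chain_sz: "length \<pi> \<le> Suc n ==> (\<And>c. c \<in> set \<pi> ==> fst c < nSt M \<and> nice M n m (snd c)) ==> sz (ctree M \<pi>) \<le> N"
    and states_sz: "length ss \<le> Suc n ==> set ss \<subseteq> {..<nSt M} ==> sz (lst (map num ss)) \<le> N"
    and acts_sz: "length \<alpha>s \<le> Suc n ==> (\<And>\<alpha>. \<alpha> \<in> set \<alpha>s ==> \<exists>s < nSt M. \<alpha> \<in> joint M s) ==> sz (lst (map acts \<alpha>s)) \<le> N"
    and clock: "length (els cl) = n"
begin

definition env :: "(nat => tr) => bool" where "env V <-> menv M V \<and> V 53 = cl"

lemma env_upd [simp]: "v < 46 \<or> 53 < v ==> env (V(v := x)) = env V"
  by (auto simp: env_def)

lemma env_callenv [simp]: "length vs \<le> 8 ==> env (callenv vs V) = env V"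
  by (simp add: env_def callenv_app)

lemma env_menv: "env V ==> menv M V"
  by (simp add: env_def)

lemma nice_mono: "nice M n b e ==> b \<le> b' ==> nice M n b' e"
  unfolding nice_def by (meson less_le_trans one_le_numeral power_increasing)

text \<open>A step produces less than \<open>2 ^ n \<le> 2 ^ b\<close> of a resource, which costs at
  most one more bit, and nothing of the diminishing resource.\<close>

lemma stp_nice:
  assumes "stp M A B \<alpha> c c'" "A \<subseteq> Agt M" "B \<subseteq> Agt M" "fst c < nSt M" "nice M n b (snd c)" "n \<le> b"
  shows "fst c' < nSt M \<and> nice M n (Suc b) (snd c')"
proof -
  obtain \<sigma> where \<sigma>: "\<sigma> \<in> joint M (fst c)" "c' = (succ M (fst c) \<sigma>, upd_en M (A \<union> B) (fst c) \<sigma> (snd c))"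
    using assms(1) unfolding stp_def by blast
  have range: "fst c' < nSt M" "snd c' \<in> En M"
    using stp_range[OF M assms(2,3,1)] assms(4) by (simp_all add: St_def)
  have av: "\<sigma> ! a \<in> avail M (fst c) a" if "a < nAgt M" for a
    using joint_avail[OF M assms(4) \<sigma>(1) that] by simp
  have "snd c' (a, k) < 2 ^ Suc b" if "a < nAgt M" "k < nRes M" for a k
  proof -
    have "produced M k (fst c) (\<sigma> ! a) < 2 ^ n"
      using cost_bound[OF assms(4) _ av[OF that(1)] that(2)] that(1) by (auto simp: produced_def Agt_def max_def abs_less_iff)
    also have "\<dots> \<le> (2 :: nat) ^ b" using assms(6) by (simp add: power_increasing)
    finally have "produced M k (fst c) (\<sigma> ! a) < 2 ^ b" .
    moreover have "snd c (a, k) < 2 ^ b" using assms(5) that by (simp add: nice_def)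
    ultimately show ?thesis using that \<sigma>(2) by (auto simp: upd_en_def Agt_def Res_def)
  qed
  moreover have "snd c' (a, 0) < n" if "a < nAgt M" for a
  proof -
    have "cost M (fst c) (\<sigma> ! a) 0 \<le> - 1"
      using M assms(4) that av[OF that] unfolding is_rbcgs_def St_def Agt_def by blast
    then have "produced M 0 (fst c) (\<sigma> ! a) = 0" by (simp add: produced_def)
    moreover have "nRes M > 0" using M by (auto simp: is_rbcgs_def Res_def)
    moreover have "snd c (a, 0) < n" using assms(5) that by (simp add: nice_def)
    ultimately show ?thesis using that \<sigma>(2) by (auto simp: upd_en_def Agt_def Res_def)
  qed
  ultimately show ?thesis using range by (simp add: nice_def)
qed

lemma rchain_nice:
  assumes "A \<subseteq> Agt M" "B \<subseteq> Agt M" "nice M n b \<eta>" "n \<le> b"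
  shows "rchain M A B \<eta> \<alpha>s \<pi> ==> set (map fst \<pi>) \<subseteq> {..<nSt M} ==> c \<in> set \<pi> ==> nice M n (b + length \<alpha>s) (snd c)"
proof (induction \<alpha>s arbitrary: \<pi> c)
  case Nil
  then show ?case using assms by (auto simp: rchain_Nil)
next
  case (Cons \<alpha> \<alpha>s)
  then obtain c1 c0 \<pi>' where p: "\<pi> = c1 # c0 # \<pi>'" "stp M A B \<alpha> c0 c1" "rchain M A B \<eta> \<alpha>s (c0 # \<pi>')"
    by (auto simp: rchain_Cons)
  have IH: "nice M n (b + length \<alpha>s) (snd x)" if "x \<in> set (c0 # \<pi>')" for x
    using Cons.IH[OF p(3) _ that] Cons.prems(2) p(1) by simp
  have "fst c0 < nSt M" using Cons.prems(2) p(1) by simp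
  then have "nice M n (Suc (b + length \<alpha>s)) (snd c1)"
    using stp_nice[OF p(2) assms(1,2) _ IH] assms(4) by simp
  moreover have "nice M n (Suc (b + length \<alpha>s)) (snd x)" if "x \<in> set (c0 # \<pi>')" for x
    by (rule nice_mono[OF IH[OF that]]) simp
  moreover have "c = c1 \<or> c \<in> set (c0 # \<pi>')" using Cons.prems(3) p(1) by simp
  ultimately show ?case by (metis add_Suc_right length_Cons)
qed

lemma ctree_mem_sz:
  assumes "fst c < nSt M" "nice M n m (snd c)"
  shows "sz (num (fst c)) \<le> N \<and> sz (tt (ten M (snd c))) \<le> N"
  using chain_sz[of "[c]"] assms by simp

end

fun winW :: "rbcgs => fm => (nat \<times> endowment) list => bool" where
  "winW M (Next A B b \<phi>) \<pi> <-> length \<pi> > 1 \<and> sat M (fst (rev \<pi> ! 1)) (snd (rev \<pi> ! 1)) \<phi>"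
| "winW M (Until A B b \<phi> \<psi>) \<pi> <-> (\<exists>i < length \<pi>. sat M (fst (rev \<pi> ! i)) (snd (rev \<pi> ! i)) \<psi> \<and>
     (\<forall>j < i. sat M (fst (rev \<pi> ! j)) (snd (rev \<pi> ! j)) \<phi>))"
| "winW M (Release A B b \<phi> \<psi>) \<pi> <-> (\<exists>i < length \<pi>. sat M (fst (rev \<pi> ! i)) (snd (rev \<pi> ! i)) \<psi> \<and>
      sat M (fst (rev \<pi> ! i)) (snd (rev \<pi> ! i)) \<phi> \<and>
     (\<forall>j < i. sat M (fst (rev \<pi> ! j)) (snd (rev \<pi> ! j)) \<psi>)) \<or>
     (\<forall>j < length \<pi>. sat M (fst (rev \<pi> ! j)) (snd (rev \<pi> ! j)) \<psi>)"
| "winW M _ \<pi> <-> False"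

text \<open>Positions of a computation correspond to nonempty suffixes of its reversal, which
  \<open>p_suf\<close> can enumerate.\<close>

lemma ex_prefix_rev:
  "(\<exists>i < length \<pi>. P (rev \<pi> ! i) \<and> (\<forall>j < i. Q (rev \<pi> ! j))) <-> (\<exists>c \<tau>. suffix (c # \<tau>) \<pi> \<and> P c \<and> (\<forall>x \<in> set \<tau>. Q x))"
proof
  assume "\<exists>i < length \<pi>. P (rev \<pi> ! i) \<and> (\<forall>j < i. Q (rev \<pi> ! j))"
  then obtain i where i: "i < length \<pi>" "P (rev \<pi> ! i)" "\<forall>j < i. Q (rev \<pi> ! j)" by blast
  have "rev \<pi> = take i (rev \<pi>) @ rev \<pi> ! i # drop (Suc i) (rev \<pi>)" using i(1) by (simp add: id_take_nth_drop)
  then have "\<pi> = rev (drop (Suc i) (rev \<pi>)) @ rev \<pi> ! i # rev (take i (rev \<pi>))"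
    by (metis append.assoc append_Cons append_Nil rev.simps(2) rev_append rev_rev_ident)
  then have "suffix (rev \<pi> ! i # rev (take i (rev \<pi>))) \<pi>" unfolding suffix_def by blast
  moreover have "\<forall>x \<in> set (rev (take i (rev \<pi>))). Q x" using i by (auto simp: in_set_conv_nth)
  ultimately show "\<exists>c \<tau>. suffix (c # \<tau>) \<pi> \<and> P c \<and> (\<forall>x \<in> set \<tau>. Q x)" using i(2) by blast
next
  assume "\<exists>c \<tau>. suffix (c # \<tau>) \<pi> \<and> P c \<and> (\<forall>x \<in> set \<tau>. Q x)"
  then obtain c \<tau> zs where c: "\<pi> = zs @ c # \<tau>" "P c" "\<forall>x \<in> set \<tau>. Q x" by (auto simp: suffix_def)
  have "rev \<pi> = rev \<tau> @ c # rev zs" using c(1) by simp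
  then have "rev \<pi> ! length \<tau> = c" "\<forall>j < length \<tau>. rev \<pi> ! j = rev \<tau> ! j" by (simp_all add: nth_append)
  moreover have "\<forall>j < length \<tau>. rev \<tau> ! j \<in> set \<tau>" by (metis length_rev nth_mem set_rev)
  ultimately show "\<exists>i < length \<pi>. P (rev \<pi> ! i) \<and> (\<forall>j < i. Q (rev \<pi> ! j))"
    using c by (intro exI[of _ "length \<tau>"]) simp
qed

lemma jump_second: "ok N V ==> V 0 = lst xs ==> length xs < d ==>
    jump prog N d p_second V <-> 1 < length xs \<and> V 1 = rev xs ! 1"
proof (induction xs arbitrary: V d)
  case Nil
  then obtain d' where "d = Suc d'" by (cases d) auto
  then show ?case using Nil by (simp add: prog_simps f_second_def)
next
  case (Cons x xs)
  obtain d' where d': "d = Suc d'" "length xs < d'" using Cons.prems(3) by (cases d) auto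
  have IH: "\<And>V. ok N V ==> V 0 = lst xs ==> jump prog N d' p_second V <-> 1 < length xs \<and> V 1 = rev xs ! 1"
    using Cons.IH d'(2) by blast
  note ok = Cons.prems(1) and r = Cons.prems(2)
  have sz: "sz x \<le> N" "sz (lst xs) \<le> N" using okD[OF ok, of 0] r by simp_all
  show ?case
  proof (cases xs)
    case Nil
    then show ?thesis using d'(1) ok r sz by (simp add: prog_simps f_second_def)
  next
    case (Cons y ys)
    have szy: "sz y \<le> N" "sz (lst ys) \<le> N" using sz(2) Cons by simp_all
    have "jump prog N d p_second V <-> ys = [] \<and> x = V 1 \<or> (1 < length xs \<and> V 1 = rev xs ! 1)"
    proof -
      have "eval N (jump prog N d') f_second V <-> lst ys = Lf \<and> x = V 1 \<or> (1 < length xs \<and> V 1 = rev xs ! 1)"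
        unfolding f_second_def
        apply (rule trans)
         apply (rule ev_MatE ev_or ev_and0 ev_L ev_eq ev_call IH | (simp add: ok r sz szy Cons callenv_app; fail))+
        done
      then show ?thesis using d'(1) by (simp add: prog_simps)
    qed
    also have "\<dots> <-> 1 < length (x # xs) \<and> V 1 = rev (x # xs) ! 1"
    proof (cases "ys = []")
      case False
      then have "1 < length xs" using Cons by (cases ys) simp_all
      then have "rev (x # xs) ! 1 = rev xs ! 1" by (simp add: nth_append)
      then show ?thesis using False Cons by simp
    qed (use Cons in auto)
    finally show ?thesis .
  qed
qed

lemma ev_eqF: "V i = x ==> V j = y ==> x \<noteq> y ==> eval N J (FAnd (FEq i j) \<phi>) V = False"
  by simp

lemma ev_eqT: "V i = x ==> V j = x ==> eval N J \<phi> V = P ==> eval N J (FAnd (FEq i j) \<phi>) V = P"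
  by simp

lemma ev_MatN: "ok N V ==> V l = Lf ==> distinct [l, h, t] ==> eval N J (Mat l h t \<phi>) V = False"
  by simp

abbreviation ptree :: "rbcgs => nat \<times> endowment => tr" where
  "ptree M c \<equiv> Nd (num (fst c)) (tt (ten M (snd c)))"

lemma sz_ctree_mem: "c \<in> set \<pi> ==> sz (ptree M c) \<le> sz (ctree M \<pi>)"
  unfolding ctree_def by (rule sz_lst_mem) simp

lemma ev_ex_eq:
  assumes "\<And>x. sz x \<le> N ==> eval N J \<psi> (V(v := x)) <-> C \<and> x = t" "C ==> sz t \<le> N"
  shows "eval N J (FEx v (FAnd \<psi> \<phi>)) V <-> C \<and> eval N J \<phi> (V(v := t))"
  unfolding eval.simps eval_FAnd using assms by blast

lemma ev_second:
  assumes "ok N V" "3 * N \<le> d" "V 0 = ctree M \<pi>"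
    "1 < length \<pi> ==> sz (ptree M (rev \<pi> ! 1)) \<le> N ==> sz (num (fst (rev \<pi> ! 1))) \<le> N ==> sz (tt (ten M (snd (rev \<pi> ! 1)))) \<le> N ==>
      eval N (jump prog N d) \<phi> (V(20 := ptree M (rev \<pi> ! 1), 21 := num (fst (rev \<pi> ! 1)), 22 := tt (ten M (snd (rev \<pi> ! 1))))) = P"
  shows "eval N (jump prog N d) (FEx 20 (FAnd (call p_second [0, 20]) (Mat 20 21 22 \<phi>))) V <-> 1 < length \<pi> \<and> P"
proof -
  let ?g = "ptree M"
  have "length (map ?g \<pi>) + 1 \<le> N"
    using length_sz[of "map ?g \<pi>"] okD[OF assms(1), of 0] assms(3) by (simp add: ctree_def)
  then have len: "length (map ?g \<pi>) < d" using assms(2) by simp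
  have sz: "sz (ptree M (rev \<pi> ! 1)) \<le> N" if "1 < length \<pi>"
  proof -
    have "rev \<pi> ! 1 \<in> set \<pi>" using nth_mem[of 1 "rev \<pi>"] that by simp
    then have "sz (ptree M (rev \<pi> ! 1)) \<le> sz (ctree M \<pi>)" by (rule sz_ctree_mem)
    then show ?thesis using okD[OF assms(1), of 0] assms(3) by simp
  qed
  have call: "eval N (jump prog N d) (call p_second [0, 20]) (V(20 := x)) <-> 1 < length \<pi> \<and> x = ptree M (rev \<pi> ! 1)" if "sz x \<le> N" for x
  proof -
    have "eval N (jump prog N d) (call p_second [0, 20]) (V(20 := x)) <-> 1 < length (map ?g \<pi>) \<and> x = rev (map ?g \<pi>) ! 1"
      by (rule ev_call) (use that assms(1,3) len in \<open>simp_all add: jump_second[of _ _ "map ?g \<pi>"] callenv_app ctree_def\<close>)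
    then show ?thesis by (simp add: rev_map cong: conj_cong)
  qed
  have "eval N (jump prog N d) (FEx 20 (FAnd (call p_second [0, 20]) (Mat 20 21 22 \<phi>))) V <->
      1 < length \<pi> \<and> eval N (jump prog N d) (Mat 20 21 22 \<phi>) (V(20 := ptree M (rev \<pi> ! 1)))"
    by (rule ev_ex_eq[OF call sz])
  also have "\<dots> <-> 1 < length \<pi> \<and> P"
  proof (cases "1 < length \<pi>")
    case True
    have "eval N (jump prog N d) (Mat 20 21 22 \<phi>) (V(20 := ptree M (rev \<pi> ! 1))) = P"
      apply (rule ev_MatE)
         apply (use sz[OF True] assms(1) in simp)
        apply simp
       apply simp
      apply (rule assms(4)[OF True sz[OF True]])
       apply assumption+
      done
    then show ?thesis using True by simp
  qed simp
  finally show ?thesis .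
qed

lemma ev_suf:
  assumes "ok N V" "3 * N \<le> d" "V 0 = ctree M \<pi>"
    "\<And>c \<tau>. suffix (c # \<tau>) \<pi> ==> sz (ptree M c) \<le> N ==> sz (ctree M \<tau>) \<le> N ==>
      sz (num (fst c)) \<le> N ==> sz (tt (ten M (snd c))) \<le> N ==> sz (ctree M (c # \<tau>)) \<le> N ==>
      eval N (jump prog N d) \<phi> (V(25 := ctree M (c # \<tau>), 26 := ptree M c, 27 := ctree M \<tau>,
        28 := num (fst c), 29 := tt (ten M (snd c)))) = P c \<tau>"
  shows "eval N (jump prog N d) (FEx 25 (FAnd (call p_suf [0, 25]) (Mat 25 26 27 (Mat 26 28 29 \<phi>)))) V <->
    (\<exists>c \<tau>. suffix (c # \<tau>) \<pi> \<and> P c \<tau>)"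
proof -
  have suf: "suffix xs (map g ys) <-> (\<exists>zs. suffix zs ys \<and> xs = map g zs)" for xs and g :: "nat \<times> endowment => tr" and ys
    unfolding suffix_def by (metis append_eq_map_conv map_append)
  have sz: "sz (ctree M \<tau>) \<le> N" if st: "suffix \<tau> \<pi>" for \<tau>
  proof -
    obtain zs where "\<pi> = zs @ \<tau>" using st by (auto simp: suffix_def)
    then have "sz (ctree M \<tau>) \<le> sz (ctree M \<pi>)" unfolding ctree_def by (simp add: sz_lst_append)
    then show ?thesis using okD[OF assms(1), of 0] assms(3) by simp
  qed
  have call: "eval N (jump prog N d) (call p_suf [0, 25]) (V(25 := x)) <-> (\<exists>\<tau>. suffix \<tau> \<pi> \<and> x = ctree M \<tau>)" if "sz x \<le> N" for x
    using assms(1-3) that by (simp add: base_jumps callenv_app ctree_def suf els_eq)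
  have mat: "eval N (jump prog N d) (Mat 25 26 27 (Mat 26 28 29 \<phi>)) (V(25 := ctree M \<tau>)) <->
      (\<exists>c \<tau>'. \<tau> = c # \<tau>' \<and> P c \<tau>')" if "suffix \<tau> \<pi>" for \<tau>
  proof (cases \<tau>)
    case Nil
    then show ?thesis using assms(1) sz[OF that] by simp
  next
    case (Cons c \<tau>')
    have sz': "sz (ctree M (c # \<tau>')) \<le> N" using sz[OF that] Cons by simp
    have "eval N (jump prog N d) (Mat 25 26 27 (Mat 26 28 29 \<phi>)) (V(25 := ctree M (c # \<tau>'))) = P c \<tau>'"
      apply (rule ev_MatE)
         apply (use sz' assms(1) in simp)
        apply (simp del: ctree_simps)
        apply (rule ctree_simps(2))
       apply simp
      apply (rule ev_MatE)
         apply (use sz' assms(1) in simp)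
        apply simp
       apply simp
      apply (rule assms(4)[OF that[unfolded Cons]], assumption, assumption, assumption, assumption, rule sz')
      done
    then show ?thesis using Cons by simp
  qed
  have each: "eval N (jump prog N d) (call p_suf [0, 25]) (V(25 := x)) \<and>
        eval N (jump prog N d) (Mat 25 26 27 (Mat 26 28 29 \<phi>)) (V(25 := x)) <->
      (\<exists>c \<tau>. suffix (c # \<tau>) \<pi> \<and> x = ctree M (c # \<tau>) \<and> P c \<tau>)" if "sz x \<le> N" for x
    unfolding call[OF that]
  proof (rule iffI; elim conjE exE)
    fix \<tau> assume "suffix \<tau> \<pi>" "x = ctree M \<tau>" "eval N (jump prog N d) (Mat 25 26 27 (Mat 26 28 29 \<phi>)) (V(25 := x))"
    then have "\<exists>c \<tau>'. \<tau> = c # \<tau>' \<and> P c \<tau>'" using mat[OF \<open>suffix \<tau> \<pi>\<close>] by (simp only:)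
    then obtain c \<tau>' where "\<tau> = c # \<tau>'" "P c \<tau>'" by (elim exE conjE) (rule that)
    then show "\<exists>c \<tau>. suffix (c # \<tau>) \<pi> \<and> x = ctree M (c # \<tau>) \<and> P c \<tau>"
      using \<open>suffix \<tau> \<pi>\<close> \<open>x = ctree M \<tau>\<close> by (intro exI[of _ c] exI[of _ \<tau>']) simp
  next
    fix c \<tau> assume "suffix (c # \<tau>) \<pi>" "x = ctree M (c # \<tau>)" "P c \<tau>"
    then show "(\<exists>\<tau>. suffix \<tau> \<pi> \<and> x = ctree M \<tau>) \<and> eval N (jump prog N d) (Mat 25 26 27 (Mat 26 28 29 \<phi>)) (V(25 := x))"
      using mat[OF \<open>suffix (c # \<tau>) \<pi>\<close>] by (intro conjI exI[of _ "c # \<tau>"]) (simp_all del: eval_Mat ctree_simps)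
  qed
  have "eval N (jump prog N d) (FEx 25 (FAnd (call p_suf [0, 25]) (Mat 25 26 27 (Mat 26 28 29 \<phi>)))) V <->
      (\<exists>x. sz x \<le> N \<and> (\<exists>c \<tau>. suffix (c # \<tau>) \<pi> \<and> x = ctree M (c # \<tau>) \<and> P c \<tau>))"
    unfolding eval.simps eval_FAnd by (rule ex_cong1, rule conj_cong[OF refl], rule each)
  also have "\<dots> <-> (\<exists>c \<tau>. suffix (c # \<tau>) \<pi> \<and> P c \<tau>)"
  proof (rule iffI; elim conjE exE)
    fix c \<tau> assume "suffix (c # \<tau>) \<pi>" "P c \<tau>"
    then show "\<exists>x. sz x \<le> N \<and> (\<exists>c \<tau>. suffix (c # \<tau>) \<pi> \<and> x = ctree M (c # \<tau>) \<and> P c \<tau>)"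
      using sz[of "c # \<tau>"] by (intro exI[of _ "ctree M (c # \<tau>)"] conjI exI[of _ c] exI[of _ \<tau>]) simp_all
  qed (intro exI conjI)
  finally show ?thesis .
qed

section \<open>Winning conditions and rounds of the game\<close>

context bounded_model
begin

text \<open>The induction hypothesis for a subformula, limited to the configurations of one
  computation, since only their endowments are known to be small.\<close>

definition sat_ok :: "nat => (nat \<times> endowment) list => fm => bool" where
  "sat_ok d \<pi> \<psi> <-> (\<forall>V c. ok N V --> env V --> V 0 = num (fst c) --> V 1 = tt (ten M (snd c)) -->
     V 2 = tt (tform M \<psi>) --> c \<in> set \<pi> --> jump prog N d p_sat V = sat M (fst c) (snd c) \<psi>)"

lemma sat_okD: "sat_ok d \<pi> \<psi> ==> ok N V ==> env V ==> V 0 = num (fst c) ==> V 1 = tt (ten M (snd c)) ==>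
     V 2 = tt (tform M \<psi>) ==> c \<in> set \<pi> ==> jump prog N d p_sat V = sat M (fst c) (snd c) \<psi>"
  unfolding sat_ok_def by blast

lemma sat_okD': "ok N V ==> env V ==> V 0 = num (fst c) ==> V 1 = tt (ten M (snd c)) ==>
     V 2 = tt (tform M \<psi>) ==> sat_ok d \<pi> \<psi> ==> c \<in> set \<pi> ==> jump prog N d p_sat V = sat M (fst c) (snd c) \<psi>"
  by (rule sat_okD)

lemma ev_sat_all:
  assumes "sat_ok d \<pi> \<psi>" "3 * N \<le> d" "ok N V" "env V" "V l = ctree M \<tau>" "V f = tt (tform M \<psi>)" "set \<tau> \<subseteq> set \<pi>"
    "l < 30" "f < 30"
  shows "eval N (jump prog N d) (sat_all l f) V <-> (\<forall>c \<in> set \<tau>. sat M (fst c) (snd c) \<psi>)"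
proof -
  have l: "V l = lst (map (ptree M) \<tau>)" using assms(5) by (simp add: ctree_def)
  have "eval N (jump prog N d) (sat_all l f) V <->
      (\<forall>x \<in> set (map (ptree M) \<tau>). eval N (jump prog N d) (Mat 30 31 32 (call p_sat [31, 32, f])) (V(30 := x)))"
    unfolding sat_all_def by (rule ev_all_mem[OF assms(3,2) l]) (use assms(8) in simp_all)
  also have "\<dots> <-> (\<forall>c \<in> set \<tau>. eval N (jump prog N d) (Mat 30 31 32 (call p_sat [31, 32, f])) (V(30 := ptree M c)))"
    by simp
  also have "\<dots> <-> (\<forall>c \<in> set \<tau>. sat M (fst c) (snd c) \<psi>)"
  proof (rule ball_cong[OF refl])
    fix c assume c: "c \<in> set \<tau>"
    have "sz (ptree M c) \<le> N"
      using order_trans[OF sz_ctree_mem[OF c]] okD[OF assms(3), of l] assms(5) by simp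
    then show "eval N (jump prog N d) (Mat 30 31 32 (call p_sat [31, 32, f])) (V(30 := ptree M c)) = sat M (fst c) (snd c) \<psi>"
      using c assms
      by (intro ev_MatE[where a = "num (fst c)" and b = "tt (ten M (snd c))"] ev_call sat_okD[OF assms(1)])
        (auto simp: callenv_app)
  qed
  finally show ?thesis .
qed

fun subs :: "fm => fm set" where
  "subs (Next A B b \<phi>) = {\<phi>}" | "subs (Until A B b \<phi> \<psi>) = {\<phi>, \<psi>}" | "subs (Release A B b \<phi> \<psi>) = {\<phi>, \<psi>}" |
  "subs _ = {}"

lemma suffix_set: "suffix (c # \<tau>) \<pi> ==> c \<in> set \<pi> \<and> set \<tau> \<subseteq> set \<pi>"
  by (auto simp: suffix_def)

lemma jump_win:
  assumes F: "subs F \<noteq> {}" and sat: "\<And>\<psi>. \<psi> \<in> subs F ==> sat_ok d \<pi> \<psi>" and d: "3 * N \<le> d" and ok: "ok N V" and e: "env V"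
    and r: "V 0 = ctree M \<pi>" "V 1 = tt (tform M F)"
  shows "jump prog N (Suc d) p_win V <-> winW M F \<pi>"
proof -
  note c = ok_const[OF ok] N_facts[OF ok]
  have "eval N (jump prog N d) f_win V <-> winW M F \<pi>"
  proof (cases F)
    case (Next A B b \<phi>)
    have sat': "sat_ok d \<pi> \<phi>" using sat Next by simp
    have r': "V 1 = tt (TL [TN 3, tset A, tset B, tbound M b, tform M \<phi>])" using r(2) Next by simp
    have mem: "1 < length \<pi> ==> rev \<pi> ! 1 \<in> set \<pi>" using nth_mem[of 1 "rev \<pi>"] by simp
    have "eval N (jump prog N d) f_win V <-> (1 < length \<pi> \<and> sat M (fst (rev \<pi> ! 1)) (snd (rev \<pi> ! 1)) \<phi>) \<or> False"
      unfolding f_win_def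
      by (rule ev_TL[where x = 1 and xs = "[TN 3, tset A, tset B, tbound M b, tform M \<phi>]"] ev_MatN[where l = 19] ev_second ev_MatE ev_TN[where x = 9] ev_or ev_eqT[where j = 43] ev_call sat_okD[OF sat']
          | (simp add: ok e r(1) r' c d sz_num callenv_app mem del: num_1; fail))+
    then show ?thesis using Next by simp
  next
    case (Until A B b \<phi> \<psi>)
    have sat': "sat_ok d \<pi> \<phi>" "sat_ok d \<pi> \<psi>" using sat Until by simp_all
    have r': "V 1 = tt (TL [TN 4, tset A, tset B, tbound M b, tform M \<phi>, tform M \<psi>])" using r(2) Until by simp
    have "eval N (jump prog N d) f_win V <-> False \<or> ((\<exists>c \<tau>. suffix (c # \<tau>) \<pi> \<and> sat M (fst c) (snd c) \<psi> \<and>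
        (\<forall>c \<in> set \<tau>. sat M (fst c) (snd c) \<phi>)) \<or> False)"
      unfolding f_win_def
      by (rule ev_TL[where x = 1 and xs = "[TN 4, tset A, tset B, tbound M b, tform M \<phi>, tform M \<psi>]"] ev_suf ev_MatE ev_TN[where x = 9] ev_or ev_eqF[where j = 43]
          ev_eqT[where j = 44] ev_eqF[where j = 45] ev_and0 ev_sat_all[OF sat'(1)] ev_call sat_okD[OF sat'(2)]
          | (simp add: ok e r(1) r' c d sz_num callenv_app suffix_set del: num_1; fail))+
    then show ?thesis
      using Until ex_prefix_rev[of \<pi> "\<lambda>c. sat M (fst c) (snd c) \<psi>" "\<lambda>c. sat M (fst c) (snd c) \<phi>"] by simp
  next
    case (Release A B b \<phi> \<psi>)
    have sat': "sat_ok d \<pi> \<phi>" "sat_ok d \<pi> \<psi>" using sat Release by simp_all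
    have r': "V 1 = tt (TL [TN 5, tset A, tset B, tbound M b, tform M \<phi>, tform M \<psi>])" using r(2) Release by simp
    have "eval N (jump prog N d) f_win V <-> False \<or> (False \<or> ((\<exists>c \<tau>. suffix (c # \<tau>) \<pi> \<and> sat M (fst c) (snd c) \<psi> \<and>
        sat M (fst c) (snd c) \<phi> \<and> (\<forall>c \<in> set \<tau>. sat M (fst c) (snd c) \<psi>)) \<or> (\<forall>c \<in> set \<pi>. sat M (fst c) (snd c) \<psi>)))"
      unfolding f_win_def
      by (rule ev_TL[where x = 1 and xs = "[TN 5, tset A, tset B, tbound M b, tform M \<phi>, tform M \<psi>]"] ev_suf ev_MatE ev_TN[where x = 9] ev_or ev_eqF[where j = 43]
          ev_eqF[where j = 44] ev_eqT[where j = 45] ev_and0 ev_sat_all[OF sat'(2)] ev_call sat_okD'[where \<pi> = \<pi>]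
          | (simp add: ok e r(1) r' c d sz_num callenv_app suffix_set sat' del: num_1; fail))+
    moreover have "(\<forall>j < length \<pi>. sat M (fst (rev \<pi> ! j)) (snd (rev \<pi> ! j)) \<psi>) <-> (\<forall>c \<in> set \<pi>. sat M (fst c) (snd c) \<psi>)"
      using all_set_conv_all_nth[of "rev \<pi>" "\<lambda>c. sat M (fst c) (snd c) \<psi>"] by simp
    ultimately show ?thesis
        using Release ex_prefix_rev[of \<pi> "\<lambda>c. sat M (fst c) (snd c) \<psi> \<and> sat M (fst c) (snd c) \<phi>" "\<lambda>c. sat M (fst c) (snd c) \<psi>"] by simp
  qed (use F in simp_all)
  then show ?thesis by (simp add: prog_simps)
qed


lemma ev_allI: "(\<And>x. sz x \<le> N ==> eval N J \<phi> (V(v := x)) = P x) ==> eval N J (FAll v \<phi>) V <-> (\<forall>x. sz x \<le> N --> P x)"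
  by simp

lemma jump_step':
  assumes "ok N V" "env V" "7 * N \<le> d" "V 0 = num s" "V 1 = tt (ten M e)" "V 2 = acts \<alpha>" "V 3 = x" "V 4 = y"
    "V 5 = tt (tset A)" "V 6 = tt (tset B)" "s < nSt M" "A \<subseteq> Agt M" "B \<subseteq> Agt M" "e \<in> En M" "length \<alpha> = nAgt M"
  shows "jump prog N d p_step V <-> (\<exists>c. stp M A B \<alpha> (s, e) c \<and> x = num (fst c) \<and> y = tt (ten M (snd c)))"
  by (rule jump_step[OF M assms(1,3) env_menv[OF assms(2)] assms(4-15) prod_sz[OF assms(11)]])

definition stuck :: "nat set => nat set => nat list => nat \<times> endowment => bool" where
  "stuck A B \<alpha> c <-> (\<forall>c'. \<not> stp M A B \<alpha> c c')"

text \<open>One turn of the game, for a fixed joint action in register 12.\<close>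

lemma ev_good:
  assumes sub: "A \<subseteq> Agt M" "B \<subseteq> Agt M" and d: "length \<alpha>s + 8 * N \<le> d" and ok: "ok N V" and e: "env V"
    and r: "V 1 = lst (map num ss)" "V 2 = lst (map acts \<alpha>s)" "V 3 = tt (ten M \<eta>)" "V 4 = tt (tset A)" "V 5 = tt (tset B)"
      "V 6 = tt (tform M F)" "V 12 = acts \<alpha>"
    and \<eta>: "nice M n b \<eta>" "n \<le> b" "b + n \<le> m" and len: "length ss = Suc (length \<alpha>s)" "length \<alpha>s < n" and ss: "set ss \<subseteq> {..<nSt M}"
    and \<alpha>s: "\<And>\<beta>. \<beta> \<in> set \<alpha>s ==> length \<beta> = nAgt M" and \<alpha>: "\<alpha> \<in> joint M (hd ss)"
    and win: "\<And>V' \<pi>. ok N V' ==> env V' ==> V' 0 = ctree M \<pi> ==> V' 1 = tt (tform M F) ==>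
      (\<And>c. c \<in> set \<pi> ==> fst c < nSt M \<and> nice M n (b + n) (snd c)) ==> jump prog N d p_win V' <-> winW M F \<pi>"
  shows "eval N (jump prog N d) (FAll 13 (FImp
          (FAnd (call p_chain [2, 13, 1, 3, 4, 5]) (Mat 13 17 18 (Mat 17 19 20
            (FAll 21 (FAll 22 (FNot (call p_step [19, 20, 12, 21, 22, 4, 5])))))))
          (call p_win [13, 6]))) V <->
    (\<forall>\<pi>. map fst \<pi> = ss \<and> rchain M A B \<eta> \<alpha>s \<pi> \<and> stuck A B \<alpha> (hd \<pi>) --> winW M F \<pi>)"
    (is "eval _ _ (FAll 13 (FImp (FAnd ?ch ?st) ?w)) _ <-> _")
proof -
  have \<eta>E: "\<eta> \<in> En M" using \<eta>(1) by (simp add: nice_def)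
  have d': "7 * N \<le> d" "3 * N \<le> d" using d by simp_all
  have \<alpha>len: "length \<alpha> = nAgt M" using \<alpha> by (simp add: joint_def)
  have chain: "eval N (jump prog N d) ?ch (V(13 := x)) <-> (\<exists>\<pi>. x = ctree M \<pi> \<and> map fst \<pi> = ss \<and> rchain M A B \<eta> \<alpha>s \<pi>)" if "sz x \<le> N" for x
    by (rule ev_call) (use that ok env_menv[OF e] r ss d \<alpha>s in
      \<open>simp_all add: jump_chain[OF M sub \<eta>E prod_sz, of _ \<alpha>s _ ss] callenv_app\<close>)
  have mem: "fst c < nSt M \<and> nice M n (b + length \<alpha>s) (snd c)" if "rchain M A B \<eta> \<alpha>s \<pi>" "map fst \<pi> = ss" "c \<in> set \<pi>" for \<pi> c
  proof -
    have "fst c \<in> set (map fst \<pi>)" using that(3) by simp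
    then have "fst c < nSt M" using that(2) ss by blast
    then show ?thesis using rchain_nice[OF sub \<eta>(1,2) that(1) _ that(3)] that(2) ss by simp
  qed
  \<comment> \<open>The quantifier over register 13 thereby reaches every chain with these states
    and actions.\<close>
  have szc: "sz (ctree M \<pi>) \<le> N" if "rchain M A B \<eta> \<alpha>s \<pi>" "map fst \<pi> = ss" for \<pi>
  proof (rule chain_sz)
    show "length \<pi> \<le> Suc n" using that(2) len by (metis length_map Suc_leI le_SucI)
    fix c assume "c \<in> set \<pi>"
    then have "fst c < nSt M \<and> nice M n (b + length \<alpha>s) (snd c)" by (rule mem[OF that])
    then show "fst c < nSt M \<and> nice M n m (snd c)" using nice_mono[of "b + length \<alpha>s" "snd c" m] \<eta>(3) len(2) by simp
  qed
  have stuck: "eval N (jump prog N d) ?st (V(13 := ctree M \<pi>)) <-> stuck A B \<alpha> (hd \<pi>)"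
    if p: "rchain M A B \<eta> \<alpha>s \<pi>" "map fst \<pi> = ss" for \<pi>
  proof -
    obtain c \<pi>' where c: "\<pi> = c # \<pi>'" using p len by (cases \<pi>) auto
    have cm: "fst c < nSt M" "nice M n (b + length \<alpha>s) (snd c)" using mem[OF p, of c] c by simp_all
    have cE: "snd c \<in> En M" using cm(2) by (simp add: nice_def)
    have sz: "sz (Nd (ptree M c) (ctree M \<pi>')) \<le> N" using szc[OF p] c by simp
    have "eval N (jump prog N d) ?st (V(13 := ctree M \<pi>)) <->
        (\<forall>x. sz x \<le> N --> (\<forall>y. sz y \<le> N --> \<not> (\<exists>c'. stp M A B \<alpha> (fst c, snd c) c' \<and> x = num (fst c') \<and> y = tt (ten M (snd c')))))"
      unfolding c ctree_simps
      by (rule ev_MatE ev_allI ev_not ev_call jump_step' | (use sz sz_Nd_le[OF sz] sz_Nd_le[OF conjunct1[OF sz_Nd_le[OF sz]]] in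
          \<open>simp add: ok e r d' cm cE sub \<alpha>len callenv_app del: sz_simps; fail\<close>))+
    also have "\<dots> <-> stuck A B \<alpha> (hd \<pi>)"
    proof -
      \<comment> \<open>The quantifiers see only small successors. By \<open>b + n \<le> m\<close>
        every successor is small, so finding none means that the computation is stuck.\<close>
      have "sz (num (fst c')) \<le> N \<and> sz (tt (ten M (snd c'))) \<le> N" if "stp M A B \<alpha> c c'" for c'
      proof (rule ctree_mem_sz)
        have "fst c' < nSt M \<and> nice M n (Suc (b + length \<alpha>s)) (snd c')"
          by (rule stp_nice[OF that sub cm]) (use \<eta>(2) in simp)
        then show "fst c' < nSt M" "nice M n m (snd c')"
          using nice_mono[of "Suc (b + length \<alpha>s)" "snd c'" m] \<eta>(3) len(2) by simp_all
      qed
      then show ?thesis unfolding stuck_def c by (simp only: list.sel prod.collapse) blast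
    qed
    finally show ?thesis .
  qed
  have w: "eval N (jump prog N d) ?w (V(13 := ctree M \<pi>)) <-> winW M F \<pi>"
    if p: "rchain M A B \<eta> \<alpha>s \<pi>" "map fst \<pi> = ss" for \<pi>
  proof (rule ev_call)
    show "jump prog N d p_win (callenv [13, 6] (V(13 := ctree M \<pi>))) <-> winW M F \<pi>"
    proof (rule win)
      fix c assume "c \<in> set \<pi>"
      then have "fst c < nSt M \<and> nice M n (b + length \<alpha>s) (snd c)" by (rule mem[OF p])
      then show "fst c < nSt M \<and> nice M n (b + n) (snd c)"
        using nice_mono[of "b + length \<alpha>s" "snd c" "b + n"] len(2) by simp
    qed (use szc[OF p] ok e r in \<open>simp_all add: callenv_app\<close>)
  qed (use szc[OF p] ok in simp_all)
  have "eval N (jump prog N d) (FAll 13 (FImp (FAnd ?ch ?st) ?w)) V <->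
      (\<forall>x. sz x \<le> N --> (\<exists>\<pi>. x = ctree M \<pi> \<and> map fst \<pi> = ss \<and> rchain M A B \<eta> \<alpha>s \<pi>) \<and>
        eval N (jump prog N d) ?st (V(13 := x)) --> eval N (jump prog N d) ?w (V(13 := x)))"
    by (rule ev_allI) (simp only: eval_FImp eval_FAnd chain)
  also have "\<dots> <-> (\<forall>\<pi>. map fst \<pi> = ss \<and> rchain M A B \<eta> \<alpha>s \<pi> \<and> stuck A B \<alpha> (hd \<pi>) --> winW M F \<pi>)"
  proof (rule iffI; intro allI impI; elim conjE exE)
    fix \<pi> assume *: "\<forall>x. sz x \<le> N --> (\<exists>\<pi>. x = ctree M \<pi> \<and> map fst \<pi> = ss \<and> rchain M A B \<eta> \<alpha>s \<pi>) \<and>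
        eval N (jump prog N d) ?st (V(13 := x)) --> eval N (jump prog N d) ?w (V(13 := x))"
      and p: "map fst \<pi> = ss" "rchain M A B \<eta> \<alpha>s \<pi>" "stuck A B \<alpha> (hd \<pi>)"
    have "eval N (jump prog N d) ?w (V(13 := ctree M \<pi>))"
      by (rule *[rule_format, OF szc[OF p(2,1)] conjI[OF exI[of _ \<pi>]]])
        (use p in \<open>simp_all only: stuck simp_thms\<close>)
    then show "winW M F \<pi>" using w[OF p(2,1)] by (simp only:)
  next
    fix x \<pi> assume *: "\<forall>\<pi>. map fst \<pi> = ss \<and> rchain M A B \<eta> \<alpha>s \<pi> \<and> stuck A B \<alpha> (hd \<pi>) --> winW M F \<pi>"
      and st: "eval N (jump prog N d) ?st (V(13 := x))" and p: "x = ctree M \<pi>" "map fst \<pi> = ss" "rchain M A B \<eta> \<alpha>s \<pi>"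
    have "stuck A B \<alpha> (hd \<pi>)" using st stuck[OF p(3,2)] unfolding p(1) by (simp only:)
    then have "winW M F \<pi>" using * p(2,3) by blast
    then show "eval N (jump prog N d) ?w (V(13 := x))" using w[OF p(3,2)] unfolding p(1) by (simp only:)
  qed
  finally show ?thesis .
qed

end

text \<open>It serves at once as induction measure, as a bound on the number of nested modalities
  and as the factor in the fuel.\<close>

primrec md :: "fm => nat" where
  "md (Prop p) = 1" | "md (Neg \<phi>) = Suc (md \<phi>)" | "md (Conj \<phi> \<psi>) = Suc (md \<phi> + md \<psi>)"
| "md (Next A B b \<phi>) = Suc (md \<phi>)" | "md (Until A B b \<phi> \<psi>) = Suc (md \<phi> + md \<psi>)"
| "md (Release A B b \<phi> \<psi>) = Suc (md \<phi> + md \<psi>)"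

context bounded_model
begin

lemma set_jl_joint: "s < nSt M ==> set (jl M s) = joint M s"
  using is_rbcgs_finite[OF M, of s] by (intro set_jl) (simp add: St_def)

text \<open>Induction on the clock. \<open>d0\<close> is the fuel that has to be left after all
  rounds: enough to recognise a chain and to evaluate the winning condition.\<close>

lemma jump_game:
  assumes sub: "A \<subseteq> Agt M" "B \<subseteq> Agt M" and \<eta>: "nice M n b \<eta>" "n \<le> b" "b + n \<le> m" and d0: "n + 8 * N \<le> d0"
    and win: "\<And>V' \<pi> d. d0 \<le> d ==> ok N V' ==> env V' ==> V' 0 = ctree M \<pi> ==> V' 1 = tt (tform M F) ==>
      (\<And>c. c \<in> set \<pi> ==> fst c < nSt M \<and> nice M n (b + n) (snd c)) ==> jump prog N d p_win V' <-> winW M F \<pi>"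
  shows "ok N V ==> env V ==> V 0 = lst ws ==> V 1 = lst (map num ss) ==> V 2 = lst (map acts \<alpha>s) ==> V 3 = tt (ten M \<eta>) ==>
    V 4 = tt (tset A) ==> V 5 = tt (tset B) ==> V 6 = tt (tform M F) ==>
    length ss = Suc (length \<alpha>s) ==> length \<alpha>s + length ws \<le> n ==> set ss \<subseteq> {..<nSt M} ==>
    (\<And>\<alpha>. \<alpha> \<in> set \<alpha>s ==> \<exists>s < nSt M. \<alpha> \<in> joint M s) ==> length ws + d0 < d ==>
    jump prog N d p_game V <-> game M A B \<eta> (winW M F) (length ws) ss \<alpha>s"
proof (induction ws arbitrary: V ss \<alpha>s d)
  case Nil
  then obtain d' where "d = Suc d'" by (cases d) auto
  then show ?case using Nil(3) by (simp add: prog_simps f_game_def)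
next
  case (Cons w ws)
  note ok = Cons.prems(1) and e = Cons.prems(2) and r = Cons.prems(3-9) and len = Cons.prems(10,11) and ss = Cons.prems(12) and \<alpha>s = Cons.prems(13)
  note c = N_facts[OF ok]
  obtain d' where d': "d = Suc d'" "length ws + d0 < d'" using Cons.prems(14) by (cases d) auto
  have f: "3 * N \<le> d'" "length \<alpha>s + 8 * N \<le> d'" "d0 \<le> d'" using d' d0 len(2) by simp_all
  obtain s ss' where s: "ss = s # ss'" using len(1) by (cases ss) auto
  have sS: "s < nSt M" using ss s by simp
  have szs: "sz (lst (map num (s' # ss))) \<le> N" if "s' < nSt M" for s'
    by (rule states_sz) (use len ss that in simp_all)
  have sza: "sz (lst (map acts (\<alpha> # \<alpha>s))) \<le> N" if "\<alpha> \<in> joint M s" for \<alpha>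
    by (rule acts_sz) (use len \<alpha>s that sS in auto)
  have IH: "\<And>V ss \<alpha>s. ok N V ==> env V ==> V 0 = lst ws ==> V 1 = lst (map num ss) ==> V 2 = lst (map acts \<alpha>s) ==> V 3 = tt (ten M \<eta>) ==>
    V 4 = tt (tset A) ==> V 5 = tt (tset B) ==> V 6 = tt (tform M F) ==>
    length ss = Suc (length \<alpha>s) ==> length \<alpha>s + length ws \<le> n ==> set ss \<subseteq> {..<nSt M} ==>
    (\<And>\<alpha>. \<alpha> \<in> set \<alpha>s ==> \<exists>s < nSt M. \<alpha> \<in> joint M s) ==>
    jump prog N d' p_game V <-> game M A B \<eta> (winW M F) (length ws) ss \<alpha>s"
    using Cons.IH d'(2) by blast
  let ?V = "V(8 := w, 9 := lst ws, 10 := num s, 11 := lst (map num ss'))"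
  have sz: "sz w \<le> N" "sz (lst ws) \<le> N" "sz (num s) \<le> N" "sz (lst (map num ss')) \<le> N"
    using okD[OF ok, of 0] okD[OF ok, of 1] r(1,2) s by simp_all
  have ok': "ok N ?V" using ok sz by simp
  have num3: "sz (num 3) \<le> N" using c by (simp add: sz_num)
  have av: "eval N (jump prog N d') (FEx 23 (FAnd (call p_nth [49, 10, 23]) (tlst 23 25 (FEx 26 (FAnd (call p_prod [25, 26]) (call p_mem [12, 26])))))) (?V(12 := x))
      <-> s < length (map tt (avT M)) \<and> x \<in> set (map acts (jl M s))" if "sz x \<le> N" for x
    by (rule ev_nth[where a = 23] ev_TL[where x = 23] ev_prodM[OF M sS] ev_memc
        | (simp add: ok sz num3 that f menvD[OF env_menv[OF e]] nth_tables sS prod_sz; fail))+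
  have nxt: "eval N (jump prog N d') (FAll 14 (FImp (lt 14 48 27 28) (FMk 15 14 1 (FMk 16 12 2 (call p_game [9, 15, 16, 3, 4, 5, 6]))))) (?V(12 := acts \<alpha>))
      <-> (\<forall>s' < nSt M. game M A B \<eta> (winW M F) (length ws) (s' # ss) (\<alpha> # \<alpha>s))" if \<alpha>: "\<alpha> \<in> joint M s" "sz (acts \<alpha>) \<le> N" for \<alpha>
  proof (rule ev_all_lt)
    fix s' assume s': "s' < nSt M" "sz (num s') \<le> N"
    have 1: "sz (Nd (num s') (lst (map num ss))) \<le> N" using szs[OF s'(1)] by simp
    have 2: "sz (Nd (acts \<alpha>) (lst (map acts \<alpha>s))) \<le> N" using sza[OF \<alpha>(1)] by simp
    have "jump prog N d' p_game (callenv [9, 15, 16, 3, 4, 5, 6]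
        (?V(12 := acts \<alpha>, 14 := num s', 15 := Nd (num s') (lst (map num ss)), 16 := Nd (acts \<alpha>) (lst (map acts \<alpha>s))))) <->
        game M A B \<eta> (winW M F) (length ws) (s' # ss) (\<alpha> # \<alpha>s)"
      by (rule IH) (use ok' \<alpha>(2) s' 1 2 e r len ss \<alpha>s \<alpha>(1) sS in \<open>auto simp: callenv_app simp del: sz_simps\<close>)
    then show "eval N (jump prog N d') (FMk 15 14 1 (FMk 16 12 2 (call p_game [9, 15, 16, 3, 4, 5, 6]))) (?V(12 := acts \<alpha>, 14 := num s')) <->
        game M A B \<eta> (winW M F) (length ws) (s' # ss) (\<alpha> # \<alpha>s)"
      using 1 2 ok' \<alpha>(2) s'(2) r by (simp del: sz_simps)
  qed (use ok' \<alpha>(2) f menvD[OF env_menv[OF e]] in simp_all)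
  have good: "eval N (jump prog N d') (FAll 13 (FImp
          (FAnd (call p_chain [2, 13, 1, 3, 4, 5]) (Mat 13 17 18 (Mat 17 19 20
            (FAll 21 (FAll 22 (FNot (call p_step [19, 20, 12, 21, 22, 4, 5])))))))
          (call p_win [13, 6]))) (?V(12 := acts \<alpha>)) <->
    (\<forall>\<pi>. map fst \<pi> = ss \<and> rchain M A B \<eta> \<alpha>s \<pi> \<and> stuck A B \<alpha> (hd \<pi>) --> winW M F \<pi>)"
    if \<alpha>: "\<alpha> \<in> joint M s" "sz (acts \<alpha>) \<le> N" for \<alpha>
  proof (rule ev_good[OF sub f(2) _ _ _ _ _ _ _ _ _ \<eta> len(1) _ ss])
    show "\<And>V' \<pi>. ok N V' ==> env V' ==> V' 0 = ctree M \<pi> ==> V' 1 = tt (tform M F) ==>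
      (\<And>c. c \<in> set \<pi> ==> fst c < nSt M \<and> nice M n (b + n) (snd c)) ==> jump prog N d' p_win V' <-> winW M F \<pi>"
      by (rule win[OF f(3)])
    show "\<And>\<beta>. \<beta> \<in> set \<alpha>s ==> length \<beta> = nAgt M" using \<alpha>s by (auto simp: joint_def)
  qed (use ok' \<alpha> e r len s in simp_all)
  have "eval N (jump prog N d') f_game V <-> (\<exists>x. sz x \<le> N \<and> x \<in> acts ` joint M s \<and> eval N (jump prog N d') (FAnd (FAll 13 (FImp
          (FAnd (call p_chain [2, 13, 1, 3, 4, 5]) (Mat 13 17 18 (Mat 17 19 20
            (FAll 21 (FAll 22 (FNot (call p_step [19, 20, 12, 21, 22, 4, 5])))))))
          (call p_win [13, 6])))
        (FAll 14 (FImp (lt 14 48 27 28) (FMk 15 14 1 (FMk 16 12 2 (call p_game [9, 15, 16, 3, 4, 5, 6])))))) (?V(12 := x)))"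
    (is "_ <-> (\<exists>x. _ \<and> _ \<and> eval _ _ ?G _)")
  proof -
    have "eval N (jump prog N d') (Mat 0 8 9 (Mat 1 10 11 \<phi>)) V = eval N (jump prog N d') \<phi> ?V" for \<phi>
      by (rule ev_MatE | (simp add: ok sz r s; fail) | rule refl)+
    moreover have "eval N (jump prog N d') (FL 0) V = False" using r by simp
    ultimately have "eval N (jump prog N d') f_game V <-> eval N (jump prog N d') (FEx 12 (FAnd
        (FEx 23 (FAnd (call p_nth [49, 10, 23]) (tlst 23 25 (FEx 26 (FAnd (call p_prod [25, 26]) (call p_mem [12, 26])))))) ?G)) ?V"
      unfolding f_game_def eval.simps(5) by (simp only: simp_thms)
    also have "\<dots> <-> (\<exists>x. sz x \<le> N \<and> (s < length (map tt (avT M)) \<and> x \<in> set (map acts (jl M s))) \<and> eval N (jump prog N d') ?G (?V(12 := x)))"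
      by (rule ev_ex) (simp only: eval_FAnd av)
    also have "\<dots> <-> (\<exists>x. sz x \<le> N \<and> x \<in> acts ` joint M s \<and> eval N (jump prog N d') ?G (?V(12 := x)))"
      using sS set_jl_joint[OF sS] by (simp add: nth_tables del: eval_FAnd)
    finally show ?thesis .
  qed
  also have "\<dots> <-> (\<exists>\<alpha>. \<alpha> \<in> joint M s \<and> eval N (jump prog N d') ?G (?V(12 := acts \<alpha>)))"
  proof -
    have "sz (acts \<alpha>) \<le> N" if "\<alpha> \<in> joint M s" for \<alpha> using sza[OF that] by simp
    then show ?thesis by blast
  qed
  also have "\<dots> <-> (\<exists>\<alpha>. \<alpha> \<in> joint M s \<and> (\<forall>\<pi>. map fst \<pi> = ss \<and> rchain M A B \<eta> \<alpha>s \<pi> \<and> stuck A B \<alpha> (hd \<pi>) --> winW M F \<pi>) \<and>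
      (\<forall>s' < nSt M. game M A B \<eta> (winW M F) (length ws) (s' # ss) (\<alpha> # \<alpha>s)))"
  proof (rule ex_cong1, rule conj_cong[OF refl])
    fix \<alpha> assume \<alpha>: "\<alpha> \<in> joint M s"
    then have "sz (acts \<alpha>) \<le> N" using sza[OF \<alpha>] by simp
    then show "eval N (jump prog N d') ?G (?V(12 := acts \<alpha>)) <->
      (\<forall>\<pi>. map fst \<pi> = ss \<and> rchain M A B \<eta> \<alpha>s \<pi> \<and> stuck A B \<alpha> (hd \<pi>) --> winW M F \<pi>) \<and>
      (\<forall>s' < nSt M. game M A B \<eta> (winW M F) (length ws) (s' # ss) (\<alpha> # \<alpha>s))"
      by (simp only: eval_FAnd good[OF \<alpha>] nxt[OF \<alpha>])
  qed
  also have "\<dots> <-> game M A B \<eta> (winW M F) (length (w # ws)) ss \<alpha>s"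
    unfolding list.size(4) add_0_right add_Suc_right Nat.add_0_right One_nat_def game.simps good_def stuck_def s list.sel
    by (simp add: St_def Ball_def)
  finally show ?case unfolding d'(1) jump.simps prog_simps .
qed


text \<open>A fixed endowment is spelled out in the input, so a modality that resets to it starts
  with \<open>n\<close> bits at any depth.\<close>

fun nice_bound :: "bound => bool" where
  "nice_bound Current = True" | "nice_bound (Fixed \<zeta>) = nice M n n \<zeta>"

primrec nice_fm :: "fm => bool" where
  "nice_fm (Prop p) = True" | "nice_fm (Neg \<phi>) = nice_fm \<phi>" | "nice_fm (Conj \<phi> \<psi>) = (nice_fm \<phi> \<and> nice_fm \<psi>)"
| "nice_fm (Next A B b \<phi>) = (nice_bound b \<and> nice_fm \<phi>)" | "nice_fm (Until A B b \<phi> \<psi>) = (nice_bound b \<and> nice_fm \<phi> \<and> nice_fm \<psi>)"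
| "nice_fm (Release A B b \<phi> \<psi>) = (nice_bound b \<and> nice_fm \<phi> \<and> nice_fm \<psi>)"

text \<open>Fuel for one modal level: \<open>n\<close> for the rounds of the game, \<open>n\<close>
  for running through a chain, and a multiple of \<open>N\<close> for the auxiliary
  procedures.\<close>

definition K :: nat where "K = 2 * n + 14 * N"

lemma subs_md: "\<psi> \<in> subs F ==> Suc (md \<psi>) \<le> md F"
  by (cases F) auto

lemma subs_nice: "\<psi> \<in> subs F ==> nice_fm F ==> nice_fm \<psi>"
  by (cases F) auto

lemma subs_over: "\<psi> \<in> subs F ==> formula_over M F ==> formula_over M \<psi>"
  by (cases F) auto

lemma tt_TL_eq_Nil: "lst (map tt xs) = Lf <-> xs = []"
  by simp

lemma modal:
  assumes sub: "A \<subseteq> Agt M" "B \<subseteq> Agt M" and b: "bound_over M bd" "nice_bound bd" and \<eta>: "nice M n b \<eta>" "n \<le> b" "b + n * md F \<le> m"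
    and d: "md F * K \<le> Suc d" and ok: "ok N V" and e: "env V" and r: "V 0 = num s" "V 1 = tt (ten M \<eta>)" "V 2 = tt (tform M F)" and s: "s < nSt M"
    and F: "subs F \<noteq> {}" "tform M F = TL (TN k # tset A # tset B # tbound M bd # rest)" "k = 3 \<or> k = 4 \<or> k = 5"
    and IH: "\<And>\<psi> d \<pi>. \<psi> \<in> subs F ==> md \<psi> * K \<le> d ==> (\<And>c. c \<in> set \<pi> ==> fst c < nSt M \<and> nice M n (b + n) (snd c)) ==> sat_ok d \<pi> \<psi>"
  shows "eval N (jump prog N d) f_sat V <-> A = {} \<and> B = {} \<or> game M A B (start_endowment bd \<eta>) (winW M F) n [s] []"
proof -
  note c = ok_const[OF ok] N_facts[OF ok]
  let ?\<theta> = "start_endowment bd \<eta>"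
  obtain \<psi> where \<psi>: "\<psi> \<in> subs F" using F(1) by blast
  have md1: "1 \<le> md F" using subs_md[OF \<psi>] by simp
  define d0 where "d0 = (md F - 1) * K + n + 12 * N"
  have K: "md F * K = (md F - 1) * K + K" using md1 by (cases "md F") simp_all
  have fuel: "n + d0 < d" "n + 8 * N \<le> d0" "3 * N \<le> d"
    using d c(7) unfolding K d0_def unfolding K_def by linarith+
  have \<theta>: "nice M n b ?\<theta>"
    using \<eta>(1,2) b nice_mono[of n _ b] by (cases bd) auto
  have win: "jump prog N d' p_win V' <-> winW M F \<pi>"
    if w: "d0 \<le> d'" "ok N V'" "env V'" "V' 0 = ctree M \<pi>" "V' 1 = tt (tform M F)"
      "\<And>c. c \<in> set \<pi> ==> fst c < nSt M \<and> nice M n (b + n) (snd c)" for V' \<pi> d'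
  proof -
    obtain d'' where d'': "d' = Suc d''" using w(1) c(7) unfolding d0_def by (cases d') simp_all
    have "sat_ok d'' \<pi> \<psi>" if "\<psi> \<in> subs F" for \<psi>
    proof (rule IH[OF that _ w(6)])
      have "md \<psi> * K \<le> (md F - 1) * K" using subs_md[OF that] by (intro mult_le_mono1) simp
      then show "md \<psi> * K \<le> d''" using w(1) d'' c(7) unfolding d0_def by linarith
    qed
    moreover have "3 * N \<le> d''" using w(1) d'' c(7) unfolding d0_def by linarith
    ultimately show ?thesis unfolding d'' by (rule jump_win[OF F(1) _ _ w(2-5)])
  qed
  have bm: "b + n \<le> m" using \<eta>(3) md1 by (metis add_le_mono1 add_left_mono le_trans mult.right_neutral mult_le_mono2)
  have game: "jump prog N d p_game V' <-> game M A B ?\<theta> (winW M F) n [s] []"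
    if g: "ok N V'" "env V'" "V' 0 = cl" "V' 1 = Nd (num s) Lf" "V' 2 = Lf" "V' 3 = tt (ten M ?\<theta>)"
      "V' 4 = tt (tset A)" "V' 5 = tt (tset B)" "V' 6 = tt (tform M F)" for V'
  proof -
    have "jump prog N d p_game V' <-> game M A B ?\<theta> (winW M F) (length (els cl)) [s] []"
    proof (rule jump_game[OF sub \<theta> \<eta>(2) bm fuel(2)])
      show "\<And>V' \<pi> d. d0 \<le> d ==> ok N V' ==> env V' ==> V' 0 = ctree M \<pi> ==> V' 1 = tt (tform M F) ==>
        (\<And>c. c \<in> set \<pi> ==> fst c < nSt M \<and> nice M n (b + n) (snd c)) ==> jump prog N d p_win V' <-> winW M F \<pi>"
        by (rule win)
    qed (use g s fuel(1) clock in simp_all)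
    then show ?thesis unfolding clock .
  qed
  have fin: "finite A" "finite B" using sub finite_subset[of _ "{..<nAgt M}"] by (auto simp: Agt_def)
  have setL: "setL S = [] <-> S = {}" if "finite S" for S using that by (simp add: setL_def)
  have szs: "sz (Nd (num s) Lf) \<le> N" using states_sz[of "[s]"] s by simp
  have r': "V 2 = tt (TL (TN k # tset A # tset B # tbound M bd # rest))" using r(3) F(2) by simp
  have bd: "eval N (jump prog N d) (tlst 16 21 (FOr (FAnd (FL 21) (FEq 20 1)) (FAnd (FNot (FL 21)) (FEq 20 16)))) V' <-> x = tt (ten M ?\<theta>)"
    if q: "ok N V'" "V' 16 = tt (tbound M bd)" "V' 20 = x" "V' 1 = tt (ten M \<eta>)" for V' x
  proof -
    \<comment> \<open>The empty list is free to encode \<open>Current\<close>, because every model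
      has an agent and so no endowment is encoded by the empty list.\<close>
    obtain xs where xs: "tbound M bd = TL xs" "xs = [] <-> bd = Current"
    proof (cases bd)
      case Current
      then show ?thesis using that by simp
    next
      case (Fixed \<zeta>)
      have "nAgt M \<noteq> 0" using M by (auto simp: is_rbcgs_def Agt_def)
      then show ?thesis using that Fixed by (simp add: ten_def)
    qed
    have q16: "V' 16 = tt (TL xs)" using q(2) xs(1) by simp
    have "eval N (jump prog N d) (tlst 16 21 (FOr (FAnd (FL 21) (FEq 20 1)) (FAnd (FNot (FL 21)) (FEq 20 16)))) V' <->
        lst (map tt xs) = Lf \<and> x = tt (ten M \<eta>) \<or> \<not> lst (map tt xs) = Lf \<and> x = tt (TL xs)"
      by (rule ev_TL[where x = 16 and xs = xs] ev_or ev_and0 ev_L ev_eq ev_not | (simp add: q(1,3,4) q16 c sz_num; fail))+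
    also have "\<dots> <-> x = tt (ten M ?\<theta>)"
      using xs by (cases bd) simp_all
    finally show ?thesis .
  qed
  have sz\<theta>: "sz (tt (ten M ?\<theta>)) \<le> N"
    using ctree_mem_sz[of "(s, ?\<theta>)"] s nice_mono[OF \<theta>, of m] bm by simp
  have exr: "eval N (jump prog N d) (FEx 20 (FAnd (tlst 16 21 (FOr (FAnd (FL 21) (FEq 20 1)) (FAnd (FNot (FL 21)) (FEq 20 16)))) \<phi>)) V' = P"
    if q: "ok N V'" "V' 16 = tt (tbound M bd)" "V' 1 = tt (ten M \<eta>)" "eval N (jump prog N d) \<phi> (V'(20 := tt (ten M ?\<theta>))) = P" for V' \<phi> P
  proof -
    have "eval N (jump prog N d) (FEx 20 (FAnd (tlst 16 21 (FOr (FAnd (FL 21) (FEq 20 1)) (FAnd (FNot (FL 21)) (FEq 20 16)))) \<phi>)) V' <->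
        True \<and> eval N (jump prog N d) \<phi> (V'(20 := tt (ten M ?\<theta>)))"
      by (rule ev_ex_eq) (use q sz\<theta> bd in simp_all)
    then show ?thesis using q(4) by simp
  qed
  have mk: "eval N (jump prog N d) (FNil 22 (FMk 23 0 22 \<phi>)) V' = P"
    if "ok N V'" "V' 0 = num s" "eval N (jump prog N d) \<phi> (V'(22 := Lf, 23 := Nd (num s) Lf)) = P" for V' \<phi> P
    using that szs by (simp del: sz_simps)
  have e53: "V 53 = cl" using e by (simp add: env_def)
  have szn: "sz (num s) \<le> N" "sz (num 3) \<le> N" using szs c by (simp_all add: sz_num)
  note szs' = szs[simplified] szn
  have kne: "k \<noteq> 0" "k \<noteq> 1" "k \<noteq> 2" using F(3) by auto
  show ?thesis
    unfolding f_sat_def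
    apply (rule trans)
     apply (rule ev_TL[where x = 2 and xs = "TN k # tset A # tset B # tbound M bd # rest"] ev_TL[where x = 12] ev_TL[where x = 14] ev_MatE ev_TN[where x = 9] ev_or ev_eqF[where j = 40] ev_eqF[where j = 41] ev_eqF[where j = 42]
       ev_and0 ev_eq ev_L ev_not exr mk ev_call game
      | (simp add: ok e r(1,2) r' F(2) c fuel callenv_app tset_setL kne e53 sz\<theta> szs' del: num_1; fail))+
    using F(3) apply (simp add: setL[OF fin(1)] setL[OF fin(2)])
    done
qed


end

section \<open>Correctness of the satisfaction procedure\<close>

context bounded_model
begin

text \<open>Without bounded agents some strategy has no outcome at all and meets any winning
  condition. Otherwise a bounded agent holds less than \<open>n\<close> of the diminishing resource,
  so \<open>n\<close> rounds suffice.\<close>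

lemma sat_game:
  assumes "A \<subseteq> Agt M" "B \<subseteq> Agt M" "nice M n b \<theta>" "s < nSt M"
  shows "A = {} \<and> B = {} \<or> game M A B \<theta> (winW M F) n [s] [] <->
    (\<exists>f. strategy M A f \<and> (\<forall>\<pi> \<in> out M s \<theta> A f B. winW M F (rev \<pi>)))"
proof (cases "A \<union> B = {}")
  case True
  then show ?thesis using out_unbounded[OF M assms(1,2), of \<theta> s] assms(3) by (auto simp: nice_def)
next
  case False
  then obtain a where a: "a \<in> A \<union> B" by blast
  then have "\<theta> (a, 0) < n" using assms by (auto simp: nice_def Agt_def)
  then have "game M A B \<theta> (winW M F) n [s] [] <-> (\<exists>f. strategy M A f \<and> (\<forall>\<pi> \<in> out M s \<theta> A f B. winW M F (rev \<pi>)))"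
    using assms by (intro game_strategy[OF M assms(1,2) _ _ a]) (simp_all add: nice_def St_def)
  then show ?thesis using False by blast
qed

lemma nice_start:
  assumes "bound_over M bd" "nice_bound bd" "nice M n b \<eta>" "n \<le> b"
  shows "nice M n b (start_endowment bd \<eta>)"
  using assms nice_mono[of n _ b] by (cases bd) auto

text \<open>A subformula is evaluated with endowments reached after at most \<open>n\<close> steps,
  so \<open>b\<close> rises by \<open>n\<close> with each modality;
  \<open>b + n * md \<phi> \<le> m\<close> reserves the bits for all levels still to come.\<close>

lemma jump_sat:
  "ok N V ==> env V ==> V 0 = num s ==> V 1 = tt (ten M \<eta>) ==> V 2 = tt (tform M \<phi>) ==> s < nSt M ==>
    formula_over M \<phi> ==> nice_fm \<phi> ==> nice M n b \<eta> ==> n \<le> b ==> b + n * md \<phi> \<le> m ==> md \<phi> * K \<le> d ==>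
    jump prog N d p_sat V <-> sat M s \<eta> \<phi>"
proof (induction \<phi> arbitrary: V s \<eta> b d rule: measure_induct_rule[where f = md])
  case (less \<phi>)
  note ok = less.prems(1) and e = less.prems(2) and r = less.prems(3-5) and s = less.prems(6) and over = less.prems(7)
    and nf = less.prems(8) and \<eta> = less.prems(9-11)
  note c = ok_const[OF ok] N_facts[OF ok]
  have md1: "1 \<le> md \<phi>" by (cases \<phi>) simp_all
  then have K: "K \<le> d" using less.prems(12) by (metis mult_1 mult_le_mono1 order_trans)
  then obtain d' where d': "d = Suc d'" using c(7) unfolding K_def by (cases d) simp_all
  have f: "3 * N \<le> d'" using K c(7) d' unfolding K_def by linarith
  have bm: "b + n * md \<psi> \<le> m" if "md \<psi> \<le> md \<phi>" for \<psi>
    using \<eta>(3) mult_le_mono2[OF that, of n] by linarith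
  have dm: "md \<psi> * K \<le> d'" if "md \<psi> < md \<phi>" for \<psi>
  proof -
    have "Suc (md \<psi>) * K \<le> d" using mult_le_mono1[of "Suc (md \<psi>)" "md \<phi>" K] that less.prems(12) by simp
    moreover have "1 \<le> K" using c(7) unfolding K_def by simp
    ultimately show ?thesis using d' by simp
  qed
  have IH: "jump prog N d' p_sat V' <-> sat M s \<eta> \<psi>"
    if "ok N V'" "env V'" "V' 0 = num s" "V' 1 = tt (ten M \<eta>)" "V' 2 = tt (tform M \<psi>)" "md \<psi> < md \<phi>" "formula_over M \<psi>" "nice_fm \<psi>" for V' \<psi>
    by (rule less.IH[OF that(6,1-5) s that(7,8) \<eta>(1,2) bm dm]) (use that(6) in simp_all)
  have nest: "sat_ok d \<pi> \<psi>" if n: "\<psi> \<in> subs \<phi>" "md \<psi> * K \<le> d" "\<And>c. c \<in> set \<pi> ==> fst c < nSt M \<and> nice M n (b + n) (snd c)" for \<psi> d \<pi>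
    unfolding sat_ok_def
  proof (intro allI impI)
    fix V' c assume h: "ok N V'" "env V'" "V' 0 = num (fst c)" "V' 1 = tt (ten M (snd c))" "V' 2 = tt (tform M \<psi>)" "c \<in> set \<pi>"
    have md: "Suc (md \<psi>) \<le> md \<phi>" by (rule subs_md[OF n(1)])
    have "b + n + n * md \<psi> \<le> m" using \<eta>(3) mult_le_mono2[OF md, of n] by simp
    then show "jump prog N d p_sat V' = sat M (fst c) (snd c) \<psi>"
      by (intro less.IH[where b = "b + n"]) (use h n md subs_over[OF n(1) over] subs_nice[OF n(1) nf] \<eta>(2) in simp_all)
  qed
  have "eval N (jump prog N d') f_sat V <-> sat M s \<eta> \<phi>"
  proof (cases \<phi>)
    case (Prop p)
    then have p: "p < nProp M" using over by (simp add: Props_def)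
    have r2: "V 2 = tt (TL [TN 0, TN p])" using r(3) Prop by simp
    have val: "val M p \<subseteq> St M" using M p unfolding is_rbcgs_def Props_def by blast
    then have fin: "finite (val M p)" using finite_subset[of _ "{..<nSt M}"] by (auto simp: St_def)
    have szs: "sz (num s) \<le> N" "sz (num 3) \<le> N" "sz (tt (TN s)) \<le> N"
      using states_sz[of "[s]"] s c by (simp_all add: sz_num tt.simps)
    have "eval N (jump prog N d') f_sat V <-> (p < length (map tt (valT M)) \<and> tt (TN s) \<in> set (map tt (setL (val M p)))) \<or> False \<or> False \<or>
        ((num 0 = num 3 \<or> num 0 = num 4 \<or> num 0 = num 5) \<and> False)"
      unfolding f_sat_def
      by (rule ev_TL[where x = 2 and xs = "[TN 0, TN p]"] ev_eqT[where j = 40] ev_eqF[where j = 41] ev_eqF[where j = 42] ev_TN[where x = 9] ev_TN[where x = 12]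
          ev_or ev_and0 ev_eq ev_nth[where a = 15] ev_TL[where x = 15] ev_mkn ev_memc ev_MatN[where l = 13] ev_MatE
        | (simp add: ok e r(1,2) r2 c(1-6) f menvD[OF env_menv[OF e]] nth_tables p tset_setL szs del: num_1; fail))+
    moreover have "tt (TN s) \<in> set (map tt (setL (val M p))) <-> s \<in> val M p"
      using fin by (auto simp: setL_def)
    ultimately show ?thesis using Prop p by (simp add: nth_tables)
  next
    case (Neg \<psi>)
    have r2: "V 2 = tt (TL [TN 1, tform M \<psi>])" using r(3) Neg by simp
    have IH': "md \<psi> < md \<phi>" "formula_over M \<psi>" "nice_fm \<psi>" using Neg over nf by simp_all
    have "eval N (jump prog N d') f_sat V <-> False \<or> \<not> sat M s \<eta> \<psi> \<or> False \<or>
        ((num 1 = num 3 \<or> num 1 = num 4 \<or> num 1 = num 5) \<and> False)"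
      unfolding f_sat_def
      by (rule ev_TL[where x = 2 and xs = "[TN 1, tform M \<psi>]"] ev_eqF[where j = 40] ev_eqT[where j = 41] ev_eqF[where j = 42] ev_TN[where x = 9]
          ev_or ev_and0 ev_eq ev_not ev_MatN[where l = 13] ev_MatE ev_call IH
        | (simp add: ok e r(1,2) r2 c f sz_num IH' callenv_app del: num_1; fail))+
    then show ?thesis using Neg by (simp del: num_1)
  next
    case (Conj \<psi> \<chi>)
    have r2: "V 2 = tt (TL [TN 2, tform M \<psi>, tform M \<chi>])" using r(3) Conj by simp
    have IH': "md \<psi> < md \<phi>" "formula_over M \<psi>" "nice_fm \<psi>" "md \<chi> < md \<phi>" "formula_over M \<chi>" "nice_fm \<chi>" using Conj over nf by simp_all
    have "eval N (jump prog N d') f_sat V <-> False \<or> False \<or> (sat M s \<eta> \<psi> \<and> sat M s \<eta> \<chi>) \<or>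
        ((num 2 = num 3 \<or> num 2 = num 4 \<or> num 2 = num 5) \<and> False)"
      unfolding f_sat_def
      by (rule ev_TL[where x = 2 and xs = "[TN 2, tform M \<psi>, tform M \<chi>]"] ev_eqF[where j = 40] ev_eqF[where j = 41] ev_eqT[where j = 42] ev_TN[where x = 9]
          ev_or ev_and0 ev_eq ev_not ev_MatN[where l = 15] ev_MatE ev_call IH
        | (simp add: ok e r(1,2) r2 c f sz_num IH' callenv_app del: num_1; fail))+
    then show ?thesis using Conj by simp
  next
    case (Next A B bd \<psi>)
    have *: "A \<subseteq> Agt M" "B \<subseteq> Agt M" "bound_over M bd" "nice_bound bd" using Next over nf by simp_all
    have "eval N (jump prog N d') f_sat V <-> A = {} \<and> B = {} \<or> game M A B (start_endowment bd \<eta>) (winW M \<phi>) n [s] []"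
      by (rule modal[OF * \<eta> less.prems(12)[unfolded d'] ok e r s _ _ _ nest, where k = 3 and rest = "[tform M \<psi>]"])
        (use Next in simp_all)
    also have "\<dots> <-> sat M s \<eta> \<phi>"
      using sat_game[OF *(1,2) nice_start[OF *(3,4) \<eta>(1,2)] s, of \<phi>] Next by simp
    finally show ?thesis .
  next
    case (Until A B bd \<psi> \<chi>)
    have *: "A \<subseteq> Agt M" "B \<subseteq> Agt M" "bound_over M bd" "nice_bound bd" using Until over nf by simp_all
    have "eval N (jump prog N d') f_sat V <-> A = {} \<and> B = {} \<or> game M A B (start_endowment bd \<eta>) (winW M \<phi>) n [s] []"
      by (rule modal[OF * \<eta> less.prems(12)[unfolded d'] ok e r s _ _ _ nest, where k = 4 and rest = "[tform M \<psi>, tform M \<chi>]"])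
        (use Until in simp_all)
    also have "\<dots> <-> sat M s \<eta> \<phi>"
      using sat_game[OF *(1,2) nice_start[OF *(3,4) \<eta>(1,2)] s, of \<phi>] Until by simp
    finally show ?thesis .
  next
    case (Release A B bd \<psi> \<chi>)
    have *: "A \<subseteq> Agt M" "B \<subseteq> Agt M" "bound_over M bd" "nice_bound bd" using Release over nf by simp_all
    have "eval N (jump prog N d') f_sat V <-> A = {} \<and> B = {} \<or> game M A B (start_endowment bd \<eta>) (winW M \<phi>) n [s] []"
      by (rule modal[OF * \<eta> less.prems(12)[unfolded d'] ok e r s _ _ _ nest, where k = 5 and rest = "[tform M \<psi>, tform M \<chi>]"])
        (use Release in simp_all)
    also have "\<dots> <-> sat M s \<eta> \<phi>"
      using sat_game[OF *(1,2) nice_start[OF *(3,4) \<eta>(1,2)] s, of \<phi>] Release by simp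
    finally show ?thesis .
  qed
  then show ?case unfolding d' jump.simps prog_simps .
qed

end

section \<open>Recognising the encodings of instances\<close>

definition genv :: "nat => nat => nat => nat => nat => tin list => tin list => tin list => tin list => (nat => tr) => bool" where
  "genv nA nR nS nP nC vs av cs su V <-> V 46 = num nA \<and> V 47 = num nR \<and> V 48 = num nS \<and> V 54 = num nP \<and> V 55 = num nC \<and>
     V 52 = lst (map tt vs) \<and> V 49 = lst (map tt av) \<and> V 50 = lst (map tt cs) \<and> V 51 = lst (map tt su)"

definition val_ok :: "nat => nat => tin list => bool" where
  "val_ok nP nS vs <-> nP = length vs \<and> (\<forall>x \<in> set vs. \<exists>xs. x = TL xs \<and> incr nS xs)"

definition av_ok :: "nat => nat => nat => tin list => bool" where
  "av_ok nS nA nC av <-> nS = length av \<and> (\<forall>x \<in> set av. \<exists>xs. x = TL xs \<and> nA = length xs \<and>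
     (\<forall>y \<in> set xs. \<exists>l. y = TL l \<and> l \<noteq> [] \<and> incr nC l))"

definition cost_ok :: "nat => nat => nat => tin list => tin list => bool" where
  "cost_ok nS nC nR av cs <-> nS = length cs \<and> (\<forall>s < nS. s < length cs \<and> s < length av \<and>
     (\<exists>xs. cs ! s = TL xs \<and> (\<exists>al. av ! s = TL al \<and> nC = length xs \<and> (\<forall>\<alpha> < nC. \<alpha> < length xs \<and>
       (\<exists>r. xs ! \<alpha> = TL r \<and>
          ((\<exists>l. TL l \<in> set al \<and> TN \<alpha> \<in> set l) \<and> nR = length r \<and> (\<forall>x \<in> set r. tag x = 1) \<and> (\<exists>y ys. r = y # ys \<and> negt y) \<or>
           \<not> (\<exists>l. TL l \<in> set al \<and> TN \<alpha> \<in> set l) \<and> r = []))))))"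

definition succ_ok :: "nat => nat => tin list => tin list => bool" where
  "succ_ok N nS av su <-> nS = length su \<and> (\<forall>s < nS. s < length su \<and> s < length av \<and>
     (\<exists>xs. su ! s = TL xs \<and> (\<exists>al. av ! s = TL al \<and>
       (sz (lst (map (\<lambda>xs. lst (map tt xs)) (product_lists (map unL al)))) \<le> N \<and>
         length (product_lists (map unL al)) = length xs) \<and>
       (\<forall>x \<in> set xs. \<exists>k. x = TN k \<and> k < nS))))"

lemma jump_wfs:
  assumes "ok N V" "5 * N \<le> d"
  shows "V 52 = lst (map tt vs) ==> V 54 = num nP ==> V 48 = num nS ==> jump prog N d p_wfval V <-> val_ok nP nS vs"
    and "V 49 = lst (map tt av) ==> V 48 = num nS ==> V 46 = num nA ==> V 55 = num nC ==>
      jump prog N d p_wfav V <-> av_ok nS nA nC av"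
    and "V 50 = lst (map tt cs) ==> V 49 = lst (map tt av) ==> V 48 = num nS ==> V 55 = num nC ==> V 47 = num nR ==>
      jump prog N d p_wfcost V <-> cost_ok nS nC nR av cs"
  unfolding val_ok_def av_ok_def cost_ok_def
  by (rule jump_wfval[OF assms] jump_wfav[OF assms] jump_wfcost[OF assms]; assumption)+

lemma jump_wfsucc':
  assumes "ok N V" "5 * N \<le> d" "V 51 = lst (map tt su)" "V 49 = lst (map tt av)" "V 48 = num nS"
    "av_ok nS nA nC av"
  shows "jump prog N d p_wfsucc V <-> succ_ok N nS av su"
  unfolding succ_ok_def
proof (rule jump_wfsucc[OF assms(1-5)])
  fix s al x assume a: "s < length av" "av ! s = TL al" "x \<in> set al"
  then have "TL al \<in> set av" by (metis nth_mem)
  then have "\<forall>y \<in> set al. \<exists>l. y = TL l \<and> l \<noteq> [] \<and> incr nC l" using assms(6) unfolding av_ok_def by auto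
  then show "\<exists>xs. x = TL xs \<and> xs \<noteq> []" using a(3) by blast
qed

definition inputT :: "nat => nat => nat => nat => nat => tin list => tin list => tin list => tin list => nat => tin => tin => tin" where
  "inputT nA nR nS nP nC vs av cs su s e f =
     TL [TL [TN nA, TN nR, TN nS, TN nP, TN nC, TL vs, TL av, TL cs, TL su], TN s, e, f]"

text \<open>Unlike \<open>ev_tlst\<close>, this hands over \<open>ok\<close> for the new valuation
  instead of a size bound, which suits a long sequence of matches.\<close>

lemma ok_tlst:
  assumes "ok N V" "V x = tt t" "x \<noteq> 39" "x \<noteq> c" "c \<noteq> 39" "c < 40 \<or> 45 < c"
    "\<And>xs. ok N (V(39 := num 3, c := lst (map tt xs))) ==> eval N J \<phi> (V(39 := num 3, c := lst (map tt xs))) = P xs"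
  shows "eval N J (tlst x c \<phi>) V <-> (\<exists>xs. t = TL xs \<and> P xs)"
  by (rule ev_tlst[OF assms(1-5)]) (use assms N_facts[OF assms(1)] in \<open>auto simp: sz_num\<close>)

lemma ok_Matt:
  assumes "ok N V" "V l = lst (map tt xs)" "distinct [l, h, t]" "h < 40 \<or> 45 < h" "t < 40 \<or> 45 < t"
    "\<And>y ys. ok N (V(h := tt y, t := lst (map tt ys))) ==> eval N J \<phi> (V(h := tt y, t := lst (map tt ys))) = P y ys"
  shows "eval N J (Mat l h t \<phi>) V <-> (\<exists>y ys. xs = y # ys \<and> P y ys)"
  by (rule ev_Matt[OF assms(1-3)]) (use assms in simp)

lemma ok_tnum:
  assumes "ok N V" "V x = tt t" "x \<noteq> 38" "x \<noteq> u" "u \<noteq> 38" "u < 40 \<or> 45 < u"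
    "\<And>k. ok N (V(38 := num 0, u := num k)) ==> eval N J \<phi> (V(38 := num 0, u := num k)) = P k"
  shows "eval N J (tnum x u \<phi>) V <-> (\<exists>k. t = TN k \<and> P k)"
  by (rule ev_tnum[OF assms(1-5)]) (use assms N_facts[OF assms(1)] in auto)

text \<open>Keeps \<open>ok\<close> of the new valuation in the resulting formula, where
  \<open>eval_restD\<close> can extract it; \<open>ok_tnum_imp\<close> offers it as an assumption,
  as the converse \<open>eval_restI\<close> requires.\<close>

lemma ok_tnum_conj:
  assumes "ok N V" "V x = tt t" "x \<noteq> 38" "x \<noteq> u" "u \<noteq> 38" "u < 40 \<or> 45 < u"
    "\<And>k. ok N (V(38 := num 0, u := num k)) ==> eval N J \<phi> (V(38 := num 0, u := num k)) = P k"
  shows "eval N J (tnum x u \<phi>) V <-> (\<exists>k. t = TN k \<and> ok N (V(38 := num 0, u := num k)) \<and> P k)"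
  by (rule ev_tnum[OF assms(1-5)]) (use assms N_facts[OF assms(1)] in auto)

lemma ok_tnum_imp:
  assumes "ok N V" "V x = tt t" "x \<noteq> 38" "x \<noteq> u" "u \<noteq> 38" "u < 40 \<or> 45 < u"
    "\<And>k. ok N (V(38 := num 0, u := num k)) ==> eval N J \<phi> (V(38 := num 0, u := num k)) = P k"
  shows "eval N J (tnum x u \<phi>) V <-> (\<exists>k. t = TN k \<and> (ok N (V(38 := num 0, u := num k)) --> P k))"
  by (rule ev_tnum[OF assms(1-5)]) (use assms N_facts[OF assms(1)] in auto)

lemma callenv_Nil: "callenv [] V = V"
  by (rule ext) (auto simp: callenv_app)

lemma ev_call_raw:
  assumes "ok N V" "\<forall>v \<in> set vs. v < 60" "length vs \<le> 8"
  shows "eval N J (call p vs) V = J p (callenv vs V)"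
  using assms by simp

lemma ev_call0: "ok N V ==> J p V = P ==> eval N J (call p []) V = P"
  by (simp add: callenv_Nil)

lemma iff_elim: "E = P ==> E ==> (P ==> thesis) ==> thesis" by simp

lemma iff_intro: "E = P ==> P ==> E" by simp

definition rest :: frm where
  "rest = (tlst 8 10 (Mat 10 11 12 (Mat 12 13 14 (Mat 14 15 16 (Mat 16 17 18 (FAnd (FL 18)
  (tlst 11 19 (Mat 19 20 21 (Mat 21 22 23 (Mat 23 24 25 (Mat 25 26 27 (Mat 27 28 29 (Mat 29 30 31
    (Mat 31 32 33 (Mat 33 34 35 (Mat 35 36 37 (FAnd (FL 37)
  (tnum 20 46 (tnum 22 47 (tnum 24 48 (tnum 26 54 (tnum 28 55
    (tlst 30 52 (tlst 32 49 (tlst 34 50 (tlst 36 51 (tnum 13 14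
  (FAnd (FNot (FL 46)) (FAnd (FNot (FL 47)) (FAnd (FNot (FL 48)) (FAnd (FNot (FL 55))
  (FAnd (call p_wfval []) (FAnd (call p_wfav []) (FAnd (call p_wfcost []) (FAnd (call p_wfsucc [])
  (FAnd (lt 14 48 9 10) (FAnd (call p_wfen [15]) (FAnd (call p_wffm [17])
    (call p_sat [14, 15, 17])))))))))))))))))))))))))))))))))))))))"

definition checked :: "nat => nat => nat => nat => nat => nat => tin list => tin list => tin list => tin list => nat => tin => tin => (nat => tr) => bool" where
  "checked N nA nR nS nP nC vs av cs su s e f V <-> ok N V \<and> genv nA nR nS nP nC vs av cs su V \<and>
     V 14 = num s \<and> V 15 = tt e \<and> V 17 = tt f"

lemma checked_exI:
  assumes "jump prog N d p_wfen (callenv [15] V')" "jump prog N d p_wffm (callenv [17] V')" "jump prog N d p_sat (callenv [14, 15, 17] V')"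
    "ok N V'" "V' 46 = num nA" "V' 47 = num nR" "V' 48 = num nS" "V' 54 = num nP" "V' 55 = num nC"
    "V' 52 = lst (map tt vs)" "V' 49 = lst (map tt av)" "V' 50 = lst (map tt cs)" "V' 51 = lst (map tt su)"
    "V' 14 = num s" "V' 15 = tt e" "V' 17 = tt f" "V' 53 = V 53"
    "num nA \<noteq> Lf" "num nR \<noteq> Lf" "num nS \<noteq> Lf" "num nC \<noteq> Lf" "val_ok nP nS vs" "av_ok nS nA nC av" "cost_ok nS nC nR av cs"
    "succ_ok N nS av su" "s < nS"
    "x = inputT nA nR nS nP nC vs av cs su s e f"
  shows "\<exists>nA nR nS nP nC vs av cs su s e f V'. x = inputT nA nR nS nP nC vs av cs su s e f \<and>
     checked N nA nR nS nP nC vs av cs su s e f V' \<and> V' 53 = V 53 \<and> nA \<noteq> 0 \<and> nR \<noteq> 0 \<and> nS \<noteq> 0 \<and> nC \<noteq> 0 \<and>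
     val_ok nP nS vs \<and> av_ok nS nA nC av \<and> cost_ok nS nC nR av cs \<and> succ_ok N nS av su \<and> s < nS \<and>
     jump prog N d p_wfen (callenv [15] V') \<and> jump prog N d p_wffm (callenv [17] V') \<and> jump prog N d p_sat (callenv [14, 15, 17] V')"
  using assms unfolding checked_def genv_def num_eq_Lf by (intro exI conjI)

text \<open>The last three calls remain uninterpreted: their meaning refers to a model, which is
  first to be decoded from the tables found here.\<close>

lemma eval_restD:
  assumes ok: "ok N V" and d: "5 * N \<le> d" "3 * N \<le> d" and r: "V 8 = tt x" and ev: "eval N (jump prog N d) rest V"
  shows "\<exists>nA nR nS nP nC vs av cs su s e f V'. x = inputT nA nR nS nP nC vs av cs su s e f \<and>
     checked N nA nR nS nP nC vs av cs su s e f V' \<and> V' 53 = V 53 \<and> nA \<noteq> 0 \<and> nR \<noteq> 0 \<and> nS \<noteq> 0 \<and> nC \<noteq> 0 \<and>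
     val_ok nP nS vs \<and> av_ok nS nA nC av \<and> cost_ok nS nC nR av cs \<and> succ_ok N nS av su \<and> s < nS \<and>
     jump prog N d p_wfen (callenv [15] V') \<and> jump prog N d p_wffm (callenv [17] V') \<and> jump prog N d p_sat (callenv [14, 15, 17] V')"
  apply (rule iff_elim[OF _ ev])
  unfolding rest_def
   apply (rule ok_tlst ok_Matt[where l = 10] ok_Matt[where l = 12] ok_Matt[where l = 14] ok_Matt[where l = 16] ok_Matt[where l = 19] ok_Matt[where l = 21]
     ok_Matt[where l = 23] ok_Matt[where l = 25] ok_Matt[where l = 27] ok_Matt[where l = 29] ok_Matt[where l = 31] ok_Matt[where l = 33] ok_Matt[where l = 35]
     ok_tnum_conj[where x = 13] ok_tnum ev_L ev_and ev_not ev_lt ev_call0 jump_wfs jump_wfsucc' ev_call_raw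
     | assumption | (simp (no_asm) add: ok d r; fail))+
  apply (elim exE conjE)
  apply (rule checked_exI)
  apply (assumption | (simp (no_asm); fail) | (simp add: inputT_def; fail))+
  done

lemma checkedI:
  assumes "ok N V'" "V' 46 = num nA" "V' 47 = num nR" "V' 48 = num nS" "V' 54 = num nP" "V' 55 = num nC"
    "V' 52 = lst (map tt vs)" "V' 49 = lst (map tt av)" "V' 50 = lst (map tt cs)" "V' 51 = lst (map tt su)"
    "V' 14 = num s" "V' 15 = tt e" "V' 17 = tt f"
  shows "checked N nA nR nS nP nC vs av cs su s e f V'"
  using assms by (simp add: checked_def genv_def)

lemma conj_Lf: "Q ==> lst (map tt []) = Lf \<and> Q"
  by simp

lemma num_neq_Lf: "k \<noteq> 0 ==> num k \<noteq> Lf"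
  by simp

lemma eval_restI:
  assumes ok: "ok N V" and d: "5 * N \<le> d" "3 * N \<le> d" and r: "V 8 = tt (inputT nA nR nS nP nC vs av cs su s e f)"
    and pos: "nA \<noteq> 0" "nR \<noteq> 0" "nS \<noteq> 0" "nC \<noteq> 0"
    and T: "val_ok nP nS vs" "av_ok nS nA nC av" "cost_ok nS nC nR av cs" "succ_ok N nS av su" "s < nS"
    and J: "\<And>V'. checked N nA nR nS nP nC vs av cs su s e f V' ==> V' 53 = V 53 ==>
      jump prog N d p_wfen (callenv [15] V') \<and> jump prog N d p_wffm (callenv [17] V') \<and> jump prog N d p_sat (callenv [14, 15, 17] V')"
  shows "eval N (jump prog N d) rest V"
  apply (rule iff_intro)
  unfolding rest_def
   apply (rule ok_tlst ok_Matt[where l = 10] ok_Matt[where l = 12] ok_Matt[where l = 14] ok_Matt[where l = 16] ok_Matt[where l = 19] ok_Matt[where l = 21]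
     ok_Matt[where l = 23] ok_Matt[where l = 25] ok_Matt[where l = 27] ok_Matt[where l = 29] ok_Matt[where l = 31] ok_Matt[where l = 33] ok_Matt[where l = 35]
     ok_tnum_imp[where x = 13] ok_tnum ev_L ev_and ev_not ev_lt ev_call0 jump_wfs jump_wfsucc' ev_call_raw
     | assumption | (simp (no_asm) add: ok d r; fail))+
  unfolding inputT_def
  apply (rule exI conjI[OF refl] conj_Lf)+
  apply (rule impI)
  apply (rule conjI T pos num_neq_Lf)+
  apply (rule J[THEN conjunct1] J[THEN conjunct2, THEN conjunct1] J[THEN conjunct2, THEN conjunct2] checkedI conjI
    | assumption | (simp (no_asm); fail))+
  done

lemma erase_tset: "erase (tset A) = input_set A"
  by (simp add: tset_def input_set_def bin_def comp_def)

lemma erase_ten: "erase (ten M \<eta>) = input_endowment M \<eta>"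
  by (simp add: ten_def input_endowment_def table_def comp_def)

lemma erase_tbound: "erase (tbound M b) = input_bound M b"
  by (cases b) (simp_all add: erase_ten)

lemma erase_tform: "erase (tform M \<phi>) = input_formula M \<phi>"
  by (induction \<phi>) (simp_all add: erase_tset erase_tbound bin_def)

definition inputM :: "rbcgs => nat => tin => tin => tin" where
  "inputM M s e f = inputT (nAgt M) (nRes M) (nSt M) (nProp M) (nAct M) (valT M) (avT M) (costT M) (succT M) s e f"

lemma encode_inputM: "encode M s \<eta> \<phi> = serialize (erase (inputM M s (ten M \<eta>) (tform M \<phi>)))"
proof -
  have "erase (TL (costR M s \<alpha>)) = (if \<exists>a \<in> Agt M. \<alpha> \<in> avail M s a then table (nRes M) (\<lambda>k. Bin (cost M s \<alpha> k)) else Lst [])" for s \<alpha>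
    by (simp add: costR_def table_def comp_def)
  moreover have "erase (TL (succR M s)) = Lst (map (\<lambda>\<sigma>. bin (succ M s \<sigma>)) (jl M s))" for s
    by (simp add: succR_def bin_def comp_def)
  ultimately show ?thesis
    unfolding encode_def inputM_def inputT_def input_model_def valT_def avT_def avR_def costT_def succT_def
    by (simp add: table_def bin_def comp_def erase_tset erase_ten erase_tform jl_def del: serialize.simps)
qed

lemma incr_setL: "S \<subseteq> {..<n} ==> incr n (setL S)"
  unfolding incr_iff setL_def by blast

context
  fixes M :: rbcgs
  assumes M: "is_rbcgs M"
begin

lemma tables_pos: "nAgt M \<noteq> 0" "nRes M \<noteq> 0" "nSt M \<noteq> 0" "nAct M \<noteq> 0"
  using M by (auto simp: is_rbcgs_def Agt_def Res_def St_def Act_def)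

lemma val_ok_tables: "val_ok (nProp M) (nSt M) (valT M)"
proof -
  have "incr (nSt M) (setL (val M p))" if "p < nProp M" for p
    using M that by (intro incr_setL) (auto simp: is_rbcgs_def Props_def St_def)
  then show ?thesis by (auto simp: val_ok_def valT_def tset_setL)
qed

lemma avail_facts:
  assumes "s < nSt M" "a < nAgt M"
  shows "avail M s a \<subseteq> {..<nAct M}" "avail M s a \<noteq> {}" "finite (avail M s a)"
proof -
  show 1: "avail M s a \<subseteq> {..<nAct M}" "avail M s a \<noteq> {}"
    using M assms unfolding is_rbcgs_def St_def Agt_def Act_def by blast+
  show "finite (avail M s a)" using 1(1) finite_subset by blast
qed

lemma av_ok_tables: "av_ok (nSt M) (nAgt M) (nAct M) (avT M)"
proof -
  have "setL (avail M s a) \<noteq> [] \<and> incr (nAct M) (setL (avail M s a))" if "s < nSt M" "a < nAgt M" for s a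
    using avail_facts[OF that] incr_setL by (simp add: setL_def)
  then show ?thesis by (auto simp: av_ok_def avT_def avR_def tset_setL)
qed

lemma cost_ok_tables: "cost_ok (nSt M) (nAct M) (nRes M) (avT M) (costT M)"
proof -
  have al: "(\<exists>l. TL l \<in> set (avR M s) \<and> TN \<alpha> \<in> set l) <-> (\<exists>a \<in> Agt M. \<alpha> \<in> avail M s a)" if "s < nSt M" for s \<alpha>
  proof -
    have "(\<exists>l. TL l \<in> set (avR M s) \<and> TN \<alpha> \<in> set l) <-> (\<exists>a \<in> Agt M. TN \<alpha> \<in> set (setL (avail M s a)))"
      unfolding avR_def tset_setL by (fastforce simp: Agt_def)
    also have "\<dots> <-> (\<exists>a \<in> Agt M. \<alpha> \<in> avail M s a)"
      using avail_facts(3)[OF that] by (intro bex_cong refl) (auto simp: setL_def Agt_def)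
    finally show ?thesis .
  qed
  have row: "(\<exists>l. TL l \<in> set (avR M s) \<and> TN \<alpha> \<in> set l) \<and> nRes M = length (costR M s \<alpha>) \<and> (\<forall>x \<in> set (costR M s \<alpha>). tag x = 1) \<and>
        (\<exists>y ys. costR M s \<alpha> = y # ys \<and> negt y) \<or>
      \<not> (\<exists>l. TL l \<in> set (avR M s) \<and> TN \<alpha> \<in> set l) \<and> costR M s \<alpha> = []" if s: "s < nSt M" for s \<alpha>
  proof (cases "\<exists>a \<in> Agt M. \<alpha> \<in> avail M s a")
    case True
    then have c: "costR M s \<alpha> = map (\<lambda>k. TI (cost M s \<alpha> k)) [0..<nRes M]" by (simp add: costR_def)
    have "cost M s \<alpha> 0 \<le> - 1" using True M s unfolding is_rbcgs_def St_def by blast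
    moreover have "[0..<nRes M] = 0 # [1..<nRes M]" using tables_pos(2) by (simp add: upt_conv_Cons One_nat_def)
    ultimately have "\<exists>y ys. costR M s \<alpha> = y # ys \<and> negt y" using c negt_TI by simp
    then show ?thesis using True al[OF s] c by auto
  next
    case False
    then show ?thesis using al[OF s] by (simp add: costR_def)
  qed
  show ?thesis unfolding cost_ok_def
    using row by (simp add: nth_tables)
qed

lemma succ_ok_tables:
  assumes "\<And>s. s < nSt M ==> sz (lst (map acts (jl M s))) \<le> N"
  shows "succ_ok N (nSt M) (avT M) (succT M)"
proof -
  have p: "map (\<lambda>xs. lst (map tt xs)) (product_lists (map unL (avR M s))) = map acts (jl M s)"
    "length (product_lists (map unL (avR M s))) = length (succR M s)" for s
    unfolding product_avR by (simp_all add: acts_def succR_def)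
  have "\<exists>k. x = TN k \<and> k < nSt M" if s: "s < nSt M" and x: "x \<in> set (succR M s)" for s x
  proof -
    have jl: "set (jl M s) = joint M s" using avail_facts(3)[OF s] by (intro set_jl) (simp add: Agt_def)
    then obtain \<sigma> where "\<sigma> \<in> joint M s" "x = TN (succ M s \<sigma>)" using x by (auto simp: succR_def)
    moreover then have "succ M s \<sigma> \<in> St M" using M s unfolding is_rbcgs_def St_def by blast
    ultimately show ?thesis by (simp add: St_def)
  qed
  then show ?thesis unfolding succ_ok_def using assms p by (simp add: nth_tables)
qed

end

subsection \<open>Sizes\<close>

primrec len :: "tin => nat" where
  "len (TN k) = length (bits k) + 1" | "len (TI z) = length (bits (nat \<bar>z\<bar>)) + of_bool (z < 0) + 1"
| "len (TU k) = k + 1" | "len (TL xs) = sum_list (map len xs) + 2"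

lemma len_serialize: "length (serialize (erase x)) = len x"
  by (induction x) (auto simp: length_concat comp_def cong: map_cong)

text \<open>Indices are written in binary in the word but as lists of leaves in the tree; bounding
  them is what keeps the tree polynomial.\<close>

primrec small :: "nat => tin => bool" where
  "small n (TN k) <-> k \<le> n" | "small n (TI z) <-> True" | "small n (TU k) <-> True" | "small n (TL xs) <-> list_all (small n) xs"

lemma sz_bits: "sz (lst (map sc (bits k))) \<le> 4 * length (bits k) + 1"
proof -
  have "sz (lst (map sc xs)) \<le> 4 * length xs + 1" if "set xs \<subseteq> {Zero, One}" for xs
    using that by (induction xs) (auto simp: sz_num)
  moreover have "set (bits k) \<subseteq> {Zero, One}"
  proof (induction k rule: less_induct)
    case (less k)
    then show ?case by (cases "k = 0") (auto simp: bits_pos)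
  qed
  ultimately show ?thesis by blast
qed

lemma bits_bound: "k < 2 ^ length (bits k)"
proof (induction k rule: less_induct)
  case (less k)
  show ?case
  proof (cases "k = 0")
    case False
    then have "k div 2 < 2 ^ length (bits (k div 2))" using less[of "k div 2"] by simp
    then show ?thesis using False by (simp add: bits_pos[of k])
  qed simp
qed

lemma length_bits: "k < 2 ^ m ==> length (bits k) \<le> m"
proof (induction m arbitrary: k)
  case (Suc m)
  show ?case
  proof (cases "k = 0")
    case False
    have "length (bits (k div 2)) \<le> m" by (rule Suc.IH) (use Suc.prems in simp)
    then show ?thesis using False by (simp add: bits_pos[of k])
  qed simp
qed simp

lemma length_bits_le: "length (bits k) \<le> k"
  by (rule length_bits) (rule less_exp)

text \<open>An index contributes at most \<open>2 * n\<close> and a constant, any other symbol a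
  constant. The \<open>+ 1\<close> is the list node above an element, so that the bound adds up over
  lists.\<close>

lemma sz_tt_len: "small n x ==> sz (tt x) + 1 \<le> (2 * n + 20) * len x"
proof (induction x)
  case (TN k)
  have "sz (tt (TN k)) + 1 \<le> 2 * n + 20" using TN by (simp add: tt.simps sz_num)
  also have "\<dots> \<le> (2 * n + 20) * len (TN k)" by simp
  finally show ?case .
next
  case (TI z)
  have "sz (tt (TI z)) + 1 \<le> 20 * len (TI z)"
    using sz_bits[of "nat \<bar>z\<bar>"] by (cases "z < 0") (simp_all add: tt.simps)
  also have "\<dots> \<le> (2 * n + 20) * len (TI z)" by (rule mult_le_mono1) simp
  finally show ?case .
next
  case (TU k)
  have "sz (tt (TU k)) + 1 \<le> 20 * len (TU k)"
    using sz_bits[of k] length_bits_le[of k] by (simp add: tt.simps sz_num)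
  also have "\<dots> \<le> (2 * n + 20) * len (TU k)" by (rule mult_le_mono1) simp
  finally show ?case .
next
  case (TL xs)
  have "sz (lst (map tt xs)) \<le> (2 * n + 20) * sum_list (map len xs) + 1"
    using TL by (induction xs) (force simp: algebra_simps)+
  then show ?case by (simp add: tt.simps sz_num algebra_simps)
qed

lemma len_mem: "x \<in> set xs ==> len x < len (TL xs)"
  using member_le_sum_list[of "len x" "map len xs"] by simp

lemma len_pos: "0 < len x"
  by (cases x) simp_all

lemma len_length: "length xs < len (TL xs)"
proof -
  have "length xs \<le> sum_list (map len xs)"
  proof (induction xs)
    case (Cons x xs)
    then show ?case using len_pos[of x] by simp
  qed simp
  then show ?thesis by simp
qed

lemma md_len: "md \<phi> \<le> len (tform M \<phi>)"
  by (induction \<phi>) simp_all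

lemma size_sz: "size x \<le> sz (tt x)"
proof (induction x)
  case (TL xs)
  have "size_list size xs \<le> sz (lst (map tt xs))"
    using TL by (induction xs) (force simp: algebra_simps)+
  then show ?case by (simp add: tt.simps sz_num)
qed (simp_all add: tt.simps)

lemma len_ten:
  assumes "a < nAgt M" "k < nRes M"
  shows "\<eta> (a, k) < len (ten M \<eta>)"
proof -
  have "len (TU (\<eta> (a, k))) < len (TL (map (\<lambda>k. TU (\<eta> (a, k))) [0..<nRes M]))"
    by (rule len_mem) (use assms in auto)
  also have "\<dots> < len (ten M \<eta>)"
    unfolding ten_def by (rule len_mem) (use assms in auto)
  finally show ?thesis by simp
qed

text \<open>Here the unary notation decides: an entry is smaller than the length of its encoding,
  and with it the number of rounds is linear in the input.\<close>

lemma ten_nice: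
  assumes "\<eta> \<in> En M" "nRes M \<noteq> 0" "len (ten M \<eta>) \<le> n"
  shows "nice M n n \<eta>"
proof -
  have lt: "\<eta> (a, k) < n" if "a < nAgt M" "k < nRes M" for a k
    using len_ten[OF that, of \<eta>] assms(3) by simp
  then have "\<eta> (a, k) < 2 ^ n" if "a < nAgt M" "k < nRes M" for a k
    using lt[OF that] less_exp[of n] less_trans by blast
  then show ?thesis using assms lt by (auto simp: nice_def)
qed

lemma sz_ten:
  assumes e: "nice M n m e" and d: "nAgt M \<le> n" "nRes M \<le> n"
  shows "sz (tt (ten M e)) \<le> n * (n * (4 * m + 8) + 10) + 9"
proof -
  have TU: "sz (tt (TU v)) \<le> 4 * m + 7" if "v < 2 ^ m" for v
    using sz_bits[of v] length_bits[OF that] by (simp add: tt.simps sz_num)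
  have row: "sz (tt (TL (rowE M e a))) \<le> n * (4 * m + 8) + 9" if "a < nAgt M" for a
  proof -
    have "sz (lst (map tt (rowE M e a))) \<le> length (map tt (rowE M e a)) * (4 * m + 7 + 1) + 1"
      by (rule sz_lst_le) (use TU e that in \<open>auto simp: rowE_def nice_def\<close>)
    also have "\<dots> \<le> n * (4 * m + 8) + 1"
      using mult_le_mono1[OF d(2), of "4 * m + 8"] by (simp add: rowE_def algebra_simps)
    finally show ?thesis by (simp add: tt.simps sz_num)
  qed
  have "sz (lst (map tt (map (\<lambda>a. TL (rowE M e a)) [0..<nAgt M]))) \<le>
      length (map tt (map (\<lambda>a. TL (rowE M e a)) [0..<nAgt M])) * (n * (4 * m + 8) + 9 + 1) + 1"
    by (rule sz_lst_le) (use row in auto)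
  also have "\<dots> = nAgt M * (n * (4 * m + 8) + 10) + 1" by simp
  also have "\<dots> \<le> n * (n * (4 * m + 8) + 10) + 1"
    by (rule add_le_mono1[OF mult_le_mono1[OF d(1)]])
  finally show ?thesis unfolding ten_rowE by (simp add: tt.simps(4)[of "map _ _"] sz_num)
qed

lemma sz_acts:
  assumes "\<sigma> \<in> joint M s" "is_rbcgs M" "s < nSt M" "nAgt M \<le> n" "nAct M \<le> n"
  shows "sz (acts \<sigma>) \<le> n * (2 * n + 4) + 1"
proof -
  have \<sigma>: "length \<sigma> = nAgt M" using assms(1) by (simp add: joint_def)
  have "sz (lst (map tt (map TN \<sigma>))) \<le> length (map tt (map TN \<sigma>)) * (2 * n + 3 + 1) + 1"
  proof (rule sz_lst_le)
    fix x assume "x \<in> set (map tt (map TN \<sigma>))"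
    then obtain a where a: "a < nAgt M" "x = tt (TN (\<sigma> ! a))" using \<sigma> by (auto simp: in_set_conv_nth)
    then have "\<sigma> ! a < n" using joint_avail[OF assms(2,3,1) a(1)] assms(5) by simp
    then show "sz x \<le> 2 * n + 3" using a(2) by (simp add: tt.simps sz_num)
  qed
  also have "\<dots> \<le> n * (2 * n + 4) + 1"
    using mult_le_mono1[OF assms(4), of "2 * n + 4"] \<sigma> by (simp add: algebra_simps)
  finally show ?thesis by (simp add: acts_def)
qed

text \<open>\<open>n\<close> is the length of the input word and at the same time the number of
  rounds of every game.\<close>

locale instance_of =
  fixes M :: rbcgs and s :: nat and \<eta> :: endowment and \<phi> :: fm and n :: nat
  assumes M: "is_rbcgs M" and s: "s < nSt M" and \<eta>: "\<eta> \<in> En M" and \<phi>: "formula_over M \<phi>"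
    and n: "n = len (inputM M s (ten M \<eta>) (tform M \<phi>))"
begin

lemma parts:
  "len (TL (valT M)) < n" "len (TL (avT M)) < n" "len (TL (costT M)) < n" "len (TL (succT M)) < n"
  "len (ten M \<eta>) < n" "len (tform M \<phi>) < n"
  unfolding n inputM_def inputT_def by simp_all

text \<open>Each of these numbers is the length of a list that is spelled out in the
  encoding.\<close>

lemma dims: "nProp M \<le> n" "nSt M \<le> n" "nAgt M \<le> n" "nAct M \<le> n" "nRes M \<le> n"
proof -
  show "nProp M \<le> n" using len_length[of "valT M"] parts(1) by (simp add: nth_tables)
  show "nSt M \<le> n" using len_length[of "avT M"] parts(2) by (simp add: nth_tables)
  have "length (avR M s) < len (TL (avR M s))" by (rule len_length)
  also have "\<dots> < len (TL (avT M))" by (rule len_mem) (use s in \<open>auto simp: avT_def\<close>)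
  finally show "nAgt M \<le> n" using parts(2) by (simp add: avR_def)
  have "length (map (\<lambda>\<alpha>. TL (costR M s \<alpha>)) [0..<nAct M]) < len (TL (map (\<lambda>\<alpha>. TL (costR M s \<alpha>)) [0..<nAct M]))" by (rule len_length)
  also have "\<dots> < len (TL (costT M))" by (rule len_mem) (use s in \<open>auto simp: costT_def\<close>)
  finally show "nAct M \<le> n" using parts(3) by simp
  have "length (rowE M \<eta> 0) < len (TL (rowE M \<eta> 0))" by (rule len_length)
  also have "\<dots> < len (ten M \<eta>)" unfolding ten_rowE by (rule len_mem) (use tables_pos(1)[OF M] in auto)
  finally show "nRes M \<le> n" using parts(5) by (simp add: rowE_def)
qed

text \<open>The number of joint actions can be exponential in the number of agents, but the
  transition table has an entry for each of them.\<close>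

lemma jl_length: "s' < nSt M ==> length (jl M s') \<le> n"
proof -
  assume s': "s' < nSt M"
  have "length (succR M s') < len (TL (succR M s'))" by (rule len_length)
  also have "\<dots> < len (TL (succT M))" by (rule len_mem) (use s' in \<open>auto simp: succT_def\<close>)
  finally show ?thesis using parts(4) by (simp add: succR_def)
qed

lemma cost_small:
  assumes "s' < nSt M" "a \<in> Agt M" "\<alpha> \<in> avail M s' a" "k < nRes M"
  shows "nat \<bar>cost M s' \<alpha> k\<bar> < 2 ^ n"
proof -
  let ?v = "nat \<bar>cost M s' \<alpha> k\<bar>"
  have \<alpha>: "\<alpha> < nAct M" using avail_facts(1)[OF M assms(1), of a] assms(2,3) by (auto simp: Agt_def)
  have "length (bits ?v) < len (TI (cost M s' \<alpha> k))" by simp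
  also have "\<dots> < len (TL (costR M s' \<alpha>))"
    by (rule len_mem) (use assms in \<open>auto simp: costR_def\<close>)
  also have "\<dots> < len (TL (map (\<lambda>\<alpha>. TL (costR M s' \<alpha>)) [0..<nAct M]))"
    by (rule len_mem) (use \<alpha> in auto)
  also have "\<dots> < len (TL (costT M))" by (rule len_mem) (use assms(1) in \<open>auto simp: costT_def\<close>)
  finally have "length (bits ?v) \<le> n" using parts(3) by simp
  then have "(2 :: nat) ^ length (bits ?v) \<le> 2 ^ n" by (simp add: power_increasing)
  then show ?thesis using bits_bound[of ?v] by linarith
qed

lemma md_n: "md \<phi> \<le> n"
  using md_len[of \<phi> M] parts(6) by simp

text \<open>The summand 20 absorbs the constants, so that powers of \<open>X\<close> can bound all
  the polynomials in \<open>n\<close> below.\<close>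

definition X :: nat where "X = n + 20"

lemma up: "a \<le> X ^ i ==> i \<le> j ==> a \<le> X ^ j"
  by (erule order_trans, rule power_increasing) (simp_all add: X_def)

text \<open>A step of Horner's scheme raises the exponent by at most two: once for the factor
  \<open>c\<close> and once for the sum, as \<open>2 \<le> X\<close>.\<close>

lemma X_step:
  assumes "a \<le> X ^ i" "b \<le> X ^ i" "c \<le> X" "i + 2 \<le> j"
  shows "c * a + b \<le> X ^ j"
proof (rule up[OF _ assms(4)])
  have "c * a \<le> X * X ^ i" using assms by (intro mult_le_mono) auto
  moreover have "X ^ i \<le> X * X ^ i" by (simp add: X_def)
  moreover have "2 * (X * X ^ i) \<le> X * (X * X ^ i)" by (intro mult_le_mono1) (simp add: X_def)
  moreover have "X * (X * X ^ i) = X ^ (i + 2)" by simp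
  ultimately show "c * a + b \<le> X ^ (i + 2)" using assms(2) by linarith
qed

text \<open>The first polynomial belongs to a computation of \<open>n + 1\<close> configurations
  whose entries have \<open>n + n * n\<close> bits. It is the largest here, with exponent 11, and is
  covered by the common exponent 12.\<close>

lemma bounds:
  "(n + 1) * (n * (n * (4 * (n + n * n) + 8) + 10) + (2 * n + 12)) + 1 \<le> X ^ 12"
  "(n + 1) * (n * (2 * n + 4) + 2) + 1 \<le> X ^ 12" "(n + 1) * (2 * n + 2) + 1 \<le> X ^ 12"
  "n * 12 + 1 \<le> X ^ 12" "(2 * n + 20) * n \<le> X ^ 12"
proof -
  have C: "c \<le> X ^ 1" if "c \<le> 20" for c using that by (simp add: X_def)
  have n1: "n \<le> X" "n + 1 \<le> X" "2 \<le> X" "4 \<le> X" by (simp_all add: X_def)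
  have n1': "n \<le> X ^ 1" by (simp add: X_def)
  have lin: "2 * n + c \<le> X ^ 3" if "c \<le> 20" for c
    by (rule X_step[OF n1' C[OF that] n1(3)]) simp
  have "n * n + n \<le> X ^ 3" by (rule X_step[OF n1' n1' n1(1)]) simp
  then have "4 * (n * n + n) + 8 \<le> X ^ 5" by (rule X_step[OF _ up[OF C] n1(4)]) simp_all
  then have "n * (4 * (n * n + n) + 8) + 10 \<le> X ^ 7" by (rule X_step[OF _ up[OF C] n1(1)]) simp_all
  then have "n * (n * (4 * (n * n + n) + 8) + 10) + (2 * n + 12) \<le> X ^ 9"
    by (rule X_step[OF _ up[OF lin] n1(1)]) simp_all
  then have "(n + 1) * (n * (n * (4 * (n * n + n) + 8) + 10) + (2 * n + 12)) + 1 \<le> X ^ 11"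
    by (rule X_step[OF _ up[OF C] n1(2)]) simp_all
  then show "(n + 1) * (n * (n * (4 * (n + n * n) + 8) + 10) + (2 * n + 12)) + 1 \<le> X ^ 12"
    unfolding add.commute[of n "n * n"] by (rule up) simp
  have "n * (2 * n + 4) + 2 \<le> X ^ 5" by (rule X_step[OF lin up[OF C] n1(1)]) simp_all
  then have "(n + 1) * (n * (2 * n + 4) + 2) + 1 \<le> X ^ 7" by (rule X_step[OF _ up[OF C] n1(2)]) simp_all
  then show "(n + 1) * (n * (2 * n + 4) + 2) + 1 \<le> X ^ 12" by (rule up) simp
  have "(n + 1) * (2 * n + 2) + 1 \<le> X ^ 5" by (rule X_step[OF lin up[OF C] n1(2)]) simp_all
  then show "(n + 1) * (2 * n + 2) + 1 \<le> X ^ 12" by (rule up) simp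
  have "n * 12 + 1 \<le> X ^ 3" by (rule X_step[OF C C n1(1)]) simp_all
  then show "n * 12 + 1 \<le> X ^ 12" by (rule up) simp
  have "n * (2 * n + 20) + 0 \<le> X ^ 5" by (rule X_step[OF lin _ n1(1)]) simp_all
  then show "(2 * n + 20) * n \<le> X ^ 12" by (intro up[of _ 5 12]) (simp_all add: mult.commute)
qed

end

lemma small_tset: "A \<subseteq> {..<k} ==> k \<le> n ==> small n (tset A)"
  using finite_subset[of A "{..<k}"] by (auto simp: tset_def list_all_iff)

lemma small_ten: "small n (ten M \<eta>)"
  by (simp add: ten_def list_all_iff)

lemma small_tform:
  assumes "nProp M \<le> n" "nAgt M \<le> n" "5 \<le> n"
  shows "formula_over M \<phi> ==> small n (tform M \<phi>)"
proof (induction \<phi>)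
  case (Next A B b \<phi>)
  then show ?case using assms by (cases b) (auto simp: Agt_def intro: small_tset small_ten)
next
  case (Until A B b \<phi> \<psi>)
  then show ?case using assms by (cases b) (auto simp: Agt_def intro: small_tset small_ten)
next
  case (Release A B b \<phi> \<psi>)
  then show ?case using assms by (cases b) (auto simp: Agt_def intro: small_tset small_ten)
qed (use assms in \<open>auto simp: Props_def\<close>)

context instance_of
begin

lemma sz_jl: "s' < nSt M ==> sz (lst (map acts (jl M s'))) \<le> X ^ 12"
proof -
  assume s': "s' < nSt M"
  have "set (jl M s') = joint M s'" using avail_facts(3)[OF M s'] by (intro set_jl) (simp add: Agt_def)
  then have "sz (lst (map acts (jl M s'))) \<le> length (map acts (jl M s')) * (n * (2 * n + 4) + 1 + 1) + 1"
    using sz_acts[OF _ M s' dims(3,4)] by (intro sz_lst_le) auto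
  also have "\<dots> = length (jl M s') * (n * (2 * n + 4) + 2) + 1" by (simp add: algebra_simps)
  also have "\<dots> \<le> (n + 1) * (n * (2 * n + 4) + 2) + 1"
    using jl_length[OF s'] by (intro add_le_mono1 mult_le_mono1) simp
  also have "\<dots> \<le> X ^ 12" by (rule bounds)
  finally show ?thesis .
qed

text \<open>Entries start with \<open>n\<close> bits, and each of at most \<open>n\<close> modal
  levels adds at most \<open>n\<close> more; hence \<open>n + n * n\<close>.\<close>

lemma bounded:
  assumes "length (els cl) = n"
  shows "bounded_model M (X ^ 12) n (n + n * n) cl"
proof
  show "length (els cl) = n" by (rule assms)
next
  fix \<pi> assume \<pi>: "length \<pi> \<le> Suc n" "\<And>c. c \<in> set \<pi> ==> fst c < nSt M \<and> nice M n (n + n * n) (snd c)"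
  let ?b = "n * (n * (4 * (n + n * n) + 8) + 10) + (2 * n + 12)"
  have "sz (ctree M \<pi>) \<le> length (map (\<lambda>c. Nd (num (fst c)) (tt (ten M (snd c)))) \<pi>) * ((?b - 1) + 1) + 1"
    unfolding ctree_def
  proof (rule sz_lst_le)
    fix x assume "x \<in> set (map (\<lambda>c. Nd (num (fst c)) (tt (ten M (snd c)))) \<pi>)"
    then obtain c where c: "c \<in> set \<pi>" "x = Nd (num (fst c)) (tt (ten M (snd c)))" by auto
    then show "sz x \<le> ?b - 1"
      using \<pi>(2)[OF c(1)] sz_ten[of M n "n + n * n" "snd c"] dims by (simp add: sz_num)
  qed
  also have "\<dots> = length \<pi> * ?b + 1" by simp
  also have "\<dots> \<le> (n + 1) * ?b + 1" using \<pi>(1) by (intro add_le_mono1 mult_le_mono1) simp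
  also have "\<dots> \<le> X ^ 12" by (rule bounds)
  finally show "sz (ctree M \<pi>) \<le> X ^ 12" .
next
  fix ss assume ss: "length ss \<le> Suc n" "set ss \<subseteq> {..<nSt M}"
  have "sz (lst (map num ss)) \<le> length (map num ss) * (2 * n + 1 + 1) + 1"
    by (rule sz_lst_le) (use ss(2) dims(2) in \<open>force simp: sz_num\<close>)
  also have "\<dots> = length ss * (2 * n + 2) + 1" by simp
  also have "\<dots> \<le> (n + 1) * (2 * n + 2) + 1" using ss(1) by (intro add_le_mono1 mult_le_mono1) simp
  also have "\<dots> \<le> X ^ 12" by (rule bounds)
  finally show "sz (lst (map num ss)) \<le> X ^ 12" .
next
  fix \<alpha>s assume \<alpha>s: "length \<alpha>s \<le> Suc n" "\<And>\<alpha>. \<alpha> \<in> set \<alpha>s ==> \<exists>s < nSt M. \<alpha> \<in> joint M s"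
  have "sz (lst (map acts \<alpha>s)) \<le> length (map acts \<alpha>s) * (n * (2 * n + 4) + 1 + 1) + 1"
  proof (rule sz_lst_le)
    fix x assume "x \<in> set (map acts \<alpha>s)"
    then obtain \<alpha> where "\<alpha> \<in> set \<alpha>s" "x = acts \<alpha>" by auto
    then show "sz x \<le> n * (2 * n + 4) + 1" using \<alpha>s(2) sz_acts[OF _ M _ dims(3,4)] by blast
  qed
  also have "\<dots> = length \<alpha>s * (n * (2 * n + 4) + 2) + 1" by (simp add: algebra_simps)
  also have "\<dots> \<le> (n + 1) * (n * (2 * n + 4) + 2) + 1" using \<alpha>s(1) by (intro add_le_mono1 mult_le_mono1) simp
  also have "\<dots> \<le> X ^ 12" by (rule bounds)
  finally show "sz (lst (map acts \<alpha>s)) \<le> X ^ 12" .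
qed (use M sz_jl cost_small in auto)

lemma nice_init: "nice M n n \<eta>"
  using ten_nice[OF \<eta> tables_pos(2)[OF M]] parts(5) by simp

lemma nice_form:
  assumes "length (els cl) = n"
  shows "bounded_model.nice_fm M n \<phi>"
proof -
  interpret bounded_model M "X ^ 12" n "n + n * n" cl by (rule bounded[OF assms])
  have b: "nice_bound bd" if "bound_over M bd" "len (tbound M bd) \<le> n" for bd
    using that ten_nice[OF _ tables_pos(2)[OF M]] by (cases bd) auto
  have "formula_over M \<psi> ==> len (tform M \<psi>) \<le> n ==> nice_fm \<psi>" for \<psi>
    by (induction \<psi>) (simp_all add: b)
  then show ?thesis using \<phi> parts(6) by simp
qed

lemma n5: "5 \<le> n"
  unfolding n inputM_def inputT_def by simp

lemma small_input: "small n (inputM M s (ten M \<eta>) (tform M \<phi>))"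
proof -
  have "\<forall>x \<in> set (valT M). small n x"
    using M dims(2) unfolding valT_def is_rbcgs_def Props_def St_def
    by (auto intro!: small_tset[of _ "nSt M"])
  moreover have "\<forall>x \<in> set (avT M). small n x"
    using avail_facts(1)[OF M, THEN subsetD] dims(4)
    by (auto simp: avT_def avR_def list_all_iff intro!: small_tset[of _ "nAct M"])
  moreover have "\<forall>x \<in> set (costT M). small n x"
    by (auto simp: costT_def costR_def list_all_iff)
  moreover have "\<forall>x \<in> set (succT M). small n x"
  proof -
    have "succ M s' \<sigma> \<le> n" if s': "s' < nSt M" and "\<sigma> \<in> set (jl M s')" for s' \<sigma>
    proof -
      have "set (jl M s') = joint M s'" using avail_facts(3)[OF M s'] by (intro set_jl) (simp add: Agt_def)
      then have "succ M s' \<sigma> \<in> St M" using that M unfolding is_rbcgs_def St_def by blast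
      then show ?thesis using dims(2) by (simp add: St_def)
    qed
    then show ?thesis by (auto simp: succT_def succR_def list_all_iff)
  qed
  ultimately show ?thesis
    using dims s small_ten small_tform[OF dims(1,3) n5 \<phi>] unfolding inputM_def inputT_def
    by (simp add: list_all_iff)
qed

lemma sz_input: "sz (tt (inputM M s (ten M \<eta>) (tform M \<phi>))) < X ^ 12"
  using sz_tt_len[OF small_input] bounds(5) n by simp

end

section \<open>Fuel and size bounds for the whole input\<close>

lemma mult_mult_power: "x * (x * x ^ k) = x ^ (k + 2)" for x :: nat
  by simp

text \<open>There are at most \<open>X\<close> modal levels, and each needs fuel
  \<open>K \<le> X * X ^ 12\<close>; together they stay below \<open>X ^ 14\<close>.\<close>

lemma (in instance_of) jump_instance:
  assumes "ok (X ^ 12) V" "menv M V" "V 53 = cl" "length (els cl) = n" "V 0 = num s" "V 1 = tt (ten M \<eta>)" "V 2 = tt (tform M \<phi>)"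
    and d: "X ^ 14 \<le> d"
  shows "jump prog (X ^ 12) d p_sat V <-> sat M s \<eta> \<phi>"
proof -
  interpret bounded_model M "X ^ 12" n "n + n * n" cl by (rule bounded[OF assms(4)])
  have "env V" using assms by (simp add: env_def)
  moreover have "md \<phi> * K \<le> d"
  proof -
    have "n \<le> X ^ 12" using up[of n 1 12] by (simp add: X_def)
    then have "K \<le> 16 * X ^ 12" unfolding K_def by simp
    also have "\<dots> \<le> X * X ^ 12" by (intro mult_le_mono1) (simp add: X_def)
    finally have "md \<phi> * K \<le> X * (X * X ^ 12)" using md_n by (intro mult_le_mono) (simp_all add: X_def)
    also have "\<dots> = X ^ 14" unfolding mult_mult_power by simp
    finally show ?thesis using d by (rule order_trans)
  qed
  moreover have "n + n * md \<phi> \<le> n + n * n" using md_n by simp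
  ultimately show ?thesis
    using jump_sat[OF assms(1) _ assms(5-7) s \<phi> nice_form[OF assms(4)] nice_init order_refl] by blast
qed

text \<open>Both sides are existential: a word belongs to the language if it encodes some true
  instance, and the procedure guesses some tree. A tree that passes the tests is the input of a
  decoded model, and a true instance provides a tree of size at most \<open>N\<close>. Whether a
  word determines its instance is never at issue.\<close>

lemma jump_check:
  assumes ok: "ok N V" and r: "V 0 = lst (map sc w)" "V 53 = lst (map sc w)" and N: "N = (length w + 20) ^ 12"
    and d: "(length w + 20) ^ 14 \<le> d"
  shows "jump prog N (Suc d) p_check V <-> w \<in> RAL_model_checking"
proof -
  define X where "X = length w + 20"
  have X20: "20 * X ^ 12 \<le> X * X ^ 12" by (intro mult_le_mono1) (simp add: X_def)
  also have "\<dots> \<le> X * (X * X ^ 12)" by (rule mult_le_mono2) (simp add: X_def)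
  also have "\<dots> = X ^ 14" unfolding mult_mult_power by simp
  finally have d7: "7 * N \<le> d" using d N by (simp add: X_def)
  then have d': "5 * N \<le> d" "3 * N \<le> d" by simp_all
  have len_els: "length (els (lst (map sc w))) = length w" by simp
  let ?J = "jump prog N d"
  let ?V = "\<lambda>x. V(8 := tt x, 9 := Lf)"
  have ok': "ok N (?V x)" if "sz (tt x) \<le> N" for x using ok that N_facts[OF ok] by simp
  have check: "jump prog N (Suc d) p_check V <-> (\<exists>x. sz (tt x) \<le> N \<and> w = serialize (erase x) \<and> eval N ?J rest (?V x))"
  proof -
    have "jump prog N (Suc d) p_check V <-> (\<exists>t. sz t \<le> N \<and> ser_ok t (lst (map sc w)) Lf \<and> eval N ?J rest (V(8 := t, 9 := Lf)))"
      unfolding jump.simps prog_simps f_check_def rest_def[symmetric] eval.simps(6)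
    proof (intro ex_cong1 conj_cong refl)
      fix t assume t: "sz t \<le> N"
      then have ok8: "ok N (V(8 := t))" and ok9: "ok N (V(8 := t, 9 := Lf))" using ok N_facts[OF ok] by simp_all
      have "?J p_ser (callenv [8, 0, 9] (V(8 := t, 9 := Lf))) <-> ser_ok t (lst (map sc w)) Lf"
        using jump_ser_serl(1)[of N "callenv [8, 0, 9] (V(8 := t, 9 := Lf))" t d] ok9 t d7 r(1)
        by (simp add: callenv_app)
      then show "eval N ?J (FNil 9 (FAnd (call p_ser [8, 0, 9]) rest)) (V(8 := t)) <->
          ser_ok t (lst (map sc w)) Lf \<and> eval N ?J rest (V(8 := t, 9 := Lf))"
        using ok8 ok9 by simp
    qed
    also have "\<dots> <-> (\<exists>x. sz (tt x) \<le> N \<and> w = serialize (erase x) \<and> eval N ?J rest (?V x))"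
      unfolding ser_ok_def consw_def by auto
    finally show ?thesis .
  qed
  show ?thesis
  proof
    assume "jump prog N (Suc d) p_check V"
    then obtain x where x: "sz (tt x) \<le> N" "w = serialize (erase x)" "eval N ?J rest (?V x)"
      unfolding check by blast
    have r8: "?V x 8 = tt x" by simp
    obtain nA nR nS nP nC vs av cs su s e f V' where x': "x = inputT nA nR nS nP nC vs av cs su s e f"
      and ch: "checked N nA nR nS nP nC vs av cs su s e f V'" and cl: "V' 53 = ?V x 53"
      and pos: "nA \<noteq> 0" "nR \<noteq> 0" "nS \<noteq> 0" "nC \<noteq> 0"
      and T: "val_ok nP nS vs" "av_ok nS nA nC av" "cost_ok nS nC nR av cs" "succ_ok N nS av su" and s: "s < nS"
      and J: "?J p_wfen (callenv [15] V')" "?J p_wffm (callenv [17] V')" "?J p_sat (callenv [14, 15, 17] V')"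
      using eval_restD[OF ok'[OF x(1)] d' r8 x(3)] by (elim exE conjE) (rule that)
    note v = T(1)[unfolded val_ok_def] and a = T(2)[unfolded av_ok_def] and c = T(3)[unfolded cost_ok_def] and u = T(4)[unfolded succ_ok_def]
    obtain M where M: "is_rbcgs M" "nAgt M = nA" "nRes M = nR" "nSt M = nS" "nProp M = nP" "nAct M = nC"
      "valT M = vs" "avT M = av" "costT M = cs" "succT M = su"
      using decode[OF pos conjunct1[OF v] conjunct2[OF v] conjunct1[OF a] conjunct2[OF a]
          conjunct1[OF c] conjunct2[OF c] conjunct1[OF u] conjunct2[OF u]] by (elim exE conjE) (rule that)
    have g: "ok N V'" "menv M V'" "V' 54 = num nP" "V' 14 = num s" "V' 15 = tt e" "V' 17 = tt f"
      using ch M unfolding checked_def genv_def menv_def by simp_all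
    have "isen M e" using J(1) unfolding isen_iff
      by (subst (asm) jump_wfen[of N _ d e nA nR]) (use g d' M in \<open>simp_all add: callenv_app menv_def\<close>)
    then obtain \<eta> where \<eta>: "\<eta> \<in> En M" "e = ten M \<eta>" unfolding isen_def by blast
    have sz: "sz (tt f) \<le> N" using okD[OF g(1), of 17] g(6) by simp
    have "isfm M f" using J(2)
      by (subst (asm) jump_wffm[of N _ f M d])
        (use g d7 M size_sz[of f] sz in \<open>simp_all add: callenv_app menv_def\<close>)
    then obtain \<phi> where \<phi>: "formula_over M \<phi>" "f = tform M \<phi>" unfolding isfm_def by blast
    have xM: "x = inputM M s (ten M \<eta>) (tform M \<phi>)" using x' M \<eta> \<phi> by (simp add: inputM_def)
    note e_eq = \<eta>(2) and f_eq = \<phi>(2)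
    interpret instance_of M s \<eta> \<phi> "length w"
      by unfold_locales (use M s \<eta> \<phi> x(2) xM in \<open>simp_all add: len_serialize\<close>)
    have "sat M s \<eta> \<phi>"
      using J(3) jump_instance[of "callenv [14, 15, 17] V'" "lst (map sc w)" d] g cl r(2) d e_eq f_eq len_els
      by (simp add: X_def N[symmetric] callenv_app)
    moreover have "w = encode M s \<eta> \<phi>" using x(2) xM by (simp add: encode_inputM)
    ultimately show "w \<in> RAL_model_checking"
      unfolding RAL_model_checking_def using M s \<eta> \<phi> by (auto simp: St_def)
  next
    assume "w \<in> RAL_model_checking"
    then obtain M s \<eta> \<phi> where w: "w = encode M s \<eta> \<phi>" and M: "is_rbcgs M" and s: "s < nSt M" and \<eta>: "\<eta> \<in> En M"
      and \<phi>: "formula_over M \<phi>" and sat: "sat M s \<eta> \<phi>"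
      unfolding RAL_model_checking_def by (auto simp: St_def)
    let ?x = "inputM M s (ten M \<eta>) (tform M \<phi>)"
    have wx: "w = serialize (erase ?x)" using w by (simp add: encode_inputM)
    interpret instance_of M s \<eta> \<phi> "length w"
      by unfold_locales (use M s \<eta> \<phi> wx in \<open>simp_all add: len_serialize\<close>)
    have x: "sz (tt ?x) \<le> N" using sz_input by (simp add: X_def N)
    have "eval N ?J rest (?V ?x)"
    proof (rule eval_restI[OF ok'[OF x] d'])
      show "(?V ?x) 8 = tt (inputT (nAgt M) (nRes M) (nSt M) (nProp M) (nAct M) (valT M) (avT M) (costT M) (succT M) s (ten M \<eta>) (tform M \<phi>))"
        by (simp add: inputM_def)
      show "nAgt M \<noteq> 0" "nRes M \<noteq> 0" "nSt M \<noteq> 0" "nAct M \<noteq> 0" by (rule tables_pos[OF M])+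
      show "val_ok (nProp M) (nSt M) (valT M)" by (rule val_ok_tables[OF M])
      show "av_ok (nSt M) (nAgt M) (nAct M) (avT M)" by (rule av_ok_tables[OF M])
      show "cost_ok (nSt M) (nAct M) (nRes M) (avT M) (costT M)" by (rule cost_ok_tables[OF M])
      show "succ_ok N (nSt M) (avT M) (succT M)"
        by (rule succ_ok_tables[OF M]) (use sz_jl in \<open>simp add: X_def N\<close>)
      show "s < nSt M" by (rule s)
      fix V'
      assume "checked N (nAgt M) (nRes M) (nSt M) (nProp M) (nAct M) (valT M) (avT M) (costT M) (succT M) s (ten M \<eta>) (tform M \<phi>) V'"
        and cl: "V' 53 = (?V ?x) 53"
      then have g: "ok N V'" "menv M V'" "V' 54 = num (nProp M)" "V' 14 = num s" "V' 15 = tt (ten M \<eta>)" "V' 17 = tt (tform M \<phi>)"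
        unfolding checked_def genv_def menv_def by simp_all
      have "isen M (ten M \<eta>)" using \<eta> unfolding isen_def by blast
      then have "?J p_wfen (callenv [15] V')" unfolding isen_iff
        by (subst jump_wfen[of N _ d "ten M \<eta>" "nAgt M" "nRes M"]) (use g d' in \<open>simp_all add: callenv_app menv_def\<close>)
      moreover have "isfm M (tform M \<phi>)" using \<phi> unfolding isfm_def by blast
      then have "?J p_wffm (callenv [17] V')"
        by (subst jump_wffm[of N _ "tform M \<phi>" M d])
          (use g d7 size_sz[of "tform M \<phi>"] okD[OF g(1), of 17] in \<open>simp_all add: callenv_app menv_def\<close>)
      moreover have "?J p_sat (callenv [14, 15, 17] V')"
        using sat jump_instance[of "callenv [14, 15, 17] V'" "lst (map sc w)" d] g cl r(2) d len_els
        by (simp add: X_def N[symmetric] callenv_app)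
      ultimately show "?J p_wfen (callenv [15] V') \<and> ?J p_wffm (callenv [17] V') \<and> ?J p_sat (callenv [14, 15, 17] V')"
        by blast
    qed
    then show "jump prog N (Suc d) p_check V" unfolding check using x wx by blast
  qed
qed

lemma jump_prog:
  "jump prog ((length w + 20) ^ 12) ((length w + 20) ^ 16) 0 ((\<lambda>_. Lf)(0 := lst (map sc w))) <-> w \<in> RAL_model_checking"
proof -
  define N where "N = (length w + 20) ^ 12"
  define d where "d = (length w + 20) ^ 16 - 2"
  \<comment> \<open>Two units of fuel are spent on entering \<open>f_main\<close> and
    \<open>f_check\<close>; \<open>jump_check\<close> asks for \<open>(length w + 20) ^ 14\<close>
    beyond them.\<close>
  have "(length w + 20) ^ 14 + 2 \<le> (length w + 20) ^ 16"
  proof -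
    have "(1 :: nat) \<le> (length w + 20) ^ 14" by simp
    moreover have "20 * (length w + 20) ^ 14 \<le> (length w + 20) * (length w + 20) ^ 14" by (rule mult_le_mono1) simp
    moreover have "(length w + 20) * (length w + 20) ^ 14 \<le> (length w + 20) * ((length w + 20) * (length w + 20) ^ 14)"
      by (rule mult_le_mono2) simp
    moreover have "(length w + 20) * ((length w + 20) * (length w + 20) ^ 14) = (length w + 20) ^ 16"
      unfolding mult_mult_power by simp
    ultimately show ?thesis by linarith
  qed
  then have d: "(length w + 20) ^ 16 = Suc (Suc d)" "(length w + 20) ^ 14 \<le> d" unfolding d_def by linarith+
  let ?V = "(\<lambda>_. Lf)(0 := lst (map sc w), 41 := num 1, 42 := num 2, 43 := num 3, 44 := num 4, 45 := num 5)"
  let ?w = "lst (map sc w)"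
  have "sz ?w \<le> length (map sc w) * (11 + 1) + 1"
    by (rule sz_lst_le) (use sz_sc in auto)
  also have "\<dots> \<le> 12 * (length w + 20)" by simp
  also have "\<dots> \<le> (length w + 20) * (length w + 20)" by (rule mult_le_mono1) simp
  also have "\<dots> = (length w + 20) ^ 2" by (simp add: power2_eq_square)
  also have "\<dots> \<le> N" unfolding N_def by (rule power_increasing) simp_all
  finally have sz_w: "sz ?w \<le> N" .
  have N: "11 \<le> N" using power_increasing[of 1 12 "length w + 20"] unfolding N_def by simp
  have ok: "ok N (?V(53 := ?w))" using sz_w N by (simp add: ok_def sz_num)
  have nums: "num 0 = Lf" "num 1 = Nd Lf (num 0)" "num 2 = Nd Lf (num 1)" "num 3 = Nd Lf (num 2)" "num 4 = Nd Lf (num 3)" "num 5 = Nd Lf (num 4)"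
    by (simp_all add: numeral_eq_Suc)
  have "jump prog N (Suc (Suc d)) 0 ((\<lambda>_. Lf)(0 := ?w)) <-> jump prog N (Suc d) p_check (?V(53 := ?w))"
    unfolding jump.simps using N sz_w by (auto simp: prog_simps f_main_def nums(1) num_numeral sz_num)
  also have "\<dots> <-> w \<in> RAL_model_checking"
    by (rule jump_check[OF ok _ _ N_def d(2)]) simp_all
  finally show ?thesis unfolding N_def d(1) .
qed

theorem theorem4p3: "RAL_model_checking \<in> PSPACE"
proof -
  have "{w. jump prog ((length w + 20) ^ 12) ((length w + 20) ^ 16) 0 ((\<lambda>_. Lf)(0 := lst (map sc w)))} \<in> PSPACE"
    \<comment> \<open>There are 32 bodies, and 70 exceeds every register in use, including those
      that pass arguments.\<close>
    by (rule logic_PSPACE[of 32 70]) (use wff_prog in simp_all)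
  then show ?thesis unfolding jump_prog by simp
qed

end
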